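(* Let $d\in\mathbb{Z}$, let $A$, $B$, $C$ be double Poisson dg algebras with brackets $\{\!\{\,,\}\!\}_A$, $\{\!\{\,,\}\!\}_B$, $\{\!\{\,,\}\!\}_C$ of degree $-d$, let $\phi:A\to B$ and $\psi:B\to C$ be morphisms of double Poisson dg algebras, and let $\upsilon=\psi\circ\phi$. Consider the morphisms of $d$-pre-Calabi-Yau algebras $(\partial_{d-1}\phi,\Phi_A,\Phi_B)$ and $(\partial_{d-1}\psi,\Psi_B,\Psi_C)$ induced by $\phi$ and $\psi$, and the fully manageable nice degenerate $(d-1)$-cyclic $A_\infty$-algebra $\partial_{d-1}\upsilon=A\oplus C^{\#}[d-1]$ associated with $\upsilon$ (all described in the context). Then the maps $$\Upsilon_\phi:\partial_{d-1}\upsilon\to\partial_{d-1}\phi,\ (a,tf)\mapsto(a,t(f\circ\psi)),\qquad\Upsilon_\psi:\partial_{d-1}\upsilon\to\partial_{d-1}\psi,\ (a,tf)\mapsto(\phi(a),tf),$$ for $a\in A$, $f\in C^{\#}$, are strict morphisms of $A_\infty$-algebras preserving the corresponding bilinear forms, and satisfy $\Phi_B\circ\Upsilon_\phi=\Psi_B\circ\Upsilon_\psi$. As a consequence, $(\partial_{d-1}\phi,\Phi_A,\Phi_B)$ and $(\partial_{d-1}\psi,\Psi_B,\Psi_C)$ are composable morphisms and their composition is $(\partial_{d-1}\upsilon,\Phi_A\circ\Upsilon_\phi,\Psi_C\circ\Upsilon_\psi)$.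
   Context: **General conventions.** $\Bbbk$ is a field of characteristic zero; tensor products are over $\Bbbk$; $\mathbb{N}=\{1,2,\dots\}$. Gradings are cohomological by $\mathbb{Z}$; $V[m]^n=V^{n+m}$, and if $V$ is dg then $\partial_{V[m]}=(-1)^m\partial_V$. $s_V^m:V\to V[m]$ is the map with underlying identity (so $|s^m_Vv|=|v|-m$); for $f$ of degree $0$, $f[m]$ has the same underlying map as $f$. Koszul sign rule: $(f\otimes g)(v\otimes w)=(-1)^{|g||v|}f(v)\otimes g(w)$. $\tau_{V,W}(v\otimes w)=(-1)^{|v||w|}w\otimes v$, and for $\sigma\in\mathbb{S}_n$, $\tau_{V,n}(\sigma)(v_1\otimes\dots\otimes v_n)=(-1)^{\epsilon(\sigma,\bar v)}v_{\sigma^{-1}(1)}\otimes\dots\otimes v_{\sigma^{-1}(n)}$ with $\epsilon(\sigma,\bar v)=\sum_{i<j,\ \sigma^{-1}(i)>\sigma^{-1}(j)}|v_{\sigma^{-1}(i)}||v_{\sigma^{-1}(j)}|$, $\bar v=v_1\otimes\dots\otimes v_n$. $V^{\#}=\mathcal{H}om(V,\Bbbk)$ is the graded dual, with differential $f\mapsto-(-1)^{|f|}f\circ\partial_V$. Algebras are not assumed unital. **Double Poisson bracket of degree $-d$** on a dg algebra $(A,\mu_A,\partial_A)$: a homogeneous linear map $\{\!\{\,,\}\!\}_A:A[d]\otimes A[d]\to A\otimes A$ of degree $d$ with $(\partial_A\otimes\mathrm{id}+\mathrm{id}\otimes\partial_A)\circ\{\!\{\,,\}\!\}_A=(-1)^d\{\!\{\,,\}\!\}_A\circ(\partial_{A[d]}\otimes\mathrm{id}+\mathrm{id}\otimes\partial_{A[d]})$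 such that: (i) $-\{\!\{\,,\}\!\}_A\circ\tau_{A[d],A[d]}=\tau_{A,A}\circ\{\!\{\,,\}\!\}_A$; (ii) for each homogeneous $a\in A$, the map $\mathrm{AD}(a):A\to A\otimes A$, $b\mapsto\{\!\{s^da,s^db\}\!\}_A$, of degree $|a|-d$, satisfies $\mathrm{AD}(a)\circ\mu_A=(\mathrm{id}\otimes\mu_A)\circ(\mathrm{AD}(a)\otimes\mathrm{id})+(\mu_A\otimes\mathrm{id})\circ(\mathrm{id}\otimes\mathrm{AD}(a))$; (iii) $\sum_{\sigma\in C_3}\tau_{A,3}(\sigma)\circ\{\!\{\,,\,,\}\!\}_{A,L}\circ\tau_{A[d],3}(\sigma^{-1})=0$, where $C_3\subseteq\mathbb{S}_3$ is the subgroup of cyclic permutations and $\{\!\{\,,\,,\}\!\}_{A,L}=(\{\!\{\,,\}\!\}_A\otimes\mathrm{id}_A)\circ(\mathrm{id}_{A[d]}\otimes s_A^d\otimes\mathrm{id}_A)\circ(\mathrm{id}_{A[d]}\otimes\{\!\{\,,\}\!\}_A)$. On elements $a,b\in A$ one writes $\{\!\{a,b\}\!\}_A$ for $\{\!\{s^da,s^db\}\!\}_A$. A *double Poisson dg algebra* is a dg algebra with such a bracket; a *morphism* $\phi:A\to B$ is a morphism of dg algebras with $(\phi\otimes\phi)\circ\{\!\{\,,\}\!\}_A=\{\!\{\,,\}\!\}_B\circ(\phi[d]\otimes\phi[d])$. **$A_\infty$-algebras.** A (nonunitary) $A_\infty$-algebra is a graded space $E$ with maps $m_n:E^{\otimes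 n}\to E$, $n\in\mathbb{N}$, of degree $2-n$ with $\sum_{r+s+t=n,\ s\geq1,\ r,t\ge0}(-1)^{r+st}m_{r+1+t}\circ(\mathrm{id}^{\otimes r}\otimes m_s\otimes\mathrm{id}^{\otimes t})=0$ for all $n\in\mathbb{N}$. It is *fully manageable* if $(E,m_2,m_1)$ is a dg algebra; *small* if $m_n=0$ for $n\ge4$; *essentially odd* if $m_{2i}=0$ for all $i>1$. A *strict morphism* $E\to E'$ is a degree $0$ linear map $f$ with $f\circ m_n=m'_n\circ f^{\otimes n}$ for all $n$; it preserves bilinear forms $\gamma,\gamma'$ if $\gamma=\gamma'\circ f^{\otimes2}$. $E$ is *degenerate $e$-cyclic* for a (not necessarily nondegenerate) bilinear form $\gamma:E\otimes E\to\Bbbk$ of degree $e$ if $\gamma\circ\tau_{E,E}=\gamma$ and $\gamma(m_n(a_1,\dots,a_n),a_0)=(-1)^{n+|a_0|\sum_{i=1}^n|a_i|}\gamma(m_n(a_0,\dots,a_{n-1}),a_n)$ for all $n$ and homogeneous $a_i\in E$; *$e$-cyclic* if moreover $\gamma$ is nondegenerate. It is *degenerate $e$-ultracyclic* if it is degenerate $e$-cyclic, essentially odd, and for all $n\in\mathbb{N}$, $\varsigma\in\mathbb{S}_n$ and homogeneous $a_i,b_i\in E$, $$\gamma\big(m_{2n-1}(a_{\varsigma(1)},b_{\varsigma(1)},\dots,a_{\varsigma(n-1)},b_{\varsigma(n-1)},a_{\varsigma(n)}),b_{\varsigma(n)}\big)=(-1)^{\epsilon}\gamma\big(m_{2n-1}(a_1,b_1,\dots,a_{n-1},b_{n-1},a_n),b_n\big),$$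 where $\epsilon=\epsilon(\theta_n(\varsigma^{-1}),a_1\otimes b_1\otimes\dots\otimes a_n\otimes b_n)$ and $\theta_n:\mathbb{S}_n\to\mathbb{S}_{2n}$ is given by $\theta_n(\varsigma)(2i)=2\varsigma(i)$, $\theta_n(\varsigma)(2i-1)=2\varsigma(i)-1$. **Good, nice.** Let $E=E_0\oplus E_1$. For odd $n$, let $\mathscr{I}_n$ be the set of $(i_1,\dots,i_n)\in\{0,1\}^n$ with $i_j\ne i_{j+1}$ for all $j$. A map $m_n:E^{\otimes n}\to E$ is *good* if it vanishes on $E_{i_1}\otimes\dots\otimes E_{i_n}$ for $(i_1,\dots,i_n)\notin\mathscr{I}_n$ and sends $E_{i_1}\otimes\dots\otimes E_{i_n}$ into $E_{i_1}$ for $(i_1,\dots,i_n)\in\mathscr{I}_n$. An $A_\infty$-structure on $E$ is *good* if it is essentially odd and $m_n$ is good for every odd $n$; *nice* if good and small. The decompositions used are $\partial_{d-1}A=A\oplus A^{\#}[d-1]$ and $\partial_{d-1}\phi=A\oplus B^{\#}[d-1]$. **Dg algebras $\partial_{d-1}A$ and $\partial_{d-1}\phi$.** Write $tf=s^{d-1}f$ for $f$ in a graded dual. For a dg $A$-bimodule $M$, $M^{\#}$ is a dg bimodule via $(a\cdot f\cdot b)(c)=(-1)^{|a|(|f|+|b|+|c|)}f(b\cdot c\cdot a)$, $M[k]$ is one via $a\cdot s^km\cdot b=(-1)^{k|a|}s^k(a\cdot m\cdot b)$, and $A\oplus M$ is a dg algebra with product $(a,m)(a',m')=(aa',m\cdot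 a'+a\cdot m')$ and direct sum differential. This gives the dg algebra $\partial_{d-1}A=A\oplus A^{\#}[d-1]$ and, for a dg algebra morphism $\phi:A\to B$ (viewing $B$ as an $A$-bimodule through $\phi$), the dg algebra $\partial_{d-1}\phi=A\oplus B^{\#}[d-1]$. **Bilinear forms** (of degree $d-1$). On $\partial_{d-1}A$: $\gamma_A(tf,a)=(-1)^{|a||tf|}\gamma_A(a,tf)=f(a)$, $\gamma_A(a,b)=\gamma_A(tf,tg)=0$. On $\partial_{d-1}\phi$: $\gamma_\phi(tf,a)=(-1)^{|a|(|f|-d+1)}\gamma_\phi(a,tf)=f(\phi(a))$, $\gamma_\phi(a,b)=\gamma_\phi(tf,tg)=0$. **$d$-pre-Calabi-Yau structure** on a graded space $A$: a $(d-1)$-cyclic $A_\infty$-structure $\{m_n\}$ on $\partial_{d-1}A$ for $\gamma_A$ with $m_n(A^{\otimes n})\subseteq A$ for all $n$. A double Poisson bracket of degree $-d$ on a dg algebra $A$ corresponds (bijectively) to the unique nice $d$-pre-Calabi-Yau structure $\{m_n^A\}$ on $A$ such that $m_1^A,m_2^A$ are the differential and product of the dg algebra $\partial_{d-1}A$ and $(f\otimes g)(\{\!\{a,b\}\!\}_A)=(-1)^{|b|(|a|+|g|+1)}\gamma_A(m_3^A(b,tg,a),tf)$ for all homogeneous $a,b\in A$, $f,g\in A^{\#}$. **Structure induced by a morphism.** For a morphism $\phi:A\to B$ of double Poisson dg algebras, $\partial_{d-1}\phi$ carries the $A_\infty$-structure with $m_1^\phi,m_2^\phi$ the differential and product of the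 dg algebra $\partial_{d-1}\phi$, $m_n^\phi=0$ for $n\ge4$, and $m_3^\phi$ the unique good map with $m_3^\phi(a,tf,b)=m_3^A(a,t(f\circ\phi),b)$ and $m_3^\phi(tf,b,tg)=m_3^B(tf,\phi(b),tg)$ for $a,b\in A$, $f,g\in B^{\#}$; with $\gamma_\phi$ it is a fully manageable nice degenerate $(d-1)$-cyclic $A_\infty$-algebra. The maps $\Phi_A:\partial_{d-1}\phi\to\partial_{d-1}A$, $(a,tf)\mapsto(a,t(f\circ\phi))$, and $\Phi_B:\partial_{d-1}\phi\to\partial_{d-1}B$, $(a,tf)\mapsto(\phi(a),tf)$, are strict morphisms preserving the bilinear forms. The same construction for $\psi$ gives $\Psi_B:\partial_{d-1}\psi\to\partial_{d-1}B$, $(b,tf)\mapsto(b,t(f\circ\psi))$, and $\Psi_C:\partial_{d-1}\psi\to\partial_{d-1}C$, $(b,tf)\mapsto(\psi(b),tf)$; and similarly for $\upsilon$. **Morphisms of $d$-pre-Calabi-Yau algebras.** Given $d$-pre-Calabi-Yau structures on $A$ and $A'$, a *morphism* from $A$ to $A'$ is a triple $(D,\Phi,\Psi)$ where $D$ is a degenerate $(d-1)$-ultracyclic $A_\infty$-algebra and $\Phi:D\to\partial_{d-1}A$, $\Psi:D\to\partial_{d-1}A'$ are strict morphisms of $A_\infty$-algebras preserving the bilinear forms. A morphism $(D,\Phi,\Psi)$ from $A$ to $A'$ and a morphism $(D',\Phi',\Psi')$ from $A'$ to $A''$ are *composable* if there is a triple $(D'',\Phi'',\Psi'')$ where $D''$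 is a degenerate $(d-1)$-ultracyclic $A_\infty$-algebra and $\Phi'':D''\to D$, $\Psi'':D''\to D'$ are strict morphisms of $A_\infty$-algebras preserving the bilinear forms with $\Psi\circ\Phi''=\Phi'\circ\Psi''$. The *composition* is then defined to be $(D'',\Phi\circ\Phi'',\Psi'\circ\Psi'')$. *)

theory Defs
  imports Complex_Main "HOL-Library.Function_Algebras" "HOL-Library.Product_Plus"
    "HOL-Combinatorics.Permutations"
begin

section \<open>Graded vector spaces\<close>

text \<open>
  A graded space lives inside an ambient vector space (a whole type \<open>'v\<close> with scalar
  multiplication \<open>scal\<close>); \<open>grade V n\<close> is its component of degree \<open>n\<close>, and the space itself is the
  set \<open>gcar V\<close> of finite sums of homogeneous elements.  A carrier is needed because the graded
  dual is a proper subset of a function type.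
\<close>

record ('k, 'v) gvs =
  scal :: "'k \<Rightarrow> 'v \<Rightarrow> 'v"
  grade :: "int \<Rightarrow> 'v set"

definition gcar :: "('k, 'v::ab_group_add, 'z) gvs_scheme \<Rightarrow> 'v set" where
  "gcar V = {v. \<exists>I x. finite I \<and> (\<forall>i\<in>I. x i \<in> grade V i) \<and> v = (\<Sum>i\<in>I. x i)}"

definition graded_space :: "('k::field, 'v::ab_group_add, 'z) gvs_scheme \<Rightarrow> bool" where
  "graded_space V \<longleftrightarrow>
     vector_space (scal V) \<and>
     (\<forall>n. module.subspace (scal V) (grade V n)) \<and>
     (\<forall>I x. finite I \<longrightarrow> (\<forall>i\<in>I. x i \<in> grade V i) \<longrightarrow> (\<Sum>i\<in>I. x i) = 0 \<longrightarrow> (\<forall>i\<in>I. x i = 0))"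

definition hcomp :: "('k, 'v::ab_group_add, 'z) gvs_scheme \<Rightarrow> 'v \<Rightarrow> int \<Rightarrow> 'v" where
  "hcomp V v = (THE c. (\<forall>i. c i \<in> grade V i) \<and> finite {i. c i \<noteq> 0} \<and> v = (\<Sum>i | c i \<noteq> 0. c i))"

text \<open>
  Linear extension to \<open>gcar V\<close> of a map given on homogeneous elements: \<open>h i x\<close> is its value at
  \<open>x\<close> of degree \<open>i\<close>.
\<close>

definition glift :: "('k, 'v::ab_group_add, 'z) gvs_scheme \<Rightarrow> (int \<Rightarrow> 'v \<Rightarrow> 'w::comm_monoid_add) \<Rightarrow> 'v \<Rightarrow> 'w" where
  "glift V h v = (\<Sum>i | hcomp V v i \<noteq> 0. h i (hcomp V v i))"

definition ground :: "('k::field, 'k) gvs" where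
  "ground = \<lparr>scal = (*), grade = (\<lambda>n. if n = 0 then UNIV else {0})\<rparr>"

definition shift :: "int \<Rightarrow> ('k, 'v, 'z) gvs_scheme \<Rightarrow> ('k, 'v) gvs" where
  "shift m V = \<lparr>scal = scal V, grade = (\<lambda>n. grade V (n + m))\<rparr>"

definition dsum :: "('k, 'v, 'y) gvs_scheme \<Rightarrow> ('k, 'w, 'z) gvs_scheme \<Rightarrow> ('k, 'v \<times> 'w) gvs" where
  "dsum V W = \<lparr>scal = (\<lambda>c (v, w). (scal V c v, scal W c w)), grade = (\<lambda>n. grade V n \<times> grade W n)\<rparr>"

definition glin :: "('k, 'v::ab_group_add, 'y) gvs_scheme \<Rightarrow> ('k, 'w::ab_group_add, 'z) gvs_scheme
    \<Rightarrow> int \<Rightarrow> ('v \<Rightarrow> 'w) \<Rightarrow> bool" where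
  "glin V W e f \<longleftrightarrow>
     (\<forall>u\<in>gcar V. \<forall>v\<in>gcar V. f (u + v) = f u + f v) \<and>
     (\<forall>c. \<forall>v\<in>gcar V. f (scal V c v) = scal W c (f v)) \<and>
     (\<forall>n. \<forall>v\<in>grade V n. f v \<in> grade W (n + e))"

text \<open>Elements of the graded dual are normalised to vanish outside the carrier.\<close>

definition gdual :: "('k::field, 'v::ab_group_add, 'z) gvs_scheme \<Rightarrow> ('k, 'v \<Rightarrow> 'k) gvs" where
  "gdual V = \<lparr>scal = (\<lambda>c f x. c * f x),
     grade = (\<lambda>n. {f. glin V ground n f \<and> (\<forall>x. x \<notin> gcar V \<longrightarrow> f x = 0)})\<rparr>"

text \<open>\<open>f \<mapsto> f \<circ> \<phi>\<close>, for \<open>\<phi>\<close> defined on \<open>gcar V\<close>.\<close>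

definition dual_map :: "('k, 'v::ab_group_add, 'z) gvs_scheme \<Rightarrow> ('v \<Rightarrow> 'w) \<Rightarrow> ('w \<Rightarrow> 'k::field) \<Rightarrow> 'v \<Rightarrow> 'k" where
  "dual_map V \<phi> f = (\<lambda>x. if x \<in> gcar V then f (\<phi> x) else 0)"


section \<open>Multilinear maps, Koszul signs, tensor powers\<close>

text \<open>
  A linear map out of \<open>V\<^sup>\<otimes>\<^sup>n\<close> is represented by the corresponding multilinear map on
  lists of length \<open>n\<close>.
\<close>

definition multilin :: "('k, 'v::ab_group_add, 'z) gvs_scheme \<Rightarrow> ('k \<Rightarrow> 'w::ab_group_add \<Rightarrow> 'w)
    \<Rightarrow> nat \<Rightarrow> ('v list \<Rightarrow> 'w) \<Rightarrow> bool" where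
  "multilin V sc n m \<longleftrightarrow>
     (\<forall>xs i. length xs = n \<and> set xs \<subseteq> gcar V \<and> i < n \<longrightarrow>
        (\<forall>u\<in>gcar V. \<forall>v\<in>gcar V. m (xs[i := u + v]) = m (xs[i := u]) + m (xs[i := v])) \<and>
        (\<forall>c. \<forall>u\<in>gcar V. m (xs[i := scal V c u]) = sc c (m (xs[i := u]))))"

definition homs :: "('k, 'v, 'z) gvs_scheme \<Rightarrow> int list \<Rightarrow> 'v list \<Rightarrow> bool" where
  "homs V ds xs \<longleftrightarrow> list_all2 (\<lambda>i x. x \<in> grade V i) ds xs"

definition multihom :: "('k, 'v::ab_group_add, 'y) gvs_scheme \<Rightarrow> ('k, 'w::ab_group_add, 'z) gvs_scheme
    \<Rightarrow> nat \<Rightarrow> int \<Rightarrow> ('v list \<Rightarrow> 'w) \<Rightarrow> bool" where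
  "multihom V W n e m \<longleftrightarrow>
     multilin V (scal W) n m \<and>
     (\<forall>ds xs. length xs = n \<and> homs V ds xs \<longrightarrow> m xs \<in> grade W (sum_list ds + e))"

text \<open>
  Elements of the symmetric group on \<open>n\<close> letters are permutations of \<open>{..<n}\<close>: positions in
  lists are counted from 0.  The list \<open>perm_list \<sigma> [v\<^sub>0, \<dots>]\<close> has entry number \<open>i\<close> equal to the
  entry number \<open>\<sigma>\<^sup>-\<^sup>1 i\<close> of the given list.
\<close>

definition perm_list :: "(nat \<Rightarrow> nat) \<Rightarrow> 'v list \<Rightarrow> 'v list" where
  "perm_list \<sigma> xs = map (\<lambda>i. xs ! (inv \<sigma> i)) [0..<length xs]"

definition koszul :: "(nat \<Rightarrow> nat) \<Rightarrow> int list \<Rightarrow> int" where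
  "koszul \<sigma> ds = (\<Sum>(i, j) \<in> {(i, j). i < j \<and> j < length ds \<and> inv \<sigma> i > inv \<sigma> j}.
      ds ! (inv \<sigma> i) * ds ! (inv \<sigma> j))"

text \<open>
  The tensor power \<open>V\<^sup>\<otimes>\<^sup>n\<close> is the space of functions on the \<open>n\<close>-linear forms on \<open>V\<close> spanned by
  the evaluations \<open>v\<^sub>1 \<otimes> \<dots> \<otimes> v\<^sub>n\<close>.  Over a field this is the tensor power: a sum of
  evaluations is zero if and only if every \<open>n\<close>-linear form vanishes on it.
\<close>

type_synonym ('k, 'v) tens = "('v list \<Rightarrow> 'k) \<Rightarrow> 'k"

definition pure :: "('k::field, 'v::ab_group_add, 'z) gvs_scheme \<Rightarrow> 'v list \<Rightarrow> ('k, 'v) tens" where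
  "pure V xs = (\<lambda>\<beta>. if multilin V (*) (length xs) \<beta> then \<beta> xs else 0)"

text \<open>
  \<open>R\<close> presents \<open>T\<close> as a sum of tensors of homogeneous elements \<open>xs\<close>, together with their
  degrees \<open>ds\<close>.
\<close>

definition tens_rep :: "('k::field, 'v::ab_group_add, 'z) gvs_scheme \<Rightarrow> nat
    \<Rightarrow> ('k, 'v) tens \<Rightarrow> (int list \<times> 'v list) list \<Rightarrow> bool" where
  "tens_rep V n T R \<longleftrightarrow>
     (\<forall>(ds, xs)\<in>set R. length xs = n \<and> homs V ds xs) \<and> T = (\<Sum>(ds, xs)\<leftarrow>R. pure V xs)"

definition tscal :: "'k::field \<Rightarrow> ('k, 'v) tens \<Rightarrow> ('k, 'v) tens" where
  "tscal c T = (\<lambda>\<beta>. c * T \<beta>)"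

definition tpow :: "('k::field, 'v::ab_group_add, 'z) gvs_scheme \<Rightarrow> nat \<Rightarrow> ('k, ('k, 'v) tens) gvs" where
  "tpow V n = \<lparr>scal = tscal,
     grade = (\<lambda>e. {T. \<exists>R. tens_rep V n T R \<and> (\<forall>(ds, xs)\<in>set R. sum_list ds = e)})\<rparr>"

text \<open>
  The linear map on \<open>V\<^sup>\<otimes>\<^sup>n\<close> whose value at \<open>x\<^sub>1 \<otimes> \<dots> \<otimes> x\<^sub>n\<close>, with \<open>x\<^sub>i\<close> homogeneous of degree
  \<open>d\<^sub>i\<close>, is \<open>h [d\<^sub>1, \<dots>] [x\<^sub>1, \<dots>]\<close>.  For \<open>h\<close> multilinear in \<open>xs\<close> for fixed degrees, the result does
  not depend on the chosen presentation.
\<close>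

definition tlift :: "('k::field, 'v::ab_group_add, 'z) gvs_scheme \<Rightarrow> nat
    \<Rightarrow> (int list \<Rightarrow> 'v list \<Rightarrow> 'w::comm_monoid_add) \<Rightarrow> ('k, 'v) tens \<Rightarrow> 'w" where
  "tlift V n h T = (\<Sum>(ds, xs)\<leftarrow>(SOME R. tens_rep V n T R). h ds xs)"

definition tens_perm :: "('k::field, 'v::ab_group_add, 'z) gvs_scheme \<Rightarrow> nat \<Rightarrow> (nat \<Rightarrow> nat)
    \<Rightarrow> ('k, 'v) tens \<Rightarrow> ('k, 'v) tens" where
  "tens_perm V n \<sigma> =
     tlift V n (\<lambda>ds xs. tscal ((-1) powi koszul \<sigma> ds) (pure V (perm_list \<sigma> xs)))"


section \<open>Double Poisson dg algebras\<close>

record ('k, 'v) dga = "('k, 'v) gvs" +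
  mul :: "'v \<Rightarrow> 'v \<Rightarrow> 'v"
  dif :: "'v \<Rightarrow> 'v"

definition dg_algebra :: "('k::field, 'v::ab_group_add, 'z) dga_scheme \<Rightarrow> bool" where
  "dg_algebra A \<longleftrightarrow>
     graded_space A \<and>
     multihom A A 2 0 (\<lambda>xs. mul A (xs ! 0) (xs ! 1)) \<and>
     (\<forall>x\<in>gcar A. \<forall>y\<in>gcar A. \<forall>z\<in>gcar A. mul A (mul A x y) z = mul A x (mul A y z)) \<and>
     glin A A 1 (dif A) \<and>
     (\<forall>x\<in>gcar A. dif A (dif A x) = 0) \<and>
     (\<forall>i. \<forall>x\<in>grade A i. \<forall>y\<in>gcar A.
        dif A (mul A x y) = mul A (dif A x) y + scal A ((-1) powi i) (mul A x (dif A y)))"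

definition dga_morphism :: "('k, 'v::ab_group_add, 'y) dga_scheme \<Rightarrow> ('k, 'w::ab_group_add, 'z) dga_scheme
    \<Rightarrow> ('v \<Rightarrow> 'w) \<Rightarrow> bool" where
  "dga_morphism A B \<phi> \<longleftrightarrow>
     glin A B 0 \<phi> \<and>
     (\<forall>x\<in>gcar A. \<forall>y\<in>gcar A. \<phi> (mul A x y) = mul B (\<phi> x) (\<phi> y)) \<and>
     (\<forall>x\<in>gcar A. \<phi> (dif A x) = dif B (\<phi> x))"

text \<open>
  The bracket is a map out of \<open>A[d] \<otimes> A[d]\<close>; as \<open>s\<^sup>d\<close> is the identity on underlying sets,
  \<open>dbr A [a, b]\<close> is the double bracket of \<open>s\<^sup>d a\<close> and \<open>s\<^sup>d b\<close>.
\<close>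

record ('k, 'v) dpa = "('k, 'v) dga" +
  dbr :: "'v list \<Rightarrow> ('k, 'v) tens"

definition tens_dif :: "('k::field, 'v::ab_group_add, 'z) dga_scheme \<Rightarrow> ('k, 'v) tens \<Rightarrow> ('k, 'v) tens" where
  "tens_dif A = tlift A 2 (\<lambda>ds xs. pure A [dif A (xs ! 0), xs ! 1]
       + tscal ((-1) powi (ds ! 0)) (pure A [xs ! 0, dif A (xs ! 1)]))"

text \<open>
  On homogeneous \<open>xs = [a, b, c]\<close>, the signs \<open>(-1)\<^bsup>d|a|\<^esup>\<close> and \<open>(-1)\<^bsup>-d|a|\<^esup>\<close> (degree of \<open>a\<close> in
  \<open>A[d]\<close>), produced by moving the bracket and \<open>s\<^sup>d\<close> past \<open>a\<close>, cancel.
\<close>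

definition dbr3L :: "('k::field, 'v::ab_group_add, 'z) dpa_scheme \<Rightarrow> 'v list \<Rightarrow> ('k, 'v) tens" where
  "dbr3L A xs = tlift A 2 (\<lambda>_ ys. tlift A 2 (\<lambda>_ zs. pure A [zs ! 0, zs ! 1, ys ! 1])
                              (dbr A [xs ! 0, ys ! 0]))
                  (dbr A [xs ! 1, xs ! 2])"

definition cyc3 :: "nat \<Rightarrow> nat" where
  "cyc3 i = (if i < 3 then (i + 1) mod 3 else i)"

definition double_poisson :: "int \<Rightarrow> ('k::field_char_0, 'v::ab_group_add, 'z) dpa_scheme \<Rightarrow> bool" where
  "double_poisson d A \<longleftrightarrow>
     dg_algebra A \<and>
     multihom (shift d A) (tpow A 2) 2 d (dbr A) \<and>
     (\<forall>i. \<forall>a\<in>grade (shift d A) i. \<forall>b\<in>gcar A.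
        tens_dif A (dbr A [a, b]) =
          tscal ((-1) powi d)
            (dbr A [scal A ((-1) powi d) (dif A a), b]
              + tscal ((-1) powi i) (dbr A [a, scal A ((-1) powi d) (dif A b)]))) \<and>
     (\<forall>i j. \<forall>a\<in>grade (shift d A) i. \<forall>b\<in>grade (shift d A) j.
        - tscal ((-1) powi (i * j)) (dbr A [b, a]) =
          tens_perm A 2 (Transposition.transpose 0 1) (dbr A [a, b])) \<and>
     (\<forall>i j. \<forall>a\<in>grade A i. \<forall>b\<in>grade A j. \<forall>c\<in>gcar A.
        dbr A [a, mul A b c] =
          tlift A 2 (\<lambda>_ xs. pure A [xs ! 0, mul A (xs ! 1) c]) (dbr A [a, b])
          + tscal ((-1) powi ((i - d) * j))
              (tlift A 2 (\<lambda>_ xs. pure A [mul A b (xs ! 0), xs ! 1]) (dbr A [a, c]))) \<and>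
     (\<forall>ds xs. length xs = 3 \<and> homs (shift d A) ds xs \<longrightarrow>
        (\<Sum>\<sigma>\<in>{id, cyc3, cyc3 \<circ> cyc3}.
           tens_perm A 3 \<sigma>
             (tscal ((-1) powi koszul (inv \<sigma>) ds) (dbr3L A (perm_list (inv \<sigma>) xs)))) = 0)"

definition double_poisson_morphism ::
    "('k::field_char_0, 'v::ab_group_add, 'y) dpa_scheme \<Rightarrow> ('k, 'w::ab_group_add, 'z) dpa_scheme
      \<Rightarrow> ('v \<Rightarrow> 'w) \<Rightarrow> bool" where
  "double_poisson_morphism A B \<phi> \<longleftrightarrow>
     dga_morphism A B \<phi> \<and>
     (\<forall>a\<in>gcar A. \<forall>b\<in>gcar A.
        tlift A 2 (\<lambda>_ xs. pure B [\<phi> (xs ! 0), \<phi> (xs ! 1)]) (dbr A [a, b]) = dbr B [\<phi> a, \<phi> b])"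


section \<open>A-infinity algebras with bilinear forms\<close>

text \<open>\<open>ops E n\<close> is \<open>m\<^sub>n\<close>; only \<open>n \<ge> 1\<close> and lists of length \<open>n\<close> are relevant.\<close>

record ('k, 'v) ainf = "('k, 'v) gvs" +
  ops :: "nat \<Rightarrow> 'v list \<Rightarrow> 'v"

record ('k, 'v) bainf = "('k, 'v) ainf" +
  form :: "'v list \<Rightarrow> 'k"

text \<open>
  The factor \<open>(-1) powi ((2 - s) * \<dots>)\<close> is the Koszul sign of moving \<open>m\<^sub>s\<close> past the first \<open>r\<close>
  arguments.
\<close>

definition a_infinity :: "('k::field, 'v::ab_group_add, 'z) ainf_scheme \<Rightarrow> bool" where
  "a_infinity E \<longleftrightarrow>
     graded_space E \<and>
     (\<forall>n\<ge>1. multihom E E n (2 - int n) (ops E n)) \<and>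
     (\<forall>n\<ge>1. \<forall>ds xs. length xs = n \<and> homs E ds xs \<longrightarrow>
        (\<Sum>(r, s, t) \<in> {(r, s, t). r + s + t = n \<and> s \<ge> 1}.
           scal E ((-1) powi (int (r + s * t)) * (-1) powi ((2 - int s) * sum_list (take r ds)))
             (ops E (r + 1 + t)
               (take r xs @ [ops E s (take s (drop r xs))] @ drop (r + s) xs))) = 0)"

definition fully_manageable :: "('k::field, 'v::ab_group_add, 'z) ainf_scheme \<Rightarrow> bool" where
  "fully_manageable E \<longleftrightarrow> a_infinity E \<and>
     dg_algebra \<lparr>scal = scal E, grade = grade E,
        mul = (\<lambda>x y. ops E 2 [x, y]), dif = (\<lambda>x. ops E 1 [x])\<rparr>"

definition op_zero :: "('k, 'v::ab_group_add, 'z) ainf_scheme \<Rightarrow> nat \<Rightarrow> bool" where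
  "op_zero E n \<longleftrightarrow> (\<forall>xs. length xs = n \<and> set xs \<subseteq> gcar E \<longrightarrow> ops E n xs = 0)"

definition small :: "('k, 'v::ab_group_add, 'z) ainf_scheme \<Rightarrow> bool" where
  "small E \<longleftrightarrow> (\<forall>n\<ge>4. op_zero E n)"

definition essentially_odd :: "('k, 'v::ab_group_add, 'z) ainf_scheme \<Rightarrow> bool" where
  "essentially_odd E \<longleftrightarrow> (\<forall>i>1. op_zero E (2 * i))"

definition strict_morphism :: "('k, 'v::ab_group_add, 'y) ainf_scheme \<Rightarrow> ('k, 'w::ab_group_add, 'z) ainf_scheme
    \<Rightarrow> ('v \<Rightarrow> 'w) \<Rightarrow> bool" where
  "strict_morphism E E' f \<longleftrightarrow>
     glin E E' 0 f \<and>
     (\<forall>n\<ge>1. \<forall>xs. length xs = n \<and> set xs \<subseteq> gcar E \<longrightarrow> f (ops E n xs) = ops E' n (map f xs))"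

definition preserves_forms :: "('k, 'v::ab_group_add, 'y) bainf_scheme \<Rightarrow> ('k, 'w::ab_group_add, 'z) bainf_scheme
    \<Rightarrow> ('v \<Rightarrow> 'w) \<Rightarrow> bool" where
  "preserves_forms E E' f \<longleftrightarrow> (\<forall>x\<in>gcar E. \<forall>y\<in>gcar E. form E [x, y] = form E' [f x, f y])"

definition degenerate_cyclic :: "int \<Rightarrow> ('k::field, 'v::ab_group_add, 'z) bainf_scheme \<Rightarrow> bool" where
  "degenerate_cyclic e E \<longleftrightarrow>
     a_infinity E \<and>
     multihom E ground 2 e (form E) \<and>
     (\<forall>i j. \<forall>x\<in>grade E i. \<forall>y\<in>grade E j. (-1) powi (i * j) * form E [y, x] = form E [x, y]) \<and>
     (\<forall>n\<ge>1. \<forall>ds xs e0. \<forall>a0\<in>grade E e0. length xs = n \<and> homs E ds xs \<longrightarrow>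
        form E [ops E n xs, a0] =
          (-1) powi (int n + e0 * sum_list ds) * form E [ops E n (a0 # butlast xs), last xs])"

definition cyclic :: "int \<Rightarrow> ('k::field, 'v::ab_group_add, 'z) bainf_scheme \<Rightarrow> bool" where
  "cyclic e E \<longleftrightarrow>
     degenerate_cyclic e E \<and>
     (\<forall>x\<in>gcar E. (\<forall>y\<in>gcar E. form E [x, y] = 0) \<longrightarrow> x = 0)"

definition theta :: "(nat \<Rightarrow> nat) \<Rightarrow> nat \<Rightarrow> nat" where
  "theta \<sigma> k = 2 * \<sigma> (k div 2) + k mod 2"

text \<open>Here \<open>xs\<close> is the list \<open>[a\<^sub>1, b\<^sub>1, \<dots>, a\<^sub>n, b\<^sub>n]\<close>.\<close>

definition degenerate_ultracyclic :: "int \<Rightarrow> ('k::field, 'v::ab_group_add, 'z) bainf_scheme \<Rightarrow> bool" where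
  "degenerate_ultracyclic e E \<longleftrightarrow>
     degenerate_cyclic e E \<and> essentially_odd E \<and>
     (\<forall>n\<ge>1. \<forall>\<sigma>. \<forall>ds xs. \<sigma> permutes {..<n} \<and> length xs = 2 * n \<and> homs E ds xs \<longrightarrow>
        (let ys = perm_list (theta (inv \<sigma>)) xs in
          form E [ops E (2 * n - 1) (butlast ys), last ys] =
            (-1) powi koszul (theta (inv \<sigma>)) ds * form E [ops E (2 * n - 1) (butlast xs), last xs]))"

text \<open>\<open>P 0\<close> and \<open>P 1\<close> are the two summands of \<open>E\<close>.\<close>

definition good_map :: "(nat \<Rightarrow> 'v::ab_group_add set) \<Rightarrow> nat \<Rightarrow> ('v list \<Rightarrow> 'v) \<Rightarrow> bool" where
  "good_map P n m \<longleftrightarrow>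
     (\<forall>is xs. length is = n \<and> set is \<subseteq> {0, 1} \<and> list_all2 (\<lambda>i x. x \<in> P i) is xs \<longrightarrow>
        (if \<forall>j. Suc j < n \<longrightarrow> is ! j \<noteq> is ! Suc j then m xs \<in> P (is ! 0) else m xs = 0))"

definition good :: "(nat \<Rightarrow> 'v set) \<Rightarrow> ('k::field, 'v::ab_group_add, 'z) ainf_scheme \<Rightarrow> bool" where
  "good P E \<longleftrightarrow> a_infinity E \<and> essentially_odd E \<and> (\<forall>n. odd n \<longrightarrow> good_map P n (ops E n))"

definition nice :: "(nat \<Rightarrow> 'v set) \<Rightarrow> ('k::field, 'v::ab_group_add, 'z) ainf_scheme \<Rightarrow> bool" where
  "nice P E \<longleftrightarrow> good P E \<and> small E"


section \<open>Dg bimodules and the dg algebra attached to a morphism\<close>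

record ('k, 'a, 'm) dgbimod = "('k, 'm) gvs" +
  lact :: "'a \<Rightarrow> 'm \<Rightarrow> 'm"
  ract :: "'m \<Rightarrow> 'a \<Rightarrow> 'm"
  mdif :: "'m \<Rightarrow> 'm"

definition restrict_bimod :: "('a \<Rightarrow> 'b) \<Rightarrow> ('k, 'b, 'z) dga_scheme \<Rightarrow> ('k, 'a, 'b) dgbimod" where
  "restrict_bimod \<phi> B = \<lparr>scal = scal B, grade = grade B,
     lact = (\<lambda>a b. mul B (\<phi> a) b), ract = (\<lambda>b a. mul B b (\<phi> a)), mdif = dif B\<rparr>"

definition dual_bimod :: "('k::field, 'a::ab_group_add, 'y) dga_scheme
    \<Rightarrow> ('k, 'a, 'm::ab_group_add) dgbimod \<Rightarrow> ('k, 'a, 'm \<Rightarrow> 'k) dgbimod" where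
  "dual_bimod A M = \<lparr>scal = scal (gdual M), grade = grade (gdual M),
     lact = (\<lambda>a f c. if c \<in> gcar M then
        glift A (\<lambda>i a'. glift (gdual M) (\<lambda>p f'. glift M (\<lambda>j c'.
          (-1) powi (i * (p + j)) * f' (ract M c' a')) c) f) a else 0),
     ract = (\<lambda>f b c. if c \<in> gcar M then f (lact M b c) else 0),
     mdif = glift (gdual M) (\<lambda>p f c. if c \<in> gcar M then - ((-1) powi p) * f (mdif M c) else 0)\<rparr>"

definition shift_bimod :: "int \<Rightarrow> ('k::field, 'a::ab_group_add, 'y) dga_scheme
    \<Rightarrow> ('k, 'a, 'm::ab_group_add) dgbimod \<Rightarrow> ('k, 'a, 'm) dgbimod" where
  "shift_bimod k A M = \<lparr>scal = scal (shift k M), grade = grade (shift k M),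
     lact = (\<lambda>a m. glift A (\<lambda>i a'. scal M ((-1) powi (k * i)) (lact M a' m)) a),
     ract = ract M,
     mdif = (\<lambda>m. scal M ((-1) powi k) (mdif M m))\<rparr>"

definition trivial_extension :: "('k, 'a, 'y) dga_scheme \<Rightarrow> ('k, 'a, 'm::plus) dgbimod
    \<Rightarrow> ('k, 'a \<times> 'm) dga" where
  "trivial_extension A M = \<lparr>scal = scal (dsum A M), grade = grade (dsum A M),
     mul = (\<lambda>(a, m) (a', m'). (mul A a a', ract M m a' + lact M a m')),
     dif = (\<lambda>(a, m). (dif A a, mdif M m))\<rparr>"

text \<open>
  The graded space \<open>A \<oplus> B\<^sup>#[d-1]\<close>, its dg algebra structure for \<open>\<phi> : A \<rightarrow> B\<close>, and its bilinear
  form.  The constructions attached to a single algebra \<open>A\<close> are those attached to the identity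
  of \<open>A\<close>.
\<close>

definition bd_space :: "int \<Rightarrow> ('k::field, 'a::ab_group_add, 'y) gvs_scheme
    \<Rightarrow> ('k, 'b::ab_group_add, 'z) gvs_scheme \<Rightarrow> ('k, 'a \<times> ('b \<Rightarrow> 'k)) gvs" where
  "bd_space d A B = dsum A (shift (d - 1) (gdual B))"

definition bd_dga :: "int \<Rightarrow> ('k::field, 'a::ab_group_add, 'y) dga_scheme
    \<Rightarrow> ('k, 'b::ab_group_add, 'z) dga_scheme \<Rightarrow> ('a \<Rightarrow> 'b) \<Rightarrow> ('k, 'a \<times> ('b \<Rightarrow> 'k)) dga" where
  "bd_dga d A B \<phi> =
     trivial_extension A (shift_bimod (d - 1) A (dual_bimod A (restrict_bimod \<phi> B)))"

definition bd_form :: "int \<Rightarrow> ('k::field, 'a::ab_group_add, 'y) gvs_scheme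
    \<Rightarrow> ('k, 'b::ab_group_add, 'z) gvs_scheme \<Rightarrow> ('a \<Rightarrow> 'b) \<Rightarrow> ('a \<times> ('b \<Rightarrow> 'k)) list \<Rightarrow> 'k" where
  "bd_form d A B \<phi> xs =
     (let (a, f) = xs ! 0; (b, g) = xs ! 1 in
       f (\<phi> b) + glift A (\<lambda>i a'. glift (gdual B) (\<lambda>p g'.
          (-1) powi (i * (p - d + 1)) * g' (\<phi> a')) g) a)"

definition bd_part :: "('k::field, 'a::ab_group_add, 'y) gvs_scheme
    \<Rightarrow> ('k, 'b::ab_group_add, 'z) gvs_scheme \<Rightarrow> nat \<Rightarrow> ('a \<times> ('b \<Rightarrow> 'k)) set" where
  "bd_part A B i = (if i = 0 then gcar A \<times> {0} else {0} \<times> gcar (gdual B))"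


section \<open>Pre-Calabi-Yau structures\<close>

definition bd_ainf :: "int \<Rightarrow> ('k::field, 'a::ab_group_add, 'z) gvs_scheme
    \<Rightarrow> (nat \<Rightarrow> ('a \<times> ('a \<Rightarrow> 'k)) list \<Rightarrow> 'a \<times> ('a \<Rightarrow> 'k)) \<Rightarrow> ('k, 'a \<times> ('a \<Rightarrow> 'k)) bainf" where
  "bd_ainf d A m = \<lparr>scal = scal (bd_space d A A), grade = grade (bd_space d A A),
     ops = m, form = bd_form d A A id\<rparr>"

definition pre_CY :: "int \<Rightarrow> ('k::field, 'a::ab_group_add, 'z) gvs_scheme
    \<Rightarrow> (nat \<Rightarrow> ('a \<times> ('a \<Rightarrow> 'k)) list \<Rightarrow> 'a \<times> ('a \<Rightarrow> 'k)) \<Rightarrow> bool" where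
  "pre_CY d A m \<longleftrightarrow>
     graded_space A \<and> cyclic (d - 1) (bd_ainf d A m) \<and>
     (\<forall>n\<ge>1. \<forall>xs. length xs = n \<and> set xs \<subseteq> bd_part A A 0 \<longrightarrow> m n xs \<in> bd_part A A 0)"

text \<open>
  \<open>m\<close> is the nice pre-Calabi-Yau structure corresponding to the double bracket of \<open>A\<close>; the
  \<open>tlift\<close> expression is \<open>f \<otimes> g\<close> applied to the bracket of \<open>a\<close> and \<open>b\<close>.
\<close>

definition corresponds :: "int \<Rightarrow> ('k::field, 'a::ab_group_add, 'z) dpa_scheme
    \<Rightarrow> (nat \<Rightarrow> ('a \<times> ('a \<Rightarrow> 'k)) list \<Rightarrow> 'a \<times> ('a \<Rightarrow> 'k)) \<Rightarrow> bool" where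
  "corresponds d A m \<longleftrightarrow>
     pre_CY d A m \<and> nice (bd_part A A) (bd_ainf d A m) \<and>
     (\<forall>x\<in>gcar (bd_space d A A). m 1 [x] = dif (bd_dga d A A id) x) \<and>
     (\<forall>x\<in>gcar (bd_space d A A). \<forall>y\<in>gcar (bd_space d A A). m 2 [x, y] = mul (bd_dga d A A id) x y) \<and>
     (\<forall>i j p q. \<forall>a\<in>grade A i. \<forall>b\<in>grade A j. \<forall>f\<in>grade (gdual A) p. \<forall>g\<in>grade (gdual A) q.
        tlift A 2 (\<lambda>ds xs. (-1) powi (q * ds ! 0) * f (xs ! 0) * g (xs ! 1)) (dbr A [a, b]) =
          (-1) powi (j * (i + q + 1))
            * bd_form d A A id [m 3 [(b, 0), (0, g), (a, 0)], (0, f)])"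

text \<open>
  Such a structure exists for every double Poisson bracket and is unique on the carrier; its
  values elsewhere are irrelevant, hence \<open>SOME\<close> rather than \<open>THE\<close>.
\<close>

definition dp_ops :: "int \<Rightarrow> ('k::field, 'a::ab_group_add, 'z) dpa_scheme
    \<Rightarrow> nat \<Rightarrow> ('a \<times> ('a \<Rightarrow> 'k)) list \<Rightarrow> 'a \<times> ('a \<Rightarrow> 'k)" where
  "dp_ops d A = (SOME m. corresponds d A m)"

text \<open>
  A good map \<open>m\<^sub>3\<close> has an \<open>A\<close>-component depending only on the arguments of type
  \<open>(a, tf, b)\<close> and a \<open>B\<^sup>#[d-1]\<close>-component depending only on those of type \<open>(tf, b, tg)\<close>.
\<close>

definition mor_op3 :: "int \<Rightarrow> ('k::field, 'a::ab_group_add, 'y) dpa_scheme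
    \<Rightarrow> ('k, 'b::ab_group_add, 'z) dpa_scheme \<Rightarrow> ('a \<Rightarrow> 'b)
    \<Rightarrow> ('a \<times> ('b \<Rightarrow> 'k)) list \<Rightarrow> 'a \<times> ('b \<Rightarrow> 'k)" where
  "mor_op3 d A B \<phi> xs =
     (let (a, f) = xs ! 0; (b, g) = xs ! 1; (c, h) = xs ! 2 in
       (fst (dp_ops d A 3 [(a, 0), (0, dual_map A \<phi> g), (c, 0)]),
        snd (dp_ops d B 3 [(0, f), (\<phi> b, 0), (0, h)])))"

definition bd_mor :: "int \<Rightarrow> ('k::field, 'a::ab_group_add, 'y) dpa_scheme
    \<Rightarrow> ('k, 'b::ab_group_add, 'z) dpa_scheme \<Rightarrow> ('a \<Rightarrow> 'b) \<Rightarrow> ('k, 'a \<times> ('b \<Rightarrow> 'k)) bainf" where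
  "bd_mor d A B \<phi> = \<lparr>scal = scal (bd_space d A B), grade = grade (bd_space d A B),
     ops = (\<lambda>n xs. if n = 1 then dif (bd_dga d A B \<phi>) (xs ! 0)
                   else if n = 2 then mul (bd_dga d A B \<phi>) (xs ! 0) (xs ! 1)
                   else if n = 3 then mor_op3 d A B \<phi> xs
                   else 0),
     form = bd_form d A B \<phi>\<rparr>"

definition pull_dual :: "('k::field, 'v::ab_group_add, 'z) gvs_scheme \<Rightarrow> ('v \<Rightarrow> 'w)
    \<Rightarrow> 'a \<times> ('w \<Rightarrow> 'k) \<Rightarrow> 'a \<times> ('v \<Rightarrow> 'k)" where
  "pull_dual V \<phi> = (\<lambda>(a, f). (a, dual_map V \<phi> f))"

definition push_alg :: "('a \<Rightarrow> 'b) \<Rightarrow> 'a \<times> 'm \<Rightarrow> 'b \<times> 'm" where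
  "push_alg \<phi> = (\<lambda>(a, f). (\<phi> a, f))"

definition pre_CY_morphism :: "int
    \<Rightarrow> ('k::field, 'a::ab_group_add, 'x) gvs_scheme
    \<Rightarrow> (nat \<Rightarrow> ('a \<times> ('a \<Rightarrow> 'k)) list \<Rightarrow> 'a \<times> ('a \<Rightarrow> 'k))
    \<Rightarrow> ('k, 'b::ab_group_add, 'y) gvs_scheme
    \<Rightarrow> (nat \<Rightarrow> ('b \<times> ('b \<Rightarrow> 'k)) list \<Rightarrow> 'b \<times> ('b \<Rightarrow> 'k))
    \<Rightarrow> ('k, 'e::ab_group_add) bainf \<times> ('e \<Rightarrow> 'a \<times> ('a \<Rightarrow> 'k)) \<times> ('e \<Rightarrow> 'b \<times> ('b \<Rightarrow> 'k)) \<Rightarrow> bool" where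
  "pre_CY_morphism d A m A' m' = (\<lambda>(D, \<Phi>, \<Psi>).
     pre_CY d A m \<and> pre_CY d A' m' \<and>
     degenerate_ultracyclic (d - 1) D \<and>
     strict_morphism D (bd_ainf d A m) \<Phi> \<and> preserves_forms D (bd_ainf d A m) \<Phi> \<and>
     strict_morphism D (bd_ainf d A' m') \<Psi> \<and> preserves_forms D (bd_ainf d A' m') \<Psi>)"

text \<open>
  \<open>(D'', \<Phi>'', \<Psi>'')\<close> witnesses that \<open>(D, \<Phi>, \<Psi>)\<close> and \<open>(D', \<Phi>', \<Psi>')\<close> are composable.
\<close>

definition composing :: "int
    \<Rightarrow> ('k::field, 'd::ab_group_add) bainf \<times> ('d \<Rightarrow> 'a) \<times> ('d \<Rightarrow> 'b)
    \<Rightarrow> ('k, 'e::ab_group_add) bainf \<times> ('e \<Rightarrow> 'b) \<times> ('e \<Rightarrow> 'c)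
    \<Rightarrow> ('k, 'f::ab_group_add) bainf \<times> ('f \<Rightarrow> 'd) \<times> ('f \<Rightarrow> 'e) \<Rightarrow> bool" where
  "composing d = (\<lambda>(D, \<Phi>, \<Psi>) (D', \<Phi>', \<Psi>') (D'', \<Phi>'', \<Psi>'').
     degenerate_ultracyclic (d - 1) D'' \<and>
     strict_morphism D'' D \<Phi>'' \<and> preserves_forms D'' D \<Phi>'' \<and>
     strict_morphism D'' D' \<Psi>'' \<and> preserves_forms D'' D' \<Psi>'' \<and>
     (\<forall>x\<in>gcar D''. \<Psi> (\<Phi>'' x) = \<Phi>' (\<Psi>'' x)))"

text \<open>The first argument of \<open>composable\<close> is the type in which \<open>D''\<close> is sought.\<close>

definition composable :: "'f::ab_group_add itself \<Rightarrow> int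
    \<Rightarrow> ('k::field, 'd::ab_group_add) bainf \<times> ('d \<Rightarrow> 'a) \<times> ('d \<Rightarrow> 'b)
    \<Rightarrow> ('k, 'e::ab_group_add) bainf \<times> ('e \<Rightarrow> 'b) \<times> ('e \<Rightarrow> 'c) \<Rightarrow> bool" where
  "composable _ d M N \<longleftrightarrow>
     (\<exists>W :: ('k, 'f) bainf \<times> ('f \<Rightarrow> 'd) \<times> ('f \<Rightarrow> 'e). composing d M N W)"

definition composition_via ::
    "('k, 'd) bainf \<times> ('d \<Rightarrow> 'a) \<times> ('d \<Rightarrow> 'b)
    \<Rightarrow> ('k, 'e) bainf \<times> ('e \<Rightarrow> 'b) \<times> ('e \<Rightarrow> 'c)
    \<Rightarrow> ('k, 'f) bainf \<times> ('f \<Rightarrow> 'd) \<times> ('f \<Rightarrow> 'e)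
    \<Rightarrow> ('k, 'f) bainf \<times> ('f \<Rightarrow> 'a) \<times> ('f \<Rightarrow> 'c)" where
  "composition_via = (\<lambda>(D, \<Phi>, \<Psi>) (D', \<Phi>', \<Psi>') (D'', \<Phi>'', \<Psi>''). (D'', \<Phi> \<circ> \<Phi>'', \<Psi>' \<circ> \<Psi>''))"

end

theory Submission imports Defs begin

text \<open>
  The heart of the matter is that a double bracket yields a nice pre-Calabi-Yau structure on
  \<open>A \<oplus> A\<^sup>#[d-1]\<close>.  Contracting the bracket with a functional gives \<open>m\<^sub>3(b, tg, a)\<close>, and cyclicity
  dictates \<open>m\<^sub>3(tf, a, tg)\<close>.  Evaluated on functionals, the A-infinity relations of arity 3, 4 and 5
  become, up to signs, the compatibility with the differential, the double Leibniz rule and the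
  double Jacobi identity; evaluating a relation with values in \<open>A\<^sup>#[d-1]\<close> at an element of \<open>A\<close>
  rotates it into a relation with values in \<open>A\<close>.

  For a morphism \<open>\<phi> : A \<rightarrow> B\<close>, the maps from \<open>\<partial>\<^bsub>d-1\<^esub>\<phi>\<close> to \<open>\<partial>\<^bsub>d-1\<^esub>A\<close> and \<open>\<partial>\<^bsub>d-1\<^esub>B\<close> commute with all
  operations and with the forms, and they are jointly injective: the first one remembers the
  \<open>A\<close>-component and the second one the \<open>B\<^sup>#\<close>-component.  Hence every identity on \<open>\<partial>\<^bsub>d-1\<^esub>\<phi>\<close> follows
  from those on \<open>\<partial>\<^bsub>d-1\<^esub>A\<close> and \<open>\<partial>\<^bsub>d-1\<^esub>B\<close>, and the maps out of \<open>\<partial>\<^bsub>d-1\<^esub>\<upsilon>\<close> are strict because their two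
  components can be compared in \<open>\<partial>\<^bsub>d-1\<^esub>A\<close>, \<open>\<partial>\<^bsub>d-1\<^esub>B\<close> and \<open>\<partial>\<^bsub>d-1\<^esub>C\<close>.
\<close>

text \<open>The structure \<open>dp_ops\<close> is obtained by \<open>SOME\<close>, so nothing is
  known about it until a witness of \<open>corresponds\<close> exists; hence a full construction is
  needed although the theorem is about morphisms. The bracket formula, cyclicity and nondegeneracy
  force every witness to agree with the constructed one on the carrier, which makes
  \<open>dp_ops\<close> computable.

  The obstacle is the signs. A functional of degree \<open>p\<close> kills every homogeneous element
  whose degree is not \<open>- p\<close>. Outside one critical total degree all evaluated terms
  therefore vanish; inside it one degree can be eliminated, and the sign exponents become
  polynomials in the remaining degrees, to be compared modulo 2. Tensors, being functions on
  multilinear forms, are handled through their values on products of functionals.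

  Rotating a relation into one with values in \<open>A\<close> is not purely formal: the rotation of
  the ternary operation by one place is a definition, but the rotation by two places is the
  antisymmetry of the bracket.\<close>

abbreviation sg :: "int \<Rightarrow> 'k::field" where "sg n \<equiv> (-1) powi n"

section \<open>Signs and their parity\<close>

lemma sg_if: "(sg n :: 'k::field) = (if even n then 1 else - 1)"
  by (metis power_int_minus_left power_int_1_left)

lemma sg_cong: "even (m + n) \<Longrightarrow> (sg m :: 'k::field) = sg n"
  by (simp add: sg_if)

lemma sg_mult: "(sg m :: 'k::field) * sg n = sg (m + n)"
  by (simp add: sg_if)

lemma sg_mult_left: "(sg m :: 'k::field) * (sg n * x) = sg (m + n) * x"
  by (simp add: sg_if)

lemma sg_square [simp]: "(sg n :: 'k::field) * sg n = 1"
  by (simp add: sg_if)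

lemma sg_square_left [simp]: "(sg n :: 'k::field) * (sg n * x) = x"
  by (simp add: sg_if)

text \<open>Two systems of signs give equivalent relations when they differ by one common sign: the
  evenness conditions say that \<open>a + a'\<close>, \<open>b + b'\<close> and
  \<open>c + c'\<close> have the same parity. Relations among evaluated operations are matched with
  the bracket axioms in this way, so that only parities remain to be checked.\<close>

lemma three_term_sg:
  fixes x y z :: "'k::field"
  assumes "sg a * x + sg b * y + sg c * z = 0"
    and "even (a + a' + b + b')" "even (a + a' + c + c')"
  shows "sg a' * x + sg b' * y + sg c' * z = 0"
proof -
  have "sg a' * x + sg b' * y + sg c' * z = sg (a + a') * (sg a * x + sg b * y + sg c * z)"
    using assms(2,3) by (auto simp: sg_if algebra_simps)
  then show ?thesis using assms(1) by simp
qed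


section \<open>Graded spaces\<close>

text \<open>Linearity on the carrier without a degree condition. The scalar multiplication of the
  target is a parameter, so that the ground field, tensors and plain function spaces can be targets
  without being packaged as graded spaces.\<close>

definition lin_on :: "('k, 'v::ab_group_add, 'z) gvs_scheme \<Rightarrow> ('k \<Rightarrow> 'w::ab_group_add \<Rightarrow> 'w)
    \<Rightarrow> ('v \<Rightarrow> 'w) \<Rightarrow> bool" where
  "lin_on V sc f \<longleftrightarrow>
     (\<forall>u\<in>gcar V. \<forall>v\<in>gcar V. f (u + v) = f u + f v) \<and>
     (\<forall>c. \<forall>v\<in>gcar V. f (scal V c v) = sc c (f v))"

lemma lin_onI:
  assumes "\<And>u v. u \<in> gcar V \<Longrightarrow> v \<in> gcar V \<Longrightarrow> f (u + v) = f u + f v"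
    and "\<And>c v. v \<in> gcar V \<Longrightarrow> f (scal V c v) = sc c (f v)"
  shows "lin_on V sc f"
  using assms by (simp add: lin_on_def)

lemma lin_on_add: "lin_on V sc f \<Longrightarrow> u \<in> gcar V \<Longrightarrow> v \<in> gcar V \<Longrightarrow> f (u + v) = f u + f v"
  and lin_on_scal: "lin_on V sc f \<Longrightarrow> v \<in> gcar V \<Longrightarrow> f (scal V c v) = sc c (f v)"
  by (simp_all add: lin_on_def)

lemma glin_iff: "glin V W e f \<longleftrightarrow> lin_on V (scal W) f \<and> (\<forall>n. \<forall>v\<in>grade V n. f v \<in> grade W (n + e))"
  by (auto simp: glin_def lin_on_def)

lemma vs_sc:
  assumes "graded_space V"
  shows "scal V c (x + y) = scal V c x + scal V c y" "scal V (c + c') x = scal V c x + scal V c' x"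
    "scal V c (scal V c' x) = scal V (c * c') x" "scal V 1 x = x" "scal V 0 x = 0"
    "scal V c 0 = 0" "scal V c (- x) = - scal V c x" "scal V (- c) x = - scal V c x"
    "scal V c (x - y) = scal V c x - scal V c y"
proof -
  interpret vector_space "scal V" using assms by (simp add: graded_space_def)
  show "scal V c (x + y) = scal V c x + scal V c y" "scal V (c + c') x = scal V c x + scal V c' x"
    "scal V c (scal V c' x) = scal V (c * c') x" "scal V 1 x = x" "scal V 0 x = 0"
    "scal V c 0 = 0" "scal V c (- x) = - scal V c x" "scal V (- c) x = - scal V c x"
    "scal V c (x - y) = scal V c x - scal V c y"
    by (simp_all add: scale_right_distrib scale_left_distrib scale_right_diff_distrib)
qed

lemma vs_sc_sum:
  assumes "graded_space V"
  shows "scal V c (\<Sum>i\<in>I. x i) = (\<Sum>i\<in>I. scal V c (x i))"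
proof -
  interpret vector_space "scal V" using assms by (simp add: graded_space_def)
  show ?thesis by (rule scale_sum_right)
qed

lemma grade_closed:
  assumes "graded_space V"
  shows "0 \<in> grade V n" "x \<in> grade V n \<Longrightarrow> y \<in> grade V n \<Longrightarrow> x + y \<in> grade V n"
    "x \<in> grade V n \<Longrightarrow> scal V c x \<in> grade V n" "x \<in> grade V n \<Longrightarrow> - x \<in> grade V n"
    "x \<in> grade V n \<Longrightarrow> y \<in> grade V n \<Longrightarrow> x - y \<in> grade V n"
proof -
  interpret vector_space "scal V" using assms by (simp add: graded_space_def)
  have s: "subspace (grade V n)" using assms by (simp add: graded_space_def)
  show "0 \<in> grade V n" "x \<in> grade V n \<Longrightarrow> y \<in> grade V n \<Longrightarrow> x + y \<in> grade V n"
    "x \<in> grade V n \<Longrightarrow> scal V c x \<in> grade V n" "x \<in> grade V n \<Longrightarrow> - x \<in> grade V n"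
    "x \<in> grade V n \<Longrightarrow> y \<in> grade V n \<Longrightarrow> x - y \<in> grade V n"
    using s by (auto intro: subspace_0 subspace_add subspace_scale subspace_neg subspace_diff)
qed

lemma grade_indep:
  assumes "graded_space V" "finite I" "\<And>i. i \<in> I \<Longrightarrow> x i \<in> grade V i" "(\<Sum>i\<in>I. x i) = 0" "i \<in> I"
  shows "x i = 0"
  using assms unfolding graded_space_def by blast

lemma gcar_grade: "x \<in> grade V n \<Longrightarrow> x \<in> gcar V"
  unfolding gcar_def by (intro CollectI exI[of _ "{n}"] exI[of _ "\<lambda>_. x"]) auto

lemma gcar_finsum:
  assumes "graded_space V" "finite I" "\<And>i. i \<in> I \<Longrightarrow> x i \<in> grade V i"
  shows "(\<Sum>i\<in>I. x i) \<in> gcar V"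
  using assms unfolding gcar_def by blast

lemma gcar_as_fun:
  assumes "graded_space V" "v \<in> gcar V"
  obtains c where "\<And>i. c i \<in> grade V i" "finite {i. c i \<noteq> 0}" "v = (\<Sum>i | c i \<noteq> 0. c i)"
proof -
  from assms(2) obtain I x where I: "finite I" "\<forall>i\<in>I. x i \<in> grade V i" "v = (\<Sum>i\<in>I. x i)"
    by (auto simp: gcar_def)
  define c where "c i = (if i \<in> I then x i else 0)" for i
  have "finite {i. c i \<noteq> 0}" by (rule finite_subset[OF _ I(1)]) (auto simp: c_def)
  moreover have "c i \<in> grade V i" for i using I(2) grade_closed(1)[OF assms(1)] by (simp add: c_def)
  moreover have "v = (\<Sum>i | c i \<noteq> 0. c i)"
    unfolding I(3) by (rule sum.mono_neutral_cong_right[OF I(1)]) (auto simp: c_def)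
  ultimately show ?thesis using that by blast
qed

lemma sum_supp:
  assumes "finite S" "{i. c i \<noteq> 0} \<subseteq> S"
  shows "(\<Sum>i | c i \<noteq> (0::'a::comm_monoid_add). c i) = (\<Sum>i\<in>S. c i)"
  by (rule sum.mono_neutral_cong_left) (use assms in auto)

text \<open>The difference of two decompositions is a vanishing sum of homogeneous elements over the
  union of the supports, so independence of the degrees applies. This gives the definite description
  in \<open>hcomp\<close> its meaning.\<close>

lemma hcomp_unique:
  assumes V: "graded_space V"
    and "\<And>i. c i \<in> grade V i" "finite {i. c i \<noteq> 0}" "v = (\<Sum>i | c i \<noteq> 0. c i)"
  shows "hcomp V v = c"
  unfolding hcomp_def
proof (rule the_equality)
  fix c' assume c': "(\<forall>i. c' i \<in> grade V i) \<and> finite {i. c' i \<noteq> 0} \<and> v = (\<Sum>i | c' i \<noteq> 0. c' i)"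
  define S where "S = {i. c i \<noteq> 0} \<union> {i. c' i \<noteq> 0}"
  have fS: "finite S" using assms c' by (simp add: S_def)
  have "(\<Sum>i\<in>S. c' i - c i) = 0"
    using sum_supp[of S c] sum_supp[of S c'] fS assms(4) c' by (auto simp: S_def sum_subtractf)
  then have "c' i - c i = 0" if "i \<in> S" for i
    using grade_indep[OF V fS, of "\<lambda>i. c' i - c i" i] grade_closed(5)[OF V] assms(2) c' that by blast
  then show "c' = c" by (force simp: S_def)
qed (use assms in auto)

lemma hcomp_props:
  assumes "graded_space V" "v \<in> gcar V"
  shows "hcomp V v i \<in> grade V i" "finite {i. hcomp V v i \<noteq> 0}" "v = (\<Sum>i | hcomp V v i \<noteq> 0. hcomp V v i)"
proof -
  obtain c where c: "\<And>i. c i \<in> grade V i" "finite {i. c i \<noteq> 0}" "v = (\<Sum>i | c i \<noteq> 0. c i)"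
    using gcar_as_fun[OF assms] by blast
  show "hcomp V v i \<in> grade V i" "finite {i. hcomp V v i \<noteq> 0}" "v = (\<Sum>i | hcomp V v i \<noteq> 0. hcomp V v i)"
    using c hcomp_unique[OF assms(1) c] by auto
qed

lemma hcomp_eqI:
  assumes V: "graded_space V" and "finite S" "\<And>i. c i \<in> grade V i" "\<And>i. i \<notin> S \<Longrightarrow> c i = 0" "v = (\<Sum>i\<in>S. c i)"
  shows "hcomp V v = c"
  by (rule hcomp_unique[OF V]) (use assms in \<open>auto intro: finite_subset[OF _ assms(2)] sum.mono_neutral_cong_right\<close>)

lemma hcomp_grade:
  assumes V: "graded_space V" and "x \<in> grade V n"
  shows "hcomp V x = (\<lambda>i. if i = n then x else 0)"
  by (rule hcomp_eqI[OF V, of "{n}"]) (use assms grade_closed[OF V] in auto)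

lemma gcar_closed:
  assumes V: "graded_space V"
  shows "0 \<in> gcar V" "x \<in> gcar V \<Longrightarrow> y \<in> gcar V \<Longrightarrow> x + y \<in> gcar V"
    "x \<in> gcar V \<Longrightarrow> scal V c x \<in> gcar V"
proof -
  show "0 \<in> gcar V" using grade_closed(1)[OF V] gcar_grade by blast
  show "x + y \<in> gcar V" if x: "x \<in> gcar V" and y: "y \<in> gcar V"
  proof -
    define S where "S = {i. hcomp V x i \<noteq> 0} \<union> {i. hcomp V y i \<noteq> 0}"
    have fS: "finite S" using hcomp_props(2)[OF V] x y by (simp add: S_def)
    have "x + y = (\<Sum>i\<in>S. hcomp V x i + hcomp V y i)"
      using sum_supp[of S "hcomp V x"] sum_supp[of S "hcomp V y"] fS hcomp_props(3)[OF V] x y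
      by (auto simp: S_def sum.distrib)
    also have "\<dots> \<in> gcar V"
      by (intro gcar_finsum[OF V fS] grade_closed[OF V] hcomp_props[OF V] x y)
    finally show ?thesis .
  qed
  show "scal V c x \<in> gcar V" if x: "x \<in> gcar V"
  proof -
    have "scal V c x = (\<Sum>i | hcomp V x i \<noteq> 0. scal V c (hcomp V x i))"
      by (subst hcomp_props(3)[OF V x]) (rule vs_sc_sum[OF V])
    also have "\<dots> \<in> gcar V"
      by (intro gcar_finsum[OF V] grade_closed[OF V] hcomp_props[OF V x])
    finally show ?thesis .
  qed
qed

lemma gcar_minus:
  assumes V: "graded_space V"
  shows "x \<in> gcar V \<Longrightarrow> - x \<in> gcar V" "x \<in> gcar V \<Longrightarrow> y \<in> gcar V \<Longrightarrow> x - y \<in> gcar V"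
proof -
  have *: "- x \<in> gcar V" if "x \<in> gcar V" for x
    using gcar_closed(3)[OF V that, of "-1"] by (simp add: vs_sc[OF V])
  show "x \<in> gcar V \<Longrightarrow> - x \<in> gcar V" by (rule *)
  show "x \<in> gcar V \<Longrightarrow> y \<in> gcar V \<Longrightarrow> x - y \<in> gcar V"
    using gcar_closed(2)[OF V, of x "-y"] * by simp
qed

lemma gcar_sum:
  assumes V: "graded_space V" and "\<And>i. i \<in> I \<Longrightarrow> x i \<in> gcar V"
  shows "(\<Sum>i\<in>I. x i) \<in> gcar V"
  using assms(2) by (induction I rule: infinite_finite_induct) (auto intro: gcar_closed[OF V])

text \<open>Zero needs no case of its own, being homogeneous of every degree. The additive step is
  offered for carrier elements only, because the ambient type may be larger.\<close>

lemma gcar_induct [consumes 2, case_names grade add]: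
  assumes V: "graded_space V" and x: "x \<in> gcar V"
    and h: "\<And>n x. x \<in> grade V n \<Longrightarrow> P x"
    and a: "\<And>x y. x \<in> gcar V \<Longrightarrow> y \<in> gcar V \<Longrightarrow> P x \<Longrightarrow> P y \<Longrightarrow> P (x + y)"
  shows "P x"
proof -
  have "P (\<Sum>i\<in>I. c i) \<and> (\<Sum>i\<in>I. c i) \<in> gcar V" if "finite I" "\<And>i. i \<in> I \<Longrightarrow> c i \<in> grade V i" for I c
    using that
  proof (induction I rule: finite_induct)
    case empty
    show ?case using h[OF grade_closed(1)[OF V]] gcar_closed(1)[OF V] by simp
  next
    case (insert i I)
    then show ?case using a[of "c i" "\<Sum>i\<in>I. c i"] h gcar_grade gcar_closed(2)[OF V]
      by (metis insertCI sum.insert)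
  qed
  moreover obtain I c where "finite I" "\<forall>i\<in>I. c i \<in> grade V i" "x = (\<Sum>i\<in>I. c i)"
    using x by (auto simp: gcar_def)
  ultimately show ?thesis by blast
qed

lemma hcomp_add:
  assumes V: "graded_space V" and x: "x \<in> gcar V" and y: "y \<in> gcar V"
  shows "hcomp V (x + y) = (\<lambda>i. hcomp V x i + hcomp V y i)"
proof (rule hcomp_eqI[OF V, of "{i. hcomp V x i \<noteq> 0} \<union> {i. hcomp V y i \<noteq> 0}"])
  let ?S = "{i. hcomp V x i \<noteq> 0} \<union> {i. hcomp V y i \<noteq> 0}"
  show "finite ?S" using hcomp_props(2)[OF V] x y by simp
  then show "x + y = (\<Sum>i\<in>?S. hcomp V x i + hcomp V y i)"
    using sum_supp[of ?S "hcomp V x"] sum_supp[of ?S "hcomp V y"] hcomp_props(3)[OF V] x y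
    by (auto simp: sum.distrib)
qed (use x y in \<open>auto intro: grade_closed[OF V] hcomp_props[OF V]\<close>)

lemma hcomp_scal:
  assumes V: "graded_space V" and x: "x \<in> gcar V"
  shows "hcomp V (scal V c x) = (\<lambda>i. scal V c (hcomp V x i))"
proof (rule hcomp_eqI[OF V, of "{i. hcomp V x i \<noteq> 0}"])
  show "finite {i. hcomp V x i \<noteq> 0}" using hcomp_props(2)[OF V] x by simp
  show "scal V c x = (\<Sum>i | hcomp V x i \<noteq> 0. scal V c (hcomp V x i))"
    by (subst hcomp_props(3)[OF V x]) (rule vs_sc_sum[OF V])
qed (use x in \<open>auto intro: grade_closed[OF V] hcomp_props[OF V] simp: vs_sc[OF V]\<close>)

text \<open>Sums over the supports of different elements must be put on a common index set before
  they can be added; this works because every \<open>h i\<close> vanishes at 0.\<close>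

lemma glift_superset:
  assumes V: "graded_space V" and "finite S" "{i. hcomp V v i \<noteq> 0} \<subseteq> S" and h0: "\<And>i. h i 0 = 0"
  shows "glift V h v = (\<Sum>i\<in>S. h i (hcomp V v i))"
  unfolding glift_def by (rule sum.mono_neutral_left) (use assms in auto)

lemma glift_grade:
  assumes V: "graded_space V" and "x \<in> grade V n" and "h n 0 = 0"
  shows "glift V h x = h n x"
proof (cases "x = 0")
  case True
  then have "hcomp V x = (\<lambda>i. 0)" using hcomp_grade[OF V assms(2)] by auto
  then show ?thesis using True assms(3) by (simp add: glift_def)
next
  case False
  then have "{i. (if i = n then x else 0) \<noteq> 0} = {n}" by auto
  then show ?thesis by (simp add: glift_def hcomp_grade[OF V assms(2)])
qed

lemma glift_add:
  assumes V: "graded_space V" and h0: "\<And>i. h i 0 = 0"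
    and h: "\<And>i x y. x \<in> grade V i \<Longrightarrow> y \<in> grade V i \<Longrightarrow> h i (x + y) = h i x + h i y"
    and x: "x \<in> gcar V" and y: "y \<in> gcar V"
  shows "glift V h (x + y) = glift V h x + glift V h y"
proof -
  let ?S = "{i. hcomp V x i \<noteq> 0} \<union> {i. hcomp V y i \<noteq> 0}"
  have fS: "finite ?S" using hcomp_props(2)[OF V] x y by simp
  have "glift V h (x + y) = (\<Sum>i\<in>?S. h i (hcomp V x i + hcomp V y i))"
    by (subst glift_superset[where h=h, OF V fS _ h0]) (auto simp: hcomp_add[OF V x y])
  also have "\<dots> = (\<Sum>i\<in>?S. h i (hcomp V x i)) + (\<Sum>i\<in>?S. h i (hcomp V y i))"
    by (simp add: h hcomp_props[OF V] x y sum.distrib)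
  also have "\<dots> = glift V h x + glift V h y"
    by (subst (1 2) glift_superset[where h=h, OF V fS _ h0]) auto
  finally show ?thesis .
qed

lemma glift_scal:
  assumes V: "graded_space V" and h0: "\<And>i. h i 0 = 0"
    and h: "\<And>i x. x \<in> grade V i \<Longrightarrow> h i (scal V c x) = sc (h i x)"
    and sc: "sc 0 = 0" "\<And>x y. sc (x + y) = sc x + sc y"
    and x: "x \<in> gcar V"
  shows "glift V h (scal V c x) = sc (glift V h x)"
proof -
  let ?S = "{i. hcomp V x i \<noteq> 0}"
  have fS: "finite ?S" using hcomp_props(2)[OF V] x by simp
  have "glift V h (scal V c x) = (\<Sum>i\<in>?S. h i (scal V c (hcomp V x i)))"
    by (subst glift_superset[where h=h, OF V fS _ h0]) (auto simp: hcomp_scal[OF V x] vs_sc[OF V])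
  also have "\<dots> = (\<Sum>i\<in>?S. sc (h i (hcomp V x i)))"
    by (simp add: h hcomp_props[OF V] x)
  also have "\<dots> = sc (\<Sum>i\<in>?S. h i (hcomp V x i))"
  proof -
    have "(\<Sum>i\<in>S. sc (g i)) = sc (\<Sum>i\<in>S. g i)" for S and g
      by (induction S rule: infinite_finite_induct) (simp_all add: sc)
    then show ?thesis .
  qed
  also have "\<dots> = sc (glift V h x)"
    by (subst glift_superset[where h=h, OF V fS _ h0]) auto
  finally show ?thesis .
qed

lemma glift_lin_on:
  assumes V: "graded_space V" and W: "vector_space sc"
    and h: "\<And>i. lin_on V sc (h i)"
  shows "lin_on V sc (glift V h)"
proof -
  interpret vector_space sc by (rule W)
  have h0: "h i 0 = 0" for i
    using lin_on_scal[OF h gcar_closed(1)[OF V], of i 0] by (simp add: vs_sc[OF V])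
  show ?thesis
  proof (rule lin_onI)
    show "glift V h (u + v) = glift V h u + glift V h v" if "u \<in> gcar V" "v \<in> gcar V" for u v
      by (rule glift_add[where h=h, OF V h0 _ that]) (auto intro: lin_on_add[OF h] gcar_grade)
    show "glift V h (scal V c v) = sc c (glift V h v)" if "v \<in> gcar V" for c v
      by (rule glift_scal[where h=h, OF V h0 _ _ _ that])
        (auto intro: lin_on_scal[OF h] gcar_grade simp: scale_right_distrib)
  qed
qed

lemma lin_on_zero:
  assumes V: "graded_space V" and "lin_on V sc f"
  shows "f 0 = 0"
  using lin_on_add[OF assms(2) gcar_closed(1)[OF V] gcar_closed(1)[OF V]] by simp

lemma lin_on_sum:
  assumes V: "graded_space V" and f: "lin_on V sc f" and "\<And>i. i \<in> I \<Longrightarrow> x i \<in> gcar V"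
  shows "f (\<Sum>i\<in>I. x i) = (\<Sum>i\<in>I. f (x i))"
  using assms(3)
  by (induction I rule: infinite_finite_induct)
    (auto simp: lin_on_zero[OF V f] lin_on_add[OF f] gcar_sum[OF V])

lemma lin_on_eqI:
  assumes V: "graded_space V" and f: "lin_on V sc f" and g: "lin_on V sc' g"
    and eq: "\<And>n x. x \<in> grade V n \<Longrightarrow> f x = g x" and x: "x \<in> gcar V"
  shows "f x = g x"
  using V x by (induction rule: gcar_induct) (auto simp: eq lin_on_add[OF f] lin_on_add[OF g])

lemma lin_on_gcar:
  assumes V: "graded_space V" and W: "graded_space W" and f: "lin_on V sc f"
    and "\<And>n x. x \<in> grade V n \<Longrightarrow> f x \<in> gcar W" and x: "x \<in> gcar V"
  shows "f x \<in> gcar W"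
  using V x by (induction rule: gcar_induct) (auto simp: assms(4) lin_on_add[OF f] gcar_closed[OF W])

lemma glin_gcar:
  assumes V: "graded_space V" and W: "graded_space W" and f: "glin V W e f" and x: "x \<in> gcar V"
  shows "f x \<in> gcar W"
proof (rule lin_on_gcar[OF V W _ _ x])
  show "lin_on V (scal W) f" using f by (simp add: glin_iff)
  show "f y \<in> gcar W" if "y \<in> grade V n" for n y
    using f that gcar_grade[of "f y" W "n + e"] by (simp add: glin_iff)
qed


subsection \<open>Shifts, direct sums and graded duals\<close>

lemma gcar_shift: "gcar (shift m V) = gcar V"
proof (rule set_eqI)
  fix v
  have "(\<exists>I x. finite I \<and> (\<forall>i\<in>I. x i \<in> grade V (i + m)) \<and> v = (\<Sum>i\<in>I. x i)) \<longleftrightarrow>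
        (\<exists>I x. finite I \<and> (\<forall>i\<in>I. x i \<in> grade V i) \<and> v = (\<Sum>i\<in>I. x i))" (is "?L \<longleftrightarrow> ?R")
  proof
    assume ?L
    then obtain I x where I: "finite I" "\<forall>i\<in>I. x i \<in> grade V (i + m)" "v = (\<Sum>i\<in>I. x i)" by blast
    then show ?R
      by (intro exI[of _ "(\<lambda>i. i + m) ` I"] exI[of _ "\<lambda>i. x (i - m)"]) (auto simp: sum.reindex)
  next
    assume ?R
    then obtain I x where I: "finite I" "\<forall>i\<in>I. x i \<in> grade V i" "v = (\<Sum>i\<in>I. x i)" by blast
    then show ?L
      by (intro exI[of _ "(\<lambda>i. i - m) ` I"] exI[of _ "\<lambda>i. x (i + m)"])
        (auto simp: sum.reindex inj_on_def)
  qed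
  then show "v \<in> gcar (shift m V) \<longleftrightarrow> v \<in> gcar V" by (simp add: gcar_def shift_def)
qed

lemma graded_space_shift:
  assumes V: "graded_space V"
  shows "graded_space (shift m V)"
proof -
  have "x i = 0" if I: "finite I" "\<forall>i\<in>I. x i \<in> grade V (i + m)" "(\<Sum>i\<in>I. x i) = 0" "i \<in> I" for I x i
  proof -
    have "(\<Sum>j\<in>(\<lambda>i. i + m) ` I. x (j - m)) = 0" using I by (simp add: sum.reindex)
    then have "x (i + m - m) = 0"
      using I by (intro grade_indep[OF V, of "(\<lambda>i. i + m) ` I" "\<lambda>j. x (j - m)"]) auto
    then show ?thesis by simp
  qed
  then show ?thesis using V unfolding graded_space_def shift_def by simp
qed

lemma scal_shift [simp]: "scal (shift m V) = scal V"
  and grade_shift [simp]: "grade (shift m V) n = grade V (n + m)"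
  by (simp_all add: shift_def)

lemma scal_dsum [simp]: "scal (dsum V W) c (v, w) = (scal V c v, scal W c w)"
  and grade_dsum [simp]: "grade (dsum V W) n = grade V n \<times> grade W n"
  by (simp_all add: dsum_def)

lemma graded_space_dsum:
  assumes V: "graded_space V" and W: "graded_space W"
  shows "graded_space (dsum V W)"
proof -
  interpret V: vector_space "scal V" using V by (simp add: graded_space_def)
  interpret W: vector_space "scal W" using W by (simp add: graded_space_def)
  have vs: "vector_space (scal (dsum V W))"
    by unfold_locales (auto simp: dsum_def V.scale_right_distrib W.scale_right_distrib
        V.scale_left_distrib W.scale_left_distrib)
  interpret vector_space "scal (dsum V W)" by (rule vs)
  have "subspace (grade (dsum V W) n)" for n
    unfolding subspace_def
    by (auto simp: zero_prod_def grade_closed[OF V] grade_closed[OF W])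
  moreover have "x i = 0" if "finite I" "\<forall>i\<in>I. x i \<in> grade (dsum V W) i" "(\<Sum>i\<in>I. x i) = 0" "i \<in> I" for I x i
  proof -
    have "(\<Sum>i\<in>I. fst (x i)) = 0" "(\<Sum>i\<in>I. snd (x i)) = 0"
      using that(3) fst_sum[of x I] snd_sum[of x I] by simp_all
    moreover have "fst (x j) \<in> grade V j" "snd (x j) \<in> grade W j" if "j \<in> I" for j
      using \<open>\<forall>i\<in>I. x i \<in> grade (dsum V W) i\<close> that by (force simp: mem_Times_iff)+
    ultimately have "fst (x i) = 0" "snd (x i) = 0"
      using grade_indep[OF V that(1), of "\<lambda>i. fst (x i)" i] grade_indep[OF W that(1), of "\<lambda>i. snd (x i)" i]
        that(4) by auto
    then show ?thesis by (simp add: prod_eq_iff)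
  qed
  ultimately show ?thesis using vs unfolding graded_space_def by blast
qed

lemma gcar_dsum:
  assumes V: "graded_space V" and W: "graded_space W"
  shows "gcar (dsum V W) = gcar V \<times> gcar W"
proof
  show "gcar (dsum V W) \<subseteq> gcar V \<times> gcar W"
  proof
    fix x assume "x \<in> gcar (dsum V W)"
    from graded_space_dsum[OF V W] this show "x \<in> gcar V \<times> gcar W"
      by (induction rule: gcar_induct) (auto intro: gcar_grade gcar_closed[OF V] gcar_closed[OF W])
  qed
  show "gcar V \<times> gcar W \<subseteq> gcar (dsum V W)"
  proof (safe)
    fix v w assume v: "v \<in> gcar V" and w: "w \<in> gcar W"
    have "(v, 0) \<in> gcar (dsum V W)" using V v
    proof (induction rule: gcar_induct)
      case (grade n x)
      then show ?case using gcar_grade[of "(x, 0)" "dsum V W" n] grade_closed[OF W] by simp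
    next
      case (add x y)
      then show ?case using gcar_closed(2)[OF graded_space_dsum[OF V W], of "(x,0)" "(y,0)"] by simp
    qed
    moreover have "(0, w) \<in> gcar (dsum V W)" using W w
    proof (induction rule: gcar_induct)
      case (grade n x)
      then show ?case using gcar_grade[of "(0, x)" "dsum V W" n] grade_closed[OF V] by simp
    next
      case (add x y)
      then show ?case using gcar_closed(2)[OF graded_space_dsum[OF V W], of "(0,x)" "(0,y)"] by simp
    qed
    ultimately show "(v, w) \<in> gcar (dsum V W)"
      using gcar_closed(2)[OF graded_space_dsum[OF V W], of "(v,0)" "(0,w)"] by simp
  qed
qed

lemma scal_ground [simp]: "scal ground = (*)"
  by (simp add: ground_def)

lemma grade_ground: "grade ground n = (if n = 0 then UNIV else {0})"
  by (simp add: ground_def)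

lemma scal_gdual [simp]: "scal (gdual V) c f = (\<lambda>x. c * f x)"
  by (simp add: gdual_def)

lemma grade_gdual: "f \<in> grade (gdual V) n \<longleftrightarrow>
   lin_on V (*) f \<and> (\<forall>m. \<forall>v\<in>grade V m. m + n \<noteq> 0 \<longrightarrow> f v = 0) \<and> (\<forall>x. x \<notin> gcar V \<longrightarrow> f x = 0)"
  by (auto simp: gdual_def glin_iff grade_ground)

lemma gdualD:
  assumes "f \<in> grade (gdual V) n"
  shows "lin_on V (*) f" "v \<in> grade V m \<Longrightarrow> m + n \<noteq> 0 \<Longrightarrow> f v = 0" "x \<notin> gcar V \<Longrightarrow> f x = 0"
  using assms by (auto simp: grade_gdual)

lemma gdualI:
  assumes "lin_on V (*) f" "\<And>m v. v \<in> grade V m \<Longrightarrow> m + n \<noteq> 0 \<Longrightarrow> f v = 0" "\<And>x. x \<notin> gcar V \<Longrightarrow> f x = 0"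
  shows "f \<in> grade (gdual V) n"
  using assms by (auto simp: grade_gdual)

lemma sum_fun_apply: "(\<Sum>i\<in>I. x i) v = (\<Sum>i\<in>I. x i v)"
  by (induction I rule: infinite_finite_induct) (auto simp: plus_fun_def zero_fun_def)

lemma graded_space_gdual:
  assumes V: "graded_space V"
  shows "graded_space (gdual V)"
proof -
  have vs: "vector_space (scal (gdual V))"
    by unfold_locales (auto simp: gdual_def algebra_simps)
  interpret vector_space "scal (gdual V)" by (rule vs)
  have "subspace (grade (gdual V) n)" for n
    unfolding subspace_def
  proof (intro conjI ballI allI)
    show "0 \<in> grade (gdual V) n" by (simp add: grade_gdual lin_on_def)
    show "f + g \<in> grade (gdual V) n" if "f \<in> grade (gdual V) n" "g \<in> grade (gdual V) n" for f g
      using gdualD[OF that(1)] gdualD[OF that(2)] by (intro gdualI) (auto simp: lin_on_def algebra_simps)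
    show "scal (gdual V) c f \<in> grade (gdual V) n" if "f \<in> grade (gdual V) n" for c f
      using gdualD[OF that] by (intro gdualI) (auto simp: lin_on_def algebra_simps)
  qed
  moreover have "x i = 0" if I: "finite I" "\<forall>i\<in>I. x i \<in> grade (gdual V) i" "(\<Sum>i\<in>I. x i) = 0" "i \<in> I" for I x i
  proof -
    have li: "lin_on V (*) (x i)" using I gdualD(1) by blast
    have z: "x i v = 0" if v: "v \<in> grade V m" for v m
    proof (cases "m + i = 0")
      case False
      then show ?thesis using gdualD(2)[of "x i" V i] I v by blast
    next
      case True
      \<comment> \<open>On an element of degree \<open>m\<close> only the functional of degree
        \<open>- m\<close> can be nonzero, so evaluation at \<open>v\<close> isolates the summand
        with index \<open>i\<close>.\<close>
      have "0 = (\<Sum>j\<in>I. x j v)" using I(3) sum_fun_apply[of x I v] by simp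
      also have "\<dots> = (\<Sum>j\<in>{i}. x j v)"
        using True I(2) gdualD(2)[OF _ v] by (intro sum.mono_neutral_right) (use I(1,4) in \<open>auto, metis add.commute add_left_cancel\<close>)
      finally show ?thesis by simp
    qed
    have "lin_on V (*) (\<lambda>v. 0 :: 'a)" by (rule lin_onI) auto
    then have "x i v = 0" if "v \<in> gcar V" for v
      using lin_on_eqI[OF V li _ _ that] z by blast
    moreover have "x i v = 0" if "v \<notin> gcar V" for v
      using gdualD(3)[of "x i" V i] I that by blast
    ultimately show ?thesis by (auto simp: zero_fun_def)
  qed
  ultimately show ?thesis using vs unfolding graded_space_def by blast
qed

lemma gcar_gdualD:
  assumes V: "graded_space V" and f: "f \<in> gcar (gdual V)"
  shows "lin_on V (*) f" "x \<notin> gcar V \<Longrightarrow> f x = 0"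
proof -
  have "lin_on V (*) f \<and> (\<forall>x. x \<notin> gcar V \<longrightarrow> f x = 0)" using graded_space_gdual[OF V] f
    by (induction rule: gcar_induct) (auto simp: grade_gdual lin_on_def algebra_simps)
  then show "lin_on V (*) f" "x \<notin> gcar V \<Longrightarrow> f x = 0" by auto
qed

lemma gdual_eqI:
  assumes V: "graded_space V" and f: "f \<in> gcar (gdual V)" and g: "g \<in> gcar (gdual V)"
    and eq: "\<And>n x. x \<in> grade V n \<Longrightarrow> f x = g x"
  shows "f = g"
proof
  fix x show "f x = g x"
  proof (cases "x \<in> gcar V")
    case True
    then show ?thesis
      by (intro lin_on_eqI[OF V gcar_gdualD(1)[OF V f] gcar_gdualD(1)[OF V g] eq])
  qed (simp add: gcar_gdualD(2)[OF V f] gcar_gdualD(2)[OF V g])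
qed

lemma gdual_grade_eqI:
  assumes V: "graded_space V" and f: "f \<in> grade (gdual V) n" and g: "g \<in> grade (gdual V) n"
    and eq: "\<And>x. x \<in> grade V (- n) \<Longrightarrow> f x = g x"
  shows "f = g"
proof (rule gdual_eqI[OF V gcar_grade[OF f] gcar_grade[OF g]])
  show "f x = g x" if "x \<in> grade V m" for m x
    using gdualD(2)[OF f that] gdualD(2)[OF g that] eq[of x] that by (cases "m = - n") auto
qed

text \<open>A basis extending \<open>{x}\<close> gives a functional on the whole ambient space;
  composing it with the projection to degree \<open>n\<close> makes it homogeneous.\<close>

lemma gdual_separates:
  assumes V: "graded_space V" and x: "x \<in> grade V n" "x \<noteq> 0"
  obtains f where "f \<in> grade (gdual V) (- n)" "f x = (1::'k::field)"
proof -
  interpret vector_space "scal V" using V by (simp add: graded_space_def)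
  interpret k: vector_space "(*) :: 'k \<Rightarrow> 'k \<Rightarrow> 'k" by unfold_locales (auto simp: algebra_simps)
  interpret vk: vector_space_pair "scal V" "(*) :: 'k \<Rightarrow> 'k \<Rightarrow> 'k" ..
  have "independent {x}" using x(2) by simp
  then obtain p where p: "Vector_Spaces.linear (scal V) (*) p" "p x = 1"
    using vk.linear_independent_extend[of "{x}" "\<lambda>_. 1"] by auto
  interpret p: Vector_Spaces.linear "scal V" "(*)" p by (rule p(1))
  define f where "f v = (if v \<in> gcar V then p (hcomp V v n) else 0)" for v
  have "f \<in> grade (gdual V) (- n)"
  proof (rule gdualI)
    show "lin_on V (*) f"
      by (rule lin_onI) (auto simp: f_def gcar_closed[OF V] hcomp_add[OF V] hcomp_scal[OF V] p.add p.scale)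
    show "f v = 0" if "v \<in> grade V m" "m + - n \<noteq> 0" for m v
      using that gcar_grade[OF that(1)] by (auto simp: f_def hcomp_grade[OF V that(1)] p.zero)
  qed (simp add: f_def)
  moreover have "f x = 1" using p(2) gcar_grade[OF x(1)] by (simp add: f_def hcomp_grade[OF V x(1)])
  ultimately show ?thesis using that by blast
qed

lemma grade_eqI:
  assumes V: "graded_space V" and x: "x \<in> grade V n" and y: "y \<in> grade V n"
    and "\<And>f. f \<in> grade (gdual V) (- n) \<Longrightarrow> f x = (f y :: 'k::field)"
  shows "x = y"
proof (rule ccontr)
  assume "x \<noteq> y"
  then obtain f where f: "f \<in> grade (gdual V) (- n)" "f (x - y) = (1::'k)"
    using gdual_separates[OF V, of "x - y" n] grade_closed(5)[OF V x y] by auto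
  have "f x = f (x - y) + f y"
    using lin_on_add[OF gdualD(1)[OF f(1)], of "x - y" y] gcar_grade[OF y]
      gcar_grade[OF grade_closed(5)[OF V x y]] by simp
  then show False using f(2) assms(4)[OF f(1)] by simp
qed

text \<open>A nonzero difference has a nonzero component in some degree \<open>n\<close>; a
  functional of degree \<open>- n\<close> normalised on that component does not see the
  others.\<close>

lemma gcar_eqI:
  assumes V: "graded_space V" and x: "x \<in> gcar V" and y: "y \<in> gcar V"
    and eq: "\<And>n f. f \<in> grade (gdual V) n \<Longrightarrow> f x = (f y :: 'k::field)"
  shows "x = y"
proof (rule ccontr)
  assume ne: "x \<noteq> y"
  define z where "z = x - y"
  have z: "z \<in> gcar V" using gcar_minus(2)[OF V x y] by (simp add: z_def)
  have "\<exists>n. hcomp V z n \<noteq> 0"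
  proof (rule ccontr)
    assume "\<not> (\<exists>n. hcomp V z n \<noteq> 0)"
    then have "{n. hcomp V z n \<noteq> 0} = {}" by auto
    then have "z = 0" using hcomp_props(3)[OF V z] by simp
    then show False using ne by (simp add: z_def)
  qed
  then obtain n where n: "hcomp V z n \<noteq> 0" by blast
  obtain f where f: "f \<in> grade (gdual V) (- n)" "f (hcomp V z n) = (1::'k)"
    using gdual_separates[OF V hcomp_props(1)[OF V z] n] by blast
  let ?S = "{i. hcomp V z i \<noteq> 0}"
  have "f z = (\<Sum>i\<in>?S. f (hcomp V z i))"
    by (subst hcomp_props(3)[OF V z], rule lin_on_sum[OF V gdualD(1)[OF f(1)]])
      (auto intro: gcar_grade hcomp_props[OF V z])
  also have "\<dots> = (\<Sum>i\<in>{n}. f (hcomp V z i))"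
    using gdualD(2)[OF f(1) hcomp_props(1)[OF V z]] n
    by (intro sum.mono_neutral_right) (auto simp: hcomp_props(2)[OF V z])
  finally have "f z = 1" using f by simp
  moreover have "f x = f z + f y"
    using lin_on_add[OF gdualD(1)[OF f(1)] z y] by (simp add: z_def)
  ultimately show False using eq[OF f(1)] by simp
qed

section \<open>Multilinear maps and tensors\<close>

lemma length_one_iff: "length xs = Suc 0 \<longleftrightarrow> (\<exists>x. xs = [x])"
  and length_two_iff: "length xs = 2 \<longleftrightarrow> (\<exists>x y. xs = [x, y])"
  and length_three_iff: "length xs = 3 \<longleftrightarrow> (\<exists>x y z. xs = [x, y, z])"
  by (auto simp: length_Suc_conv numeral_eq_Suc)

lemma all_less_two: "(\<forall>i<2. P i) \<longleftrightarrow> P 0 \<and> P (1::nat)"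
  and all_less_three: "(\<forall>i<3. P i) \<longleftrightarrow> P 0 \<and> P 1 \<and> P (2::nat)"
  by (auto simp: less_Suc_eq numeral_eq_Suc)

lemma multilin_iff:
  "multilin V sc n m \<longleftrightarrow>
     (\<forall>xs. length xs = n \<longrightarrow> set xs \<subseteq> gcar V \<longrightarrow> (\<forall>i<n. lin_on V sc (\<lambda>u. m (xs[i := u]))))"
  unfolding multilin_def lin_on_def by blast

lemma multilin1_iff:
  assumes "graded_space V"
  shows "multilin V sc 1 m \<longleftrightarrow> lin_on V sc (\<lambda>x. m [x])"
  unfolding multilin_iff using gcar_closed(1)[OF assms]
  by (auto simp: length_one_iff intro!: exI[of _ 0])

lemma multilin2_iff:
  "multilin V sc 2 m \<longleftrightarrow> (\<forall>y\<in>gcar V. lin_on V sc (\<lambda>x. m [x, y])) \<and> (\<forall>x\<in>gcar V. lin_on V sc (\<lambda>y. m [x, y]))"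
  (is "?L \<longleftrightarrow> ?R")
proof
  assume L: ?L
  show ?R
  proof (intro conjI ballI)
    fix y assume "y \<in> gcar V"
    then show "lin_on V sc (\<lambda>x. m [x, y])" "lin_on V sc (\<lambda>x. m [y, x])"
      using L[unfolded multilin_iff, rule_format, of "[y, y]" 0] L[unfolded multilin_iff, rule_format, of "[y, y]" 1]
      by simp_all
  qed
next
  assume ?R
  then show ?L unfolding multilin_iff all_less_two
    by (auto simp: length_two_iff)
qed

lemma multilin3_iff:
  "multilin V sc 3 m \<longleftrightarrow> (\<forall>y\<in>gcar V. \<forall>z\<in>gcar V.
     lin_on V sc (\<lambda>x. m [x, y, z]) \<and> lin_on V sc (\<lambda>x. m [y, x, z]) \<and> lin_on V sc (\<lambda>x. m [y, z, x]))"
  (is "?L \<longleftrightarrow> ?R")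
proof
  assume L: ?L
  show ?R
  proof (intro conjI ballI)
    fix y z assume "y \<in> gcar V" "z \<in> gcar V"
    then show "lin_on V sc (\<lambda>x. m [x, y, z])" "lin_on V sc (\<lambda>x. m [y, x, z])" "lin_on V sc (\<lambda>x. m [y, z, x])"
      using L[unfolded multilin_iff, rule_format, of "[y, y, z]" 0]
        L[unfolded multilin_iff, rule_format, of "[y, y, z]" 1]
        L[unfolded multilin_iff, rule_format, of "[y, z, y]" 2]
      by simp_all
  qed
next
  assume ?R
  then show ?L unfolding multilin_iff all_less_three
    by (auto simp: length_three_iff)
qed

lemma homs_Nil [simp]: "homs V ds [] \<longleftrightarrow> ds = []"
  by (simp add: homs_def)

lemma homs_Cons: "homs V ds (x # xs) \<longleftrightarrow> (\<exists>i is. ds = i # is \<and> x \<in> grade V i \<and> homs V is xs)"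
  by (simp add: homs_def list_all2_Cons2)

lemma homs_length: "homs V ds xs \<Longrightarrow> length ds = length xs"
  by (simp add: homs_def list_all2_lengthD)

lemma homs_gcar: "homs V ds xs \<Longrightarrow> set xs \<subseteq> gcar V"
  unfolding homs_def by (induction rule: list_all2_induct) (auto dest: gcar_grade)

lemma homs2E:
  assumes "homs V ds xs" "length xs = 2"
  obtains i j x y where "ds = [i, j]" "xs = [x, y]" "x \<in> grade V i" "y \<in> grade V j"
  using assms by (auto simp: length_two_iff homs_Cons)

lemma homs3E:
  assumes "homs V ds xs" "length xs = 3"
  obtains i j k x y z where "ds = [i, j, k]" "xs = [x, y, z]" "x \<in> grade V i" "y \<in> grade V j" "z \<in> grade V k"
  using assms by (auto simp: length_three_iff homs_Cons)

lemma lin_on_ground: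
  "lin_on V (*) f \<Longrightarrow> lin_on V (*) (\<lambda>x. f x * c)" "lin_on V (*) f \<Longrightarrow> lin_on V (*) (\<lambda>x. c * f x)"
  "lin_on V (*) f \<Longrightarrow> lin_on V (*) g \<Longrightarrow> lin_on V (*) (\<lambda>x. f x + g x)"
  "lin_on V (*) (\<lambda>x. 0)"
  for c :: "'k::field"
  by (auto simp: lin_on_def algebra_simps)

lemma multilin_prod2:
  assumes "lin_on V (*) f" "lin_on V (*) g"
  shows "multilin V (*) 2 (\<lambda>xs. f (xs ! 0) * g (xs ! 1) :: 'k::field)"
  using assms by (simp add: multilin2_iff lin_on_ground)

lemma multilin_prod3:
  assumes "lin_on V (*) f" "lin_on V (*) g" "lin_on V (*) h"
  shows "multilin V (*) 3 (\<lambda>xs. f (xs ! 0) * g (xs ! 1) * h (xs ! 2) :: 'k::field)"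
  using assms by (simp add: multilin3_iff lin_on_ground)

section \<open>Tensors through their values on multilinear forms\<close>

definition is_tens :: "('k::field, 'v::ab_group_add, 'z) gvs_scheme \<Rightarrow> nat \<Rightarrow> ('k, 'v) tens \<Rightarrow> bool" where
  "is_tens V n T \<longleftrightarrow> (\<exists>R. tens_rep V n T R)"

lemma sum_list_fun_apply: "(\<Sum>x\<leftarrow>xs. F x) \<beta> = (\<Sum>x\<leftarrow>xs. F x \<beta>)"
  by (induction xs) auto

text \<open>\<open>pure\<close> is evaluation, so every presentation of a tensor computes the same
  value on a multilinear form. This makes the choice of a presentation in \<open>tlift\<close>
  harmless.\<close>

lemma tens_rep_eval:
  assumes "tens_rep V n T R" "multilin V (*) n \<beta>"
  shows "T \<beta> = (\<Sum>(ds, xs)\<leftarrow>R. \<beta> xs)"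
proof -
  have "T \<beta> = (\<Sum>p\<leftarrow>R. (case p of (ds, xs) \<Rightarrow> pure V xs) \<beta>)"
    using assms(1) by (simp add: tens_rep_def sum_list_fun_apply)
  also have "\<dots> = (\<Sum>p\<leftarrow>R. case p of (ds, xs) \<Rightarrow> \<beta> xs)"
    by (rule arg_cong[of _ _ sum_list], rule map_cong)
      (use assms in \<open>auto simp: tens_rep_def pure_def\<close>)
  finally show ?thesis .
qed

lemma tens_rep_mem: "tens_rep V n T R \<Longrightarrow> (ds, xs) \<in> set R \<Longrightarrow> length xs = n \<and> homs V ds xs"
  by (auto simp: tens_rep_def)

lemma tens_rep_some: "is_tens V n T \<Longrightarrow> tens_rep V n T (SOME R. tens_rep V n T R)"
  unfolding is_tens_def by (rule someI_ex)

lemma tens_eval_add: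
  assumes "is_tens V n T" "multilin V (*) n \<beta>" "multilin V (*) n \<gamma>" "multilin V (*) n (\<lambda>xs. \<beta> xs + \<gamma> xs)"
  shows "T (\<lambda>xs. \<beta> xs + \<gamma> xs) = T \<beta> + T \<gamma>"
proof -
  obtain R where R: "tens_rep V n T R" using assms(1) by (auto simp: is_tens_def)
  show ?thesis unfolding tens_rep_eval[OF R assms(2)] tens_rep_eval[OF R assms(3)] tens_rep_eval[OF R assms(4)]
    by (simp add: sum_list_addf split_def)
qed

lemma tens_eval_scal:
  assumes "is_tens V n T" "multilin V (*) n \<beta>" "multilin V (*) n (\<lambda>xs. c * \<beta> xs)"
  shows "T (\<lambda>xs. c * \<beta> xs) = c * T \<beta>"
proof -
  obtain R where R: "tens_rep V n T R" using assms(1) by (auto simp: is_tens_def)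
  show ?thesis unfolding tens_rep_eval[OF R assms(2)] tens_rep_eval[OF R assms(3)]
    by (simp add: sum_list_const_mult split_def)
qed

text \<open>The map \<open>h\<close> may look at degrees, but it has to agree with a multilinear
  \<open>\<beta>\<close> on homogeneous tensors. The lift then becomes evaluation of
  \<open>T\<close> at \<open>\<beta>\<close>, whichever presentation was picked.\<close>

lemma tlift_scalar:
  assumes "is_tens V n T" "multilin V (*) n \<beta>"
    and "\<And>ds xs. length xs = n \<Longrightarrow> homs V ds xs \<Longrightarrow> h ds xs = \<beta> xs"
  shows "tlift V n h T = T \<beta>"
proof -
  note R = tens_rep_some[OF assms(1)]
  show ?thesis unfolding tlift_def tens_rep_eval[OF R assms(2)]
    by (rule arg_cong[of _ _ sum_list], rule map_cong) (use assms(3) in \<open>auto dest: tens_rep_mem[OF R]\<close>)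
qed

lemma tlift_apply: "tlift V n h T \<beta> = tlift V n (\<lambda>ds xs. h ds xs \<beta>) T"
  unfolding tlift_def by (simp add: sum_list_fun_apply split_def)

lemma tlift_eval:
  assumes "is_tens V n T" "multilin V (*) n \<gamma>"
    and "\<And>ds xs. length xs = n \<Longrightarrow> homs V ds xs \<Longrightarrow> h ds xs \<beta> = \<gamma> xs"
  shows "tlift V n h T \<beta> = T \<gamma>"
  unfolding tlift_apply by (rule tlift_scalar[OF assms])

lemma is_tens_zero [simp]: "is_tens V n 0"
  unfolding is_tens_def tens_rep_def by (intro exI[of _ "[]"]) auto

lemma is_tens_add:
  assumes "is_tens V n S" "is_tens V n T"
  shows "is_tens V n (S + T)"
proof -
  obtain R R' where "tens_rep V n S R" "tens_rep V n T R'" using assms by (auto simp: is_tens_def)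
  then have "tens_rep V n (S + T) (R @ R')" by (auto simp: tens_rep_def)
  then show ?thesis by (auto simp: is_tens_def)
qed

lemma is_tens_sum_list: "(\<And>x. x \<in> set xs \<Longrightarrow> is_tens V n (F x)) \<Longrightarrow> is_tens V n (\<Sum>x\<leftarrow>xs. F x)"
  by (induction xs) (auto intro: is_tens_add)

lemma is_tens_pure:
  assumes "length xs = n" "homs V ds xs"
  shows "is_tens V n (pure V xs)"
  unfolding is_tens_def tens_rep_def using assms by (intro exI[of _ "[(ds, xs)]"]) auto

lemma is_tens_tlift:
  assumes "is_tens V n T"
    and "\<And>ds xs. length xs = n \<Longrightarrow> homs V ds xs \<Longrightarrow> is_tens W m (h ds xs)"
  shows "is_tens W m (tlift V n h T)"
proof -
  note R = tens_rep_some[OF assms(1)]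
  show ?thesis unfolding tlift_def
    by (rule is_tens_sum_list) (use assms(2) in \<open>auto dest: tens_rep_mem[OF R]\<close>)
qed

text \<open>The scalar is absorbed by the first tensor factor, which exists because
  \<open>n > 0\<close>.\<close>

lemma is_tens_tscal:
  assumes V: "graded_space V" and "is_tens V n T" and n: "n > 0"
  shows "is_tens V n (tscal c T)"
proof -
  obtain R where R: "tens_rep V n T R" using assms(2) by (auto simp: is_tens_def)
  have "tscal c T = (\<Sum>p\<leftarrow>R. tscal c (pure V (snd p)))"
    using R by (auto simp: tens_rep_def tscal_def sum_list_fun_apply sum_list_const_mult split_def)
  moreover have "is_tens V n (\<Sum>p\<leftarrow>R. tscal c (pure V (snd p)))"
  proof (rule is_tens_sum_list)
    fix p assume p: "p \<in> set R"
    obtain ds xs where dx: "p = (ds, xs)" by (cases p)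
    have l: "length xs = n" "homs V ds xs" using R p dx by (auto simp: tens_rep_def)
    obtain i "is" x ys where e: "xs = x # ys" "ds = i # is" using l n
      by (cases xs) (auto simp: homs_Cons)
    have "tscal c (pure V xs) = pure V (scal V c x # ys)"
    proof
      fix \<beta>
      have "\<beta> (scal V c x # ys) = c * \<beta> (x # ys)" if "multilin V (*) n \<beta>"
      proof -
        have "lin_on V (*) (\<lambda>u. \<beta> ((x # ys)[0 := u]))"
          using that homs_gcar[OF l(2)] l(1) n e unfolding multilin_iff by blast
        moreover have "x \<in> gcar V" using homs_gcar[OF l(2)] e by simp
        ultimately show ?thesis by (simp add: lin_on_def)
      qed
      then show "tscal c (pure V xs) \<beta> = pure V (scal V c x # ys) \<beta>"
        using l e by (simp add: tscal_def pure_def)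
    qed
    moreover have "is_tens V n (pure V (scal V c x # ys))"
      by (rule is_tens_pure[of _ _ _ ds]) (use l e grade_closed[OF V] in \<open>auto simp: homs_Cons\<close>)
    ultimately show "is_tens V n (tscal c (pure V (snd p)))" using dx by simp
  qed
  ultimately show ?thesis by simp
qed

lemma is_tens_grade: "T \<in> grade (tpow V n) e \<Longrightarrow> is_tens V n T"
  by (auto simp: tpow_def is_tens_def)

lemma tens_eval_degree:
  assumes "T \<in> grade (tpow V n) e" "multilin V (*) n \<beta>"
    and "\<And>ds xs. length xs = n \<Longrightarrow> homs V ds xs \<Longrightarrow> sum_list ds = e \<Longrightarrow> \<beta> xs = 0"
  shows "T \<beta> = 0"
proof -
  obtain R where R: "tens_rep V n T R" "\<forall>(ds, xs)\<in>set R. sum_list ds = e"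
    using assms(1) by (auto simp: tpow_def)
  have "(\<Sum>(ds, xs)\<leftarrow>R. \<beta> xs) = (\<Sum>(ds, xs)\<leftarrow>R. 0)"
    by (rule arg_cong[of _ _ sum_list], rule map_cong)
      (use R(2) assms(3) tens_rep_mem[OF R(1)] in \<open>fastforce+\<close>)
  then show ?thesis unfolding tens_rep_eval[OF R(1) assms(2)]
    by (simp add: split_def sum_list_0)
qed

text \<open>Both sides vanish unless \<open>i = - p\<close>, so the parity of the degree of
  \<open>x\<close> may be replaced by that of \<open>f\<close>. Koszul signs that depend on the
  factors of a tensor thereby become constants, and evaluation remains linear in the tensor.\<close>

lemma prod2_sign:
  assumes "f \<in> grade (gdual V) p" "x \<in> grade V i"
  shows "sg (i * m) * f x = (sg (p * m) :: 'k::field) * f x"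
proof (cases "i + p = 0")
  case True
  then have "i = - p" by simp
  then show ?thesis by (simp add: sg_if)
next
  case False
  then show ?thesis using gdualD(2)[OF assms] by simp
qed

section \<open>Dg algebras and double brackets evaluated on functionals\<close>

locale dgalg =
  fixes A :: "('k::field, 'v::ab_group_add, 'z) dga_scheme"
  assumes dga: "dg_algebra A"
begin

lemma gs: "graded_space A"
  using dga by (simp add: dg_algebra_def)

lemma gsd: "graded_space (gdual A)"
  by (rule graded_space_gdual[OF gs])

lemma mul_lin1: "y \<in> gcar A \<Longrightarrow> lin_on A (scal A) (\<lambda>x. mul A x y)"
  and mul_lin2: "x \<in> gcar A \<Longrightarrow> lin_on A (scal A) (\<lambda>y. mul A x y)"
  using dga by (auto simp: dg_algebra_def multihom_def multilin2_iff)

lemma mul_grade: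
  assumes "x \<in> grade A i" "y \<in> grade A j"
  shows "mul A x y \<in> grade A (i + j)"
proof -
  have "\<forall>ds xs. length xs = 2 \<and> homs A ds xs \<longrightarrow> mul A (xs ! 0) (xs ! 1) \<in> grade A (sum_list ds + 0)"
    using dga by (simp add: dg_algebra_def multihom_def)
  from this[rule_format, of "[x, y]" "[i, j]"] assms show ?thesis by (simp add: homs_Cons)
qed

lemma mul_gcar:
  assumes x: "x \<in> gcar A" and y: "y \<in> gcar A"
  shows "mul A x y \<in> gcar A"
proof (rule lin_on_gcar[OF gs gs mul_lin1[OF y] _ x])
  fix n u assume u: "u \<in> grade A n"
  show "mul A u y \<in> gcar A"
    by (rule lin_on_gcar[OF gs gs mul_lin2[OF gcar_grade[OF u]] _ y]) (rule gcar_grade[OF mul_grade[OF u]])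
qed

lemma mul_assoc: "x \<in> gcar A \<Longrightarrow> y \<in> gcar A \<Longrightarrow> z \<in> gcar A \<Longrightarrow> mul A (mul A x y) z = mul A x (mul A y z)"
  using dga by (simp add: dg_algebra_def)

lemma dif_lin: "lin_on A (scal A) (dif A)"
  and dif_grade: "x \<in> grade A i \<Longrightarrow> dif A x \<in> grade A (i + 1)"
  and dif_dif: "x \<in> gcar A \<Longrightarrow> dif A (dif A x) = 0"
  and dif_mul: "x \<in> grade A i \<Longrightarrow> y \<in> gcar A \<Longrightarrow>
    dif A (mul A x y) = mul A (dif A x) y + scal A (sg i) (mul A x (dif A y))"
  using dga by (auto simp: dg_algebra_def glin_iff)

lemma dif_gcar: "x \<in> gcar A \<Longrightarrow> dif A x \<in> gcar A"
  using glin_gcar[OF gs gs, of 1 "dif A"] dga by (simp add: dg_algebra_def)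

text \<open>Like \<open>lmulf\<close> and \<open>dfun\<close> below, an unsigned transpose, set to 0
  outside the carrier as elements of the graded dual must be. The signs of the bimodule actions are
  kept apart and enter only in the formulas for the operations.\<close>

definition rmulf :: "('v \<Rightarrow> 'k) \<Rightarrow> 'v \<Rightarrow> 'v \<Rightarrow> 'k" where
  "rmulf f c = (\<lambda>x. if x \<in> gcar A then f (mul A x c) else 0)"

definition lmulf :: "'v \<Rightarrow> ('v \<Rightarrow> 'k) \<Rightarrow> 'v \<Rightarrow> 'k" where
  "lmulf b f = (\<lambda>x. if x \<in> gcar A then f (mul A b x) else 0)"

definition dfun :: "('v \<Rightarrow> 'k) \<Rightarrow> 'v \<Rightarrow> 'k" where
  "dfun f = (\<lambda>x. if x \<in> gcar A then f (dif A x) else 0)"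

lemma lin_on_comp:
  assumes "lin_on A (*) f" "lin_on A (scal A) h" "\<And>x. x \<in> gcar A \<Longrightarrow> h x \<in> gcar A"
  shows "lin_on A (*) (\<lambda>x. if x \<in> gcar A then f (h x) else (0::'k))"
  by (rule lin_onI)
    (simp_all add: gcar_closed[OF gs] lin_on_add[OF assms(2)] lin_on_scal[OF assms(2)]
      lin_on_add[OF assms(1)] lin_on_scal[OF assms(1)] assms(3))

lemma rmulf_lin: "lin_on A (*) f \<Longrightarrow> c \<in> gcar A \<Longrightarrow> lin_on A (*) (rmulf f c)"
  unfolding rmulf_def by (rule lin_on_comp) (auto intro: mul_lin1 mul_gcar)

lemma lmulf_lin: "lin_on A (*) f \<Longrightarrow> b \<in> gcar A \<Longrightarrow> lin_on A (*) (lmulf b f)"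
  unfolding lmulf_def by (rule lin_on_comp) (auto intro: mul_lin2 mul_gcar)

lemma dfun_lin: "lin_on A (*) f \<Longrightarrow> lin_on A (*) (dfun f)"
  unfolding dfun_def by (rule lin_on_comp) (auto intro: dif_lin dif_gcar)

lemma rmulf_grade:
  assumes "f \<in> grade (gdual A) p" "c \<in> grade A k"
  shows "rmulf f c \<in> grade (gdual A) (p + k)"
proof (rule gdualI)
  show "rmulf f c v = 0" if "v \<in> grade A m" "m + (p + k) \<noteq> 0" for m v
    using gdualD(2)[OF assms(1) mul_grade[OF that(1) assms(2)]] that(2) by (simp add: rmulf_def algebra_simps)
qed (simp_all add: rmulf_def[of f c] rmulf_lin[OF gdualD(1)[OF assms(1)] gcar_grade[OF assms(2)], unfolded rmulf_def])

lemma lmulf_grade: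
  assumes "f \<in> grade (gdual A) p" "b \<in> grade A k"
  shows "lmulf b f \<in> grade (gdual A) (p + k)"
proof (rule gdualI)
  show "lmulf b f v = 0" if "v \<in> grade A m" "m + (p + k) \<noteq> 0" for m v
    using gdualD(2)[OF assms(1) mul_grade[OF assms(2) that(1)]] that(2) by (simp add: lmulf_def algebra_simps)
qed (simp_all add: lmulf_def[of b f] lmulf_lin[OF gdualD(1)[OF assms(1)] gcar_grade[OF assms(2)], unfolded lmulf_def])

lemma dfun_grade:
  assumes "f \<in> grade (gdual A) p"
  shows "dfun f \<in> grade (gdual A) (p + 1)"
proof (rule gdualI)
  show "dfun f v = 0" if "v \<in> grade A m" "m + (p + 1) \<noteq> 0" for m v
    using gdualD(2)[OF assms(1) dif_grade[OF that(1)]] that(2) by (simp add: dfun_def algebra_simps)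
qed (simp_all add: dfun_def[of f] dfun_lin[OF gdualD(1)[OF assms(1)], unfolded dfun_def])

end

section \<open>Koszul signs of the permutations in the bracket axioms\<close>

lemma koszul_transpose: "koszul (Transposition.transpose 0 1) [i, j] = i * j"
proof -
  have "{(a, b). a < b \<and> b < length [i, j] \<and>
      inv (Transposition.transpose 0 1) a > inv (Transposition.transpose 0 (1::nat)) b} = {(0, 1)}"
    by (auto simp: less_Suc_eq transpose_def split: if_splits)
  then show ?thesis by (simp add: koszul_def)
qed

lemma perm_list_transpose: "perm_list (Transposition.transpose 0 1) [x, y] = [y, x]"
  by (simp add: perm_list_def upt_rec)

lemma cyc3_inv: "inv cyc3 = cyc3 \<circ> cyc3" "inv (cyc3 \<circ> cyc3) = cyc3"
proof -
  have c: "cyc3 (cyc3 (cyc3 i)) = i" for i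
    unfolding cyc3_def by (auto, presburger)
  show "inv cyc3 = cyc3 \<circ> cyc3" "inv (cyc3 \<circ> cyc3) = cyc3"
    by (rule inv_unique_comp; auto simp: c fun_eq_iff)+
qed

text \<open>A rotation moves one entry past the two others, so it has two inversions; they are found
  through the inverse, which is the other rotation.\<close>

lemma koszul_cyc3:
  "koszul cyc3 [i, j, k] = k * (i + j)" "koszul (cyc3 \<circ> cyc3) [i, j, k] = i * (j + k)"
proof -
  have "{(a, b). a < b \<and> b < length [i, j, k] \<and> inv cyc3 a > inv cyc3 b} = {(0, 1), (0, 2)}"
    unfolding cyc3_inv by (auto simp: cyc3_def less_Suc_eq)
  moreover have "{(a, b). a < b \<and> b < length [i, j, k] \<and> inv (cyc3 \<circ> cyc3) a > inv (cyc3 \<circ> cyc3) b}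
      = {(0, 2), (1, 2)}"
    unfolding cyc3_inv by (auto simp: cyc3_def less_Suc_eq)
  ultimately show "koszul cyc3 [i, j, k] = k * (i + j)" "koszul (cyc3 \<circ> cyc3) [i, j, k] = i * (j + k)"
    unfolding koszul_def by (simp_all add: cyc3_inv cyc3_def algebra_simps)
qed

lemma perm_list_cyc3: "perm_list cyc3 [x, y, z] = [z, x, y]" "perm_list (cyc3 \<circ> cyc3) [x, y, z] = [y, z, x]"
  unfolding perm_list_def cyc3_inv by (simp_all add: upt_rec cyc3_def)

lemma koszul_id: "koszul id ds = 0"
  unfolding koszul_def by (rule sum.neutral) auto

lemma perm_list_id: "perm_list id xs = xs"
  by (simp add: perm_list_def map_nth)

section \<open>The axioms of a double bracket as scalar identities\<close>

locale dpalg =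
  fixes d :: int and A :: "('k::field_char_0, 'v::ab_group_add, 'z) dpa_scheme"
  assumes dp: "double_poisson d A"

sublocale dpalg \<subseteq> dgalg A
  by unfold_locales (use dp in \<open>simp add: double_poisson_def\<close>)

context dpalg
begin

text \<open>The bracket evaluated on the product of \<open>f\<close> and \<open>g\<close> without
  the Koszul sign of \<open>f \<otimes> g\<close>. For functionals of degrees \<open>p\<close> and
  \<open>q\<close> the signed evaluation used in \<open>corresponds\<close> differs by
  \<open>sg (p * q)\<close>.\<close>

definition br :: "'v \<Rightarrow> 'v \<Rightarrow> ('v \<Rightarrow> 'k) \<Rightarrow> ('v \<Rightarrow> 'k) \<Rightarrow> 'k" where
  "br a b f g = dbr A [a, b] (\<lambda>xs. f (xs ! 0) * g (xs ! 1))"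

lemma dbr_lin1: "b \<in> gcar A \<Longrightarrow> lin_on A tscal (\<lambda>a. dbr A [a, b])"
  and dbr_lin2: "a \<in> gcar A \<Longrightarrow> lin_on A tscal (\<lambda>b. dbr A [a, b])"
  using dp by (auto simp: double_poisson_def multihom_def multilin2_iff gcar_shift tpow_def lin_on_def)

lemma dbr_grade:
  assumes "a \<in> grade A i" "b \<in> grade A j"
  shows "dbr A [a, b] \<in> grade (tpow A 2) (i + j - d)"
proof -
  have "\<forall>ds xs. length xs = 2 \<and> homs (shift d A) ds xs \<longrightarrow> dbr A xs \<in> grade (tpow A 2) (sum_list ds + d)"
    using dp by (simp add: double_poisson_def multihom_def)
  from this[rule_format, of "[a, b]" "[i - d, j - d]"] assms show ?thesis by (simp add: homs_Cons)
qed

lemma dbr_tens: "a \<in> grade A i \<Longrightarrow> b \<in> grade A j \<Longrightarrow> is_tens A 2 (dbr A [a, b])"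
  by (rule is_tens_grade[OF dbr_grade])

lemma br_lin1: "b \<in> gcar A \<Longrightarrow> lin_on A (*) (\<lambda>a. br a b f g)"
  using dbr_lin1[of b] by (auto simp: lin_on_def br_def tscal_def)

lemma br_lin2: "a \<in> gcar A \<Longrightarrow> lin_on A (*) (\<lambda>b. br a b f g)"
  using dbr_lin2[of a] by (auto simp: lin_on_def br_def tscal_def)

text \<open>The bracket has total degree \<open>i + j - d\<close>, so in each term of a presentation
  one of the two functionals meets a factor of the wrong degree.\<close>

lemma br_degree:
  assumes "a \<in> grade A i" "b \<in> grade A j" "f \<in> grade (gdual A) p" "g \<in> grade (gdual A) q"
    and "i + j - d + p + q \<noteq> 0"
  shows "br a b f g = 0"
  unfolding br_def
proof (rule tens_eval_degree[OF dbr_grade[OF assms(1,2)] multilin_prod2])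
  show "lin_on A (*) f" "lin_on A (*) g" using assms gdualD(1) by auto
  fix ds xs assume "length xs = 2" "homs A ds xs" "sum_list ds = i + j - d"
  then obtain k l x y where *: "ds = [k, l]" "xs = [x, y]" "x \<in> grade A k" "y \<in> grade A l" "k + l = i + j - d"
    by (auto elim!: homs2E)
  have "k + p \<noteq> 0 \<or> l + q \<noteq> 0" using assms(5) *(5) by linarith
  then have "f x = 0 \<or> g y = 0"
    using gdualD(2)[OF assms(3) *(3)] gdualD(2)[OF assms(4) *(4)] by blast
  then show "f (xs ! 0) * g (xs ! 1) = 0" using * by auto
qed

text \<open>Multiplications inside the tensor are moved to the functionals: right multiplication of
  the second factor turns \<open>g\<close> into \<open>rmulf g c\<close>, left multiplication of the
  first turns \<open>f\<close> into \<open>lmulf b f\<close>.\<close>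

lemma br_leibniz:
  assumes a: "a \<in> grade A i" and b: "b \<in> grade A j" and c: "c \<in> grade A k"
    and f: "lin_on A (*) f" and g: "lin_on A (*) g"
  shows "br a (mul A b c) f g = br a b f (rmulf g c) + sg ((i - d) * j) * br a c (lmulf b f) g"
proof -
  note b' = gcar_grade[OF b] and c' = gcar_grade[OF c]
  let ?\<beta> = "\<lambda>xs. f (xs ! 0) * g (xs ! 1)"
  have \<beta>: "multilin A (*) 2 ?\<beta>" by (rule multilin_prod2[OF f g])
  have "dbr A [a, mul A b c] =
      tlift A 2 (\<lambda>_ xs. pure A [xs ! 0, mul A (xs ! 1) c]) (dbr A [a, b])
      + tscal (sg ((i - d) * j)) (tlift A 2 (\<lambda>_ xs. pure A [mul A b (xs ! 0), xs ! 1]) (dbr A [a, c]))"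
    using dp a b c' unfolding double_poisson_def by blast
  then have "br a (mul A b c) f g =
      tlift A 2 (\<lambda>_ xs. pure A [xs ! 0, mul A (xs ! 1) c]) (dbr A [a, b]) ?\<beta>
      + sg ((i - d) * j) * tlift A 2 (\<lambda>_ xs. pure A [mul A b (xs ! 0), xs ! 1]) (dbr A [a, c]) ?\<beta>"
    by (simp add: br_def tscal_def)
  also have "tlift A 2 (\<lambda>_ xs. pure A [xs ! 0, mul A (xs ! 1) c]) (dbr A [a, b]) ?\<beta> = br a b f (rmulf g c)"
    unfolding br_def
    by (rule tlift_eval[OF dbr_tens[OF a b] multilin_prod2[OF f rmulf_lin[OF g c']]])
      (use \<beta> in \<open>auto simp: pure_def rmulf_def numeral_2_eq_2 gcar_grade elim!: homs2E[unfolded numeral_2_eq_2]\<close>)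
  also have "tlift A 2 (\<lambda>_ xs. pure A [mul A b (xs ! 0), xs ! 1]) (dbr A [a, c]) ?\<beta> = br a c (lmulf b f) g"
    unfolding br_def
    by (rule tlift_eval[OF dbr_tens[OF a c] multilin_prod2[OF lmulf_lin[OF f b'] g]])
      (use \<beta> in \<open>auto simp: pure_def lmulf_def numeral_2_eq_2 gcar_grade elim!: homs2E[unfolded numeral_2_eq_2]\<close>)
  finally show ?thesis .
qed

text \<open>Exchanging the arguments costs the sign for \<open>A[d]\<close>, whence the degrees
  \<open>i - d\<close> and \<open>j - d\<close>; exchanging the tensor factors costs a sign that
  evaluation expresses by the degrees of \<open>f\<close> and \<open>g\<close>.\<close>

lemma br_antisym:
  assumes a: "a \<in> grade A i" and b: "b \<in> grade A j"
    and f: "f \<in> grade (gdual A) p" and g: "g \<in> grade (gdual A) q"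
  shows "br b a f g = - sg ((i - d) * (j - d) + p * q) * br a b g f"
proof -
  note f' = gdualD(1)[OF f] and g' = gdualD(1)[OF g]
  let ?\<beta> = "\<lambda>xs. f (xs ! 0) * g (xs ! 1)"
  have \<beta>: "multilin A (*) 2 ?\<beta>" by (rule multilin_prod2[OF f' g'])
  have "\<forall>i j. \<forall>a\<in>grade (shift d A) i. \<forall>b\<in>grade (shift d A) j.
        - tscal (sg (i * j)) (dbr A [b, a]) = tens_perm A 2 (Transposition.transpose 0 1) (dbr A [a, b])"
    using dp unfolding double_poisson_def by blast
  from this[rule_format, of a "i - d" b "j - d"] a b
  have "- tscal (sg ((i - d) * (j - d))) (dbr A [b, a]) = tens_perm A 2 (Transposition.transpose 0 1) (dbr A [a, b])"
    by simp
  from fun_cong[OF this, of ?\<beta>]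
  have "- sg ((i - d) * (j - d)) * br b a f g = tens_perm A 2 (Transposition.transpose 0 1) (dbr A [a, b]) ?\<beta>"
    by (simp add: tscal_def br_def)
  also have "\<dots> = dbr A [a, b] (\<lambda>xs. sg (p * q) * (g (xs ! 0) * f (xs ! 1)))"
    unfolding tens_perm_def
  proof (rule tlift_eval[OF dbr_tens[OF a b]])
    show "multilin A (*) 2 (\<lambda>xs. sg (p * q) * (g (xs ! 0) * f (xs ! 1)))"
      using f' g' by (simp add: multilin2_iff lin_on_ground)
    fix ds xs assume "length xs = 2" "homs A ds xs"
    then obtain k l x y where *: "ds = [k, l]" "xs = [x, y]" "x \<in> grade A k" "y \<in> grade A l"
      by (auto elim!: homs2E)
    have "sg (k * l) * (g x * f y) = (sg (q * l) * g x) * f y"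
      using prod2_sign[OF g *(3), of l] by (simp add: mult.assoc[symmetric])
    also have "\<dots> = g x * (sg (l * q) * f y)" by (simp add: mult_ac)
    also have "\<dots> = g x * (sg (p * q) * f y)" using prod2_sign[OF f *(4), of q] by simp
    finally show "tscal (sg (koszul (Transposition.transpose 0 1) ds)) (pure A (perm_list (Transposition.transpose 0 1) xs)) ?\<beta> =
         sg (p * q) * (g (xs ! 0) * f (xs ! 1))"
      using \<beta> unfolding * koszul_transpose perm_list_transpose
      by (simp add: tscal_def pure_def numeral_2_eq_2 mult_ac)
  qed
  also have "\<dots> = sg (p * q) * br a b g f"
    unfolding br_def
    by (rule tens_eval_scal[OF dbr_tens[OF a b] multilin_prod2[OF g' f']])
      (use f' g' in \<open>simp add: multilin2_iff lin_on_ground\<close>)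
  finally have "br b a f g = - (sg ((i - d) * (j - d)) * (sg (p * q) * br a b g f))"
  proof -
    assume h: "- sg ((i - d) * (j - d)) * br b a f g = sg (p * q) * br a b g f"
    have "br b a f g = - (sg ((i - d) * (j - d)) * (- sg ((i - d) * (j - d)) * br b a f g))" by simp
    then show ?thesis unfolding h .
  qed
  then show ?thesis by (simp add: sg_mult_left)
qed

lemma br_dif:
  assumes a: "a \<in> grade A i" and b: "b \<in> grade A j"
    and f: "f \<in> grade (gdual A) p" and g: "g \<in> grade (gdual A) q"
  shows "br a b (dfun f) g + sg p * br a b f (dfun g) = br (dif A a) b f g + sg (i - d) * br a (dif A b) f g"
proof -
  note f' = gdualD(1)[OF f] and g' = gdualD(1)[OF g]
  note a' = gcar_grade[OF a] and b' = gcar_grade[OF b]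
  let ?\<beta> = "\<lambda>xs. f (xs ! 0) * g (xs ! 1)"
  have \<beta>: "multilin A (*) 2 ?\<beta>" by (rule multilin_prod2[OF f' g'])
  have "\<forall>i. \<forall>a\<in>grade (shift d A) i. \<forall>b\<in>gcar A.
        tens_dif A (dbr A [a, b]) =
          tscal (sg d)
            (dbr A [scal A (sg d) (dif A a), b]
              + tscal (sg i) (dbr A [a, scal A (sg d) (dif A b)]))"
    using dp unfolding double_poisson_def by blast
  from this[rule_format, of a "i - d" b] a b'
  have "tens_dif A (dbr A [a, b]) = tscal (sg d)
            (dbr A [scal A (sg d) (dif A a), b] + tscal (sg (i - d)) (dbr A [a, scal A (sg d) (dif A b)]))"
    by simp
  from fun_cong[OF this, of ?\<beta>]
  have "tens_dif A (dbr A [a, b]) ?\<beta> = sg d * (br (scal A (sg d) (dif A a)) b f g + sg (i - d) * br a (scal A (sg d) (dif A b)) f g)"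
    by (simp add: tscal_def br_def)
  \<comment> \<open>The differential of \<open>A[d]\<close> carries \<open>sg d\<close>, and so does
    the commutation of the bracket with the differentials; the two cancel.\<close>
  also have "\<dots> = br (dif A a) b f g + sg (i - d) * br a (dif A b) f g"
    using lin_on_scal[OF br_lin1[OF b'] dif_gcar[OF a']] lin_on_scal[OF br_lin2[OF a'] dif_gcar[OF b']]
    by (simp add: distrib_left mult.left_commute)
  also have "tens_dif A (dbr A [a, b]) ?\<beta> =
      dbr A [a, b] (\<lambda>xs. dfun f (xs ! 0) * g (xs ! 1) + sg p * (f (xs ! 0) * dfun g (xs ! 1)))"
    unfolding tens_dif_def
  proof (rule tlift_eval[OF dbr_tens[OF a b]])
    show "multilin A (*) 2 (\<lambda>xs. dfun f (xs ! 0) * g (xs ! 1) + sg p * (f (xs ! 0) * dfun g (xs ! 1)))"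
      using f' g' by (simp add: multilin2_iff lin_on_ground dfun_lin)
    fix ds xs assume "length xs = 2" "homs A ds xs"
    then obtain k l x y where *: "ds = [k, l]" "xs = [x, y]" "x \<in> grade A k" "y \<in> grade A l"
      by (auto elim!: homs2E)
    have "sg k * f x = sg p * f x" using prod2_sign[OF f *(3), of 1] by simp
    then show "(pure A [dif A (xs ! 0), xs ! 1] + tscal (sg (ds ! 0)) (pure A [xs ! 0, dif A (xs ! 1)])) ?\<beta> =
         dfun f (xs ! 0) * g (xs ! 1) + sg p * (f (xs ! 0) * dfun g (xs ! 1))"
      using \<beta> * by (simp add: tscal_def pure_def numeral_2_eq_2 dfun_def gcar_grade mult.assoc[symmetric])
  qed
  also have "\<dots> = br a b (dfun f) g + dbr A [a, b] (\<lambda>xs. sg p * (f (xs ! 0) * dfun g (xs ! 1)))"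
    unfolding br_def
    by (rule tens_eval_add[OF dbr_tens[OF a b]]) (use f' g' in \<open>simp_all add: multilin2_iff lin_on_ground dfun_lin\<close>)
  also have "dbr A [a, b] (\<lambda>xs. sg p * (f (xs ! 0) * dfun g (xs ! 1))) = sg p * br a b f (dfun g)"
    unfolding br_def
    by (rule tens_eval_scal[OF dbr_tens[OF a b]]) (use f' g' in \<open>simp_all add: multilin2_iff lin_on_ground dfun_lin\<close>)
  finally show ?thesis .
qed

text \<open>With all but the second argument frozen, the bracket is an element of the graded dual.
  An iterated bracket can thus be written as a single bracket evaluated on a composite
  functional.\<close>

definition brf :: "'v \<Rightarrow> ('v \<Rightarrow> 'k) \<Rightarrow> ('v \<Rightarrow> 'k) \<Rightarrow> 'v \<Rightarrow> 'k" where
  "brf a f g = (\<lambda>y. if y \<in> gcar A then br a y f g else 0)"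

lemma brf_grade:
  assumes a: "a \<in> grade A i" and f: "f \<in> grade (gdual A) p" and g: "g \<in> grade (gdual A) q"
  shows "brf a f g \<in> grade (gdual A) (i - d + p + q)"
proof (rule gdualI)
  show "lin_on A (*) (brf a f g)"
    using br_lin2[OF gcar_grade[OF a], of f g] by (simp add: lin_on_def brf_def gcar_closed[OF gs])
  show "brf a f g v = 0" if "v \<in> grade A m" "m + (i - d + p + q) \<noteq> 0" for m v
    using br_degree[OF a that(1) f g] that(2) by (simp add: brf_def algebra_simps)
qed (simp add: brf_def)

lemma dbr3L_tens:
  assumes "a \<in> grade A i" "b \<in> grade A j" "c \<in> grade A k"
  shows "is_tens A 3 (dbr3L A [a, b, c])"
  unfolding dbr3L_def
proof (rule is_tens_tlift)
  show "is_tens A 2 (dbr A [[a, b, c] ! 1, [a, b, c] ! 2])" using dbr_tens[OF assms(2,3)] by simp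
  fix ds ys assume "length ys = 2" "homs A ds ys"
  then obtain k l x y where *: "ds = [k, l]" "ys = [x, y]" "x \<in> grade A k" "y \<in> grade A l"
    by (auto elim!: homs2E)
  show "is_tens A 3 (tlift A 2 (\<lambda>_ zs. pure A [zs ! 0, zs ! 1, ys ! 1]) (dbr A [[a, b, c] ! 0, ys ! 0]))"
  proof (rule is_tens_tlift)
    show "is_tens A 2 (dbr A [[a, b, c] ! 0, ys ! 0])" using dbr_tens[OF assms(1) *(3)] * by simp
    fix es zs assume "length zs = 2" "homs A es zs"
    then obtain k' l' x' y' where **: "es = [k', l']" "zs = [x', y']" "x' \<in> grade A k'" "y' \<in> grade A l'"
      by (auto elim!: homs2E)
    show "is_tens A 3 (pure A [zs ! 0, zs ! 1, ys ! 1])"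
      by (rule is_tens_pure[of _ _ _ "[k', l', l]"]) (use * ** in \<open>simp_all add: homs_Cons\<close>)
  qed
qed

text \<open>The first leg \<open>x\<close> of the bracket of \<open>b\<close> and \<open>c\<close>
  is fed into the bracket with \<open>a\<close> and contributes \<open>br a x f g\<close>, which is
  \<open>brf a f g\<close> at \<open>x\<close>; the second leg is untouched and evaluated by
  \<open>h\<close>.\<close>

lemma dbr3L_eval:
  assumes a: "a \<in> grade A i" and b: "b \<in> grade A j" and c: "c \<in> grade A k"
    and f: "f \<in> grade (gdual A) p" and g: "g \<in> grade (gdual A) q" and h: "h \<in> grade (gdual A) r"
  shows "dbr3L A [a, b, c] (\<lambda>xs. f (xs ! 0) * g (xs ! 1) * h (xs ! 2)) = br b c (brf a f g) h"
proof -
  let ?\<beta> = "\<lambda>xs. f (xs ! 0) * g (xs ! 1) * h (xs ! 2)"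
  note f' = gdualD(1)[OF f] and g' = gdualD(1)[OF g] and h' = gdualD(1)[OF h]
  have \<beta>: "multilin A (*) 3 ?\<beta>" by (rule multilin_prod3[OF f' g' h'])
  have "tlift A 2 (\<lambda>_ ys. tlift A 2 (\<lambda>_ zs. pure A [zs ! 0, zs ! 1, ys ! 1]) (dbr A [a, ys ! 0])) (dbr A [b, c]) ?\<beta>
      = dbr A [b, c] (\<lambda>xs. brf a f g (xs ! 0) * h (xs ! 1))"
  proof (rule tlift_eval[OF dbr_tens[OF b c] multilin_prod2[OF gdualD(1)[OF brf_grade[OF a f g]] h']])
    fix ds ys assume "length ys = 2" "homs A ds ys"
    then obtain k l x y where *: "ds = [k, l]" "ys = [x, y]" "x \<in> grade A k" "y \<in> grade A l"
      by (auto elim!: homs2E)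
    have "tlift A 2 (\<lambda>_ zs. pure A [zs ! 0, zs ! 1, y]) (dbr A [a, x]) ?\<beta>
        = dbr A [a, x] (\<lambda>zs. h y * (f (zs ! 0) * g (zs ! 1)))"
      by (rule tlift_eval[OF dbr_tens[OF a *(3)]])
        (use \<beta> f' g' h' in \<open>auto simp: pure_def multilin2_iff lin_on_ground numeral_3_eq_3\<close>)
    also have "\<dots> = h y * br a x f g"
      unfolding br_def
      by (rule tens_eval_scal[OF dbr_tens[OF a *(3)]]) (use f' g' in \<open>simp_all add: multilin2_iff lin_on_ground\<close>)
    finally show "tlift A 2 (\<lambda>_ zs. pure A [zs ! 0, zs ! 1, ys ! 1]) (dbr A [a, ys ! 0]) ?\<beta> = brf a f g (ys ! 0) * h (ys ! 1)"
      using * by (simp add: brf_def gcar_grade)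
  qed
  then show ?thesis by (simp add: dbr3L_def br_def)
qed

text \<open>Permuting tensor factors before evaluation amounts to permuting the functionals, up to a
  sign expressed by their degrees. In the exponents the shifts by \<open>d\<close> of the two
  elements that are passed cancel modulo 2, so only the moving element keeps its shift.\<close>

lemma br_jacobi:
  assumes a: "a \<in> grade A i" and b: "b \<in> grade A j" and c: "c \<in> grade A k"
    and f: "f \<in> grade (gdual A) p" and g: "g \<in> grade (gdual A) q" and h: "h \<in> grade (gdual A) r"
  shows "br b c (brf a f g) h
    + sg ((i - d) * (j + k) + p * (q + r)) * br c a (brf b g h) f
    + sg ((k - d) * (i + j) + r * (p + q)) * br a b (brf c h f) g = 0"
proof -
  let ?\<beta> = "\<lambda>xs. f (xs ! 0) * g (xs ! 1) * h (xs ! 2)"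
  note f' = gdualD(1)[OF f] and g' = gdualD(1)[OF g] and h' = gdualD(1)[OF h]
  have \<beta>: "multilin A (*) 3 ?\<beta>" by (rule multilin_prod3[OF f' g' h'])
  let ?ds = "[i - d, j - d, k - d]"
  let ?t = "\<lambda>\<sigma>. tens_perm A 3 \<sigma> (tscal (sg (koszul (inv \<sigma>) ?ds)) (dbr3L A (perm_list (inv \<sigma>) [a, b, c])))"
  have "\<forall>ds xs. length xs = 3 \<and> homs (shift d A) ds xs \<longrightarrow>
        (\<Sum>\<sigma>\<in>{id, cyc3, cyc3 \<circ> cyc3}.
           tens_perm A 3 \<sigma>
             (tscal (sg (koszul (inv \<sigma>) ds)) (dbr3L A (perm_list (inv \<sigma>) xs)))) = 0"
    using dp unfolding double_poisson_def by blast
  from this[rule_format, of "[a, b, c]" ?ds] a b c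
  have "(\<Sum>\<sigma>\<in>{id, cyc3, cyc3 \<circ> cyc3}. ?t \<sigma>) = 0"
    by (simp add: homs_Cons)
  moreover have "id \<noteq> cyc3" "id \<noteq> cyc3 \<circ> cyc3" "cyc3 \<noteq> cyc3 \<circ> cyc3"
    by (auto simp: fun_eq_iff cyc3_def intro!: exI[of _ 0])
  ultimately have "?t id + ?t cyc3 + ?t (cyc3 \<circ> cyc3) = 0" by (simp add: add.assoc)
  from fun_cong[OF this, of ?\<beta>]
  have eq: "?t id ?\<beta> + ?t cyc3 ?\<beta> + ?t (cyc3 \<circ> cyc3) ?\<beta> = 0" by simp
  \<comment> \<open>The computation shared by the three rotations: \<open>s\<close> is the sign of
    permuting the arguments, and \<open>s'\<close> is the constant that \<open>hh\<close> extracts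
    from permuting the tensor factors.\<close>
  have val: "tens_perm A 3 \<sigma> (tscal s (dbr3L A [x, y, z])) ?\<beta> = s * (s' * br y z (brf x f1 g1) h1)"
    if xyz: "x \<in> grade A l" "y \<in> grade A m" "z \<in> grade A n"
      and fgh: "f1 \<in> grade (gdual A) p1" "g1 \<in> grade (gdual A) q1" "h1 \<in> grade (gdual A) r1"
      and hh: "\<And>k l m u v w. u \<in> grade A k \<Longrightarrow> v \<in> grade A l \<Longrightarrow> w \<in> grade A m \<Longrightarrow>
          sg (koszul \<sigma> [k, l, m]) * pure A (perm_list \<sigma> [u, v, w]) ?\<beta> = s' * (f1 u * g1 v * h1 w)"
    for \<sigma> s s' x y z f1 g1 h1 l m n p1 q1 r1
  proof -
    let ?\<gamma> = "\<lambda>xs. f1 (xs ! 0) * g1 (xs ! 1) * h1 (xs ! 2)"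
    have \<gamma>: "multilin A (*) 3 ?\<gamma>" using fgh by (intro multilin_prod3 gdualD(1))
    have \<gamma>': "multilin A (*) 3 (\<lambda>xs. s' * ?\<gamma> xs)" using fgh by (simp add: multilin3_iff lin_on_ground gdualD(1))
    note T = dbr3L_tens[OF xyz]
    have "tens_perm A 3 \<sigma> (tscal s (dbr3L A [x, y, z])) ?\<beta> = tscal s (dbr3L A [x, y, z]) (\<lambda>xs. s' * ?\<gamma> xs)"
      unfolding tens_perm_def
      by (rule tlift_eval[OF is_tens_tscal[OF gs T] \<gamma>'])
        (use hh in \<open>auto simp: tscal_def elim!: homs3E\<close>)
    also have "\<dots> = s * dbr3L A [x, y, z] (\<lambda>xs. s' * ?\<gamma> xs)" by (simp add: tscal_def)
    also have "dbr3L A [x, y, z] (\<lambda>xs. s' * ?\<gamma> xs) = s' * dbr3L A [x, y, z] ?\<gamma>"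
      by (rule tens_eval_scal[OF T \<gamma> \<gamma>'])
    also have "dbr3L A [x, y, z] ?\<gamma> = br y z (brf x f1 g1) h1"
      by (rule dbr3L_eval[OF xyz fgh])
    finally show ?thesis .
  qed
  have pure3: "pure A [u, v, w] ?\<beta> = f u * g v * h w" for u v w
    using \<beta> by (simp add: pure_def numeral_3_eq_3)
  \<comment> \<open>If the degrees of \<open>x\<close>, \<open>y\<close>, \<open>z\<close> are not
    opposite to those of \<open>f\<close>, \<open>g\<close>, \<open>h\<close>, both sides vanish;
    otherwise the sign depends on the functionals alone.\<close>
  have s1: "sg (w * (u + v)) * (f x * g y * h z) = sg (p * (q + r)) * (f x * g y * h z)"
    if x: "x \<in> grade A w" and y: "y \<in> grade A u" and z: "z \<in> grade A v" for u v w x y z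
  proof (cases "w + p = 0 \<and> u + q = 0 \<and> v + r = 0")
    case True
    then have "w = - p" "u = - q" "v = - r" by auto
    then show ?thesis by (simp add: sg_if)
  next
    case False
    then have "f x * g y * h z = 0" using gdualD(2)[OF f x] gdualD(2)[OF g y] gdualD(2)[OF h z] by auto
    then show ?thesis by simp
  qed
  have s2: "sg (w * (u + v)) * (f y * g z * h x) = sg (r * (p + q)) * (f y * g z * h x)"
    if x: "x \<in> grade A w" and y: "y \<in> grade A u" and z: "z \<in> grade A v" for u v w x y z
  proof (cases "w + r = 0 \<and> u + p = 0 \<and> v + q = 0")
    case True
    then have "w = - r" "u = - p" "v = - q" by auto
    then show ?thesis by (simp add: sg_if)
  next
    case False
    then have "f y * g z * h x = 0" using gdualD(2)[OF h x] gdualD(2)[OF f y] gdualD(2)[OF g z] by auto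
    then show ?thesis by simp
  qed
  have "?t id ?\<beta> = 1 * (1 * br b c (brf a f g) h)"
    unfolding inv_id koszul_id perm_list_id power_int_0_right
    by (rule val[OF a b c f g h]) (simp add: koszul_id perm_list_id pure3[unfolded One_nat_def])
  moreover have "?t cyc3 ?\<beta> = sg (koszul (cyc3 \<circ> cyc3) ?ds) * (sg (p * (q + r)) * br c a (brf b g h) f)"
    unfolding cyc3_inv perm_list_cyc3
    by (rule val[OF b c a g h f], simp only: koszul_cyc3 perm_list_cyc3 pure3 s1, simp only: mult_ac)
  moreover have "?t (cyc3 \<circ> cyc3) ?\<beta> = sg (koszul cyc3 ?ds) * (sg (r * (p + q)) * br a b (brf c h f) g)"
    unfolding cyc3_inv perm_list_cyc3
    by (rule val[OF c a b h f g], simp only: koszul_cyc3 perm_list_cyc3 pure3 s2, simp only: mult_ac)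
  moreover have "(sg (koszul (cyc3 \<circ> cyc3) ?ds) :: 'k) * sg (p * (q + r)) = sg ((i - d) * (j + k) + p * (q + r))"
    by (simp only: koszul_cyc3 sg_mult, rule sg_cong) (simp add: algebra_simps)
  moreover have "(sg (koszul cyc3 ?ds) :: 'k) * sg (r * (p + q)) = sg ((k - d) * (i + j) + r * (p + q))"
    by (simp only: koszul_cyc3 sg_mult, rule sg_cong) (simp add: algebra_simps)
  ultimately show ?thesis using eq by (simp add: mult.assoc[symmetric])
qed

end

section \<open>Signed multilinear extensions\<close>

definition bilin :: "('k, 'u::ab_group_add, 'x) gvs_scheme \<Rightarrow> ('k, 'v::ab_group_add, 'y) gvs_scheme
    \<Rightarrow> ('k \<Rightarrow> 'w::ab_group_add \<Rightarrow> 'w) \<Rightarrow> ('u \<Rightarrow> 'v \<Rightarrow> 'w) \<Rightarrow> bool" where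
  "bilin U V sc H \<longleftrightarrow>
     (\<forall>y\<in>gcar V. lin_on U sc (\<lambda>x. H x y)) \<and> (\<forall>x\<in>gcar U. lin_on V sc (\<lambda>y. H x y))"

definition trilin :: "('k, 'u::ab_group_add, 'x) gvs_scheme \<Rightarrow> ('k, 'v::ab_group_add, 'y) gvs_scheme
    \<Rightarrow> ('k, 't::ab_group_add, 'z) gvs_scheme
    \<Rightarrow> ('k \<Rightarrow> 'w::ab_group_add \<Rightarrow> 'w) \<Rightarrow> ('u \<Rightarrow> 'v \<Rightarrow> 't \<Rightarrow> 'w) \<Rightarrow> bool" where
  "trilin U V T sc H \<longleftrightarrow>
     (\<forall>y\<in>gcar V. \<forall>z\<in>gcar T. lin_on U sc (\<lambda>x. H x y z)) \<and>
     (\<forall>x\<in>gcar U. \<forall>z\<in>gcar T. lin_on V sc (\<lambda>y. H x y z)) \<and>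
     (\<forall>x\<in>gcar U. \<forall>y\<in>gcar V. lin_on T sc (\<lambda>z. H x y z))"

lemma bilin_ground_scal: "bilin U V (*) H \<Longrightarrow> bilin U V (*) (\<lambda>x y. s * H x y)"
  and trilin_ground_scal: "trilin U V T (*) K \<Longrightarrow> trilin U V T (*) (\<lambda>x y z. s * K x y z)"
  for s :: "'k::field"
  by (auto simp: bilin_def trilin_def intro: lin_on_ground)

lemma bilin_eqI:
  assumes U: "graded_space U" and V: "graded_space V"
    and H: "bilin U V sc H" and K: "bilin U V sc' K"
    and eq: "\<And>i j x y. x \<in> grade U i \<Longrightarrow> y \<in> grade V j \<Longrightarrow> H x y = K x y"
    and x: "x \<in> gcar U" and y: "y \<in> gcar V"
  shows "H x y = K x y"
proof (rule lin_on_eqI[OF U _ _ _ x])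
  show "lin_on U sc (\<lambda>x. H x y)" "lin_on U sc' (\<lambda>x. K x y)" using H K y by (auto simp: bilin_def)
  fix i x assume x: "x \<in> grade U i"
  show "H x y = K x y"
    by (rule lin_on_eqI[OF V _ _ _ y, of sc "H x" sc' "K x"])
      (use H K gcar_grade[OF x] eq[OF x] in \<open>auto simp: bilin_def\<close>)
qed

lemma trilin_bilin: "trilin U V T sc H \<Longrightarrow> x \<in> gcar U \<Longrightarrow> bilin V T sc (H x)"
  by (auto simp: trilin_def bilin_def)

lemma trilin_eqI:
  assumes U: "graded_space U" and V: "graded_space V" and T: "graded_space T"
    and H: "trilin U V T sc H" and K: "trilin U V T sc' K"
    and eq: "\<And>i j k x y z. x \<in> grade U i \<Longrightarrow> y \<in> grade V j \<Longrightarrow> z \<in> grade T k \<Longrightarrow> H x y z = K x y z"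
    and x: "x \<in> gcar U" and y: "y \<in> gcar V" and z: "z \<in> gcar T"
  shows "H x y z = K x y z"
proof (rule lin_on_eqI[OF U _ _ _ x])
  show "lin_on U sc (\<lambda>x. H x y z)" "lin_on U sc' (\<lambda>x. K x y z)"
    using H K y z by (auto simp: trilin_def)
  fix i x assume x: "x \<in> grade U i"
  show "H x y z = K x y z"
    by (rule bilin_eqI[OF V T trilin_bilin[OF H] trilin_bilin[OF K] eq[OF x] y z])
      (use gcar_grade[OF x] in auto)
qed

lemma lin_on_sum_fun:
  assumes "vector_space sc" and "\<And>i. i \<in> I \<Longrightarrow> lin_on V sc (\<lambda>v. h i v)"
  shows "lin_on V sc (\<lambda>v. \<Sum>i\<in>I. h i v)"
proof -
  interpret vector_space sc by (rule assms)
  show ?thesis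
    by (rule lin_onI)
      (auto simp: sum.distrib[symmetric] scale_sum_right intro!: sum.cong lin_on_add[OF assms(2)] lin_on_scal[OF assms(2)])
qed

lemma glift_param_lin:
  assumes V: "graded_space V" and sc: "vector_space sc" and v: "v \<in> gcar V"
    and "\<And>i x. x \<in> gcar V \<Longrightarrow> lin_on W sc (\<lambda>w. h i x w)"
  shows "lin_on W sc (\<lambda>w. glift V (\<lambda>i x. h i x w) v)"
  unfolding glift_def
  by (rule lin_on_sum_fun[OF sc]) (rule assms(4)[OF gcar_grade[OF hcomp_props(1)[OF V v]]])

text \<open>Each \<open>H i j\<close> is bilinear on the whole carriers and only the index depends
  on the degrees; this is why the extension is bilinear although its formula varies with the degrees
  of the components.\<close>

lemma bilin_glift:
  assumes U: "graded_space U" and V: "graded_space V" and sc: "vector_space sc"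
    and H: "\<And>i j. bilin U V sc (H i j)"
  shows "bilin U V sc (\<lambda>x y. glift U (\<lambda>i x'. glift V (\<lambda>j y'. H i j x' y') y) x)"
proof -
  have inner: "bilin U V sc (\<lambda>x y. glift V (\<lambda>j y'. H i j x y') y)" for i
    unfolding bilin_def using H[of i]
    by (auto intro!: glift_param_lin[OF V sc] glift_lin_on[OF V sc] simp: bilin_def)
  then show ?thesis
    unfolding bilin_def
    by (intro conjI ballI glift_lin_on[OF U sc] glift_param_lin[OF U sc]) auto
qed

lemma glift2_grade:
  assumes U: "graded_space U" and V: "graded_space V" and H: "\<And>i j. bilin U V sc (H i j)"
    and x: "x \<in> grade U i" and y: "y \<in> grade V j"
  shows "glift U (\<lambda>i x'. glift V (\<lambda>j y'. H i j x' y') y) x = H i j x y"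
proof -
  have z: "H i j x' 0 = 0" if "x' \<in> gcar U" for i j x'
    using H[of i j] that lin_on_zero[OF V, of sc "H i j x'"] by (simp add: bilin_def)
  have z': "H i j 0 y = 0" for i j
    using H[of i j] gcar_grade[OF y] lin_on_zero[OF U, of sc "\<lambda>x. H i j x y"] by (simp add: bilin_def)
  have "glift V (\<lambda>j y'. H i j x' y') y = H i j x' y" if "x' \<in> gcar U" for x'
    using glift_grade[OF V y, of "\<lambda>j y'. H i j x' y'"] z[OF that] by simp
  then show ?thesis
    using glift_grade[OF U x, of "\<lambda>i x'. glift V (\<lambda>j y'. H i j x' y') y"] gcar_grade[OF x]
      gcar_closed(1)[OF U] z' by simp
qed

lemma trilin_glift:
  assumes U: "graded_space U" and V: "graded_space V" and T: "graded_space T" and sc: "vector_space sc"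
    and H: "\<And>i j k. trilin U V T sc (H i j k)"
  shows "trilin U V T sc (\<lambda>x y z. glift U (\<lambda>i x'. glift V (\<lambda>j y'. glift T (\<lambda>k z'. H i j k x' y' z') z) y) x)"
proof -
  have b: "bilin V T sc (\<lambda>y z. glift V (\<lambda>j y'. glift T (\<lambda>k z'. H i j k x y' z') z) y)" if "x \<in> gcar U" for i x
    by (rule bilin_glift[OF V T sc]) (rule trilin_bilin[OF H that])
  have u: "lin_on U sc (\<lambda>x. glift V (\<lambda>j y'. glift T (\<lambda>k z'. H i j k x y' z') z) y)"
    if "y \<in> gcar V" "z \<in> gcar T" for i y z
    by (intro glift_param_lin[OF V sc] glift_param_lin[OF T sc] that) (use H in \<open>auto simp: trilin_def\<close>)
  show ?thesis
    unfolding trilin_def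
    by (intro conjI ballI glift_lin_on[OF U sc] glift_param_lin[OF U sc] u) (use b in \<open>auto simp: bilin_def\<close>)
qed

lemma glift3_grade:
  assumes U: "graded_space U" and V: "graded_space V" and T: "graded_space T"
    and H: "\<And>i j k. trilin U V T sc (H i j k)"
    and x: "x \<in> grade U i" and y: "y \<in> grade V j" and z: "z \<in> grade T k"
  shows "glift U (\<lambda>i x'. glift V (\<lambda>j y'. glift T (\<lambda>k z'. H i j k x' y' z') z) y) x = H i j k x y z"
proof -
  have b: "glift V (\<lambda>j y'. glift T (\<lambda>k z'. H i j k x' y' z') z) y = H i j k x' y z" if "x' \<in> gcar U" for x' i
    by (rule glift2_grade[OF V T _ y z]) (rule trilin_bilin[OF H that])
  have "H i j k 0 y z = 0" for i
    using H[of i j k] lin_on_zero[OF U, of sc "\<lambda>x. H i j k x y z"] gcar_grade[OF y] gcar_grade[OF z]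
    by (simp add: trilin_def)
  then show ?thesis
    using glift_grade[OF U x, of "\<lambda>i x'. glift V (\<lambda>j y'. glift T (\<lambda>k z'. H i j k x' y' z') z) y"]
      b gcar_grade[OF x] gcar_closed(1)[OF U] by simp
qed

lemma vs_ground: "vector_space ((*) :: 'k::field \<Rightarrow> 'k \<Rightarrow> 'k)"
  by unfold_locales (auto simp: algebra_simps)

lemma gs_vs: "graded_space V \<Longrightarrow> vector_space (scal V)"
  by (simp add: graded_space_def)

text \<open>
  The sign operator \<open>x \<mapsto> (-1)\<^bsup>k|x|\<^esup> x\<close>.  It absorbs the Koszul signs, so that the product, the
  differential and the form of \<open>\<partial>\<^bsub>d-1\<^esub>\<phi>\<close> are given by one formula on all of the carrier.
\<close>

definition par :: "('k::field, 'v::ab_group_add, 'z) gvs_scheme \<Rightarrow> int \<Rightarrow> 'v \<Rightarrow> 'v" where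
  "par V k = glift V (\<lambda>i. scal V (sg (k * i)))"

lemma par_lin: "graded_space V \<Longrightarrow> lin_on V (scal V) (par V k)"
  unfolding par_def
  by (rule glift_lin_on) (auto simp: gs_vs lin_on_def vs_sc mult.commute)

lemma par_grade: "graded_space V \<Longrightarrow> x \<in> grade V i \<Longrightarrow> par V k x = scal V (sg (k * i)) x"
  unfolding par_def by (rule glift_grade) (auto simp: vs_sc)

lemma par_gcar:
  assumes V: "graded_space V" and x: "x \<in> gcar V"
  shows "par V k x \<in> gcar V"
  by (rule lin_on_gcar[OF V V par_lin[OF V] _ x])
    (simp add: par_grade[OF V] gcar_closed(3)[OF V] gcar_grade)

lemma lin_on_compose:
  assumes "lin_on V (scal W) f" "lin_on W sc g" "\<And>x. x \<in> gcar V \<Longrightarrow> f x \<in> gcar W"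
  shows "lin_on V sc (\<lambda>x. g (f x))"
  using assms by (simp add: lin_on_def)

text \<open>A functional of degree \<open>p\<close> sees only the component of degree
  \<open>- p\<close>, on which the sign operator is a single scalar.\<close>

lemma gdual_par:
  assumes V: "graded_space V" and f: "f \<in> grade (gdual V) p" and x: "x \<in> gcar V"
  shows "f (par V k x) = sg (k * p) * f x"
proof (rule lin_on_eqI[OF V _ _ _ x])
  show "lin_on V (*) (\<lambda>x. f (par V k x))"
    by (rule lin_on_compose[OF par_lin[OF V] gdualD(1)[OF f] par_gcar[OF V]])
  show "lin_on V (*) (\<lambda>x. sg (k * p) * f x)" by (rule lin_on_ground(2)[OF gdualD(1)[OF f]])
  fix n x assume x: "x \<in> grade V n"
  then show "f (par V k x) = sg (k * p) * f x"
    using prod2_sign[OF f x, of k] lin_on_scal[OF gdualD(1)[OF f] gcar_grade[OF x]]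
    by (simp add: par_grade[OF V x] mult.commute)
qed

lemma par_natural:
  assumes V: "graded_space V" and W: "graded_space W" and f: "glin V W 0 f" and x: "x \<in> gcar V"
  shows "f (par V k x) = par W k (f x)"
proof (rule lin_on_eqI[OF V _ _ _ x])
  have f': "lin_on V (scal W) f" using f by (simp add: glin_iff)
  show "lin_on V (scal W) (\<lambda>x. f (par V k x))"
    by (rule lin_on_compose[OF par_lin[OF V] f' par_gcar[OF V]])
  show "lin_on V (scal W) (\<lambda>x. par W k (f x))"
    by (rule lin_on_compose[OF f' par_lin[OF W] glin_gcar[OF V W f]])
  fix n x assume x: "x \<in> grade V n"
  then have "f x \<in> grade W n" using f by (simp add: glin_iff)
  then show "f (par V k x) = par W k (f x)"
    using lin_on_scal[OF f' gcar_grade[OF x]] by (simp add: par_grade[OF V x] par_grade[OF W])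
qed


section \<open>The dg algebra and the form attached to a morphism, without nested extensions\<close>

lemma gcar_cong: "grade V = grade W \<Longrightarrow> gcar V = gcar W"
  by (simp add: gcar_def)

lemma hcomp_cong: "grade V = grade W \<Longrightarrow> hcomp V = hcomp W"
  by (simp add: hcomp_def fun_eq_iff)

lemma glift_cong: "grade V = grade W \<Longrightarrow> glift V = glift W"
  using hcomp_cong[of V W] by (simp add: glift_def fun_eq_iff)

lemma gdual_cong: "scal V = scal W \<Longrightarrow> grade V = grade W \<Longrightarrow> gdual V = gdual W"
  using gcar_cong[of V W] by (simp add: gdual_def glin_def)

lemma graded_space_cong: "scal V = scal W \<Longrightarrow> grade V = grade W \<Longrightarrow> graded_space V \<longleftrightarrow> graded_space W"
  by (simp add: graded_space_def)

lemma restrict_bimod_simps: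
  "gcar (restrict_bimod \<phi> B) = gcar B" "gdual (restrict_bimod \<phi> B) = gdual B"
  "glift (restrict_bimod \<phi> B) = glift B" "mdif (restrict_bimod \<phi> B) = dif B"
  "lact (restrict_bimod \<phi> B) = (\<lambda>a b. mul B (\<phi> a) b)" "ract (restrict_bimod \<phi> B) = (\<lambda>b a. mul B b (\<phi> a))"
  by (auto intro!: gcar_cong gdual_cong glift_cong simp: restrict_bimod_def)

locale dgmor = A: dgalg A + B: dgalg B
  for A :: "('k::field, 'a::ab_group_add, 'y) dga_scheme" and B :: "('k, 'b::ab_group_add, 'z) dga_scheme" +
  fixes \<phi> :: "'a \<Rightarrow> 'b" and d :: int
  assumes mor: "dga_morphism A B \<phi>"
begin

lemma phi_glin: "glin A B 0 \<phi>"
  and phi_mul: "x \<in> gcar A \<Longrightarrow> y \<in> gcar A \<Longrightarrow> \<phi> (mul A x y) = mul B (\<phi> x) (\<phi> y)"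
  and phi_dif: "x \<in> gcar A \<Longrightarrow> \<phi> (dif A x) = dif B (\<phi> x)"
  using mor by (auto simp: dga_morphism_def)

lemma phi_lin: "lin_on A (scal B) \<phi>" and phi_grade: "x \<in> grade A i \<Longrightarrow> \<phi> x \<in> grade B i"
  using phi_glin by (auto simp: glin_iff)

lemma phi_gcar: "x \<in> gcar A \<Longrightarrow> \<phi> x \<in> gcar B"
  by (rule glin_gcar[OF A.gs B.gs phi_glin])

lemma phi_par: "x \<in> gcar A \<Longrightarrow> \<phi> (par A k x) = par B k (\<phi> x)"
  by (rule par_natural[OF A.gs B.gs phi_glin])

lemma bd_gs: "graded_space (bd_space d A B)"
  unfolding bd_space_def by (intro graded_space_dsum graded_space_shift A.gs B.gsd)

lemma bd_gcar: "gcar (bd_space d A B) = gcar A \<times> gcar (gdual B)"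
  unfolding bd_space_def by (simp add: gcar_dsum[OF A.gs graded_space_shift[OF B.gsd]] gcar_shift)

lemma bd_grade: "(a, f) \<in> grade (bd_space d A B) n \<longleftrightarrow> a \<in> grade A n \<and> f \<in> grade (gdual B) (n + d - 1)"
  by (simp add: bd_space_def algebra_simps)

lemma bd_scal: "scal (bd_space d A B) c (a, f) = (scal A c a, \<lambda>x. c * f x)"
  by (simp add: bd_space_def)

text \<open>For homogeneous arguments of degrees \<open>i\<close> and \<open>p\<close>, the value
  \<open>g (\<phi> a)\<close> is nonzero only if \<open>p = - i\<close>, and there the prescribed
  exponent \<open>i * (p - d + 1)\<close> has the parity of \<open>d * i\<close>. This is the sign
  operator \<open>par A d\<close>.\<close>

lemma bd_form_closed:
  assumes a: "a \<in> gcar A" and g: "g \<in> gcar (gdual B)"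
  shows "bd_form d A B \<phi> [(a, f), (b, g)] = f (\<phi> b) + g (\<phi> (par A d a))"
proof -
  have K: "bilin A (gdual B) (*) (\<lambda>x y. y (\<phi> (h x)) :: 'k)"
    if "lin_on A (scal A) h" "\<And>x. x \<in> gcar A \<Longrightarrow> h x \<in> gcar A" for h
    unfolding bilin_def
  proof (intro conjI ballI)
    fix y :: "'b \<Rightarrow> 'k" assume y: "y \<in> gcar (gdual B)"
    have "lin_on A (scal B) (\<lambda>x. \<phi> (h x))" by (rule lin_on_compose[OF that(1) phi_lin that(2)])
    then show "lin_on A (*) (\<lambda>x. y (\<phi> (h x)))"
      by (rule lin_on_compose) (auto intro: gcar_gdualD(1)[OF B.gs y] phi_gcar that(2))
  qed (auto simp: lin_on_def)
  have H: "bilin A (gdual B) (*) (\<lambda>x y. sg (i * (p - d + 1)) * y (\<phi> x) :: 'k)" for i p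
    by (rule bilin_ground_scal, rule K) (auto simp: lin_on_def)
  have "glift A (\<lambda>i a'. glift (gdual B) (\<lambda>p g'. sg (i * (p - d + 1)) * g' (\<phi> a')) g) a = g (\<phi> (par A d a))"
  proof (rule bilin_eqI[OF A.gs B.gsd bilin_glift[OF A.gs B.gsd vs_ground H] K[OF par_lin[OF A.gs] par_gcar[OF A.gs]] _ a g])
    fix i j x y assume x: "x \<in> grade A i" and y: "y \<in> grade (gdual B) j"
    have "sg (i * (j - d + 1)) * y (\<phi> x) = y (\<phi> (par A d x))"
    proof (cases "i + j = 0")
      case True
      then have "j = - i" by simp
      then have "(sg (i * (j - d + 1)) :: 'k) = sg (d * i)" by (intro sg_cong) auto
      then show ?thesis
        using lin_on_scal[OF phi_lin gcar_grade[OF x]] lin_on_scal[OF gdualD(1)[OF y] phi_gcar[OF gcar_grade[OF x]]]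
        by (simp add: par_grade[OF A.gs x])
    next
      case False
      then have z: "y (\<phi> x) = 0" using gdualD(2)[OF y phi_grade[OF x]] by simp
      then show ?thesis
        using lin_on_scal[OF phi_lin gcar_grade[OF x]] lin_on_scal[OF gdualD(1)[OF y] phi_gcar[OF gcar_grade[OF x]]]
        by (simp add: par_grade[OF A.gs x])
    qed
    then show "glift A (\<lambda>i a'. glift (gdual B) (\<lambda>p g'. sg (i * (p - d + 1)) * g' (\<phi> a')) y) x = y (\<phi> (par A d x))"
      by (subst glift2_grade[OF A.gs B.gsd H x y])
  qed
  then show ?thesis by (simp add: bd_form_def)
qed

text \<open>The left action on the dual has sign exponent \<open>i * (p + j)\<close>, which has the
  parity of \<open>i\<close> where the value can be nonzero, that is for
  \<open>i + p + j = 0\<close>. The shift adds \<open>(d - 1) * i\<close>, and together they give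
  \<open>par A d\<close>. The right action carries no sign.\<close>

lemma bd_mul_closed:
  assumes a: "a \<in> gcar A" and g: "g \<in> gcar (gdual B)"
  shows "mul (bd_dga d A B \<phi>) (a, f) (b, g) =
    (mul A a b, \<lambda>c. if c \<in> gcar B then f (mul B (\<phi> b) c) + g (mul B c (\<phi> (par A d a))) else 0)"
proof -
  let ?D = "dual_bimod A (restrict_bimod \<phi> B)"
  have l: "lact ?D x y = (\<lambda>c. if c \<in> gcar B then glift A (\<lambda>i a'. glift (gdual B) (\<lambda>p f'. glift B (\<lambda>j c'.
          sg (i * (p + j)) * f' (mul B c' (\<phi> a'))) c) y) x else 0)" for x y
    by (simp add: dual_bimod_def restrict_bimod_simps fun_eq_iff)
  have K: "trilin A (gdual B) B (*) (\<lambda>x y c. y (mul B c (\<phi> (h x))) :: 'k)"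
    if h: "lin_on A (scal A) h" "\<And>x. x \<in> gcar A \<Longrightarrow> h x \<in> gcar A" for h
    unfolding trilin_def
  proof (intro conjI ballI)
    fix y :: "'b \<Rightarrow> 'k" and c assume y: "y \<in> gcar (gdual B)" and c: "c \<in> gcar B"
    have 1: "lin_on A (scal B) (\<lambda>x. \<phi> (h x))" by (rule lin_on_compose[OF h(1) phi_lin h(2)])
    have 2: "lin_on A (scal B) (\<lambda>x. mul B c (\<phi> (h x)))"
      by (rule lin_on_compose[OF 1 B.mul_lin2[OF c]]) (simp add: phi_gcar h(2))
    show "lin_on A (*) (\<lambda>x. y (mul B c (\<phi> (h x))))"
      by (rule lin_on_compose[OF 2 gcar_gdualD(1)[OF B.gs y]]) (simp add: phi_gcar h(2) B.mul_gcar c)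
  next
    fix x c assume "x \<in> gcar A" "c \<in> gcar B"
    show "lin_on (gdual B) (*) (\<lambda>y. y (mul B c (\<phi> (h x))))" by (simp add: lin_on_def)
  next
    fix x and y :: "'b \<Rightarrow> 'k" assume x: "x \<in> gcar A" and y: "y \<in> gcar (gdual B)"
    show "lin_on B (*) (\<lambda>c. y (mul B c (\<phi> (h x))))"
      by (rule lin_on_compose[OF B.mul_lin1 gcar_gdualD(1)[OF B.gs y]]) (simp_all add: phi_gcar h(2) x B.mul_gcar)
  qed
  have H: "trilin A (gdual B) B (*) (\<lambda>x y c. sg (i * (p + j)) * y (mul B c (\<phi> x)) :: 'k)" for i p j
    by (rule trilin_ground_scal, rule K) (auto simp: lin_on_def)
  let ?G = "\<lambda>x y c. glift A (\<lambda>i a'. glift (gdual B) (\<lambda>p f'. glift B (\<lambda>j c'.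
          sg (i * (p + j)) * f' (mul B c' (\<phi> a')) :: 'k) c) y) x"
  have G: "?G x y c = y (mul B c (\<phi> (par A 1 x)))"
    if x: "x \<in> gcar A" and y: "y \<in> gcar (gdual B)" and c: "c \<in> gcar B" for x y c
  proof (rule trilin_eqI[OF A.gs B.gsd B.gs trilin_glift[OF A.gs B.gsd B.gs vs_ground H]
        K[OF par_lin[OF A.gs] par_gcar[OF A.gs]] _ x y c])
    fix i p j x y c assume x: "x \<in> grade A i" and y: "y \<in> grade (gdual B) p" and c: "c \<in> grade B j"
    note x' = gcar_grade[OF x] and c' = gcar_grade[OF c]
    have v: "y (mul B c (\<phi> (par A 1 x))) = sg i * y (mul B c (\<phi> x))"
      using lin_on_scal[OF phi_lin x'] lin_on_scal[OF B.mul_lin2[OF c'] phi_gcar[OF x']]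
        lin_on_scal[OF gdualD(1)[OF y] B.mul_gcar[OF c' phi_gcar[OF x']]]
      by (simp add: par_grade[OF A.gs x])
    have "sg (i * (p + j)) * y (mul B c (\<phi> x)) = sg i * y (mul B c (\<phi> x))"
    proof (cases "j + i + p = 0")
      case True
      then have "p + j = - i" by simp
      then have "(sg (i * (p + j)) :: 'k) = sg i" by (simp add: sg_if)
      then show ?thesis by simp
    next
      case False
      then show ?thesis using gdualD(2)[OF y B.mul_grade[OF c phi_grade[OF x]]] by simp
    qed
    then show "?G x y c = y (mul B c (\<phi> (par A 1 x)))"
      unfolding v by (subst glift3_grade[OF A.gs B.gsd B.gs H x y c])
  qed
  have L: "lin_on A (\<lambda>s f c. s * f c) (\<lambda>x. lact ?D x g)"
    unfolding l using trilin_glift[OF A.gs B.gsd B.gs vs_ground H] g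
    by (auto simp: trilin_def lin_on_def fun_eq_iff)
  have Li: "lin_on A (\<lambda>s f c. s * f c) (\<lambda>x. scal ?D (sg ((d - 1) * i)) (lact ?D x g))" for i
    using L by (auto simp: lin_on_def dual_bimod_def gdual_def fun_eq_iff algebra_simps)
  have vs: "vector_space (\<lambda>s (f :: 'b \<Rightarrow> 'k) c. s * f c)"
    by unfold_locales (auto simp: algebra_simps)
  have R: "lin_on A (\<lambda>s f c. s * f c) (\<lambda>x c. if c \<in> gcar B then g (mul B c (\<phi> (par A d x))) else 0)"
    using K[OF par_lin[OF A.gs] par_gcar[OF A.gs]] g by (auto simp: trilin_def lin_on_def fun_eq_iff)
  have "glift A (\<lambda>i a'. scal ?D (sg ((d - 1) * i)) (lact ?D a' g)) a
      = (\<lambda>c. if c \<in> gcar B then g (mul B c (\<phi> (par A d a))) else 0)"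
  proof (rule lin_on_eqI[OF A.gs glift_lin_on[OF A.gs vs Li] R _ a])
    fix i x assume x: "x \<in> grade A i"
    note x' = gcar_grade[OF x]
    have "scal ?D (sg ((d - 1) * i)) (lact ?D x g) c = (if c \<in> gcar B then g (mul B c (\<phi> (par A d x))) else 0)" for c
    proof (cases "c \<in> gcar B")
      case True
      have k: "g (mul B c (\<phi> (par A k x))) = sg (k * i) * g (mul B c (\<phi> x))" for k
        using lin_on_scal[OF phi_lin x'] lin_on_scal[OF B.mul_lin2[OF True] phi_gcar[OF x']]
          lin_on_scal[OF gcar_gdualD(1)[OF B.gs g] B.mul_gcar[OF True phi_gcar[OF x']]]
        by (simp add: par_grade[OF A.gs x])
      have "scal ?D (sg ((d - 1) * i)) (lact ?D x g) c = sg ((d - 1) * i) * (sg i * g (mul B c (\<phi> x)))"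
        using True G[OF x' g True] k[of 1] by (simp add: l dual_bimod_def restrict_bimod_simps)
      also have "\<dots> = sg (d * i) * g (mul B c (\<phi> x))"
        unfolding sg_mult_left by (simp add: algebra_simps)
      finally show ?thesis using True k[of d] by simp
    next
      case False
      then show ?thesis by (simp add: l dual_bimod_def restrict_bimod_simps)
    qed
    moreover have "glift A (\<lambda>i a'. scal ?D (sg ((d - 1) * i)) (lact ?D a' g)) x = scal ?D (sg ((d - 1) * i)) (lact ?D x g)"
      by (rule glift_grade[OF A.gs x]) (rule lin_on_zero[OF A.gs Li])
    ultimately show "glift A (\<lambda>i a'. scal ?D (sg ((d - 1) * i)) (lact ?D a' g)) x
      = (\<lambda>c. if c \<in> gcar B then g (mul B c (\<phi> (par A d x))) else 0)" by auto
  qed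
  then have "mul (bd_dga d A B \<phi>) (a, f) (b, g) = (mul A a b, ract ?D f b +
      (\<lambda>c. if c \<in> gcar B then g (mul B c (\<phi> (par A d a))) else 0))"
    by (simp add: bd_dga_def trivial_extension_def shift_bimod_def)
  then show ?thesis
    by (simp add: dual_bimod_def restrict_bimod_simps fun_eq_iff)
qed

text \<open>The dual contributes \<open>- sg p\<close> and the shift \<open>sg (d - 1)\<close>, so
  \<open>sg (d + p)\<close> remains; its dependence on \<open>p\<close> is expressed by the sign
  operator at \<open>dif B c\<close>.\<close>

lemma bd_dif_closed:
  assumes f: "f \<in> gcar (gdual B)"
  shows "dif (bd_dga d A B \<phi>) (a, f) =
    (dif A a, \<lambda>c. if c \<in> gcar B then sg d * f (par B 1 (dif B c)) else 0)"
proof -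
  let ?D = "dual_bimod A (restrict_bimod \<phi> B)"
  have l: "mdif ?D = glift (gdual B) (\<lambda>p f c. if c \<in> gcar B then - sg p * f (dif B c) else 0)"
    unfolding dual_bimod_def restrict_bimod_simps by simp
  have vs: "vector_space (\<lambda>s (f :: 'b \<Rightarrow> 'k) c. s * f c)"
    by unfold_locales (auto simp: algebra_simps)
  have Li: "lin_on (gdual B) (\<lambda>s f c. s * f c) (\<lambda>f c. if c \<in> gcar B then - sg p * f (dif B c) else 0)" for p
    by (auto simp: lin_on_def fun_eq_iff algebra_simps)
  have L: "lin_on (gdual B) (\<lambda>s f c. s * f c) (\<lambda>f. scal ?D (sg (d - 1)) (mdif ?D f))"
    unfolding l using glift_lin_on[OF B.gsd vs Li]
    by (auto simp: lin_on_def dual_bimod_def gdual_def fun_eq_iff algebra_simps)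
  have R: "lin_on (gdual B) (\<lambda>s f c. s * f c) (\<lambda>f c. if c \<in> gcar B then sg d * f (par B 1 (dif B c)) else 0)"
    by (auto simp: lin_on_def fun_eq_iff algebra_simps)
  have "scal ?D (sg (d - 1)) (mdif ?D f) = (\<lambda>c. if c \<in> gcar B then sg d * f (par B 1 (dif B c)) else 0)"
  proof (rule lin_on_eqI[OF B.gsd L R _ f])
    fix p f assume f: "f \<in> grade (gdual B) p"
    have "mdif ?D f = (\<lambda>c. if c \<in> gcar B then - sg p * f (dif B c) else 0)"
      unfolding l by (rule glift_grade[OF B.gsd f]) auto
    then show "scal ?D (sg (d - 1)) (mdif ?D f) = (\<lambda>c. if c \<in> gcar B then sg d * f (par B 1 (dif B c)) else 0)"
      using gdual_par[OF B.gs f B.dif_gcar]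
      by (auto simp: dual_bimod_def gdual_def fun_eq_iff sg_if)
  qed
  then show ?thesis
    by (simp add: bd_dga_def trivial_extension_def shift_bimod_def)
qed

end

section \<open>The ternary operations of a double bracket\<close>

lemma gdual_hcomp:
  assumes V: "graded_space V" and f: "f \<in> grade (gdual V) n" and z: "z \<in> gcar V"
  shows "f z = f (hcomp V z (- n))"
proof (rule lin_on_eqI[OF V gdualD(1)[OF f] _ _ z])
  show "lin_on V (*) (\<lambda>z. f (hcomp V z (- n)))"
    using gdualD(1)[OF f] gcar_grade[OF hcomp_props(1)[OF V]]
    by (auto simp: lin_on_def hcomp_add[OF V] hcomp_scal[OF V])
  fix m x assume x: "x \<in> grade V m"
  show "f x = f (hcomp V x (- n))"
    using gdualD(2)[OF f x] lin_on_zero[OF V gdualD(1)[OF f]] by (auto simp: hcomp_grade[OF V x])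
qed

text \<open>A functional of degree \<open>- e\<close> sees nothing of \<open>z\<close> but its
  component of degree \<open>e\<close>, and all the others vanish on both. Hence no functional
  distinguishes \<open>z\<close> from that component.\<close>

lemma gcar_gradeI:
  fixes V :: "('k::field, 'v::ab_group_add, 'z) gvs_scheme"
  assumes V: "graded_space V" and z: "z \<in> gcar V"
    and 0: "\<And>n f. f \<in> grade (gdual V) n \<Longrightarrow> n \<noteq> - e \<Longrightarrow> f z = (0::'k)"
  shows "z \<in> grade V e"
proof -
  note h = hcomp_props(1)[OF V z, of e]
  have "z = hcomp V z e"
  proof (rule gcar_eqI[OF V z gcar_grade[OF h]])
    fix n and f :: "'v \<Rightarrow> 'k" assume f: "f \<in> grade (gdual V) n"
    show "f z = f (hcomp V z e)"
    proof (cases "n = - e")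
      case True
      then show ?thesis using gdual_hcomp[OF V f z] by simp
    next
      case False
      then show ?thesis using 0[OF f] gdualD(2)[OF f h] by auto
    qed
  qed
  then show ?thesis using h by simp
qed

text \<open>A term \<open>x \<otimes> y\<close> of a presentation contributes \<open>g y\<close>
  times \<open>x\<close>. The contraction is thus an element of \<open>V\<close> itself and not only
  a functional on its dual, without any finite-dimensionality.\<close>

lemma contraction_exists:
  assumes V: "graded_space V" and T: "is_tens V 2 T" and g: "lin_on V (*) g"
  shows "\<exists>z\<in>gcar V. \<forall>f. lin_on V (*) f \<longrightarrow> f z = T (\<lambda>xs. f (xs ! 0) * g (xs ! 1))"
proof -
  obtain R where R: "tens_rep V 2 T R" using T by (auto simp: is_tens_def)
  have "\<exists>z\<in>gcar V. \<forall>f. lin_on V (*) f \<longrightarrow> f z = (\<Sum>(ds, xs)\<leftarrow>R'. f (xs ! 0) * g (xs ! 1))"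
    if "\<forall>(ds, xs)\<in>set R'. length xs = 2 \<and> homs V ds xs" for R'
    using that
  proof (induction R')
    case Nil
    show ?case using gcar_closed(1)[OF V] lin_on_zero[OF V] by (intro bexI[of _ 0]) auto
  next
    case (Cons p R')
    obtain ds xs where p: "p = (ds, xs)" by (cases p)
    then obtain i j x y where *: "ds = [i, j]" "xs = [x, y]" "x \<in> grade V i" "y \<in> grade V j"
      using Cons.prems by (auto elim!: homs2E)
    obtain z where z: "z \<in> gcar V" "\<forall>f. lin_on V (*) f \<longrightarrow> f z = (\<Sum>(ds, xs)\<leftarrow>R'. f (xs ! 0) * g (xs ! 1))"
      using Cons by auto
    have x': "scal V (g y) x \<in> gcar V" using gcar_closed(3)[OF V gcar_grade[OF *(3)]] .
    show ?case
      by (rule bexI[of _ "scal V (g y) x + z"])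
        (use p * z x' gcar_grade[OF *(3)] in \<open>auto simp: lin_on_def gcar_closed[OF V] mult.commute\<close>)
  qed
  from this[of R] R show ?thesis
    using tens_rep_eval[OF R multilin_prod2[OF _ g]] by (auto simp: tens_rep_def)
qed

lemma four_term_sg:
  fixes x y z w :: "'k::field"
  assumes "sg a * x + sg b * y + sg c * z + sg e * w = 0"
    and "even (a + a' + b + b')" "even (a + a' + c + c')" "even (a + a' + e + e')"
  shows "sg a' * x + sg b' * y + sg c' * z + sg e' * w = 0"
proof -
  have "sg a' * x + sg b' * y + sg c' * z + sg e' * w
      = sg (a + a') * (sg a * x + sg b * y + sg c * z + sg e * w)"
    using assms(2-4) by (auto simp: sg_if algebra_simps)
  then show ?thesis using assms(1) by simp
qed

section \<open>Contraction of the bracket, and the relations of the contracted operation\<close>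

context dpalg
begin

lemma dbr_tens_gcar:
  assumes a: "a \<in> gcar A" and b: "b \<in> gcar A"
  shows "is_tens A 2 (dbr A [a, b])"
  using gs a
proof (induction rule: gcar_induct)
  case (grade n x)
  show ?case using gs b
  proof (induction rule: gcar_induct)
    case (grade m y)
    then show ?case using dbr_tens \<open>x \<in> grade A n\<close> by blast
  next
    case (add y z)
    show ?case unfolding lin_on_add[OF dbr_lin2[OF gcar_grade[OF grade]] add(1,2)]
      by (rule is_tens_add[OF add(3,4)])
  qed
next
  case (add x y)
  show ?case unfolding lin_on_add[OF dbr_lin1[OF b] add(1,2)]
    by (rule is_tens_add[OF add(3,4)])
qed

text \<open>The first leg of the bracket of \<open>a\<close> and \<open>b\<close> after contraction
  of the second leg with \<open>g\<close>; the order of the arguments is that of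
  \<open>m\<^sub>3(b, tg, a)\<close>. The chosen element is determined, since functionals separate
  points.\<close>

definition contr :: "'v \<Rightarrow> ('v \<Rightarrow> 'k) \<Rightarrow> 'v \<Rightarrow> 'v" where
  "contr b g a = (SOME z. z \<in> gcar A \<and> (\<forall>f. lin_on A (*) f \<longrightarrow> f z = br a b f g))"

lemma contr_props:
  assumes "a \<in> gcar A" "b \<in> gcar A" "g \<in> gcar (gdual A)"
  shows "contr b g a \<in> gcar A" "lin_on A (*) f \<Longrightarrow> f (contr b g a) = br a b f g"
proof -
  have "\<exists>z. z \<in> gcar A \<and> (\<forall>f. lin_on A (*) f \<longrightarrow> f z = br a b f g)"
    using contraction_exists[OF gs dbr_tens_gcar[OF assms(1,2)] gcar_gdualD(1)[OF gs assms(3)]]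
    unfolding br_def by blast
  from someI_ex[OF this]
  show "contr b g a \<in> gcar A" "lin_on A (*) f \<Longrightarrow> f (contr b g a) = br a b f g"
    unfolding contr_def[symmetric] by auto
qed

lemma br_lin4:
  assumes "a \<in> gcar A" "b \<in> gcar A" "lin_on A (*) f"
  shows "lin_on (gdual A) (*) (br a b f)"
proof (rule lin_onI)
  note T = dbr_tens_gcar[OF assms(1,2)]
  fix u v c assume u: "u \<in> gcar (gdual A)"
  note u' = gcar_gdualD(1)[OF gs u]
  show "br a b f (u + v) = br a b f u + br a b f v" if v: "v \<in> gcar (gdual A)"
  proof -
    note v' = gcar_gdualD(1)[OF gs v]
    have "multilin A (*) 2 (\<lambda>xs. f (xs ! 0) * u (xs ! 1) + f (xs ! 0) * v (xs ! 1))"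
      using assms(3) u' v' by (simp add: multilin2_iff lin_on_ground)
    from tens_eval_add[OF T multilin_prod2[OF assms(3) u'] multilin_prod2[OF assms(3) v'] this]
    show ?thesis by (simp add: br_def distrib_left)
  qed
  have "multilin A (*) 2 (\<lambda>xs. c * (f (xs ! 0) * u (xs ! 1)))"
    using assms(3) u' by (simp add: multilin2_iff lin_on_ground)
  from tens_eval_scal[OF T multilin_prod2[OF assms(3) u'] this]
  show "br a b f (scal (gdual A) c u) = c * br a b f u" by (simp add: br_def mult_ac)
qed

text \<open>Linearity of an element given by a choice follows from separation of points: both sides
  have equal values under every homogeneous functional, because \<open>br\<close> is linear in each
  slot concerned.\<close>

lemma contr_trilin: "trilin A (gdual A) A (scal A) contr"
proof -
  note ad = gcar_closed[OF gs] gcar_closed[OF gsd] gcar_closed(3)[OF gsd, simplified]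
  note eq = gcar_eqI[OF gs]
  show ?thesis
    unfolding trilin_def lin_on_def
    by (intro conjI ballI allI eq; auto simp: contr_props ad gdualD(1) lin_on_add[OF gdualD(1)] lin_on_scal[OF gdualD(1)]
        lin_on_add[OF br_lin1] lin_on_scal[OF br_lin1] lin_on_add[OF br_lin2] lin_on_scal[OF br_lin2]
        lin_on_add[OF br_lin4] lin_on_scal[OF br_lin4, simplified])
qed

text \<open>
  \<open>opM b g a\<close> is \<open>m\<^sub>3(b, tg, a)\<close>, with the sign that the formula in \<open>corresponds\<close> prescribes;
  there \<open>|f| = d - |a| - |b| - |g|\<close>.
\<close>

definition opM :: "'v \<Rightarrow> ('v \<Rightarrow> 'k) \<Rightarrow> 'v \<Rightarrow> 'v" where
  "opM b g a = glift A (\<lambda>j b'. glift (gdual A) (\<lambda>q g'. glift A (\<lambda>i a'.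
     scal A (sg ((d - i - j - q) * q + j * (i + q + 1) + (d - i - j - q) * d)) (contr b' g' a')) a) g) b"

lemma contr_scal_trilin: "trilin A (gdual A) A (scal A) (\<lambda>b g a. scal A s (contr b g a))"
  using contr_trilin by (auto simp: trilin_def lin_on_def vs_sc[OF gs] mult.commute)

lemma opM_trilin: "trilin A (gdual A) A (scal A) opM"
  unfolding opM_def by (rule trilin_glift[OF gs gsd gs gs_vs[OF gs] contr_scal_trilin])

lemma opM_hom:
  assumes "b \<in> grade A j" "g \<in> grade (gdual A) q" "a \<in> grade A i"
  shows "opM b g a = scal A (sg ((d - i - j - q) * q + j * (i + q + 1) + (d - i - j - q) * d)) (contr b g a)"
  unfolding opM_def by (rule glift3_grade[OF gs gsd gs contr_scal_trilin assms])

lemma opM_grade: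
  assumes b: "b \<in> grade A j" and g: "g \<in> grade (gdual A) q" and a: "a \<in> grade A i"
  shows "opM b g a \<in> grade A (j + q + i - d)"
  unfolding opM_hom[OF assms]
proof (rule grade_closed(3)[OF gs], rule gcar_gradeI[OF gs])
  show "contr b g a \<in> gcar A"
    by (rule contr_props(1)[OF gcar_grade[OF a] gcar_grade[OF b] gcar_grade[OF g]])
  fix n and f :: "'v \<Rightarrow> 'k" assume f: "f \<in> grade (gdual A) n" and n: "n \<noteq> - (j + q + i - d)"
  have "br a b f g = 0" by (rule br_degree[OF a b f g]) (use n in linarith)
  then show "f (contr b g a) = 0"
    using contr_props(2)[OF gcar_grade[OF a] gcar_grade[OF b] gcar_grade[OF g] gdualD(1)[OF f]] by simp
qed

text \<open>The exponent has three sources: \<open>p * q\<close> relates the signed evaluation of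
  \<open>f \<otimes> g\<close> to \<open>br\<close>, \<open>j * (i + q + 1)\<close> is the sign in
  \<open>corresponds\<close>, and \<open>p * d\<close> comes from the form, whose value at
  \<open>(z, 0)\<close> and \<open>(0, f)\<close> is \<open>f (par A d z)\<close>.\<close>

lemma opM_eval:
  assumes b: "b \<in> grade A j" and g: "g \<in> grade (gdual A) q" and a: "a \<in> grade A i"
    and f: "f \<in> grade (gdual A) p" and deg: "i + j + p + q = d"
  shows "f (opM b g a) = sg (p * q + j * (i + q + 1) + p * d) * br a b f g"
proof -
  have "d - i - j - q = p" using deg by simp
  then show ?thesis
    unfolding opM_hom[OF b g a]
    using lin_on_scal[OF gdualD(1)[OF f] contr_props(1)] contr_props(2)[OF _ _ _ gdualD(1)[OF f]]
      gcar_grade[OF a] gcar_grade[OF b] gcar_grade[OF g] by simp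
qed

text \<open>
  \<open>opN f a g\<close> is \<open>m\<^sub>3(tf, a, tg)\<close>.  Its sign is the one in the cyclicity relation
  \<open>\<gamma>(m\<^sub>3(tf, a, tg), c) = \<plusminus>\<gamma>(m\<^sub>3(c, tf, a), tg)\<close>, from which \<open>|c|\<close> has been eliminated.
\<close>

definition opN :: "('v \<Rightarrow> 'k) \<Rightarrow> 'v \<Rightarrow> ('v \<Rightarrow> 'k) \<Rightarrow> 'v \<Rightarrow> 'k" where
  "opN f a g = glift (gdual A) (\<lambda>p f'. glift A (\<lambda>i a'. glift (gdual A) (\<lambda>q g'.
     (\<lambda>c. if c \<in> gcar A then sg (1 + q + (d + 1) * (p + i)) * g' (opM c f' a') else 0)) g) a) f"

lemma vs_fun: "vector_space (\<lambda>s (f :: 'u \<Rightarrow> 'k) c. s * f c)"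
  by unfold_locales (auto simp: algebra_simps)

text \<open>The scalar \<open>s\<close> stands for the sign, which varies with the degrees; the
  graded extension requires trilinearity for each of its values.\<close>

lemma opN_aux_trilin: "trilin (gdual A) A (gdual A) (\<lambda>s f c. s * f c)
    (\<lambda>f a g c. if c \<in> gcar A then s * g (opM c f a) else 0)"
proof -
  have M: "opM c f a \<in> gcar A" if "c \<in> gcar A" "f \<in> gcar (gdual A)" "a \<in> gcar A" for c f a
  proof -
    have "\<forall>n x. x \<in> grade A n \<longrightarrow> opM x f a \<in> gcar A"
    proof (intro allI impI)
      fix n x assume x: "x \<in> grade A n"
      show "opM x f a \<in> gcar A"
      proof (rule lin_on_gcar[OF gsd gs _ _ that(2)])
        show "lin_on (gdual A) (scal A) (\<lambda>f. opM x f a)"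
          using opM_trilin gcar_grade[OF x] that(3) by (auto simp: trilin_def)
        fix m f assume f: "f \<in> grade (gdual A) m"
        show "opM x f a \<in> gcar A"
        proof (rule lin_on_gcar[OF gs gs _ _ that(3)])
          show "lin_on A (scal A) (opM x f)"
            using opM_trilin gcar_grade[OF x] gcar_grade[OF f] by (auto simp: trilin_def)
        qed (rule gcar_grade[OF opM_grade[OF x f]])
      qed
    qed
    moreover have "lin_on A (scal A) (\<lambda>x. opM x f a)" using opM_trilin that by (auto simp: trilin_def)
    ultimately show ?thesis using lin_on_gcar[OF gs gs _ _ that(1)] by blast
  qed
  show ?thesis
    unfolding trilin_def
    using opM_trilin
    by (auto simp: lin_on_def trilin_def fun_eq_iff M gcar_gdualD(1)[OF gs] lin_on_add[OF gcar_gdualD(1)[OF gs]]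
        lin_on_scal[OF gcar_gdualD(1)[OF gs]] algebra_simps)
qed

lemma opN_trilin': "trilin (gdual A) A (gdual A) (\<lambda>s f c. s * f c) opN"
  unfolding opN_def by (rule trilin_glift[OF gsd gs gsd vs_fun opN_aux_trilin])

lemma opN_trilin: "trilin (gdual A) A (gdual A) (scal (gdual A)) opN"
  using opN_trilin' by (simp add: trilin_def lin_on_def)

lemma opN_hom:
  assumes "f \<in> grade (gdual A) p" "a \<in> grade A i" "g \<in> grade (gdual A) q"
  shows "opN f a g = (\<lambda>c. if c \<in> gcar A then sg (1 + q + (d + 1) * (p + i)) * g (opM c f a) else 0)"
  unfolding opN_def by (rule glift3_grade[OF gsd gs gsd opN_aux_trilin assms])

lemma opN_eval:
  assumes "f \<in> grade (gdual A) p" "a \<in> grade A i" "g \<in> grade (gdual A) q" "c \<in> gcar A"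
  shows "opN f a g c = sg (1 + q + (d + 1) * (p + i)) * g (opM c f a)"
  using opN_hom[OF assms(1-3)] assms(4) by simp

lemma opN_grade:
  assumes f: "f \<in> grade (gdual A) p" and a: "a \<in> grade A i" and g: "g \<in> grade (gdual A) q"
  shows "opN f a g \<in> grade (gdual A) (p + i + q - d)"
proof (rule gdualI)
  have l: "lin_on A (scal A) (\<lambda>c. opM c f a)"
    using opM_trilin gcar_grade[OF f] gcar_grade[OF a] by (auto simp: trilin_def)
  have m: "opM c f a \<in> gcar A" if "c \<in> gcar A" for c
    by (rule lin_on_gcar[OF gs gs l _ that]) (rule gcar_grade[OF opM_grade[OF _ f a]])
  have "lin_on A (*) (\<lambda>c. g (opM c f a))" by (rule lin_on_compose[OF l gdualD(1)[OF g] m])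
  from lin_on_ground(2)[OF this, of "sg (1 + q + (d + 1) * (p + i))"]
  show "lin_on A (*) (opN f a g)"
    unfolding opN_hom[OF assms] by (simp add: lin_on_def gcar_closed[OF gs])
  show "opN f a g v = 0" if "v \<in> grade A m" "m + (p + i + q - d) \<noteq> 0" for m v
    using gdualD(2)[OF g opM_grade[OF that(1) f a]] that(2)
    by (simp add: opN_hom[OF assms] algebra_simps)
qed (simp add: opN_hom[OF assms])

text \<open>Both sides are bracket values, of \<open>a\<close>, \<open>c\<close> on one side and of
  \<open>c\<close>, \<open>a\<close> on the other, so this is antisymmetry. It expresses the
  rotation of \<open>m\<^sub>3\<close> by two places, which the definition of \<open>opN\<close>
  does not provide.\<close>

lemma opM_swap:
  assumes c: "c \<in> grade A k" and f: "f \<in> grade (gdual A) p" and a: "a \<in> grade A i"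
    and g: "g \<in> grade (gdual A) q" and deg: "k + i + p + q = d"
  shows "g (opM c f a) = sg (1 + (i + d) * (k + d) + k * (i + p + 1) + i * (k + q + 1) + (p + q) * d + p * q) * f (opM a g c)"
proof -
  have 1: "g (opM c f a) = sg (q * p + k * (i + p + 1) + q * d) * br a c g f"
    by (rule opM_eval[OF c f a g]) (use deg in simp)
  have 2: "f (opM a g c) = sg (p * q + i * (k + q + 1) + p * d) * br c a f g"
    by (rule opM_eval[OF a g c f]) (use deg in simp)
  have 3: "br c a f g = - sg ((i - d) * (k - d) + p * q) * br a c g f"
    by (rule br_antisym[OF a c f g])
  have 4: "- x = sg 1 * x" for x :: 'k by simp
  \<comment> \<open>Once the signs are collected, an equality of exponents modulo 2 remains. It is
    polynomial in the degrees and hence decided by running through their parities; all later sign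
    comparisons end in this way.\<close>
  show ?thesis
    unfolding 1 2 3 mult_minus_left 4[of "_ * _"] sg_mult sg_mult_left mult.assoc
    by (rule arg_cong[of _ _ "\<lambda>s. s * br a c g f"], rule sg_cong) (cases "even d"; cases "even i"; cases "even k"; cases "even p"; cases "even q"; simp)
qed

text \<open>Since \<open>f (dif A z)\<close> is \<open>dfun f z\<close>, all four terms are bracket
  values, and the relation is compatibility with the differential. The condition on the degrees
  selects the only case in which the terms can be nonzero and allows \<open>p\<close> to be
  eliminated.\<close>

lemma opM_dif:
  assumes b: "b \<in> grade A j" and g: "g \<in> grade (gdual A) q" and a: "a \<in> grade A i"
    and f: "f \<in> grade (gdual A) p" and deg: "i + j + p + q + 1 = d"
  shows "sg 0 * f (dif A (opM b g a)) + sg 0 * f (opM (dif A b) g a)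
    + sg (j + d + q) * f (opM b (dfun g) a) + sg (j + d + q + 1) * f (opM b g (dif A a)) = 0"
proof -
  have "f (dif A (opM b g a)) = dfun f (opM b g a)"
    using gcar_grade[OF opM_grade[OF b g a]] by (simp add: dfun_def)
  also have "\<dots> = sg ((p + 1) * q + j * (i + q + 1) + (p + 1) * d) * br a b (dfun f) g"
    by (rule opM_eval[OF b g a dfun_grade[OF f]]) (use deg in simp)
  finally have 1: "f (dif A (opM b g a)) = sg ((p + 1) * q + j * (i + q + 1) + (p + 1) * d) * br a b (dfun f) g" .
  have 2: "f (opM (dif A b) g a) = sg (p * q + (j + 1) * (i + q + 1) + p * d) * br a (dif A b) f g"
    by (rule opM_eval[OF dif_grade[OF b] g a f]) (use deg in simp)
  have 3: "f (opM b (dfun g) a) = sg (p * (q + 1) + j * (i + (q + 1) + 1) + p * d) * br a b f (dfun g)"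
    by (rule opM_eval[OF b dfun_grade[OF g] a f]) (use deg in simp)
  have 4: "f (opM b g (dif A a)) = sg (p * q + j * ((i + 1) + q + 1) + p * d) * br (dif A a) b f g"
    by (rule opM_eval[OF b g dif_grade[OF a] f]) (use deg in simp)
  have ax: "sg 0 * br a b (dfun f) g + sg (1 + i - d) * br a (dif A b) f g
     + sg p * br a b f (dfun g) + sg 1 * br (dif A a) b f g = 0"
  proof -
    have "(sg (1 + i - d) :: 'k) = - sg (i - d)" by (simp add: sg_if)
    then show ?thesis using br_dif[OF a b f g] by (simp add: algebra_simps)
  qed
  have p: "p = d - i - j - q - 1" using deg by simp
  show ?thesis unfolding 1 2 3 4 sg_mult_left
    by (rule four_term_sg[OF ax]; unfold p; (cases "even d"; cases "even i"; cases "even j"; cases "even q"; simp))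
qed

text \<open>The axioms contain the Leibniz rule for the second argument; antisymmetry applied before
  and after carries it over to the first.\<close>

lemma br_leibniz_left:
  assumes a: "a \<in> grade A i" and b: "b \<in> grade A j" and c: "c \<in> grade A k"
    and f: "f \<in> grade (gdual A) p" and g: "g \<in> grade (gdual A) q"
  shows "br (mul A a b) c f g = sg (j * (k + d + q)) * br a c (rmulf f b) g + sg (i * p) * br b c f (lmulf a g)"
proof -
  have 1: "br (mul A a b) c f g = - sg ((k - d) * (i + j - d) + p * q) * br c (mul A a b) g f"
    by (rule br_antisym[OF c mul_grade[OF a b] f g])
  have 2: "br c (mul A a b) g f = br c a g (rmulf f b) + sg ((k - d) * i) * br c b (lmulf a g) f"
    by (rule br_leibniz[OF c a b gdualD(1)[OF g] gdualD(1)[OF f]])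
  have 3: "br c a g (rmulf f b) = - sg ((i - d) * (k - d) + q * (p + j)) * br a c (rmulf f b) g"
    by (rule br_antisym[OF a c g rmulf_grade[OF f b]])
  have 4: "br c b (lmulf a g) f = - sg ((j - d) * (k - d) + (q + i) * p) * br b c f (lmulf a g)"
    by (rule br_antisym[OF b c lmulf_grade[OF g a] f])
  have "br (mul A a b) c f g = sg (((k - d) * (i + j - d) + p * q) + ((i - d) * (k - d) + q * (p + j))) * br a c (rmulf f b) g
     + sg (((k - d) * (i + j - d) + p * q) + ((k - d) * i + ((j - d) * (k - d) + (q + i) * p))) * br b c f (lmulf a g)"
    unfolding 1 2 3 4 sg_mult[symmetric] by (simp add: distrib_left right_diff_distrib mult.assoc)
  moreover have "(sg (((k - d) * (i + j - d) + p * q) + ((i - d) * (k - d) + q * (p + j))) :: 'k) = sg (j * (k + d + q))"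
    by (rule sg_cong) (cases "even d"; cases "even i"; cases "even j"; cases "even k"; cases "even p"; cases "even q"; simp)
  moreover have "(sg (((k - d) * (i + j - d) + p * q) + ((k - d) * i + ((j - d) * (k - d) + (q + i) * p))) :: 'k) = sg (i * p)"
    by (rule sg_cong) (cases "even d"; cases "even i"; cases "even j"; cases "even k"; cases "even p"; cases "even q"; simp)
  ultimately show ?thesis by simp
qed

text \<open>The last argument of \<open>opM\<close> is the first argument of the bracket, so the
  derived Leibniz rule is the one needed. The sign built into \<open>opM\<close> makes all
  coefficients equal to 1.\<close>

lemma opM_mul_right:
  assumes b: "b \<in> grade A j" and g: "g \<in> grade (gdual A) q" and a: "a \<in> grade A i" and c: "c \<in> grade A k"
    and f: "f \<in> grade (gdual A) p" and deg: "i + j + k + p + q = d"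
  shows "f (opM b g (mul A a c)) = f (mul A (opM b g a) c) + f (opM b (lmulf a g) c)"
proof -
  have 1: "f (opM b g (mul A a c)) = sg (p * q + j * ((i + k) + q + 1) + p * d) * br (mul A a c) b f g"
    by (rule opM_eval[OF b g mul_grade[OF a c] f]) (use deg in simp)
  have "f (mul A (opM b g a) c) = rmulf f c (opM b g a)"
    using gcar_grade[OF opM_grade[OF b g a]] by (simp add: rmulf_def)
  also have "\<dots> = sg ((p + k) * q + j * (i + q + 1) + (p + k) * d) * br a b (rmulf f c) g"
    by (rule opM_eval[OF b g a rmulf_grade[OF f c]]) (use deg in simp)
  finally have 2: "f (mul A (opM b g a) c) = sg ((p + k) * q + j * (i + q + 1) + (p + k) * d) * br a b (rmulf f c) g" .
  have 3: "f (opM b (lmulf a g) c) = sg (p * (q + i) + j * (k + (q + i) + 1) + p * d) * br c b f (lmulf a g)"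
    by (rule opM_eval[OF b lmulf_grade[OF g a] c f]) (use deg in simp)
  have ax: "sg 0 * br (mul A a c) b f g + sg (1 + k * (j + d + q)) * br a b (rmulf f c) g + sg (1 + i * p) * br c b f (lmulf a g) = 0"
    using br_leibniz_left[OF a c b f g] by (simp add: sg_if)
  have p: "p = d - i - j - k - q" using deg by simp
  have "sg 0 * f (opM b g (mul A a c)) + sg 1 * f (mul A (opM b g a) c) + sg 1 * f (opM b (lmulf a g) c) = 0"
    unfolding 1 2 3 sg_mult_left
    by (rule three_term_sg[OF ax]; unfold p; (cases "even d"; cases "even i"; cases "even j"; cases "even k"; cases "even q"; simp))
  then show ?thesis by (simp add: algebra_simps)
qed

text \<open>Here the product is the second argument of the bracket, and the Leibniz rule of the
  axioms applies.\<close>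

lemma opM_mul_left:
  assumes b: "b \<in> grade A j" and c: "c \<in> grade A k" and g: "g \<in> grade (gdual A) q" and a: "a \<in> grade A i"
    and f: "f \<in> grade (gdual A) p" and deg: "i + j + k + p + q = d"
  shows "sg 0 * f (opM (mul A b c) g a) + sg (j + 1) * f (mul A b (opM c g a))
    + sg (d * k + 1) * f (opM b (rmulf g c) a) = 0"
proof -
  have 1: "f (opM (mul A b c) g a) = sg (p * q + (j + k) * (i + q + 1) + p * d) * br a (mul A b c) f g"
    by (rule opM_eval[OF mul_grade[OF b c] g a f]) (use deg in simp)
  have "f (mul A b (opM c g a)) = lmulf b f (opM c g a)"
    using gcar_grade[OF opM_grade[OF c g a]] by (simp add: lmulf_def)
  also have "\<dots> = sg ((p + j) * q + k * (i + q + 1) + (p + j) * d) * br a c (lmulf b f) g"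
    by (rule opM_eval[OF c g a lmulf_grade[OF f b]]) (use deg in simp)
  finally have 2: "f (mul A b (opM c g a)) = sg ((p + j) * q + k * (i + q + 1) + (p + j) * d) * br a c (lmulf b f) g" .
  have 3: "f (opM b (rmulf g c) a) = sg (p * (q + k) + j * (i + (q + k) + 1) + p * d) * br a b f (rmulf g c)"
    by (rule opM_eval[OF b rmulf_grade[OF g c] a f]) (use deg in simp)
  have ax: "sg 0 * br a (mul A b c) f g + sg (1 + (i - d) * j) * br a c (lmulf b f) g + sg 1 * br a b f (rmulf g c) = 0"
    using br_leibniz[OF a b c gdualD(1)[OF f] gdualD(1)[OF g]] by (simp add: sg_if)
  have p: "p = d - i - j - k - q" using deg by simp
  show ?thesis
    unfolding 1 2 3 sg_mult_left
    by (rule three_term_sg[OF ax]; unfold p; (cases "even d"; cases "even i"; cases "even j"; cases "even k"; cases "even q"; simp))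
qed

text \<open>Each nested term is a bracket evaluated on some \<open>brf\<close>: the first directly,
  the other two after antisymmetry, and in the middle one \<open>opN\<close> is itself a multiple of
  a \<open>brf\<close>. What results is the Jacobi identity for \<open>c\<close>, \<open>b\<close>,
  \<open>a\<close> evaluated on \<open>h\<close>, \<open>g\<close>, \<open>f\<close>.\<close>

lemma opM_jacobi:
  assumes a: "a \<in> grade A i" and f: "f \<in> grade (gdual A) p" and b: "b \<in> grade A j"
    and g: "g \<in> grade (gdual A) q" and c: "c \<in> grade A k" and h: "h \<in> grade (gdual A) r"
    and deg: "i + j + k + p + q + r = 2 * d"
  shows "sg 0 * h (opM (opM a f b) g c) + sg i * h (opM a (opN f b g) c)
    + sg (i + p + d + 1) * h (opM a f (opM b g c)) = 0"
proof -
  have r: "r = 2 * d - i - j - k - p - q" using deg by simp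
  have t1: "h (opM (opM a f b) g c) = sg (r * q + (i + p + j - d) * (k + q + 1) + r * d) * br c (opM a f b) h g"
    by (rule opM_eval[OF opM_grade[OF a f b] g c h]) (use deg in simp)
  have "br c (opM a f b) h g = brf c h g (opM a f b)"
    using gcar_grade[OF opM_grade[OF a f b]] by (simp add: brf_def)
  also have "\<dots> = sg ((k - d + r + q) * p + i * (j + p + 1) + (k - d + r + q) * d) * br b a (brf c h g) f"
    by (rule opM_eval[OF a f b brf_grade[OF c h g]]) (use deg in simp)
  finally have t1': "br c (opM a f b) h g = sg ((k - d + r + q) * p + i * (j + p + 1) + (k - d + r + q) * d) * br b a (brf c h g) f" .
  have t2: "h (opM a (opN f b g) c) = sg (r * (p + j + q - d) + i * (k + (p + j + q - d) + 1) + r * d) * br c a h (opN f b g)"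
    by (rule opM_eval[OF a opN_grade[OF f b g] c h]) (use deg in simp)
  have t2': "br c a h (opN f b g) = - sg ((i - d) * (k - d) + r * (p + j + q - d)) * br a c (opN f b g) h"
    by (rule br_antisym[OF a c h opN_grade[OF f b g]])
  \<comment> \<open>The functional \<open>opN f b g\<close> can be nonzero only in degree
    \<open>?y\<close>. The two parts of \<open>?s\<close> are the sign in the definition of
    \<open>opN\<close> and the one from evaluating \<open>opM\<close> there.\<close>
  let ?y = "d - p - j - q"
  let ?s = "1 + q + (d + 1) * (p + j) + (q * p + ?y * (j + p + 1) + q * d)"
  have N: "opN f b g x = sg ?s * brf b g f x" if x: "x \<in> grade A ?y" for x
  proof -
    have "opN f b g x = sg (1 + q + (d + 1) * (p + j)) * g (opM x f b)"
      by (rule opN_eval[OF f b g gcar_grade[OF x]])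
    also have "g (opM x f b) = sg (q * p + ?y * (j + p + 1) + q * d) * br b x g f"
      by (rule opM_eval[OF x f b g]) simp
    finally show ?thesis using gcar_grade[OF x] by (simp add: sg_mult_left brf_def)
  qed
  have "opN f b g = (\<lambda>x. sg ?s * brf b g f x)"
  proof (rule gdual_grade_eqI[OF gs opN_grade[OF f b g]])
    have "(\<lambda>x. sg ?s * brf b g f x) = scal (gdual A) (sg ?s) (brf b g f)" by simp
    also have "\<dots> \<in> grade (gdual A) (p + j + q - d)"
    proof -
      have "j - d + q + p = p + j + q - d" by simp
      with brf_grade[OF b g f] have "brf b g f \<in> grade (gdual A) (p + j + q - d)" by metis
      then show ?thesis by (rule grade_closed(3)[OF gsd])
    qed
    finally show "(\<lambda>x. sg ?s * brf b g f x) \<in> grade (gdual A) (p + j + q - d)" .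
  qed (use N in \<open>simp add: algebra_simps\<close>)
  moreover have "br a c (\<lambda>x. sg ?s * brf b g f x) h = sg ?s * br a c (brf b g f) h"
    using tens_eval_scal[OF dbr_tens[OF a c] multilin_prod2, of "brf b g f" h "sg ?s"]
      gdualD(1)[OF brf_grade[OF b g f]] gdualD(1)[OF h]
    by (simp add: br_def mult.assoc multilin2_iff lin_on_ground)
  ultimately have t2'': "br a c (opN f b g) h = sg ?s * br a c (brf b g f) h" by simp
  have t3: "h (opM a f (opM b g c)) = sg (r * p + i * ((j + q + k - d) + p + 1) + r * d) * br (opM b g c) a h f"
    by (rule opM_eval[OF a f opM_grade[OF b g c] h]) (use deg in simp)
  have t3': "br (opM b g c) a h f = - sg ((i - d) * ((j + q + k - d) - d) + r * p) * br a (opM b g c) f h"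
    by (rule br_antisym[OF a opM_grade[OF b g c] h f])
  have "br a (opM b g c) f h = brf a f h (opM b g c)"
    using gcar_grade[OF opM_grade[OF b g c]] by (simp add: brf_def)
  also have "\<dots> = sg ((i - d + p + r) * q + j * (k + q + 1) + (i - d + p + r) * d) * br c b (brf a f h) g"
    by (rule opM_eval[OF b g c brf_grade[OF a f h]]) (use deg in simp)
  finally have t3'': "br a (opM b g c) f h = sg ((i - d + p + r) * q + j * (k + q + 1) + (i - d + p + r) * d) * br c b (brf a f h) g" .
  have ax: "sg 0 * br b a (brf c h g) f
    + sg ((k - d) * (j + i) + r * (q + p)) * br a c (brf b g f) h
    + sg ((i - d) * (k + j) + p * (r + q)) * br c b (brf a f h) g = 0"
    using br_jacobi[OF c b a h g f] by simp
  have neg: "- sg e = (sg (1 + e) :: 'k)" for e by (simp add: sg_if)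
  show ?thesis
    unfolding t1 t1' t2 t2' t2'' t3 t3' t3'' neg sg_mult_left
    by (rule three_term_sg[OF ax]; unfold r; (cases "even d"; cases "even i"; cases "even j"; cases "even k"; cases "even p"; cases "even q"; simp))
qed

end

section \<open>A-infinity structures with vanishing operations from arity four on\<close>

lemma multihom_zero:
  assumes "graded_space W" "\<And>xs. m xs = 0"
  shows "multihom V W n e m"
  using assms by (simp add: multihom_def multilin_def vs_sc grade_closed)

text \<open>Since \<open>t\<close> is determined by \<open>r\<close> and \<open>s\<close>, and the
  inner arity is written as \<open>Suc s\<close>, the sum over a set of triples becomes an iterated
  sum that can be expanded for a concrete \<open>n\<close>.\<close>

lemma sum_rst:
  "(\<Sum>(r, s, t) \<in> {(r, s, t). r + s + t = n \<and> s \<ge> 1}. F r s t) = (\<Sum>s<n. \<Sum>r\<le>n - Suc s. F r (Suc s) (n - Suc s - r))"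
proof -
  have "(\<Sum>s<n. \<Sum>r\<le>n - Suc s. F r (Suc s) (n - Suc s - r))
      = (\<Sum>(s, r)\<in>Sigma {..<n} (\<lambda>s. {..n - Suc s}). F r (Suc s) (n - Suc s - r))"
    by (simp add: sum.Sigma)
  also have "\<dots> = (\<Sum>(r, s, t) \<in> {(r, s, t). r + s + t = n \<and> s \<ge> 1}. F r s t)"
    by (rule sum.reindex_bij_witness[of _ "\<lambda>(r, s, t). (s - 1, r)" "\<lambda>(s, r). (r, Suc s, n - Suc s - r)"]) auto
  finally show ?thesis by simp
qed

lemma sg_minus: "(sg (- i) :: 'k::field) = sg i"
  by (simp add: sg_if)

text \<open>Inner and outer arity add up to \<open>n + 1\<close>. For \<open>n \<ge> 6\<close> one
  of them is at least 4 and every term vanishes; for \<open>n = 4\<close> and \<open>n = 5\<close>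
  only compositions of binary and ternary operations remain. In arity 3 associativity and the
  relation for \<open>o3\<close> are separate assumptions, as the product is strictly
  associative.\<close>

lemma a_infinity_ternaryI:
  fixes E :: "('k::field, 'v::ab_group_add, 'z) ainf_scheme"
  assumes E: "graded_space E"
    and high: "\<And>n xs. n \<ge> 4 \<Longrightarrow> ops E n xs = 0"
    and h: "multihom E E 1 1 (ops E 1)" "multihom E E 2 0 (ops E 2)" "multihom E E 3 (-1) (ops E 3)"
    and o1: "\<And>x. ops E 1 [x] = o1 x" and o2: "\<And>x y. ops E 2 [x, y] = o2 x y"
    and o3: "\<And>x y z. ops E 3 [x, y, z] = o3 x y z"
    and R1: "\<And>i x. x \<in> grade E i \<Longrightarrow> o1 (o1 x) = 0"
    and R2: "\<And>i j x y. x \<in> grade E i \<Longrightarrow> y \<in> grade E j \<Longrightarrow> o1 (o2 x y) = o2 (o1 x) y + scal E (sg i) (o2 x (o1 y))"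
    and R3: "\<And>i j k x y z. x \<in> grade E i \<Longrightarrow> y \<in> grade E j \<Longrightarrow> z \<in> grade E k \<Longrightarrow> o2 (o2 x y) z = o2 x (o2 y z)"
    and R3': "\<And>i j k x y z. x \<in> grade E i \<Longrightarrow> y \<in> grade E j \<Longrightarrow> z \<in> grade E k \<Longrightarrow>
      o1 (o3 x y z) + o3 (o1 x) y z + scal E (sg i) (o3 x (o1 y) z) + scal E (sg (i + j)) (o3 x y (o1 z)) = 0"
    and R4: "\<And>i j k l x y z w. x \<in> grade E i \<Longrightarrow> y \<in> grade E j \<Longrightarrow> z \<in> grade E k \<Longrightarrow> w \<in> grade E l \<Longrightarrow>
      - o2 (o3 x y z) w - scal E (sg i) (o2 x (o3 y z w)) + o3 (o2 x y) z w - o3 x (o2 y z) w + o3 x y (o2 z w) = 0"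
    and R5: "\<And>i j k l m x y z w v. x \<in> grade E i \<Longrightarrow> y \<in> grade E j \<Longrightarrow> z \<in> grade E k \<Longrightarrow> w \<in> grade E l \<Longrightarrow> v \<in> grade E m \<Longrightarrow>
      o3 (o3 x y z) w v + scal E (sg i) (o3 x (o3 y z w) v) + scal E (sg (i + j)) (o3 x y (o3 z w v)) = 0"
  shows "a_infinity E"
proof -
  have mh: "multihom E E n (2 - int n) (ops E n)" if n: "n \<ge> 1" for n
  proof -
    consider "n = 1" | "n = 2" | "n = 3" | "n \<ge> 4" using n by linarith
    then show ?thesis using h by cases (auto intro: multihom_zero[OF E] high)
  qed
  \<comment> \<open>When the inner operation vanishes, the outer one receives a zero argument and
    vanishes by multilinearity.\<close>
  have zero: "ops E n xs = 0" if n: "n \<ge> 1" "length xs = n" "set xs \<subseteq> gcar E" "i < n" "xs ! i = 0" for n xs i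
  proof -
    have "lin_on E (scal E) (\<lambda>u. ops E n (xs[i := u]))"
      using mh[OF n(1)] n unfolding multihom_def multilin_iff by blast
    from lin_on_zero[OF E this] show ?thesis using n(5) by (metis list_update_id)
  qed
  let ?T = "\<lambda>ds xs r s t. scal E (sg (int (r + s * t)) * sg ((2 - int s) * sum_list (take r ds)))
             (ops E (r + 1 + t)
               (take r xs @ [ops E s (take s (drop r xs))] @ drop (r + s) xs))"
  have rel: "(\<Sum>(r, s, t) \<in> {(r, s, t). r + s + t = n \<and> s \<ge> 1}. ?T ds xs r s t) = 0"
    if n: "n \<ge> 1" and xs: "length xs = n" "homs E ds xs" for n ds xs
  proof -
    have car: "set xs \<subseteq> gcar E" by (rule homs_gcar[OF xs(2)])
    have vanish: "?T ds xs r s t = 0"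
      if "r + s + t = n" "s \<ge> 1" "r + 1 + t \<ge> 4 \<or> s \<ge> 4" for r s t
    proof (cases "r + 1 + t \<ge> 4")
      case True
      then show ?thesis using high vs_sc[OF E] by simp
    next
      case False
      then have "ops E s (take s (drop r xs)) = 0" using that high by blast
      moreover have "ops E (r + 1 + t) (take r xs @ [0] @ drop (r + s) xs) = 0"
        by (rule zero[where i=r])
          (use that xs car gcar_closed(1)[OF E] set_take_subset[of r xs] set_drop_subset[of "r + s" xs] in
            \<open>auto simp: nth_append min_def\<close>)
      ultimately show ?thesis using vs_sc[OF E] by simp
    qed
    have fin: "finite {(r, s, t). r + s + t = n \<and> s \<ge> 1}"
      by (rule finite_subset[of _ "{..n} \<times> {..n} \<times> {..n}"]) auto
    note sums = lessThan_Suc atMost_Suc numeral_eq_Suc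
    note ops' = o1[unfolded One_nat_def] o2[unfolded numeral_2_eq_2] o3[unfolded numeral_3_eq_3]
    consider "n = 1" | "n = 2" | "n = 3" | "n = 4" | "n = 5" | "n \<ge> 6" using n by linarith
    then show ?thesis
    proof cases
      case 1
      then obtain x i where x: "xs = [x]" "ds = [i]" "x \<in> grade E i"
        using xs by (auto simp: length_one_iff homs_Cons)
      show ?thesis unfolding sum_rst using x R1[OF x(3)] 1 by (simp add: ops' vs_sc[OF E])
    next
      case 2
      then obtain x y i j where x: "xs = [x, y]" "ds = [i, j]" "x \<in> grade E i" "y \<in> grade E j"
        using xs by (auto simp: length_two_iff homs_Cons)
      show ?thesis unfolding sum_rst using x R2[OF x(3,4)] 2
        by (simp add: sums ops' vs_sc[OF E])
    next
      case 3
      then obtain x y z i j k where x: "xs = [x, y, z]" "ds = [i, j, k]" "x \<in> grade E i" "y \<in> grade E j" "z \<in> grade E k"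
        using xs by (auto simp: length_three_iff homs_Cons)
      have "(\<Sum>(r, s, t) \<in> {(r, s, t). r + s + t = n \<and> s \<ge> 1}. ?T ds xs r s t) =
        (o2 (o2 x y) z - o2 x (o2 y z)) +
        (o1 (o3 x y z) + o3 (o1 x) y z + scal E (sg i) (o3 x (o1 y) z) + scal E (sg (i + j)) (o3 x y (o1 z)))"
        unfolding sum_rst using x 3 by (simp add: sums ops' vs_sc[OF E] algebra_simps)
      then show ?thesis using R3[OF x(3-5)] R3'[OF x(3-5)] by simp
    next
      case 4
      then obtain x y z w i j k l where x: "xs = [x, y, z, w]" "ds = [i, j, k, l]"
        "x \<in> grade E i" "y \<in> grade E j" "z \<in> grade E k" "w \<in> grade E l"
        using xs by (auto simp: length_Suc_conv homs_Cons numeral_eq_Suc)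
      have "(\<Sum>(r, s, t) \<in> {(r, s, t). r + s + t = n \<and> s \<ge> 1}. ?T ds xs r s t)
         = (\<Sum>(r, s, t) \<in> {(0, 3, 1), (1, 3, 0), (0, 2, 2), (1, 2, 1), (2, 2, 0)}. ?T ds xs r s t)"
      proof (rule sum.mono_neutral_right[OF fin])
        show "\<forall>p\<in>{(r, s, t). r + s + t = n \<and> s \<ge> 1} - {(0, 3, 1), (1, 3, 0), (0, 2, 2), (1, 2, 1), (2, 2, 0)}. (case p of (r, s, t) \<Rightarrow> ?T ds xs r s t) = 0"
        proof
          fix p assume p: "p \<in> {(r, s, t). r + s + t = n \<and> s \<ge> 1} - {(0, 3, 1), (1, 3, 0), (0, 2, 2), (1, 2, 1), (2, 2, 0)}"
          obtain r s t where rst': "p = (r, s, t)" by (cases p)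
          then have rst: "r + s + t = n" "s \<ge> 1" "(r, s, t) \<notin> {(0, 3, 1), (1, 3, 0), (0, 2, 2), (1, 2, 1), (2, 2, 0)}" using p by auto
          have "r + 1 + t \<ge> 4 \<or> s \<ge> 4"
          proof (rule ccontr)
            assume no: "\<not> (r + 1 + t \<ge> 4 \<or> s \<ge> 4)"
            have s: "s = 2 \<or> s = 3" and r: "r = 0 \<or> r = 1 \<or> r = 2" and t: "t = 4 - r - s" using no rst(1,2) 4 by linarith+
            show False using rst(1,3) s r 4 unfolding t by auto
          qed
          then show "(case p of (r, s, t) \<Rightarrow> ?T ds xs r s t) = 0"
            unfolding rst' prod.case by (rule vanish[OF rst(1,2)])
        qed
      qed (use 4 in auto)
      also have "\<dots> = - o2 (o3 x y z) w - scal E (sg i) (o2 x (o3 y z w)) + o3 (o2 x y) z w - o3 x (o2 y z) w + o3 x y (o2 z w)"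
        using x by (simp add: sums ops' vs_sc[OF E] sg_minus algebra_simps)
      finally show ?thesis using R4[OF x(3-6)] by simp
    next
      case 5
      then obtain x y z w v i j k l m where x: "xs = [x, y, z, w, v]" "ds = [i, j, k, l, m]"
        "x \<in> grade E i" "y \<in> grade E j" "z \<in> grade E k" "w \<in> grade E l" "v \<in> grade E m"
        using xs by (auto simp: length_Suc_conv homs_Cons numeral_eq_Suc)
      have "(\<Sum>(r, s, t) \<in> {(r, s, t). r + s + t = n \<and> s \<ge> 1}. ?T ds xs r s t)
         = (\<Sum>(r, s, t) \<in> {(0, 3, 2), (1, 3, 1), (2, 3, 0)}. ?T ds xs r s t)"
      proof (rule sum.mono_neutral_right[OF fin])
        show "\<forall>p\<in>{(r, s, t). r + s + t = n \<and> s \<ge> 1} - {(0, 3, 2), (1, 3, 1), (2, 3, 0)}. (case p of (r, s, t) \<Rightarrow> ?T ds xs r s t) = 0"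
        proof
          fix p assume p: "p \<in> {(r, s, t). r + s + t = n \<and> s \<ge> 1} - {(0, 3, 2), (1, 3, 1), (2, 3, 0)}"
          obtain r s t where rst': "p = (r, s, t)" by (cases p)
          then have rst: "r + s + t = n" "s \<ge> 1" "(r, s, t) \<notin> {(0, 3, 2), (1, 3, 1), (2, 3, 0)}" using p by auto
          have "r + 1 + t \<ge> 4 \<or> s \<ge> 4"
          proof (rule ccontr)
            assume no: "\<not> (r + 1 + t \<ge> 4 \<or> s \<ge> 4)"
            have s: "s = 3" and r: "r = 0 \<or> r = 1 \<or> r = 2" and t: "t = 5 - r - s" using no rst(1,2) 5 by linarith+
            show False using rst(1,3) s r 5 unfolding t by auto
          qed
          then show "(case p of (r, s, t) \<Rightarrow> ?T ds xs r s t) = 0"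
            unfolding rst' prod.case by (rule vanish[OF rst(1,2)])
        qed
      qed (use 5 in auto)
      also have "\<dots> = o3 (o3 x y z) w v + scal E (sg i) (o3 x (o3 y z w) v) + scal E (sg (i + j)) (o3 x y (o3 z w v))"
        using x by (simp add: sums ops' vs_sc[OF E] sg_minus sg_minus[of "i + j", simplified] algebra_simps)
      finally show ?thesis using R5[OF x(3-7)] by simp
    next
      case 6
      show ?thesis
      proof (rule sum.neutral, rule ballI)
        fix p assume p: "p \<in> {(r, s, t). r + s + t = n \<and> s \<ge> 1}"
        obtain r s t where rst': "p = (r, s, t)" by (cases p)
        then have rst: "r + s + t = n" "s \<ge> 1" using p by auto
        then have "r + 1 + t \<ge> 4 \<or> s \<ge> 4" using 6 by linarith
        then show "(case p of (r, s, t) \<Rightarrow> ?T ds xs r s t) = 0"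
          unfolding rst' prod.case by (rule vanish[OF rst])
      qed
    qed
  qed
  show ?thesis unfolding a_infinity_def using E mh rel by blast
qed

section \<open>The pre-Calabi-Yau structure of a double bracket\<close>

text \<open>The identity is a morphism, so the closed formulas for product, differential and form
  also cover the structure attached to \<open>A\<close> alone.\<close>

sublocale dpalg \<subseteq> I: dgmor A A id d
  by unfold_locales (simp add: dga_morphism_def glin_def)

lemma grade_cast: "x \<in> grade V m \<Longrightarrow> m = n \<Longrightarrow> x \<in> grade V n"
  by simp

context dpalg
begin

abbreviation E where "E \<equiv> bd_space d A A"

definition op1 :: "'v \<times> ('v \<Rightarrow> 'k) \<Rightarrow> 'v \<times> ('v \<Rightarrow> 'k)" where
  "op1 = dif (bd_dga d A A id)"

definition op2 :: "'v \<times> ('v \<Rightarrow> 'k) \<Rightarrow> 'v \<times> ('v \<Rightarrow> 'k) \<Rightarrow> 'v \<times> ('v \<Rightarrow> 'k)" where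
  "op2 = mul (bd_dga d A A id)"

text \<open>Reading off only the components of types \<open>(a, tf, b)\<close> and
  \<open>(tf, b, tg)\<close> makes the operation good by construction, without a case
  distinction.\<close>

definition op3 :: "'v \<times> ('v \<Rightarrow> 'k) \<Rightarrow> 'v \<times> ('v \<Rightarrow> 'k) \<Rightarrow> 'v \<times> ('v \<Rightarrow> 'k) \<Rightarrow> 'v \<times> ('v \<Rightarrow> 'k)" where
  "op3 x y z = (opM (fst x) (snd y) (fst z), opN (snd x) (fst y) (snd z))"

abbreviation mult where "mult x f \<equiv> (\<lambda>v. (x::'k) * (f :: 'v \<Rightarrow> 'k) v)"

lemma E_gs: "graded_space E"
  by (rule I.bd_gs)

text \<open>The second component of an element of degree \<open>n\<close> has degree
  \<open>n + d - 1\<close> in the dual and is determined on elements of degree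
  \<open>1 - n - d\<close>. Every relation thus reduces to scalar identities in the critical degree,
  where the evaluated relations for \<open>opM\<close> are available.\<close>

lemma E_zeroI:
  assumes "u \<in> grade E n"
    and "\<And>f. f \<in> grade (gdual A) (- n) \<Longrightarrow> f (fst u) = (0::'k)"
    and "\<And>c. c \<in> grade A (1 - n - d) \<Longrightarrow> snd u c = 0"
  shows "u = 0"
proof -
  obtain a f where u: "u = (a, f)" by (cases u)
  then have a: "a \<in> grade A n" and f: "f \<in> grade (gdual A) (n + d - 1)"
    using assms(1) by (simp_all add: I.bd_grade)
  have "a = 0"
  proof (rule grade_eqI[OF gs a grade_closed(1)[OF gs]])
    fix h assume h: "h \<in> grade (gdual A) (- n)"
    show "h a = h 0" using assms(2)[OF h] lin_on_zero[OF gs gdualD(1)[OF h]] u by simp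
  qed
  moreover have "f = 0"
    by (rule gdual_grade_eqI[OF gs f grade_closed(1)[OF gsd]])
      (use assms(3) u in \<open>auto simp: algebra_simps\<close>)
  ultimately show ?thesis using u by (simp add: zero_prod_def)
qed

lemma op1_gcar: "f \<in> gcar (gdual A) \<Longrightarrow> op1 (a, f) =
    (dif A a, \<lambda>c. if c \<in> gcar A then sg d * f (par A 1 (dif A c)) else 0)"
  unfolding op1_def by (rule I.bd_dif_closed)

lemma op2_gcar: "a \<in> gcar A \<Longrightarrow> g \<in> gcar (gdual A) \<Longrightarrow> op2 (a, f) (b, g) =
    (mul A a b, \<lambda>c. if c \<in> gcar A then f (mul A b c) + g (mul A c (par A d a)) else 0)"
  using I.bd_mul_closed[of a g f b] unfolding op2_def id_apply by blast

text \<open>The functional has degree \<open>i + d - 1\<close>, so on it the sign operator is a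
  scalar, and its product with \<open>sg d\<close> is \<open>sg (i + 1)\<close>.\<close>

lemma op1_hom:
  assumes f: "f \<in> grade (gdual A) (i + d - 1)"
  shows "op1 (a, f) = (dif A a, mult (sg (i + 1)) (dfun f))"
proof -
  have "sg d * f (par A 1 (dif A c)) = sg (i + 1) * f (dif A c)" if c: "c \<in> gcar A" for c
  proof -
    have "sg d * f (par A 1 (dif A c)) = (sg d * sg (1 * (i + d - 1))) * f (dif A c)"
      by (simp add: gdual_par[OF gs f dif_gcar[OF c]])
    also have "(sg d * sg (1 * (i + d - 1)) :: 'k) = sg (i + 1)"
      unfolding sg_mult by (rule sg_cong) simp
    finally show ?thesis .
  qed
  then show ?thesis by (auto simp: op1_gcar[OF gcar_grade[OF f]] dfun_def)
qed

lemma op2_hom: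
  assumes a: "a \<in> grade A i" and g: "g \<in> gcar (gdual A)"
  shows "op2 (a, f) (b, g) = (mul A a b, \<lambda>x. lmulf b f x + sg (d * i) * rmulf g a x)"
proof -
  have "g (mul A c (par A d a)) = sg (d * i) * g (mul A c a)" if c: "c \<in> gcar A" for c
    using lin_on_scal[OF mul_lin2[OF c] gcar_grade[OF a]]
      lin_on_scal[OF gcar_gdualD(1)[OF gs g] mul_gcar[OF c gcar_grade[OF a]]]
    by (simp add: par_grade[OF gs a])
  then show ?thesis by (auto simp: op2_gcar[OF gcar_grade[OF a] g] lmulf_def rmulf_def)
qed

lemma form_gcar: "a \<in> gcar A \<Longrightarrow> g \<in> gcar (gdual A) \<Longrightarrow> bd_form d A A id [(a, f), (b, g)] = f b + g (par A d a)"
  using I.bd_form_closed by simp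

lemma form_hom:
  assumes a: "a \<in> grade A i" and g: "g \<in> gcar (gdual A)"
  shows "bd_form d A A id [(a, f), (b, g)] = f b + sg (d * i) * g a"
  using form_gcar[OF gcar_grade[OF a] g] lin_on_scal[OF gcar_gdualD(1)[OF gs g] gcar_grade[OF a]]
  by (simp add: par_grade[OF gs a])

lemma gradeE:
  assumes "x \<in> grade E i"
  obtains a f where "x = (a, f)" "a \<in> grade A i" "f \<in> grade (gdual A) (i + d - 1)"
    "a \<in> gcar A" "f \<in> gcar (gdual A)" "lin_on A (*) f"
proof -
  obtain a f where x: "x = (a, f)" by (cases x)
  then have "a \<in> grade A i" "f \<in> grade (gdual A) (i + d - 1)" using assms by (simp_all add: I.bd_grade)
  from that[OF x this gcar_grade[OF this(1)] gcar_grade[OF this(2)] gdualD(1)[OF this(2)]] show ?thesis .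
qed

lemma mult_grade: "f \<in> grade (gdual A) p \<Longrightarrow> mult c f \<in> grade (gdual A) p"
  using grade_closed(3)[OF gsd, of f p c] by simp

lemma op1_grade:
  assumes "x \<in> grade E i"
  shows "op1 x \<in> grade E (i + 1)"
proof -
  from assms obtain a f where x: "x = (a, f)" "a \<in> grade A i" "f \<in> grade (gdual A) (i + d - 1)"
    by (rule gradeE)
  show ?thesis unfolding x(1) op1_hom[OF x(3)] I.bd_grade
    by (intro conjI dif_grade[OF x(2)] grade_cast[OF mult_grade[OF dfun_grade[OF x(3)]]]) simp
qed

lemma op2_grade:
  assumes "x \<in> grade E i" "y \<in> grade E j"
  shows "op2 x y \<in> grade E (i + j)"
proof -
  from assms(1) obtain a f where x: "x = (a, f)" "a \<in> grade A i" "f \<in> grade (gdual A) (i + d - 1)"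
    by (rule gradeE)
  from assms(2) obtain b g where y: "y = (b, g)" "b \<in> grade A j" "g \<in> grade (gdual A) (j + d - 1)" "g \<in> gcar (gdual A)"
    by (rule gradeE)
  have "lmulf b f + mult (sg (d * i)) (rmulf g a) \<in> grade (gdual A) (i + j + d - 1)"
    by (intro grade_closed(2)[OF gsd] grade_cast[OF lmulf_grade[OF x(3) y(2)]]
        grade_cast[OF mult_grade[OF rmulf_grade[OF y(3) x(2)]]]) simp_all
  then show ?thesis unfolding x(1) y(1) op2_hom[OF x(2) y(4)] I.bd_grade
    using mul_grade[OF x(2) y(2)] by (simp add: plus_fun_def)
qed

lemma op3_grade:
  assumes "x \<in> grade E i" "y \<in> grade E j" "z \<in> grade E k"
  shows "op3 x y z \<in> grade E (i + j + k - 1)"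
proof -
  from assms(1) obtain a f where x: "x = (a, f)" "a \<in> grade A i" "f \<in> grade (gdual A) (i + d - 1)" by (rule gradeE)
  from assms(2) obtain b g where y: "y = (b, g)" "b \<in> grade A j" "g \<in> grade (gdual A) (j + d - 1)" by (rule gradeE)
  from assms(3) obtain c h where z: "z = (c, h)" "c \<in> grade A k" "h \<in> grade (gdual A) (k + d - 1)" by (rule gradeE)
  show ?thesis using opM_grade[OF x(2) y(3) z(2)] opN_grade[OF x(3) y(2) z(3)]
    by (simp add: x y z op3_def I.bd_grade algebra_simps)
qed

lemma scal_E: "scal E c x = (scal A c (fst x), mult c (snd x))"
  by (cases x) (simp add: I.bd_scal)

lemma gcar_E: "x \<in> gcar E \<longleftrightarrow> fst x \<in> gcar A \<and> snd x \<in> gcar (gdual A)"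
  by (cases x) (simp add: I.bd_gcar)

lemma op1_lin: "lin_on E (scal E) op1"
proof (rule lin_onI)
  note ad = gcar_closed[OF gsd] gcar_closed(3)[OF gsd, simplified] lin_on_add[OF dif_lin] lin_on_scal[OF dif_lin]
  show "op1 (u + v) = op1 u + op1 v" if "u \<in> gcar E" "v \<in> gcar E" for u v
    using that by (cases u, cases v) (auto simp: gcar_E op1_gcar ad fun_eq_iff algebra_simps)
  show "op1 (scal E c v) = scal E c (op1 v)" if "v \<in> gcar E" for c v
    using that by (cases v) (auto simp: gcar_E scal_E op1_gcar ad fun_eq_iff algebra_simps)
qed

lemma op2_bilin: "bilin E E (scal E) op2"
  unfolding bilin_def
proof (intro conjI ballI lin_onI)
  note ad = gcar_closed[OF gs] gcar_closed[OF gsd] gcar_closed(3)[OF gsd, simplified] mul_gcar par_gcar[OF gs]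
    lin_on_add[OF mul_lin1] lin_on_scal[OF mul_lin1] lin_on_add[OF mul_lin2] lin_on_scal[OF mul_lin2]
    lin_on_add[OF par_lin[OF gs]] lin_on_scal[OF par_lin[OF gs]]
    lin_on_add[OF gcar_gdualD(1)[OF gs]] lin_on_scal[OF gcar_gdualD(1)[OF gs]]
  fix y assume y: "y \<in> gcar E"
  show "op2 (u + v) y = op2 u y + op2 v y" if "u \<in> gcar E" "v \<in> gcar E" for u v
    using that y by (cases u, cases v, cases y) (auto simp: gcar_E op2_gcar ad fun_eq_iff algebra_simps)
  show "op2 (scal E c v) y = scal E c (op2 v y)" if "v \<in> gcar E" for c v
    using that y by (cases v, cases y) (auto simp: gcar_E scal_E op2_gcar ad fun_eq_iff algebra_simps)
  show "op2 y (u + v) = op2 y u + op2 y v" if "u \<in> gcar E" "v \<in> gcar E" for u v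
    using that y by (cases u, cases v, cases y) (auto simp: gcar_E op2_gcar ad fun_eq_iff algebra_simps)
  show "op2 y (scal E c v) = scal E c (op2 y v)" if "v \<in> gcar E" for c v
    using that y by (cases v, cases y) (auto simp: gcar_E scal_E op2_gcar ad fun_eq_iff algebra_simps)
qed

lemma op3_trilin: "trilin E E E (scal E) op3"
  using opM_trilin opN_trilin
  unfolding trilin_def lin_on_def
  by (auto simp: op3_def gcar_E scal_E)

lemma op1_op1:
  assumes "x \<in> grade E i"
  shows "op1 (op1 x) = 0"
proof -
  from assms obtain a f where x: "x = (a, f)" "a \<in> grade A i" "f \<in> grade (gdual A) (i + d - 1)"
    "a \<in> gcar A" "f \<in> gcar (gdual A)" "lin_on A (*) f" by (rule gradeE)
  have 1: "mult (sg (i + 1)) (dfun f) \<in> grade (gdual A) ((i + 1) + d - 1)"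
    by (rule grade_cast[OF mult_grade[OF dfun_grade[OF x(3)]]]) simp
  show ?thesis
    unfolding x(1) op1_hom[OF x(3)] op1_hom[OF 1]
    by (auto simp: dif_dif[OF x(4)] dfun_def dif_gcar dif_dif lin_on_zero[OF gs x(6)] zero_prod_def fun_eq_iff)
qed

text \<open>In the second component, evaluated at \<open>c\<close>, the terms with \<open>f\<close>
  are compared by the Leibniz rule for \<open>mul A b c\<close> and those with \<open>g\<close> by
  the one for \<open>mul A c a\<close>.\<close>

lemma op2_leibniz:
  assumes "x \<in> grade E i" "y \<in> grade E j"
  shows "op1 (op2 x y) = op2 (op1 x) y + scal E (sg i) (op2 x (op1 y))"
proof -
  from assms(1) obtain a f where x: "x = (a, f)" "a \<in> grade A i" "f \<in> grade (gdual A) (i + d - 1)"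
    "a \<in> gcar A" "f \<in> gcar (gdual A)" "lin_on A (*) f" by (rule gradeE)
  from assms(2) obtain b g where y: "y = (b, g)" "b \<in> grade A j" "g \<in> grade (gdual A) (j + d - 1)"
    "b \<in> gcar A" "g \<in> gcar (gdual A)" "lin_on A (*) g" by (rule gradeE)
  note gE = grade_closed[OF E_gs]
  let ?u = "op1 (op2 x y) - (op2 (op1 x) y + scal E (sg i) (op2 x (op1 y)))"
  have "op2 (op1 x) y \<in> grade E (i + j + 1)" "op2 x (op1 y) \<in> grade E (i + j + 1)"
    using op2_grade[OF op1_grade[OF assms(1)] assms(2)] op2_grade[OF assms(1) op1_grade[OF assms(2)]]
    by (simp_all add: algebra_simps)
  then have u: "?u \<in> grade E (i + j + 1)"
    using op1_grade[OF op2_grade[OF assms]] by (intro gE) auto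
  have xy: "op2 x y = (mul A a b, \<lambda>v. lmulf b f v + sg (d * i) * rmulf g a v)"
    unfolding x(1) y(1) by (rule op2_hom[OF x(2) y(5)])
  have "(\<lambda>v. lmulf b f v + sg (d * i) * rmulf g a v) \<in> grade (gdual A) ((i + j) + d - 1)"
    using op2_grade[OF assms] unfolding xy I.bd_grade by simp
  note L = op1_hom[OF this, of "mul A a b", folded xy]
  have x1: "op1 x = (dif A a, mult (sg (i + 1)) (dfun f))" unfolding x(1) by (rule op1_hom[OF x(3)])
  have y1: "op1 y = (dif A b, mult (sg (j + 1)) (dfun g))" unfolding y(1) by (rule op1_hom[OF y(3)])
  have "mult (sg (j + 1)) (dfun g) \<in> gcar (gdual A)"
    using op1_grade[OF assms(2)] gcar_grade unfolding y1 I.bd_grade by blast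
  note R2 = op2_hom[OF x(2) this, of f "dif A b", folded x(1) y1]
  note R1 = op2_hom[OF dif_grade[OF x(2)] y(5), of "mult (sg (i + 1)) (dfun f)" b, folded x1 y(1)]
  have "?u = 0"
  proof (rule E_zeroI[OF u])
    show "h (fst ?u) = 0" if "h \<in> grade (gdual A) (- (i + j + 1))" for h :: "'v \<Rightarrow> 'k"
      unfolding L R1 R2 using dif_mul[OF x(2) y(4)] lin_on_zero[OF gs gdualD(1)[OF that]]
      by (simp add: scal_E)
    fix c assume c: "c \<in> grade A (1 - (i + j + 1) - d)"
    note c' = gcar_grade[OF c]
    \<comment> \<open>The degree of \<open>c\<close>, fixed by the total degree; its parity enters
      the Leibniz rule for \<open>mul A c a\<close>.\<close>
    define m where "m = 1 - (i + j + 1) - d"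
    have fbc: "f (dif A (mul A b c)) = f (mul A (dif A b) c) + sg j * f (mul A b (dif A c))"
      using dif_mul[OF y(2) c'] by (simp add: lin_on_add[OF x(6)] lin_on_scal[OF x(6)] mul_gcar gcar_closed[OF gs] dif_gcar c' y(4))
    have gca: "g (dif A (mul A c a)) = g (mul A (dif A c) a) + sg m * g (mul A c (dif A a))"
      using dif_mul[OF c x(4)] by (simp add: m_def lin_on_add[OF y(6)] lin_on_scal[OF y(6)] mul_gcar gcar_closed[OF gs] dif_gcar c' x(4))
    have "snd ?u c = sg (i + j + 1) * (f (mul A b (dif A c)) + sg (d * i) * g (mul A (dif A c) a))
       - (sg (i + 1) * f (dif A (mul A b c)) + sg (d * (i + 1)) * g (mul A c (dif A a))
       + sg i * (f (mul A (dif A b) c) + sg (d * i) * (sg (j + 1) * g (dif A (mul A c a)))))"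
      unfolding L R1 R2
      by (simp add: scal_E dfun_def lmulf_def rmulf_def c' dif_gcar mul_gcar x(4) y(4))
    also have "\<dots> = 0"
      unfolding fbc gca m_def by (cases "even d"; cases "even i"; cases "even j"; simp add: algebra_simps)
    finally show "snd ?u c = 0" .
  qed
  then show ?thesis by simp
qed

lemma op2_assoc:
  assumes "x \<in> grade E i" "y \<in> grade E j" "z \<in> grade E k"
  shows "op2 (op2 x y) z = op2 x (op2 y z)"
proof -
  from assms(1) obtain a f where x: "x = (a, f)" "a \<in> grade A i" "f \<in> grade (gdual A) (i + d - 1)"
    "a \<in> gcar A" "f \<in> gcar (gdual A)" "lin_on A (*) f" by (rule gradeE)
  from assms(2) obtain b g where y: "y = (b, g)" "b \<in> grade A j" "g \<in> grade (gdual A) (j + d - 1)"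
    "b \<in> gcar A" "g \<in> gcar (gdual A)" "lin_on A (*) g" by (rule gradeE)
  from assms(3) obtain c h where z: "z = (c, h)" "c \<in> grade A k" "h \<in> grade (gdual A) (k + d - 1)"
    "c \<in> gcar A" "h \<in> gcar (gdual A)" "lin_on A (*) h" by (rule gradeE)
  have xy: "op2 x y = (mul A a b, \<lambda>v. lmulf b f v + sg (d * i) * rmulf g a v)"
    unfolding x(1) y(1) by (rule op2_hom[OF x(2) y(5)])
  have yz: "op2 y z = (mul A b c, \<lambda>v. lmulf c g v + sg (d * j) * rmulf h b v)"
    unfolding y(1) z(1) by (rule op2_hom[OF y(2) z(5)])
  have "(\<lambda>v. lmulf c g v + sg (d * j) * rmulf h b v) \<in> gcar (gdual A)"
    using op2_grade[OF assms(2,3)] gcar_grade unfolding yz I.bd_grade by blast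
  note R = op2_hom[OF x(2) this, of f "mul A b c", folded x(1) yz]
  note L = op2_hom[OF mul_grade[OF x(2) y(2)] z(5), of "\<lambda>v. lmulf b f v + sg (d * i) * rmulf g a v" c, folded xy z(1)]
  show ?thesis unfolding L R
    using x(4) y(4) z(4)
    by (auto simp: mul_assoc fun_eq_iff lmulf_def rmulf_def mul_gcar distrib_left sg_mult_left)
qed

end

section \<open>The A-infinity relations containing the ternary operation\<close>

context dpalg
begin

lemma opM_scal_mid:
  assumes "b \<in> gcar A" "g \<in> gcar (gdual A)" "a \<in> gcar A"
  shows "opM b (mult s g) a = scal A s (opM b g a)"
  using opM_trilin assms by (auto simp: trilin_def lin_on_def)

lemma opN_scal:
  assumes "f \<in> gcar (gdual A)" "g \<in> gcar (gdual A)" "a \<in> gcar A"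
  shows "opN (mult s f) a g = mult s (opN f a g)" "opN f a (mult s g) = mult s (opN f a g)"
  using opN_trilin assms by (auto simp: trilin_def lin_on_def)

lemma opM_add_mid:
  assumes "b \<in> gcar A" "g \<in> gcar (gdual A)" "h \<in> gcar (gdual A)" "a \<in> gcar A"
  shows "opM b (g + h) a = opM b g a + opM b h a"
  using opM_trilin assms by (auto simp: trilin_def lin_on_def)

lemma opN_add:
  assumes "f \<in> gcar (gdual A)" "g \<in> gcar (gdual A)" "h \<in> gcar (gdual A)" "a \<in> gcar A"
  shows "opN (f + h) a g = opN f a g + opN h a g" "opN f a (g + h) = opN f a g + opN f a h"
  using opN_trilin assms by (auto simp: trilin_def lin_on_def)

text \<open>The first component is \<open>opM_dif\<close> tested by a functional. The second,
  evaluated at \<open>v\<close>, is \<open>opM_dif\<close> for the rotated arguments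
  \<open>v\<close>, \<open>f\<close>, \<open>b\<close> tested by \<open>h\<close>: the differential
  of the value turns into \<open>dif A v\<close>, and \<open>dfun h\<close> into the differential of
  \<open>opM v f b\<close>.\<close>

lemma op3_dif:
  assumes "x \<in> grade E i" "y \<in> grade E j" "z \<in> grade E k"
  shows "op1 (op3 x y z) + op3 (op1 x) y z + scal E (sg i) (op3 x (op1 y) z) + scal E (sg (i + j)) (op3 x y (op1 z)) = 0"
proof (rule E_zeroI)
  from assms(1) obtain a f where x: "x = (a, f)" "a \<in> grade A i" "f \<in> grade (gdual A) (i + d - 1)"
    "a \<in> gcar A" "f \<in> gcar (gdual A)" "lin_on A (*) f" by (rule gradeE)
  from assms(2) obtain b g where y: "y = (b, g)" "b \<in> grade A j" "g \<in> grade (gdual A) (j + d - 1)"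
    "b \<in> gcar A" "g \<in> gcar (gdual A)" "lin_on A (*) g" by (rule gradeE)
  from assms(3) obtain c h where z: "z = (c, h)" "c \<in> grade A k" "h \<in> grade (gdual A) (k + d - 1)"
    "c \<in> gcar A" "h \<in> gcar (gdual A)" "lin_on A (*) h" by (rule gradeE)
  note x1 = op1_hom[OF x(3), of a, folded x(1)] and y1 = op1_hom[OF y(3), of b, folded y(1)]
    and z1 = op1_hom[OF z(3), of c, folded z(1)]
  have xyz: "op3 x y z = (opM a g c, opN f b h)" by (simp add: op3_def x y z)
  have "opN f b h \<in> grade (gdual A) ((i + j + k - 1) + d - 1)"
    using op3_grade[OF assms] unfolding xyz I.bd_grade by simp
  note w1 = op1_hom[OF this, of "opM a g c", folded xyz]
  note df = dfun_grade[OF x(3)] and dg = dfun_grade[OF y(3)] and dh = dfun_grade[OF z(3)]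
  let ?u = "op1 (op3 x y z) + op3 (op1 x) y z + scal E (sg i) (op3 x (op1 y) z) + scal E (sg (i + j)) (op3 x y (op1 z))"
  show "?u \<in> grade E (i + j + k)"
    using op1_grade[OF op3_grade[OF assms]] op3_grade[OF op1_grade[OF assms(1)] assms(2,3)]
      op3_grade[OF assms(1) op1_grade[OF assms(2)] assms(3)] op3_grade[OF assms(1,2) op1_grade[OF assms(3)]]
    by (intro grade_closed[OF E_gs]) (auto elim: grade_cast)
  show "p (fst ?u) = 0" if p: "p \<in> grade (gdual A) (- (i + j + k))" for p :: "'v \<Rightarrow> 'k"
  proof -
    note p' = gdualD(1)[OF p]
    have g1: "dif A (opM a g c) \<in> gcar A" "opM (dif A a) g c \<in> gcar A" "opM a (dfun g) c \<in> gcar A" "opM a g (dif A c) \<in> gcar A"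
      using dif_gcar opM_grade[OF x(2) y(3) z(2)] opM_grade[OF dif_grade[OF x(2)] y(3) z(2)]
        opM_grade[OF x(2) dg z(2)] opM_grade[OF x(2) y(3) dif_grade[OF z(2)]] gcar_grade by blast+
    have "fst ?u = dif A (opM a g c) + opM (dif A a) g c + scal A (sg i) (scal A (sg (j + 1)) (opM a (dfun g) c))
        + scal A (sg (i + j)) (opM a g (dif A c))"
      unfolding w1 x1 y1 z1
      by (simp add: op3_def scal_E x(1) y(1) z(1) opM_scal_mid[OF x(4) gcar_grade[OF dg] z(4)])
    then have "p (fst ?u) = p (dif A (opM a g c)) + p (opM (dif A a) g c) + sg i * (sg (j + 1) * p (opM a (dfun g) c))
        + sg (i + j) * p (opM a g (dif A c))"
      by (simp add: lin_on_add[OF p'] lin_on_scal[OF p'] g1 gcar_closed[OF gs])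
    also have "\<dots> = sg 0 * p (dif A (opM a g c)) + sg 0 * p (opM (dif A a) g c)
        + sg (i + (j + 1)) * p (opM a (dfun g) c) + sg (i + j) * p (opM a g (dif A c))"
      by (simp add: sg_mult_left)
    also have "\<dots> = 0"
      by (rule four_term_sg[OF opM_dif[OF x(2) y(3) z(2) p]]) simp_all
    finally show ?thesis .
  qed
  show "snd ?u v = 0" if v: "v \<in> grade A (1 - (i + j + k) - d)" for v
  proof -
    note v' = gcar_grade[OF v]
    have e1: "dfun (opN f b h) v = sg (1 + (k + d - 1) + (d + 1) * ((i + d - 1) + j)) * h (opM (dif A v) f b)"
      using v' by (simp add: dfun_def opN_eval[OF x(3) y(2) z(3) dif_gcar])
    have e2: "opN (dfun f) b h v = sg (1 + (k + d - 1) + (d + 1) * ((i + d - 1 + 1) + j)) * h (opM v (dfun f) b)"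
      by (rule opN_eval[OF df y(2) z(3) v'])
    have e3: "opN f (dif A b) h v = sg (1 + (k + d - 1) + (d + 1) * ((i + d - 1) + (j + 1))) * h (opM v f (dif A b))"
      by (rule opN_eval[OF x(3) dif_grade[OF y(2)] z(3) v'])
    have e4: "opN f b (dfun h) v = sg (1 + (k + d - 1 + 1) + (d + 1) * ((i + d - 1) + j)) * h (dif A (opM v f b))"
      using opN_eval[OF x(3) y(2) dh v'] gcar_grade[OF opM_grade[OF v x(3) y(2)]] by (simp add: dfun_def)
    have "snd ?u v = sg (i + j + k - 1 + 1) * dfun (opN f b h) v + sg (i + 1) * opN (dfun f) b h v
        + sg i * opN f (dif A b) h v + sg (i + j) * (sg (k + 1) * opN f b (dfun h) v)"
      unfolding w1 x1 y1 z1
      by (simp add: op3_def scal_E x(1) y(1) z(1) opN_scal[OF gcar_grade[OF df] z(5) y(4)] opN_scal[OF x(5) gcar_grade[OF dh] y(4)])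
    also have "\<dots> = sg (i + j + (k + 1) + (1 + (k + d - 1 + 1) + (d + 1) * ((i + d - 1) + j))) * h (dif A (opM v f b))
        + sg (i + j + k - 1 + 1 + (1 + (k + d - 1) + (d + 1) * ((i + d - 1) + j))) * h (opM (dif A v) f b)
        + sg (i + 1 + (1 + (k + d - 1) + (d + 1) * ((i + d - 1 + 1) + j))) * h (opM v (dfun f) b)
        + sg (i + (1 + (k + d - 1) + (d + 1) * ((i + d - 1) + (j + 1)))) * h (opM v f (dif A b))"
      unfolding e1 e2 e3 e4 sg_mult_left by (simp add: add_ac)
    also have "\<dots> = 0"
      by (rule four_term_sg[OF opM_dif[OF v x(3) y(2) z(3)]]; (cases "even d"; cases "even i"; cases "even j"; cases "even k"; simp))
    finally show ?thesis .
  qed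
qed

text \<open>At \<open>v\<close> the second component has nine terms. They fall into three groups
  according to the functionals involved, which are \<open>f1\<close> and \<open>f3\<close>, or
  \<open>f2\<close> and \<open>f4\<close>, or \<open>f1\<close> and \<open>f4\<close>. The first two
  groups are instances of \<open>opM_mul_left\<close>, the last is one of
  \<open>opM_mul_right\<close>.\<close>

lemma op3_mul:
  assumes "x \<in> grade E i" "y \<in> grade E j" "z \<in> grade E k" "w \<in> grade E l"
  shows "- op2 (op3 x y z) w - scal E (sg i) (op2 x (op3 y z w)) + op3 (op2 x y) z w - op3 x (op2 y z) w + op3 x y (op2 z w) = 0"
proof (rule E_zeroI)
  from assms(1) obtain a1 f1 where x: "x = (a1, f1)" "a1 \<in> grade A i" "f1 \<in> grade (gdual A) (i + d - 1)"
    "a1 \<in> gcar A" "f1 \<in> gcar (gdual A)" "lin_on A (*) f1" by (rule gradeE)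
  from assms(2) obtain a2 f2 where y: "y = (a2, f2)" "a2 \<in> grade A j" "f2 \<in> grade (gdual A) (j + d - 1)"
    "a2 \<in> gcar A" "f2 \<in> gcar (gdual A)" "lin_on A (*) f2" by (rule gradeE)
  from assms(3) obtain a3 f3 where z: "z = (a3, f3)" "a3 \<in> grade A k" "f3 \<in> grade (gdual A) (k + d - 1)"
    "a3 \<in> gcar A" "f3 \<in> gcar (gdual A)" "lin_on A (*) f3" by (rule gradeE)
  from assms(4) obtain a4 f4 where w: "w = (a4, f4)" "a4 \<in> grade A l" "f4 \<in> grade (gdual A) (l + d - 1)"
    "a4 \<in> gcar A" "f4 \<in> gcar (gdual A)" "lin_on A (*) f4" by (rule gradeE)
  note M123 = opM_grade[OF x(2) y(3) z(2)] and M234 = opM_grade[OF y(2) z(3) w(2)]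
  note N234 = opN_grade[OF y(3) z(2) w(3)]
  have xyz: "op3 x y z = (opM a1 f2 a3, opN f1 a2 f3)" by (simp add: op3_def x y z)
  have yzw: "op3 y z w = (opM a2 f3 a4, opN f2 a3 f4)" by (simp add: op3_def y z w)
  have xy: "op2 x y = (mul A a1 a2, lmulf a2 f1 + mult (sg (d * i)) (rmulf f2 a1))"
    unfolding x(1) y(1) using op2_hom[OF x(2) y(5)] by (simp add: plus_fun_def)
  have yz: "op2 y z = (mul A a2 a3, lmulf a3 f2 + mult (sg (d * j)) (rmulf f3 a2))"
    unfolding y(1) z(1) using op2_hom[OF y(2) z(5)] by (simp add: plus_fun_def)
  have zw: "op2 z w = (mul A a3 a4, lmulf a4 f3 + mult (sg (d * k)) (rmulf f4 a3))"
    unfolding z(1) w(1) using op2_hom[OF z(2) w(5)] by (simp add: plus_fun_def)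
  have A': "op2 (op3 x y z) w = (mul A (opM a1 f2 a3) a4, lmulf a4 (opN f1 a2 f3)
      + mult (sg (d * (i + (j + d - 1) + k - d))) (rmulf f4 (opM a1 f2 a3)))"
    unfolding xyz w(1) using op2_hom[OF M123 w(5)] by (simp add: plus_fun_def)
  have B': "op2 x (op3 y z w) = (mul A a1 (opM a2 f3 a4), lmulf (opM a2 f3 a4) f1
      + mult (sg (d * i)) (rmulf (opN f2 a3 f4) a1))"
    unfolding yzw x(1) using op2_hom[OF x(2) gcar_grade[OF N234]] by (simp add: plus_fun_def)
  note lr = lmulf_grade[OF x(3) y(2)] rmulf_grade[OF y(3) x(2)] lmulf_grade[OF y(3) z(2)] rmulf_grade[OF z(3) y(2)]
    lmulf_grade[OF z(3) w(2)] rmulf_grade[OF w(3) z(2)]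
  note lr' = lr[THEN gcar_grade] lr(2,4,6)[THEN mult_grade, THEN gcar_grade]
  have C': "op3 (op2 x y) z w = (opM (mul A a1 a2) f3 a4, opN (lmulf a2 f1) a3 f4 + mult (sg (d * i)) (opN (rmulf f2 a1) a3 f4))"
    unfolding xy by (simp add: op3_def z(1) w(1) opN_add opN_scal lr' z w)
  have D': "op3 x (op2 y z) w = (opM a1 (lmulf a3 f2) a4 + scal A (sg (d * j)) (opM a1 (rmulf f3 a2) a4), opN f1 (mul A a2 a3) f4)"
    unfolding yz by (simp add: op3_def x(1) w(1) opM_add_mid opM_scal_mid lr' x w)
  have E': "op3 x y (op2 z w) = (opM a1 f2 (mul A a3 a4), opN f1 a2 (lmulf a4 f3) + mult (sg (d * k)) (opN f1 a2 (rmulf f4 a3)))"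
    unfolding zw by (simp add: op3_def x(1) y(1) opN_add opN_scal lr' x y)
  let ?u = "- op2 (op3 x y z) w - scal E (sg i) (op2 x (op3 y z w)) + op3 (op2 x y) z w - op3 x (op2 y z) w + op3 x y (op2 z w)"
  show "?u \<in> grade E (i + j + k + l - 1)"
    using op2_grade[OF op3_grade[OF assms(1-3)] assms(4)] op2_grade[OF assms(1) op3_grade[OF assms(2-4)]]
      op3_grade[OF op2_grade[OF assms(1,2)] assms(3,4)] op3_grade[OF assms(1) op2_grade[OF assms(2,3)] assms(4)]
      op3_grade[OF assms(1,2) op2_grade[OF assms(3,4)]]
    by (intro grade_closed[OF E_gs]) (auto elim: grade_cast)
  show "p (fst ?u) = 0" if p: "p \<in> grade (gdual A) (- (i + j + k + l - 1))" for p :: "'v \<Rightarrow> 'k"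
  proof -
    note p' = gdualD(1)[OF p]
    have g1: "mul A (opM a1 f2 a3) a4 \<in> gcar A" "mul A a1 (opM a2 f3 a4) \<in> gcar A" "opM (mul A a1 a2) f3 a4 \<in> gcar A"
        "opM a1 (lmulf a3 f2) a4 \<in> gcar A" "opM a1 (rmulf f3 a2) a4 \<in> gcar A" "opM a1 f2 (mul A a3 a4) \<in> gcar A"
      using mul_gcar[OF gcar_grade[OF M123] w(4)] mul_gcar[OF x(4) gcar_grade[OF M234]]
        opM_grade[OF mul_grade[OF x(2) y(2)] z(3) w(2)] opM_grade[OF x(2) lr(3) w(2)]
        opM_grade[OF x(2) lr(4) w(2)] opM_grade[OF x(2) y(3) mul_grade[OF z(2) w(2)]]
        gcar_grade by blast+
    have "p (fst ?u) = - p (mul A (opM a1 f2 a3) a4) - sg i * p (mul A a1 (opM a2 f3 a4)) + p (opM (mul A a1 a2) f3 a4)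
        - (p (opM a1 (lmulf a3 f2) a4) + sg (d * j) * p (opM a1 (rmulf f3 a2) a4)) + p (opM a1 f2 (mul A a3 a4))"
    proof -
      have pm: "p (- t) = - p t" if "t \<in> gcar A" for t
        using lin_on_scal[OF p' that, of "-1"] by (simp add: vs_sc[OF gs])
      have pd: "p (s - t) = p s - p t" if "s \<in> gcar A" "t \<in> gcar A" for s t
        using lin_on_add[OF p' that(1) gcar_minus(1)[OF gs that(2)]] pm[OF that(2)] by simp
      show ?thesis
        unfolding A' B' C' D' E'
        by (simp add: scal_E pm pd lin_on_add[OF p'] lin_on_scal[OF p'] g1 gcar_closed[OF gs] gcar_minus[OF gs])
    qed
    moreover have "p (opM a1 f2 (mul A a3 a4)) = p (mul A (opM a1 f2 a3) a4) + p (opM a1 (lmulf a3 f2) a4)"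
      by (rule opM_mul_right[OF x(2) y(3) z(2) w(2) p]) simp
    moreover have "sg 0 * p (opM (mul A a1 a2) f3 a4) + sg (i + 1) * p (mul A a1 (opM a2 f3 a4))
        + sg (d * j + 1) * p (opM a1 (rmulf f3 a2) a4) = 0"
      by (rule opM_mul_left[OF x(2) y(2) z(3) w(2) p]) simp
    moreover have "(sg (i + 1) :: 'k) = - sg i" "(sg (d * j + 1) :: 'k) = - sg (d * j)" by (simp_all add: sg_if)
    ultimately show ?thesis by (simp add: algebra_simps)
  qed
  show "snd ?u v = 0" if v: "v \<in> grade A (1 - (i + j + k + l - 1) - d)" for v
  proof -
    note v' = gcar_grade[OF v]
    let ?s = "\<lambda>p i q :: int. 1 + q + (d + 1) * (p + i)"
    have n1: "lmulf a4 (opN f1 a2 f3) v = sg (?s (i + d - 1) j (k + d - 1)) * f3 (opM (mul A a4 v) f1 a2)"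
      using v' opN_eval[OF x(3) y(2) z(3) mul_gcar[OF w(4) v']] by (simp add: lmulf_def)
    \<comment> \<open>Here \<open>f3\<close> sits inside the operation, whereas the other terms of
      its group are tested by \<open>f3\<close>; antisymmetry in the form of \<open>opM_swap\<close>
      brings it outside.\<close>
    have "lmulf (opM a2 f3 a4) f1 v = rmulf f1 v (opM a2 f3 a4)"
      using v' gcar_grade[OF M234] by (simp add: lmulf_def rmulf_def)
    also have "\<dots> = sg (1 + (l + d) * (j + d) + j * (l + (k + d - 1) + 1) + l * (j + (i + d - 1 + (1 - (i + j + k + l - 1) - d)) + 1)
        + ((k + d - 1) + (i + d - 1 + (1 - (i + j + k + l - 1) - d))) * d
        + (k + d - 1) * (i + d - 1 + (1 - (i + j + k + l - 1) - d))) * f3 (opM a4 (rmulf f1 v) a2)"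
      by (rule opM_swap[OF y(2) z(3) w(2) rmulf_grade[OF x(3) v]]) simp
    finally have n2: "lmulf (opM a2 f3 a4) f1 v = sg (1 + (l + d) * (j + d) + j * (l + (k + d - 1) + 1)
        + l * (j + (i + d - 1 + (1 - (i + j + k + l - 1) - d)) + 1)
        + ((k + d - 1) + (i + d - 1 + (1 - (i + j + k + l - 1) - d))) * d
        + (k + d - 1) * (i + d - 1 + (1 - (i + j + k + l - 1) - d))) * f3 (opM a4 (rmulf f1 v) a2)" .
    have n3: "opN f1 a2 (lmulf a4 f3) v = sg (?s (i + d - 1) j (k + d - 1 + l)) * f3 (mul A a4 (opM v f1 a2))"
      using opN_eval[OF x(3) y(2) lr(5) v'] gcar_grade[OF opM_grade[OF v x(3) y(2)]] by (simp add: lmulf_def)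
    have m1: "rmulf f4 (opM a1 f2 a3) v = f4 (mul A v (opM a1 f2 a3))"
      using v' by (simp add: rmulf_def)
    have m2: "rmulf (opN f2 a3 f4) a1 v = sg (?s (j + d - 1) k (l + d - 1)) * f4 (opM (mul A v a1) f2 a3)"
      using v' opN_eval[OF y(3) z(2) w(3) mul_gcar[OF v' x(4)]] by (simp add: rmulf_def)
    have m3: "opN (rmulf f2 a1) a3 f4 v = sg (?s (j + d - 1 + i) k (l + d - 1)) * f4 (opM v (rmulf f2 a1) a3)"
      by (rule opN_eval[OF lr(2) z(2) w(3) v'])
    have k1: "opN (lmulf a2 f1) a3 f4 v = sg (?s (i + d - 1 + j) k (l + d - 1)) * f4 (opM v (lmulf a2 f1) a3)"
      by (rule opN_eval[OF lr(1) z(2) w(3) v'])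
    have k2: "opN f1 (mul A a2 a3) f4 v = sg (?s (i + d - 1) (j + k) (l + d - 1)) * f4 (opM v f1 (mul A a2 a3))"
      by (rule opN_eval[OF x(3) mul_grade[OF y(2) z(2)] w(3) v'])
    have k3: "opN f1 a2 (rmulf f4 a3) v = sg (?s (i + d - 1) j (l + d - 1 + k)) * f4 (mul A (opM v f1 a2) a3)"
      using opN_eval[OF x(3) y(2) lr(6) v'] gcar_grade[OF opM_grade[OF v x(3) y(2)]] by (simp add: rmulf_def)
    have r1: "sg 1 * lmulf a4 (opN f1 a2 f3) v + sg (i + 1) * lmulf (opM a2 f3 a4) f1 v + sg 0 * opN f1 a2 (lmulf a4 f3) v = 0"
    proof -
      have ax: "sg 0 * f3 (opM (mul A a4 v) f1 a2) + sg (l + 1) * f3 (mul A a4 (opM v f1 a2))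
          + sg (d * (1 - (i + j + k + l - 1) - d) + 1) * f3 (opM a4 (rmulf f1 v) a2) = 0"
        by (rule opM_mul_left[OF w(2) v x(3) y(2) z(3)]) simp
      have ax': "sg 0 * f3 (opM (mul A a4 v) f1 a2) + sg (d * (1 - (i + j + k + l - 1) - d) + 1) * f3 (opM a4 (rmulf f1 v) a2)
          + sg (l + 1) * f3 (mul A a4 (opM v f1 a2)) = 0"
        using ax by (simp only: add_ac)
      show ?thesis unfolding n1 n2 n3 sg_mult_left
        by (rule three_term_sg[OF ax']; (cases "even d"; cases "even i"; cases "even j"; cases "even k"; cases "even l"; simp))
    qed
    have r2: "sg (1 + d * (i + (j + d - 1) + k - d)) * rmulf f4 (opM a1 f2 a3) v + sg (1 + i + d * i) * rmulf (opN f2 a3 f4) a1 v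
       + sg (d * i) * opN (rmulf f2 a1) a3 f4 v = 0"
    proof -
      have ax: "sg 0 * f4 (opM (mul A v a1) f2 a3) + sg (1 - (i + j + k + l - 1) - d + 1) * f4 (mul A v (opM a1 f2 a3))
          + sg (d * i + 1) * f4 (opM v (rmulf f2 a1) a3) = 0"
        by (rule opM_mul_left[OF v x(2) y(3) z(2) w(3)]) simp
      have ax': "sg (1 - (i + j + k + l - 1) - d + 1) * f4 (mul A v (opM a1 f2 a3)) + sg 0 * f4 (opM (mul A v a1) f2 a3)
          + sg (d * i + 1) * f4 (opM v (rmulf f2 a1) a3) = 0"
        using ax by (simp only: add_ac)
      show ?thesis unfolding m1 m2 m3 sg_mult_left
        by (rule three_term_sg[OF ax']; (cases "even d"; cases "even i"; cases "even j"; cases "even k"; cases "even l"; simp))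
    qed
    have r3: "sg 0 * opN (lmulf a2 f1) a3 f4 v + sg 1 * opN f1 (mul A a2 a3) f4 v + sg (d * k) * opN f1 a2 (rmulf f4 a3) v = 0"
    proof -
      have "f4 (opM v f1 (mul A a2 a3)) = f4 (mul A (opM v f1 a2) a3) + f4 (opM v (lmulf a2 f1) a3)"
        by (rule opM_mul_right[OF v x(3) y(2) z(2) w(3)]) simp
      then have ax: "sg 0 * f4 (opM v (lmulf a2 f1) a3) + sg 1 * f4 (opM v f1 (mul A a2 a3)) + sg 0 * f4 (mul A (opM v f1 a2) a3) = 0"
        by simp
      show ?thesis unfolding k1 k2 k3 sg_mult_left
        by (rule three_term_sg[OF ax]; (cases "even d"; cases "even i"; cases "even j"; cases "even k"; cases "even l"; simp))
    qed
    have "snd ?u v = (sg 1 * lmulf a4 (opN f1 a2 f3) v + sg (i + 1) * lmulf (opM a2 f3 a4) f1 v + sg 0 * opN f1 a2 (lmulf a4 f3) v)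
       + (sg (1 + d * (i + (j + d - 1) + k - d)) * rmulf f4 (opM a1 f2 a3) v + sg (1 + i + d * i) * rmulf (opN f2 a3 f4) a1 v
       + sg (d * i) * opN (rmulf f2 a1) a3 f4 v)
       + (sg 0 * opN (lmulf a2 f1) a3 f4 v + sg 1 * opN f1 (mul A a2 a3) f4 v + sg (d * k) * opN f1 a2 (rmulf f4 a3) v)"
    proof -
      have "(sg (i + 1) :: 'k) = - sg i" "(sg (1 + d * (i + (j + d - 1) + k - d)) :: 'k) = - sg (d * (i + (j + d - 1) + k - d))"
        "(sg (1 + i + d * i) :: 'k) = - (sg i * sg (d * i))"
        unfolding sg_mult by (auto simp: sg_if)
      note sgs = this
      show ?thesis
        unfolding A' B' C' D' E' sgs by (simp add: scal_E) (simp add: distrib_left mult.assoc)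
    qed
    then show ?thesis unfolding r1 r2 r3 by simp
  qed
qed

text \<open>Both components are \<open>opM_jacobi\<close>: the first tested by a functional, the
  second evaluated at \<open>v\<close> and rotated to \<open>v\<close>, \<open>f1\<close>,
  \<open>a2\<close>, \<open>f3\<close>, \<open>a4\<close> tested by \<open>f5\<close>. The rotation
  permutes the three nesting patterns cyclically.\<close>

lemma op3_op3:
  assumes "x \<in> grade E i" "y \<in> grade E j" "z \<in> grade E k" "w \<in> grade E l" "t \<in> grade E m"
  shows "op3 (op3 x y z) w t + scal E (sg i) (op3 x (op3 y z w) t) + scal E (sg (i + j)) (op3 x y (op3 z w t)) = 0"
proof (rule E_zeroI)
  from assms(1) obtain a1 f1 where x: "x = (a1, f1)" "a1 \<in> grade A i" "f1 \<in> grade (gdual A) (i + d - 1)" by (rule gradeE)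
  from assms(2) obtain a2 f2 where y: "y = (a2, f2)" "a2 \<in> grade A j" "f2 \<in> grade (gdual A) (j + d - 1)" by (rule gradeE)
  from assms(3) obtain a3 f3 where z: "z = (a3, f3)" "a3 \<in> grade A k" "f3 \<in> grade (gdual A) (k + d - 1)" by (rule gradeE)
  from assms(4) obtain a4 f4 where w: "w = (a4, f4)" "a4 \<in> grade A l" "f4 \<in> grade (gdual A) (l + d - 1)" by (rule gradeE)
  from assms(5) obtain a5 f5 where t: "t = (a5, f5)" "a5 \<in> grade A m" "f5 \<in> grade (gdual A) (m + d - 1)" by (rule gradeE)
  let ?u = "op3 (op3 x y z) w t + scal E (sg i) (op3 x (op3 y z w) t) + scal E (sg (i + j)) (op3 x y (op3 z w t))"
  show "?u \<in> grade E (i + j + k + l + m - 2)"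
    using op3_grade[OF op3_grade[OF assms(1-3)] assms(4,5)] op3_grade[OF assms(1) op3_grade[OF assms(2-4)] assms(5)]
      op3_grade[OF assms(1,2) op3_grade[OF assms(3-5)]]
    by (intro grade_closed[OF E_gs]) (auto elim: grade_cast)
  have u: "?u = (opM (opM a1 f2 a3) f4 a5 + scal A (sg i) (opM a1 (opN f2 a3 f4) a5) + scal A (sg (i + j)) (opM a1 f2 (opM a3 f4 a5)),
      opN (opN f1 a2 f3) a4 f5 + mult (sg i) (opN f1 (opM a2 f3 a4) f5) + mult (sg (i + j)) (opN f1 a2 (opN f3 a4 f5)))"
    by (simp add: op3_def x y z w t scal_E)
  note M123 = opM_grade[OF x(2) y(3) z(2)] and M234 = opM_grade[OF y(2) z(3) w(2)] and M345 = opM_grade[OF z(2) w(3) t(2)]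
  note N123 = opN_grade[OF x(3) y(2) z(3)] and N234 = opN_grade[OF y(3) z(2) w(3)] and N345 = opN_grade[OF z(3) w(2) t(3)]
  show "p (fst ?u) = 0" if p: "p \<in> grade (gdual A) (- (i + j + k + l + m - 2))" for p :: "'v \<Rightarrow> 'k"
  proof -
    note p' = gdualD(1)[OF p]
    have g1: "opM (opM a1 f2 a3) f4 a5 \<in> gcar A" "opM a1 (opN f2 a3 f4) a5 \<in> gcar A" "opM a1 f2 (opM a3 f4 a5) \<in> gcar A"
      using opM_grade[OF M123 w(3) t(2)] opM_grade[OF x(2) N234 t(2)] opM_grade[OF x(2) y(3) M345] gcar_grade by blast+
    have "p (fst ?u) = sg 0 * p (opM (opM a1 f2 a3) f4 a5) + sg i * p (opM a1 (opN f2 a3 f4) a5) + sg (i + j) * p (opM a1 f2 (opM a3 f4 a5))"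
      unfolding u by (simp add: lin_on_add[OF p'] lin_on_scal[OF p'] g1 gcar_closed[OF gs])
    also have "\<dots> = 0"
      by (rule three_term_sg[OF opM_jacobi[OF x(2) y(3) z(2) w(3) t(2) p]]) simp_all
    finally show ?thesis .
  qed
  show "snd ?u v = 0" if v: "v \<in> grade A (1 - (i + j + k + l + m - 2) - d)" for v
  proof -
    note v' = gcar_grade[OF v]
    let ?s = "\<lambda>p i q :: int. 1 + q + (d + 1) * (p + i)"
    have e1: "opN (opN f1 a2 f3) a4 f5 v = sg (?s (i + d - 1 + j + (k + d - 1) - d) l (m + d - 1)) * f5 (opM v (opN f1 a2 f3) a4)"
      by (rule opN_eval[OF N123 w(2) t(3) v'])
    have e2: "opN f1 (opM a2 f3 a4) f5 v = sg (?s (i + d - 1) (j + (k + d - 1) + l - d) (m + d - 1)) * f5 (opM v f1 (opM a2 f3 a4))"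
      by (rule opN_eval[OF x(3) M234 t(3) v'])
    have e3: "opN f1 a2 (opN f3 a4 f5) v = sg (?s (i + d - 1) j (k + d - 1 + l + (m + d - 1) - d)) * opN f3 a4 f5 (opM v f1 a2)"
      by (rule opN_eval[OF x(3) y(2) N345 v'])
    have e4: "opN f3 a4 f5 (opM v f1 a2) = sg (?s (k + d - 1) l (m + d - 1)) * f5 (opM (opM v f1 a2) f3 a4)"
      by (rule opN_eval[OF z(3) w(2) t(3) gcar_grade[OF opM_grade[OF v x(3) y(2)]]])
    have ax: "sg 0 * f5 (opM (opM v f1 a2) f3 a4) + sg (1 - (i + j + k + l + m - 2) - d) * f5 (opM v (opN f1 a2 f3) a4)
        + sg (1 - (i + j + k + l + m - 2) - d + (i + d - 1) + d + 1) * f5 (opM v f1 (opM a2 f3 a4)) = 0"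
      by (rule opM_jacobi[OF v x(3) y(2) z(3) w(2) t(3)]) simp
    have "snd ?u v = sg (i + j + (?s (i + d - 1) j (k + d - 1 + l + (m + d - 1) - d) + ?s (k + d - 1) l (m + d - 1))) * f5 (opM (opM v f1 a2) f3 a4)
      + sg (?s (i + d - 1 + j + (k + d - 1) - d) l (m + d - 1)) * f5 (opM v (opN f1 a2 f3) a4)
      + sg (i + ?s (i + d - 1) (j + (k + d - 1) + l - d) (m + d - 1)) * f5 (opM v f1 (opM a2 f3 a4))"
      unfolding u snd_conv plus_fun_def e1 e2 e3 e4 sg_mult_left by (simp only: add_ac)
    also have "\<dots> = 0"
      by (rule three_term_sg[OF ax]; (cases "even d"; cases "even i"; cases "even j"; cases "even k"; cases "even l"; cases "even m"; simp))
    finally show ?thesis .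
  qed
qed

end

lemma lin_on_cong: "scal V = scal W \<Longrightarrow> grade V = grade W \<Longrightarrow> lin_on V = lin_on W"
  using gcar_cong[of V W] by (simp add: lin_on_def fun_eq_iff)

lemma homs_cong: "grade V = grade W \<Longrightarrow> homs V = homs W"
  by (simp add: homs_def fun_eq_iff)

section \<open>The cyclic A-infinity algebra of a bracket and its correspondence with the
  bracket\<close>

context dpalg
begin

definition ops_br :: "nat \<Rightarrow> ('v \<times> ('v \<Rightarrow> 'k)) list \<Rightarrow> 'v \<times> ('v \<Rightarrow> 'k)" where
  "ops_br n xs = (if n = 1 then op1 (xs ! 0) else if n = 2 then op2 (xs ! 0) (xs ! 1)
     else if n = 3 then op3 (xs ! 0) (xs ! 1) (xs ! 2) else 0)"

abbreviation BE where "BE \<equiv> bd_ainf d A ops_br"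

lemma BE_simps [simp]:
  "scal BE = scal E" "grade BE = grade E" "ops BE = ops_br" "form BE = bd_form d A A id"
  by (simp_all add: bd_ainf_def)

lemma BE_cong: "gcar BE = gcar E" "lin_on BE = lin_on E" "homs BE = homs E" "graded_space BE"
  using E_gs by (auto intro!: gcar_cong lin_on_cong homs_cong simp: graded_space_cong[of BE E])

lemma BE_multihom: "multihom BE BE 1 1 (ops BE 1)" "multihom BE BE 2 0 (ops BE 2)" "multihom BE BE 3 (-1) (ops BE 3)"
proof -
  show "multihom BE BE 1 1 (ops BE 1)"
    unfolding multihom_def multilin1_iff[OF BE_cong(4)]
    using op1_lin by (auto simp: ops_br_def BE_cong length_one_iff homs_Cons op1_grade)
  show "multihom BE BE 2 0 (ops BE 2)"
    unfolding multihom_def multilin2_iff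
    using op2_bilin by (auto simp: ops_br_def BE_cong bilin_def op2_grade numeral_2_eq_2 elim!: homs2E[unfolded numeral_2_eq_2])
  show "multihom BE BE 3 (-1) (ops BE 3)"
    unfolding multihom_def multilin3_iff
  proof (intro conjI ballI allI impI)
    fix ds xs assume "length xs = 3 \<and> homs BE ds xs"
    then obtain i j k x y z where *: "ds = [i, j, k]" "xs = [x, y, z]" "x \<in> grade E i" "y \<in> grade E j" "z \<in> grade E k"
      by (auto simp: BE_cong elim!: homs3E)
    show "ops BE 3 xs \<in> grade BE (sum_list ds + - 1)"
      using grade_cast[OF op3_grade[OF *(3-5)], of "i + (j + k) - 1"] by (simp add: * ops_br_def)
  qed (use op3_trilin in \<open>auto simp: ops_br_def BE_cong trilin_def\<close>)
qed

lemma BE_a_infinity: "a_infinity BE"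
proof (rule a_infinity_ternaryI[OF BE_cong(4) _ BE_multihom])
  show "ops BE n xs = 0" if "n \<ge> 4" for n xs using that by (auto simp: ops_br_def)
  show "ops BE 1 [x] = op1 x" "ops BE 2 [x, y] = op2 x y" "ops BE 3 [x, y, z] = op3 x y z" for x y z
    by (simp_all add: ops_br_def)
qed (simp_all add: op1_op1 op2_leibniz op2_assoc op3_dif op3_mul op3_op3)

lemma form_bilin: "bilin E E (*) (\<lambda>x y. bd_form d A A id [x, y])"
  unfolding bilin_def
proof (intro conjI ballI lin_onI)
  note ad = gcar_closed[OF gs] gcar_closed[OF gsd] gcar_closed(3)[OF gsd, simplified] par_gcar[OF gs]
    lin_on_add[OF par_lin[OF gs]] lin_on_scal[OF par_lin[OF gs]]
    lin_on_add[OF gcar_gdualD(1)[OF gs]] lin_on_scal[OF gcar_gdualD(1)[OF gs]]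
  fix y assume y: "y \<in> gcar E"
  show "bd_form d A A id [u + v, y] = bd_form d A A id [u, y] + bd_form d A A id [v, y]" if "u \<in> gcar E" "v \<in> gcar E" for u v
    using that y by (cases u, cases v, cases y) (auto simp: gcar_E form_gcar ad algebra_simps)
  show "bd_form d A A id [scal E c v, y] = c * bd_form d A A id [v, y]" if "v \<in> gcar E" for c v
    using that y by (cases v, cases y) (auto simp: gcar_E scal_E form_gcar ad algebra_simps)
  show "bd_form d A A id [y, u + v] = bd_form d A A id [y, u] + bd_form d A A id [y, v]" if "u \<in> gcar E" "v \<in> gcar E" for u v
    using that y by (cases u, cases v, cases y) (auto simp: gcar_E form_gcar ad algebra_simps)
  show "bd_form d A A id [y, scal E c v] = c * bd_form d A A id [y, v]" if "v \<in> gcar E" for c v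
    using that y by (cases v, cases y) (auto simp: gcar_E scal_E form_gcar ad algebra_simps)
qed

lemma form_zero: "x \<in> gcar E \<Longrightarrow> bd_form d A A id [0, x] = 0"
  using lin_on_zero[OF E_gs, of "(*)" "\<lambda>y. bd_form d A A id [y, x]"] form_bilin by (simp add: bilin_def)

lemma form_degree:
  assumes "x \<in> grade E i" "y \<in> grade E j"
  shows "bd_form d A A id [x, y] \<in> grade ground (i + j + (d - 1))"
proof (cases "i + j + d - 1 = 0")
  case True
  then show ?thesis by (simp add: grade_ground)
next
  case False
  from assms(1) obtain a f where x: "x = (a, f)" "a \<in> grade A i" "f \<in> grade (gdual A) (i + d - 1)" by (rule gradeE)
  from assms(2) obtain b g where y: "y = (b, g)" "b \<in> grade A j" "g \<in> grade (gdual A) (j + d - 1)" by (rule gradeE)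
  have "f b = 0" "g a = 0"
    using gdualD(2)[OF x(3) y(2)] gdualD(2)[OF y(3) x(2)] False by (auto simp: algebra_simps)
  then show ?thesis using False
    unfolding x(1) y(1) form_hom[OF x(2) gcar_grade[OF y(3)]] by (simp add: grade_ground)
qed

lemma form_sym:
  assumes "x \<in> grade E i" "y \<in> grade E j"
  shows "sg (i * j) * bd_form d A A id [y, x] = bd_form d A A id [x, y]"
proof -
  from assms(1) obtain a f where x: "x = (a, f)" "a \<in> grade A i" "f \<in> grade (gdual A) (i + d - 1)" by (rule gradeE)
  from assms(2) obtain b g where y: "y = (b, g)" "b \<in> grade A j" "g \<in> grade (gdual A) (j + d - 1)" by (rule gradeE)
  show ?thesis
  proof (cases "i + j + d - 1 = 0")
    case True
    then have j: "j = 1 - i - d" by simp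
    show ?thesis
      unfolding x(1) y(1) form_hom[OF x(2) gcar_grade[OF y(3)]] form_hom[OF y(2) gcar_grade[OF x(3)]] j
      by (cases "even d"; cases "even i"; simp add: algebra_simps)
  next
    case False
    then have "f b = 0" "g a = 0"
      using gdualD(2)[OF x(3) y(2)] gdualD(2)[OF y(3) x(2)] by (auto simp: algebra_simps)
    then show ?thesis
      unfolding x(1) y(1) form_hom[OF x(2) gcar_grade[OF y(3)]] form_hom[OF y(2) gcar_grade[OF x(3)]] by simp
  qed
qed

lemma form_op1:
  assumes "x \<in> grade E i" "y \<in> grade E j"
  shows "bd_form d A A id [op1 x, y] = sg (1 + j * i) * bd_form d A A id [op1 y, x]"
proof -
  from assms(1) obtain a f where x: "x = (a, f)" "a \<in> grade A i" "f \<in> grade (gdual A) (i + d - 1)" by (rule gradeE)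
  from assms(2) obtain b g where y: "y = (b, g)" "b \<in> grade A j" "g \<in> grade (gdual A) (j + d - 1)" by (rule gradeE)
  note x' = gcar_grade[OF x(2)] and y' = gcar_grade[OF y(2)]
  have L: "bd_form d A A id [op1 x, y] = sg (i + 1) * f (dif A b) + sg (d * (i + 1)) * g (dif A a)"
    unfolding x(1) y(1) op1_hom[OF x(3)] form_hom[OF dif_grade[OF x(2)] gcar_grade[OF y(3)]]
    by (simp add: dfun_def y')
  have R: "bd_form d A A id [op1 y, x] = sg (j + 1) * g (dif A a) + sg (d * (j + 1)) * f (dif A b)"
    unfolding x(1) y(1) op1_hom[OF y(3)] form_hom[OF dif_grade[OF y(2)] gcar_grade[OF x(3)]]
    by (simp add: dfun_def x')
  show ?thesis
  proof (cases "i + j + d = 0")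
    case True
    then have j: "j = - i - d" by simp
    show ?thesis unfolding L R j by (cases "even d"; cases "even i"; simp add: algebra_simps)
  next
    case False
    then have "f (dif A b) = 0" "g (dif A a) = 0"
      using gdualD(2)[OF x(3) dif_grade[OF y(2)]] gdualD(2)[OF y(3) dif_grade[OF x(2)]] by (auto simp: algebra_simps)
    then show ?thesis unfolding L R by simp
  qed
qed

text \<open>Both sides combine the same three values, of \<open>f\<close> at
  \<open>mul A b c\<close>, of \<open>g\<close> at \<open>mul A c a\<close> and of \<open>h\<close>
  at \<open>mul A a b\<close>. In the critical total degree the signs agree; in any other degree all
  three values vanish.\<close>

lemma form_op2:
  assumes "x \<in> grade E i" "y \<in> grade E j" "z \<in> grade E k"
  shows "bd_form d A A id [op2 x y, z] = sg (2 + k * (i + j)) * bd_form d A A id [op2 z x, y]"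
proof -
  from assms(1) obtain a f where x: "x = (a, f)" "a \<in> grade A i" "f \<in> grade (gdual A) (i + d - 1)" by (rule gradeE)
  from assms(2) obtain b g where y: "y = (b, g)" "b \<in> grade A j" "g \<in> grade (gdual A) (j + d - 1)" by (rule gradeE)
  from assms(3) obtain c h where z: "z = (c, h)" "c \<in> grade A k" "h \<in> grade (gdual A) (k + d - 1)" by (rule gradeE)
  note y' = gcar_grade[OF y(2)] and z' = gcar_grade[OF z(2)]
  have L: "bd_form d A A id [op2 x y, z] = f (mul A b c) + sg (d * i) * g (mul A c a) + sg (d * (i + j)) * h (mul A a b)"
    unfolding x(1) y(1) z(1) op2_hom[OF x(2) gcar_grade[OF y(3)]] form_hom[OF mul_grade[OF x(2) y(2)] gcar_grade[OF z(3)]]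
    by (simp add: lmulf_def rmulf_def z')
  have R: "bd_form d A A id [op2 z x, y] = h (mul A a b) + sg (d * k) * f (mul A b c) + sg (d * (k + i)) * g (mul A c a)"
    unfolding x(1) y(1) z(1) op2_hom[OF z(2) gcar_grade[OF x(3)]] form_hom[OF mul_grade[OF z(2) x(2)] gcar_grade[OF y(3)]]
    by (simp add: lmulf_def rmulf_def y')
  show ?thesis
  proof (cases "i + j + k + d - 1 = 0")
    case True
    then have k: "k = 1 - i - j - d" by simp
    show ?thesis unfolding L R k by (cases "even d"; cases "even i"; cases "even j"; simp add: algebra_simps)
  next
    case False
    then have "f (mul A b c) = 0" "g (mul A c a) = 0" "h (mul A a b) = 0"
      using gdualD(2)[OF x(3) mul_grade[OF y(2) z(2)]] gdualD(2)[OF y(3) mul_grade[OF z(2) x(2)]]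
        gdualD(2)[OF z(3) mul_grade[OF x(2) y(2)]] by (auto simp: algebra_simps)
    then show ?thesis unfolding L R by simp
  qed
qed

text \<open>Each side has two terms. One pair matches because \<open>opN\<close> was defined by this
  very rotation; the other requires, once \<open>opN\<close> is unfolded, the rotation by two places
  from \<open>opM_swap\<close>.\<close>

lemma form_op3:
  assumes "x \<in> grade E i" "y \<in> grade E j" "z \<in> grade E k" "w \<in> grade E l"
  shows "bd_form d A A id [op3 x y z, w] = sg (3 + l * (i + j + k)) * bd_form d A A id [op3 w x y, z]"
proof -
  from assms(1) obtain a1 f1 where x: "x = (a1, f1)" "a1 \<in> grade A i" "f1 \<in> grade (gdual A) (i + d - 1)" by (rule gradeE)
  from assms(2) obtain a2 f2 where y: "y = (a2, f2)" "a2 \<in> grade A j" "f2 \<in> grade (gdual A) (j + d - 1)" by (rule gradeE)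
  from assms(3) obtain a3 f3 where z: "z = (a3, f3)" "a3 \<in> grade A k" "f3 \<in> grade (gdual A) (k + d - 1)" by (rule gradeE)
  from assms(4) obtain a4 f4 where w: "w = (a4, f4)" "a4 \<in> grade A l" "f4 \<in> grade (gdual A) (l + d - 1)" by (rule gradeE)
  note M123 = opM_grade[OF x(2) y(3) z(2)] and M412 = opM_grade[OF w(2) x(3) y(2)]
  have L: "bd_form d A A id [op3 x y z, w] = opN f1 a2 f3 a4 + sg (d * (i + (j + d - 1) + k - d)) * f4 (opM a1 f2 a3)"
    unfolding x(1) y(1) z(1) w(1) op3_def fst_conv snd_conv by (rule form_hom[OF M123 gcar_grade[OF w(3)]])
  have R: "bd_form d A A id [op3 w x y, z] = opN f4 a1 f2 a3 + sg (d * (l + (i + d - 1) + j - d)) * f3 (opM a4 f1 a2)"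
    unfolding x(1) y(1) z(1) w(1) op3_def fst_conv snd_conv by (rule form_hom[OF M412 gcar_grade[OF z(3)]])
  have n1: "opN f1 a2 f3 a4 = sg (1 + (k + d - 1) + (d + 1) * ((i + d - 1) + j)) * f3 (opM a4 f1 a2)"
    by (rule opN_eval[OF x(3) y(2) z(3) gcar_grade[OF w(2)]])
  have n2: "opN f4 a1 f2 a3 = sg (1 + (j + d - 1) + (d + 1) * ((l + d - 1) + i)) * f2 (opM a3 f4 a1)"
    by (rule opN_eval[OF w(3) x(2) y(3) gcar_grade[OF z(2)]])
  show ?thesis
  proof (cases "i + j + k + l + d - 2 = 0")
    case True
    then have l: "l = 2 - i - j - k - d" by simp
    have sw: "f2 (opM a3 f4 a1) = sg (1 + (i + d) * (k + d) + k * (i + (l + d - 1) + 1) + i * (k + (j + d - 1) + 1)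
        + ((l + d - 1) + (j + d - 1)) * d + (l + d - 1) * (j + d - 1)) * f4 (opM a1 f2 a3)"
      by (rule opM_swap[OF z(2) w(3) x(2) y(3)]) (use True in simp)
    show ?thesis unfolding L R n1 n2 sw l by (cases "even d"; cases "even i"; cases "even j"; cases "even k"; simp add: algebra_simps)
  next
    case False
    then have "f2 (opM a3 f4 a1) = 0" "f3 (opM a4 f1 a2) = 0" "f4 (opM a1 f2 a3) = 0"
      using gdualD(2)[OF y(3) opM_grade[OF z(2) w(3) x(2)]] gdualD(2)[OF z(3) M412] gdualD(2)[OF w(3) M123]
      by (auto simp: algebra_simps)
    then show ?thesis unfolding L R n1 n2 by simp
  qed
qed

lemma BE_degenerate_cyclic: "degenerate_cyclic (d - 1) BE"
  unfolding degenerate_cyclic_def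
proof (intro conjI ballI allI impI)
  show "a_infinity BE" by (rule BE_a_infinity)
  show "multihom BE ground 2 (d - 1) (form BE)"
    unfolding multihom_def multilin2_iff
  proof (intro conjI ballI allI impI)
    fix ds xs assume "length xs = 2 \<and> homs BE ds xs"
    then obtain i j x y where *: "ds = [i, j]" "xs = [x, y]" "x \<in> grade E i" "y \<in> grade E j"
      by (auto simp: BE_cong elim!: homs2E)
    show "form BE xs \<in> grade ground (sum_list ds + (d - 1))"
      using form_degree[OF *(3,4)] by (simp add: * add.assoc)
  qed (use form_bilin in \<open>simp_all add: bilin_def BE_cong\<close>)
  show "sg (i * j) * form BE [y, x] = form BE [x, y]" if "x \<in> grade BE i" "y \<in> grade BE j" for i j x y
    using form_sym that by simp
  fix n ds xs l w
  assume n: "1 \<le> n" and w: "w \<in> grade BE l" and xs: "length xs = n \<and> homs BE ds xs"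
  then have w': "w \<in> grade E l" and hs: "homs E ds xs" by (simp_all add: BE_cong)
  consider "n = 1" | "n = 2" | "n = 3" | "n \<ge> 4" using n by linarith
  then show "form BE [ops BE n xs, w] = sg (int n + l * sum_list ds) * form BE [ops BE n (w # butlast xs), last xs]"
  proof cases
    case 1
    then obtain x i where x: "xs = [x]" "ds = [i]" "x \<in> grade E i"
      using xs hs by (auto simp: length_one_iff homs_Cons)
    show ?thesis using form_op1[OF x(3) w'] 1 by (simp add: ops_br_def x)
  next
    case 2
    then obtain x y i j where x: "xs = [x, y]" "ds = [i, j]" "x \<in> grade E i" "y \<in> grade E j"
      using xs hs by (auto elim!: homs2E)
    show ?thesis using form_op2[OF x(3,4) w'] 2 by (simp add: ops_br_def x)
  next
    case 3
    then obtain x y z i j k where x: "xs = [x, y, z]" "ds = [i, j, k]" "x \<in> grade E i" "y \<in> grade E j" "z \<in> grade E k"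
      using xs hs by (auto elim!: homs3E)
    show ?thesis using form_op3[OF x(3-5) w'] 3 by (simp add: ops_br_def x add.assoc)
  next
    case 4
    then have "last xs \<in> gcar E" using homs_gcar[OF hs] xs n last_in_set[of xs] by fastforce
    then show ?thesis using 4 form_zero gcar_grade[OF w'] by (auto simp: ops_br_def)
  qed
qed

text \<open>Pairing with \<open>(b, 0)\<close> detects the functional. Pairing with
  \<open>(0, g)\<close> detects the element up to the sign operator, which a homogeneous
  \<open>g\<close> turns into a mere sign, and homogeneous functionals separate points.\<close>

lemma BE_cyclic: "cyclic (d - 1) BE"
  unfolding cyclic_def
proof (intro conjI BE_degenerate_cyclic ballI impI)
  fix x assume "x \<in> gcar BE" and 0: "\<forall>y\<in>gcar BE. form BE [x, y] = 0"
  then obtain a f where x: "x = (a, f)" "a \<in> gcar A" "f \<in> gcar (gdual A)"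
    by (cases x) (auto simp: BE_cong gcar_E)
  have z: "f b + g (par A d a) = 0" if "b \<in> gcar A" "g \<in> gcar (gdual A)" for b g
    using 0[rule_format, of "(b, g)"] that x by (simp add: BE_cong gcar_E form_gcar)
  have "f b = 0" if "b \<in> gcar A" for b
    using z[OF that gcar_closed(1)[OF gsd]] by simp
  then have "f = 0" using gdual_eqI[OF gs x(3) gcar_closed(1)[OF gsd]] gcar_grade by (metis zero_fun_apply)
  have "a = 0"
  proof (rule gcar_eqI[OF gs x(2) gcar_closed(1)[OF gs]])
    fix n and g :: "'v \<Rightarrow> 'k" assume g: "g \<in> grade (gdual A) n"
    have "g (par A d a) = 0" using z[OF gcar_closed(1)[OF gs] gcar_grade[OF g]] \<open>f = 0\<close> by simp
    then have "g a = 0" using gdual_par[OF gs g x(2)] by simp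
    then show "g a = g 0" using lin_on_zero[OF gs gdualD(1)[OF g]] by simp
  qed
  then show "x = 0" using x \<open>f = 0\<close> by (simp add: zero_prod_def)
qed

lemma opM_zero: "b \<in> gcar A \<Longrightarrow> g \<in> gcar (gdual A) \<Longrightarrow> a \<in> gcar A \<Longrightarrow>
    opM 0 g a = 0 \<and> opM b 0 a = 0 \<and> opM b g 0 = 0"
  using opM_trilin lin_on_zero[OF gs, of "scal A" "\<lambda>b. opM b g a"] lin_on_zero[OF gsd, of "scal A" "\<lambda>g. opM b g a"]
    lin_on_zero[OF gs, of "scal A" "opM b g"] by (simp add: trilin_def)

lemma opN_zero: "f \<in> gcar (gdual A) \<Longrightarrow> a \<in> gcar A \<Longrightarrow> g \<in> gcar (gdual A) \<Longrightarrow>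
    opN 0 a g = 0 \<and> opN f 0 g = 0 \<and> opN f a 0 = 0"
  using opN_trilin lin_on_zero[OF gsd, of "scal (gdual A)" "\<lambda>f. opN f a g"]
    lin_on_zero[OF gs, of "scal (gdual A)" "\<lambda>a. opN f a g"]
    lin_on_zero[OF gsd, of "scal (gdual A)" "opN f a"] by (simp add: trilin_def)

lemma op1_gcar_E:
  assumes x: "x \<in> gcar E"
  shows "op1 x \<in> gcar E"
  by (rule lin_on_gcar[OF E_gs E_gs op1_lin _ x]) (rule gcar_grade[OF op1_grade])

lemma op3_gcar_E:
  assumes x: "x \<in> gcar E" and y: "y \<in> gcar E" and z: "z \<in> gcar E"
  shows "op3 x y z \<in> gcar E"
proof (rule lin_on_gcar[OF E_gs E_gs _ _ x])
  show "lin_on E (scal E) (\<lambda>x. op3 x y z)" using op3_trilin y z by (simp add: trilin_def)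
  fix n x assume x: "x \<in> grade E n"
  show "op3 x y z \<in> gcar E"
  proof (rule lin_on_gcar[OF E_gs E_gs _ _ y])
    show "lin_on E (scal E) (\<lambda>y. op3 x y z)" using op3_trilin gcar_grade[OF x] z by (simp add: trilin_def)
    fix m y assume y: "y \<in> grade E m"
    show "op3 x y z \<in> gcar E"
    proof (rule lin_on_gcar[OF E_gs E_gs _ _ z])
      show "lin_on E (scal E) (op3 x y)" using op3_trilin gcar_grade[OF x] gcar_grade[OF y] by (simp add: trilin_def)
    qed (rule gcar_grade[OF op3_grade[OF x y]])
  qed
qed

lemma bd_part_E: "bd_part A A i = (if i = 0 then {x \<in> gcar E. snd x = 0} else {x \<in> gcar E. fst x = 0})"
  using gcar_closed(1)[OF gs] gcar_closed(1)[OF gsd] by (auto simp: bd_part_def gcar_E)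

text \<open>In arity 3 everything follows from the vanishing of \<open>opM\<close> and
  \<open>opN\<close> as soon as one argument is zero.\<close>

lemma BE_good_map: "odd n \<Longrightarrow> good_map (bd_part A A) n (ops BE n)"
  unfolding good_map_def
proof (intro allI impI)
  fix js xs assume n: "odd n" and a: "length js = n \<and> set js \<subseteq> {0, 1} \<and> list_all2 (\<lambda>i x. x \<in> bd_part A A i) js xs"
  have "n = 1 \<or> n = 3 \<or> n \<ge> 4" using n by presburger
  then consider "n = 1" | "n = 3" | "n \<ge> 4" by blast
  then show "if \<forall>j. Suc j < n \<longrightarrow> js ! j \<noteq> js ! Suc j then ops BE n xs \<in> bd_part A A (js ! 0) else ops BE n xs = 0"
  proof cases
    case 1
    then obtain i x where ix: "js = [i]" "xs = [x]" "x \<in> bd_part A A i"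
      using a by (auto simp: length_one_iff list_all2_Cons1)
    have "op1 x \<in> gcar E" using ix op1_gcar_E by (auto simp: bd_part_E split: if_splits)
    moreover have "snd (op1 x) = 0" if "snd x = 0" "x \<in> gcar E"
    proof -
      have "x = (fst x, 0)" using that(1) by (simp add: prod_eq_iff)
      then have "op1 x = op1 (fst x, 0)" by simp
      then show ?thesis
        using op1_gcar[OF gcar_closed(1)[OF gsd], of "fst x"] by (simp add: fun_eq_iff)
    qed
    moreover have "fst (op1 x) = 0" if "fst x = 0" "x \<in> gcar E"
      using that op1_gcar[of "snd x" 0] lin_on_zero[OF gs dif_lin] by (cases x) (auto simp: gcar_E)
    ultimately show ?thesis using 1 ix by (auto simp: bd_part_E ops_br_def split: if_splits)
  next
    case 2
    then obtain i j k x y z where ix: "js = [i, j, k]" "xs = [x, y, z]" "x \<in> bd_part A A i" "y \<in> bd_part A A j" "z \<in> bd_part A A k"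
      using a by (auto simp: length_three_iff list_all2_Cons1)
    have ijk: "i = 0 \<or> i = 1" "j = 0 \<or> j = 1" "k = 0 \<or> k = 1" using a ix by auto
    have g: "x \<in> gcar E" "y \<in> gcar E" "z \<in> gcar E" using ix by (auto simp: bd_part_E split: if_splits)
    have al: "(\<forall>j. Suc j < n \<longrightarrow> js ! j \<noteq> js ! Suc j) \<longleftrightarrow> i \<noteq> j \<and> j \<noteq> k"
      using 2 ix by (auto simp: less_Suc_eq numeral_3_eq_3)
    have v: "ops BE n xs = op3 x y z" using 2 ix by (simp add: ops_br_def)
    note g' = g[unfolded gcar_E]
    note mz = opM_zero[of "fst x" "snd y" "fst z"] opN_zero[of "snd x" "fst y" "snd z"]
    have "op3 x y z \<in> bd_part A A i" if "i \<noteq> j" "j \<noteq> k"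
      using that ijk ix(3-5) op3_gcar_E[OF g] mz g' by (auto simp: bd_part_E op3_def)
    moreover have "op3 x y z = 0" if "\<not> (i \<noteq> j \<and> j \<noteq> k)"
      using that ijk ix(3-5) mz g' by (auto simp: bd_part_E op3_def zero_prod_def)
    ultimately show ?thesis unfolding al v by (simp add: ix(1))
  next
    case 3
    then show ?thesis
      using a gcar_closed(1)[OF E_gs] by (auto simp: ops_br_def bd_part_E)
  qed
qed

text \<open>The bracket formula holds in degree \<open>i + j + p + q = d\<close> by the choice of
  the sign in \<open>opM\<close>; in every other degree the bracket and the pairing both
  vanish.\<close>

lemma corresponds_ops_br: "corresponds d A ops_br"
  unfolding corresponds_def
proof (intro conjI ballI allI)
  have op2_A: "op2 x y \<in> bd_part A A 0" if xy: "x \<in> bd_part A A 0" "y \<in> bd_part A A 0" for x y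
  proof -
    obtain a b where "x = (a, 0)" "y = (b, 0)" "a \<in> gcar A" "b \<in> gcar A"
      using xy by (auto simp: bd_part_def)
    then show ?thesis using op2_gcar[of a 0 0 b] mul_gcar gcar_closed(1)[OF gsd]
      by (auto simp: bd_part_def fun_eq_iff)
  qed
  have g: "good_map (bd_part A A) n (ops BE n)" if "odd n" for n by (rule BE_good_map[OF that])
  show "pre_CY d A ops_br"
    unfolding pre_CY_def
  proof (intro conjI allI impI gs BE_cyclic)
    fix n xs assume n: "1 \<le> n" and xs: "length xs = n \<and> set xs \<subseteq> bd_part A A 0"
    consider "n = 1" | "n = 2" | "n = 3" | "n \<ge> 4" using n by linarith
    then show "ops_br n xs \<in> bd_part A A 0"
    proof cases
      case 1
      then obtain x where x: "xs = [x]" "x \<in> bd_part A A 0" using xs by (auto simp: length_one_iff)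
      then show ?thesis using g[of 1, unfolded good_map_def, rule_format, of "[0]" xs] 1 by simp
    next
      case 2
      then obtain x y where x: "xs = [x, y]" "x \<in> bd_part A A 0" "y \<in> bd_part A A 0" using xs by (auto simp: length_two_iff)
      then show ?thesis using op2_A 2 by (simp add: ops_br_def)
    next
      case 3
      then obtain x y z where x: "xs = [x, y, z]" "x \<in> bd_part A A 0" "y \<in> bd_part A A 0" "z \<in> bd_part A A 0"
        using xs by (auto simp: length_three_iff)
      then have "ops_br 3 xs = 0"
        using g[of 3, unfolded good_map_def, rule_format, of "[0, 0, 0]" xs] by (auto simp: all_less_two)
      then show ?thesis using 3 gcar_closed(1)[OF E_gs] by (simp add: bd_part_E)
    next
      case 4
      then show ?thesis using gcar_closed(1)[OF E_gs] by (auto simp: ops_br_def bd_part_E)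
    qed
  qed
  show "nice (bd_part A A) BE"
    unfolding nice_def good_def essentially_odd_def small_def op_zero_def
    using BE_a_infinity g by (auto simp: ops_br_def)
  show "ops_br 1 [x] = dif (bd_dga d A A id) x" for x by (simp add: ops_br_def op1_def)
  show "ops_br 2 [x, y] = mul (bd_dga d A A id) x y" for x y by (simp add: ops_br_def op2_def)
  fix i j p q a b and f g :: "'v \<Rightarrow> 'k"
  assume a: "a \<in> grade A i" and b: "b \<in> grade A j" and f: "f \<in> grade (gdual A) p" and g: "g \<in> grade (gdual A) q"
  note f' = gdualD(1)[OF f] and g' = gdualD(1)[OF g]
  have "tlift A 2 (\<lambda>ds xs. sg (q * ds ! 0) * f (xs ! 0) * g (xs ! 1)) (dbr A [a, b])
      = dbr A [a, b] (\<lambda>xs. sg (p * q) * (f (xs ! 0) * g (xs ! 1)))"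
  proof (rule tlift_scalar[OF dbr_tens[OF a b]])
    fix ds xs assume "length xs = 2" "homs A ds xs"
    then obtain k l x y where *: "ds = [k, l]" "xs = [x, y]" "x \<in> grade A k" "y \<in> grade A l"
      by (auto elim!: homs2E)
    show "sg (q * ds ! 0) * f (xs ! 0) * g (xs ! 1) = sg (p * q) * (f (xs ! 0) * g (xs ! 1))"
      using prod2_sign[OF f *(3), of q] by (simp add: * mult.commute[of q] mult.assoc[symmetric])
  qed (use f' g' in \<open>simp add: multilin2_iff lin_on_ground\<close>)
  also have "\<dots> = sg (p * q) * br a b f g"
    unfolding br_def
    by (rule tens_eval_scal[OF dbr_tens[OF a b] multilin_prod2[OF f' g']])
      (use f' g' in \<open>simp add: multilin2_iff lin_on_ground\<close>)
  finally have L: "tlift A 2 (\<lambda>ds xs. sg (q * ds ! 0) * f (xs ! 0) * g (xs ! 1)) (dbr A [a, b]) = sg (p * q) * br a b f g" .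
  have R: "bd_form d A A id [ops_br 3 [(b, 0), (0, g), (a, 0)], (0, f)] = sg (d * p) * f (opM b g a)"
    using opN_zero[OF gcar_closed(1)[OF gsd] gcar_closed(1)[OF gs] gcar_closed(1)[OF gsd]]
      form_gcar[OF gcar_grade[OF opM_grade[OF b g a]] gcar_grade[OF f], of 0 0]
      gdual_par[OF gs f gcar_grade[OF opM_grade[OF b g a]], of d]
    by (simp add: ops_br_def op3_def)
  show "tlift A 2 (\<lambda>ds xs. sg (q * ds ! 0) * f (xs ! 0) * g (xs ! 1)) (dbr A [a, b]) =
      sg (j * (i + q + 1)) * bd_form d A A id [ops_br 3 [(b, 0), (0, g), (a, 0)], (0, f)]"
  proof (cases "i + j + p + q = d")
    case True
    have "sg (p * q) = (sg (j * (i + q + 1)) * (sg (d * p) * sg (p * q + j * (i + q + 1) + p * d)) :: 'k)"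
      unfolding sg_mult by (rule sg_cong) (cases "even d"; cases "even i"; cases "even j"; cases "even p"; cases "even q"; simp)
    then show ?thesis unfolding L R opM_eval[OF b g a f True] by (simp only: mult.assoc)
  next
    case False
    then have "br a b f g = 0" "f (opM b g a) = 0"
      using br_degree[OF a b f g] gdualD(2)[OF f opM_grade[OF b g a]] by (auto simp: algebra_simps)
    then show ?thesis unfolding L R by simp
  qed
qed

text \<open>The existence of one witness makes the choice in \<open>dp_ops\<close> satisfy its
  specification.\<close>

lemma dp_ops_corresponds: "corresponds d A (dp_ops d A)"
  unfolding dp_ops_def by (rule someI[of "corresponds d A", OF corresponds_ops_br])

end

section \<open>Transfer of structures along strict morphisms\<close>

text \<open>Homogeneous arguments give homogeneous values, and general ones are reached one position
  at a time: in the inductive statement only the entries before position \<open>k\<close> may be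
  inhomogeneous.\<close>

lemma multihom_gcar:
  assumes V: "graded_space V" and W: "graded_space W" and m: "multihom V W n e m"
    and xs: "length xs = n" "set xs \<subseteq> gcar V"
  shows "m xs \<in> gcar W"
proof -
  have "\<forall>xs. length xs = n \<and> set xs \<subseteq> gcar V \<and> (\<forall>i. k \<le> i \<and> i < n \<longrightarrow> (\<exists>j. xs ! i \<in> grade V j)) \<longrightarrow> m xs \<in> gcar W" for k
  proof (induction k)
    case 0
    show ?case
    proof (intro allI impI)
      fix xs assume xs: "length xs = n \<and> set xs \<subseteq> gcar V \<and> (\<forall>i. 0 \<le> i \<and> i < n \<longrightarrow> (\<exists>j. xs ! i \<in> grade V j))"
      then obtain D where D: "\<And>i. i < n \<Longrightarrow> xs ! i \<in> grade V (D i)" by (metis le0)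
      have "homs V (map D [0..<n]) xs" unfolding homs_def using xs D by (auto simp: list_all2_conv_all_nth)
      then show "m xs \<in> gcar W" using m xs gcar_grade unfolding multihom_def by blast
    qed
  next
    case (Suc k)
    show ?case
    proof (intro allI impI)
      fix xs assume xs: "length xs = n \<and> set xs \<subseteq> gcar V \<and> (\<forall>i. Suc k \<le> i \<and> i < n \<longrightarrow> (\<exists>j. xs ! i \<in> grade V j))"
      show "m xs \<in> gcar W"
      proof (cases "k < n")
        case False
        then show ?thesis using Suc.IH xs by auto
      next
        case True
        have l: "lin_on V (scal W) (\<lambda>u. m (xs[k := u]))"
          using m xs True unfolding multihom_def multilin_iff by blast
        have "m (xs[k := xs ! k]) \<in> gcar W"
        proof (rule lin_on_gcar[OF V W l])
          show "xs ! k \<in> gcar V" using xs True nth_mem by blast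
          fix j u assume u: "u \<in> grade V j"
          have "set (xs[k := u]) \<subseteq> gcar V"
            using xs set_update_subset_insert[of xs k u] gcar_grade[OF u] by auto
          moreover have "\<exists>j. xs[k := u] ! i \<in> grade V j" if "k \<le> i" "i < n" for i
            using that u xs by (cases "i = k") auto
          ultimately show "m (xs[k := u]) \<in> gcar W" using Suc.IH xs by simp
        qed
        then show ?thesis by simp
      qed
    qed
  qed
  from this[of n] xs show ?thesis by auto
qed

lemma ops_gcar:
  assumes "a_infinity E" "n \<ge> 1" "length xs = n" "set xs \<subseteq> gcar E"
  shows "ops E n xs \<in> gcar E"
  using assms multihom_gcar[of E E n "2 - int n" "ops E n" xs] by (auto simp: a_infinity_def)

lemma strict_morphismD:
  assumes "strict_morphism E E' f"
  shows "lin_on E (scal E') f" "x \<in> grade E i \<Longrightarrow> f x \<in> grade E' i"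
    "n \<ge> 1 \<Longrightarrow> length xs = n \<Longrightarrow> set xs \<subseteq> gcar E \<Longrightarrow> f (ops E n xs) = ops E' n (map f xs)"
  using assms by (auto simp: strict_morphism_def glin_iff)

lemma strict_morphism_gcar:
  assumes "graded_space E" "graded_space E'" "strict_morphism E E' f" "x \<in> gcar E"
  shows "f x \<in> gcar E'"
  using assms glin_gcar[of E E' 0 f x] by (simp add: strict_morphism_def)

lemma homs_map:
  assumes "\<And>i x. x \<in> grade E i \<Longrightarrow> f x \<in> grade E' i" "homs E ds xs"
  shows "homs E' ds (map f xs)"
  using assms(2) unfolding homs_def by (induction rule: list_all2_induct) (auto simp: assms(1))

text \<open>\<open>inj\<close> carries equations over from the two targets and \<open>refl\<close>
  carries over degrees. Both apply to carrier elements only, so \<open>closed\<close> has to be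
  known beforehand.\<close>

locale joint_strict =
  fixes E :: "('k::field, 'v::ab_group_add, 'x) ainf_scheme"
    and E1 :: "('k, 'u::ab_group_add, 'y) ainf_scheme" and E2 :: "('k, 'w::ab_group_add, 'z) ainf_scheme"
    and f :: "'v \<Rightarrow> 'u" and g :: "'v \<Rightarrow> 'w"
  assumes E: "graded_space E" and E1: "a_infinity E1" and E2: "a_infinity E2"
    and f: "strict_morphism E E1 f" and g: "strict_morphism E E2 g"
    and inj: "\<And>u. u \<in> gcar E \<Longrightarrow> f u = 0 \<Longrightarrow> g u = 0 \<Longrightarrow> u = 0"
    and refl: "\<And>u n. u \<in> gcar E \<Longrightarrow> f u \<in> grade E1 n \<Longrightarrow> g u \<in> grade E2 n \<Longrightarrow> u \<in> grade E n"
    and closed: "\<And>n xs. n \<ge> 1 \<Longrightarrow> length xs = n \<Longrightarrow> set xs \<subseteq> gcar E \<Longrightarrow> ops E n xs \<in> gcar E"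
begin

lemma gs1: "graded_space E1" and gs2: "graded_space E2"
  using E1 E2 by (auto simp: a_infinity_def)

lemmas fl = strict_morphismD(1)[OF f] and gl = strict_morphismD(1)[OF g]
lemmas fops = strict_morphismD(3)[OF f] and gops = strict_morphismD(3)[OF g]

lemma f_gcar: "x \<in> gcar E \<Longrightarrow> f x \<in> gcar E1" and g_gcar: "x \<in> gcar E \<Longrightarrow> g x \<in> gcar E2"
  using strict_morphism_gcar[OF E gs1 f] strict_morphism_gcar[OF E gs2 g] by auto

lemma eqI:
  assumes u: "u \<in> gcar E" and v: "v \<in> gcar E" and "f u = f v" "g u = g v"
  shows "u = v"
proof -
  note m = gcar_minus(2)[OF E u v]
  have "f u = f (u - v) + f v" "g u = g (u - v) + g v"
    using lin_on_add[OF fl m v] lin_on_add[OF gl m v] by simp_all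
  then have "u - v = 0" using assms by (intro inj[OF m]) auto
  then show ?thesis by simp
qed

lemma multilin_ops: "n \<ge> 1 \<Longrightarrow> multilin E (scal E) n (ops E n)"
  unfolding multilin_def
proof (intro allI impI conjI ballI)
  fix xs i u v c assume n: "n \<ge> 1" and xs: "length xs = n \<and> set xs \<subseteq> gcar E \<and> i < n" and u: "u \<in> gcar E"
  have m: "multilin E1 (scal E1) n (ops E1 n)" "multilin E2 (scal E2) n (ops E2 n)"
    using E1 E2 n by (auto simp: a_infinity_def multihom_def)
  have sub: "set (xs[i := w]) \<subseteq> gcar E" if "w \<in> gcar E" for w
    using xs set_update_subset_insert[of xs i w] that by auto
  have c: "ops E n (xs[i := w]) \<in> gcar E" if "w \<in> gcar E" for w
    using closed[OF n, of "xs[i := w]"] xs sub[OF that] by simp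
  have fw: "f (ops E n (xs[i := w])) = ops E1 n ((map f xs)[i := f w])"
    "g (ops E n (xs[i := w])) = ops E2 n ((map g xs)[i := g w])" if "w \<in> gcar E" for w
    using fops[OF n, of "xs[i := w]"] gops[OF n, of "xs[i := w]"] xs sub[OF that] by (simp_all add: map_update)
  have fx: "length (map f xs) = n" "set (map f xs) \<subseteq> gcar E1" "length (map g xs) = n" "set (map g xs) \<subseteq> gcar E2"
    using xs f_gcar g_gcar by auto
  show "ops E n (xs[i := u + v]) = ops E n (xs[i := u]) + ops E n (xs[i := v])" if v: "v \<in> gcar E"
    using m fx xs u v unfolding multilin_def
    by (intro eqI) (auto simp: fw c gcar_closed[OF E] lin_on_add[OF fl] lin_on_add[OF gl] f_gcar g_gcar)
  show "ops E n (xs[i := scal E c u]) = scal E c (ops E n (xs[i := u]))"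
    using m fx xs u unfolding multilin_def
    by (intro eqI) (auto simp: fw c gcar_closed[OF E] lin_on_scal[OF fl] lin_on_scal[OF gl] f_gcar g_gcar)
qed

lemma multihom_ops: "n \<ge> 1 \<Longrightarrow> multihom E E n (2 - int n) (ops E n)"
  unfolding multihom_def
proof (intro conjI allI impI multilin_ops)
  fix ds xs assume n: "n \<ge> 1" and xs: "length xs = n \<and> homs E ds xs"
  have "multihom E1 E1 n (2 - int n) (ops E1 n)" "multihom E2 E2 n (2 - int n) (ops E2 n)"
    using E1 E2 n by (auto simp: a_infinity_def)
  moreover have "homs E1 ds (map f xs)" "homs E2 ds (map g xs)"
    using xs homs_map strict_morphismD(2)[OF f] strict_morphismD(2)[OF g] by blast+
  ultimately have "ops E1 n (map f xs) \<in> grade E1 (sum_list ds + (2 - int n))"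
    "ops E2 n (map g xs) \<in> grade E2 (sum_list ds + (2 - int n))"
    using xs by (auto simp: multihom_def)
  then show "ops E n xs \<in> grade E (sum_list ds + (2 - int n))"
    using xs n homs_gcar[of E ds xs] closed[OF n, of xs] by (intro refl) (auto simp: fops gops)
qed

text \<open>Each summand of a relation is mapped by \<open>f\<close> and by \<open>g\<close> to the
  corresponding summand in \<open>E1\<close> and \<open>E2\<close>, so the whole sum has image 0
  under both.\<close>

lemma joint_a_infinity: "a_infinity E"
  unfolding a_infinity_def
proof (intro conjI allI impI E multihom_ops)
  fix n ds xs assume n: "n \<ge> 1" and xs: "length xs = n \<and> homs E ds xs"
  let ?I = "{(r, s, t). r + s + t = n \<and> s \<ge> 1}"
  let ?c = "\<lambda>r s t. sg (int (r + s * t)) * sg ((2 - int s) * sum_list (take r ds)) :: 'k"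
  let ?T = "\<lambda>r s t. ops E (r + 1 + t) (take r xs @ [ops E s (take s (drop r xs))] @ drop (r + s) xs)"
  let ?T1 = "\<lambda>xs r s t. ops E1 (r + 1 + t) (take r xs @ [ops E1 s (take s (drop r xs))] @ drop (r + s) xs)"
  let ?T2 = "\<lambda>xs r s t. ops E2 (r + 1 + t) (take r xs @ [ops E2 s (take s (drop r xs))] @ drop (r + s) xs)"
  have car: "set xs \<subseteq> gcar E" using xs homs_gcar by blast
  have T: "?T r s t \<in> gcar E \<and> f (?T r s t) = ?T1 (map f xs) r s t \<and> g (?T r s t) = ?T2 (map g xs) r s t"
    if "(r, s, t) \<in> ?I" for r s t
  proof -
    from that have rst: "r + s + t = n" "s \<ge> 1" by auto
    let ?ys = "take s (drop r xs)"
    have ys: "length ?ys = s" "set ?ys \<subseteq> gcar E"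
      using rst xs car by (auto dest: in_set_takeD in_set_dropD)
    let ?zs = "take r xs @ [ops E s ?ys] @ drop (r + s) xs"
    have zs: "length ?zs = r + 1 + t" "set ?zs \<subseteq> gcar E"
      using rst xs car closed[OF rst(2) ys] by (auto dest: in_set_takeD in_set_dropD)
    have "f (ops E (r + 1 + t) ?zs) = ops E1 (r + 1 + t) (map f ?zs)" "g (ops E (r + 1 + t) ?zs) = ops E2 (r + 1 + t) (map g ?zs)"
      using fops[OF _ zs] gops[OF _ zs] by simp_all
    then show ?thesis using closed[OF _ zs] fops[OF rst(2) ys] gops[OF rst(2) ys]
      by (simp add: take_map drop_map)
  qed
  have gc: "(case p of (r, s, t) \<Rightarrow> scal E (?c r s t) (?T r s t)) \<in> gcar E" if "p \<in> ?I" for p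
    using T that by (cases p) (auto intro: gcar_closed[OF E])
  have "f (\<Sum>(r, s, t) \<in> ?I. scal E (?c r s t) (?T r s t)) = (\<Sum>p \<in> ?I. f (case p of (r, s, t) \<Rightarrow> scal E (?c r s t) (?T r s t)))"
    by (rule lin_on_sum[OF E fl gc])
  also have "\<dots> = (\<Sum>(r, s, t) \<in> ?I. scal E1 (?c r s t) (?T1 (map f xs) r s t))"
  proof (rule sum.cong[OF HOL.refl])
    fix p assume "p \<in> ?I"
    then show "f (case p of (r, s, t) \<Rightarrow> scal E (?c r s t) (?T r s t)) = (case p of (r, s, t) \<Rightarrow> scal E1 (?c r s t) (?T1 (map f xs) r s t))"
      using T by (cases p) (simp add: lin_on_scal[OF fl])
  qed
  also have "\<dots> = 0"
    using E1 n xs homs_map[of E f E1 ds xs] strict_morphismD(2)[OF f] unfolding a_infinity_def by simp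
  finally have 1: "f (\<Sum>(r, s, t) \<in> ?I. scal E (?c r s t) (?T r s t)) = 0" .
  have "g (\<Sum>(r, s, t) \<in> ?I. scal E (?c r s t) (?T r s t)) = (\<Sum>p \<in> ?I. g (case p of (r, s, t) \<Rightarrow> scal E (?c r s t) (?T r s t)))"
    by (rule lin_on_sum[OF E gl gc])
  also have "\<dots> = (\<Sum>(r, s, t) \<in> ?I. scal E2 (?c r s t) (?T2 (map g xs) r s t))"
  proof (rule sum.cong[OF HOL.refl])
    fix p assume "p \<in> ?I"
    then show "g (case p of (r, s, t) \<Rightarrow> scal E (?c r s t) (?T r s t)) = (case p of (r, s, t) \<Rightarrow> scal E2 (?c r s t) (?T2 (map g xs) r s t))"
      using T by (cases p) (simp add: lin_on_scal[OF gl])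
  qed
  also have "\<dots> = 0"
    using E2 n xs homs_map[of E g E2 ds xs] strict_morphismD(2)[OF g] unfolding a_infinity_def by simp
  finally have 2: "g (\<Sum>(r, s, t) \<in> ?I. scal E (?c r s t) (?T r s t)) = 0" .
  show "(\<Sum>(r, s, t) \<in> ?I. scal E (?c r s t) (?T r s t)) = 0"
    by (rule inj[OF gcar_sum[OF E gc] 1 2])
qed

lemma joint_fully_manageable:
  assumes m1: "fully_manageable E1" and m2: "fully_manageable E2"
  shows "fully_manageable E"
proof -
  let ?D = "\<lambda>E. \<lparr>scal = scal E, grade = grade E, mul = (\<lambda>x y. ops E 2 [x, y]), dif = (\<lambda>x. ops E 1 [x])\<rparr>"
  have c: "gcar (?D E) = gcar E" "lin_on (?D E) = lin_on E" "homs (?D E) = homs E" "graded_space (?D E)"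
    using E graded_space_cong[of "?D E" E] gcar_cong[of "?D E" E] lin_on_cong[of "?D E" E] homs_cong[of "?D E" E]
    by simp_all
  interpret D1: dgalg "?D E1" using m1 by unfold_locales (simp add: fully_manageable_def)
  interpret D2: dgalg "?D E2" using m2 by unfold_locales (simp add: fully_manageable_def)
  have c1: "gcar (?D E1) = gcar E1" and c2: "gcar (?D E2) = gcar E2" by (auto intro!: gcar_cong)
  note o2 = closed[of 2 "[_, _]", simplified] and o1 = closed[of 1 "[_]", simplified]
  note f2 = fops[of 2 "[_, _]", simplified] and f1 = fops[of 1 "[_]", simplified]
  note g2 = gops[of 2 "[_, _]", simplified] and g1 = gops[of 1 "[_]", simplified]
  note s1 = D1.mul_assoc[unfolded c1, simplified] D1.dif_dif[unfolded c1, simplified] D1.dif_mul[unfolded c1, simplified]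
  note s2 = D2.mul_assoc[unfolded c2, simplified] D2.dif_dif[unfolded c2, simplified] D2.dif_mul[unfolded c2, simplified]
  note fg = f_gcar g_gcar strict_morphismD(2)[OF f] strict_morphismD(2)[OF g] gcar_grade
    lin_on_add[OF fl] lin_on_scal[OF fl] lin_on_add[OF gl] lin_on_scal[OF gl] gcar_closed[OF E]
  have h2: "multihom E E 2 0 (ops E 2)" and h1: "multihom E E 1 1 (ops E 1)"
    using multihom_ops[of 2] multihom_ops[of 1] by simp_all
  have "dg_algebra (?D E)"
    unfolding dg_algebra_def
  proof (intro conjI ballI allI c(4))
    show "multihom (?D E) (?D E) 2 0 (\<lambda>xs. mul (?D E) (xs ! 0) (xs ! 1))"
      unfolding multihom_def multilin2_iff c
    proof (intro conjI ballI allI impI)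
      fix ds xs assume "length xs = 2 \<and> homs E ds xs"
      then show "mul (?D E) (xs ! 0) (xs ! 1) \<in> grade (?D E) (sum_list ds + 0)"
        using h2[unfolded multihom_def, THEN conjunct2, rule_format, of xs ds] by (auto elim!: homs2E)
    qed (use h2[unfolded multihom_def multilin2_iff] in simp_all)
    show "glin (?D E) (?D E) 1 (dif (?D E))"
      unfolding glin_iff c
    proof (intro conjI allI ballI)
      show "lin_on E (scal (?D E)) (dif (?D E))" using h1[unfolded multihom_def multilin1_iff[OF E]] by simp
      show "dif (?D E) v \<in> grade (?D E) (n + 1)" if "v \<in> grade (?D E) n" for n v
        using h1[unfolded multihom_def, THEN conjunct2, rule_format, of "[v]" "[n]"] that by (simp add: homs_Cons)
    qed
    show "mul (?D E) (mul (?D E) x y) z = mul (?D E) x (mul (?D E) y z)" if "x \<in> gcar (?D E)" "y \<in> gcar (?D E)" "z \<in> gcar (?D E)" for x y z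
      using that unfolding c by (intro eqI) (simp_all add: o2 f2 g2 s1 s2 fg)
    show "dif (?D E) (dif (?D E) x) = 0" if "x \<in> gcar (?D E)" for x
      using that unfolding c by (intro inj) (simp_all add: o1 f1 g1 s1 s2 fg)
    show "dif (?D E) (mul (?D E) x y) = mul (?D E) (dif (?D E) x) y + scal (?D E) (sg i) (mul (?D E) x (dif (?D E) y))"
      if x: "x \<in> grade (?D E) i" and y: "y \<in> gcar (?D E)" for i x y
    proof -
      have x': "x \<in> grade E i" "x \<in> gcar E" and y': "y \<in> gcar E" using x y c gcar_grade[of x E i] by simp_all
      show ?thesis
        using x' y' s1(3)[OF strict_morphismD(2)[OF f x'(1)] f_gcar[OF y']] s2(3)[OF strict_morphismD(2)[OF g x'(1)] g_gcar[OF y']]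
        by (intro eqI) (simp_all add: o1 o2 f1 f2 g1 g2 f_gcar g_gcar lin_on_add[OF fl] lin_on_scal[OF fl]
            lin_on_add[OF gl] lin_on_scal[OF gl] gcar_closed[OF E])
    qed
  qed
  then show ?thesis using joint_a_infinity by (simp add: fully_manageable_def)
qed

text \<open>The two clauses of goodness are reflected separately: membership of a value in a summand
  by \<open>r\<close>, its vanishing by joint injectivity.\<close>

lemma joint_good_map:
  assumes n: "n \<ge> 1" and g1: "good_map P1 n (ops E1 n)" and g2: "good_map P2 n (ops E2 n)"
    and P: "\<And>i x. x \<in> P i \<Longrightarrow> x \<in> gcar E \<and> f x \<in> P1 i \<and> g x \<in> P2 i"
    and r: "\<And>i x. x \<in> gcar E \<Longrightarrow> f x \<in> P1 i \<Longrightarrow> g x \<in> P2 i \<Longrightarrow> x \<in> P i"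
  shows "good_map P n (ops E n)"
  unfolding good_map_def
proof (intro allI impI)
  fix js xs assume a: "length js = n \<and> set js \<subseteq> {0, 1} \<and> list_all2 (\<lambda>i x. x \<in> P i) js xs"
  then have l: "length xs = n" using list_all2_lengthD by fastforce
  have car: "set xs \<subseteq> gcar E"
    using a P by (metis in_set_conv_nth list_all2_conv_all_nth subsetI)
  have "list_all2 (\<lambda>i x. x \<in> P1 i) js (map f xs)" "list_all2 (\<lambda>i x. x \<in> P2 i) js (map g xs)"
    using a P by (auto simp: list_all2_conv_all_nth)
  then have "if \<forall>j. Suc j < n \<longrightarrow> js ! j \<noteq> js ! Suc j then ops E1 n (map f xs) \<in> P1 (js ! 0) else ops E1 n (map f xs) = 0"
     "if \<forall>j. Suc j < n \<longrightarrow> js ! j \<noteq> js ! Suc j then ops E2 n (map g xs) \<in> P2 (js ! 0) else ops E2 n (map g xs) = 0"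
    using g1 g2 a unfolding good_map_def by blast+
  then show "if \<forall>j. Suc j < n \<longrightarrow> js ! j \<noteq> js ! Suc j then ops E n xs \<in> P (js ! 0) else ops E n xs = 0"
    using fops[OF n l car] gops[OF n l car] closed[OF n l car] r inj by (auto split: if_splits)
qed

end

text \<open>Every term of the cyclicity conditions is a value of the form, hence equal to the
  corresponding term in \<open>E'\<close>; one form-preserving strict morphism suffices for this.
  Nondegeneracy would not be inherited in this way.\<close>

lemma degenerate_cyclic_pullback:
  assumes E: "a_infinity E" and E': "degenerate_cyclic e E'"
    and f: "strict_morphism E E' f" and p: "preserves_forms E E' f"
  shows "degenerate_cyclic e E"
proof -
  have gE: "graded_space E" and gE': "graded_space E'" using E E' by (auto simp: a_infinity_def degenerate_cyclic_def)
  note fl = strict_morphismD(1)[OF f] and fg = strict_morphismD(2)[OF f] and fc = strict_morphism_gcar[OF gE gE' f]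
  have p': "form E [x, y] = form E' [f x, f y]" if "x \<in> gcar E" "y \<in> gcar E" for x y
    using p that by (simp add: preserves_forms_def)
  have h: "multihom E' ground 2 e (form E')" using E' by (simp add: degenerate_cyclic_def)
  show ?thesis
    unfolding degenerate_cyclic_def
  proof (intro conjI allI ballI impI E)
    have b: "multilin E' (*) 2 (form E')" using h by (simp add: multihom_def)
    show "multihom E ground 2 e (form E)"
      unfolding multihom_def multilin2_iff
    proof (intro conjI ballI allI impI)
      fix y assume y: "y \<in> gcar E"
      show "lin_on E (scal ground) (\<lambda>x. form E [x, y])" "lin_on E (scal ground) (\<lambda>x. form E [y, x])"
        using b fc[OF y] y unfolding multilin2_iff
        by (auto simp: lin_on_def p' fc gcar_closed[OF gE] lin_on_add[OF fl, unfolded lin_on_def] lin_on_scal[OF fl, unfolded lin_on_def])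
    next
      fix ds xs assume "length xs = 2 \<and> homs E ds xs"
      then obtain i j x y where *: "ds = [i, j]" "xs = [x, y]" "x \<in> grade E i" "y \<in> grade E j" by (auto elim!: homs2E)
      have "form E' [f x, f y] \<in> grade ground (sum_list ds + e)"
        using h fg[OF *(3)] fg[OF *(4)] unfolding multihom_def *(1)
        by (metis (no_types, lifting) homs_Cons homs_Nil length_two_iff)
      then show "form E xs \<in> grade ground (sum_list ds + e)"
        using p' gcar_grade[OF *(3)] gcar_grade[OF *(4)] * by simp
    qed
    show "sg (i * j) * form E [y, x] = form E [x, y]" if "x \<in> grade E i" "y \<in> grade E j" for i j x y
    proof -
      have "sg (i * j) * form E' [f y, f x] = form E' [f x, f y]"
        using E' fg[OF that(1)] fg[OF that(2)] unfolding degenerate_cyclic_def by blast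
      then show ?thesis using p' gcar_grade[OF that(1)] gcar_grade[OF that(2)] by simp
    qed
    fix n ds xs e0 a0 assume n: "1 \<le> n" and a0: "a0 \<in> grade E e0" and xs: "length xs = n \<and> homs E ds xs"
    have car: "set xs \<subseteq> gcar E" using xs homs_gcar by blast
    have ne: "xs \<noteq> []" using xs n by auto
    note a0' = gcar_grade[OF a0]
    have car': "set (a0 # butlast xs) \<subseteq> gcar E" using car a0' by (auto dest: in_set_butlastD)
    have "form E' [ops E' n (map f xs), f a0] = sg (int n + e0 * sum_list ds) * form E' [ops E' n (f a0 # butlast (map f xs)), last (map f xs)]"
      using E' n xs fg[OF a0] homs_map[of E f E' ds xs, OF fg] unfolding degenerate_cyclic_def by simp
    moreover have "form E [ops E n xs, a0] = form E' [ops E' n (map f xs), f a0]"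
      using p'[OF ops_gcar[OF E n _ car] a0'] xs strict_morphismD(3)[OF f n _ car] by simp
    moreover have "form E [ops E n (a0 # butlast xs), last xs] = form E' [ops E' n (f a0 # butlast (map f xs)), last (map f xs)]"
    proof -
      have "last xs \<in> gcar E" using car last_in_set[OF ne] by blast
      then show ?thesis
        using p'[OF ops_gcar[OF E n _ car'], of "last xs"] xs strict_morphismD(3)[OF f n _ car'] n ne
        by (simp add: map_butlast last_map)
    qed
    ultimately show "form E [ops E n xs, a0] = sg (int n + e0 * sum_list ds) * form E [ops E n (a0 # butlast xs), last xs]"
      by simp
  qed
qed

lemma theta_inv:
  assumes "\<sigma> permutes {..<n}"
  shows "inv (theta (inv \<sigma>)) = theta \<sigma>"
  by (rule inv_unique_comp)
    (auto simp: fun_eq_iff theta_def permutes_inverses[OF assms])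

lemma theta_less:
  assumes "\<sigma> permutes {..<n}" "k < 2 * n"
  shows "theta \<sigma> k < 2 * n"
proof -
  have "\<sigma> (k div 2) < n" using permutes_in_image[OF assms(1), of "k div 2"] assms(2) by auto
  then have "2 * \<sigma> (k div 2) + 1 < 2 * n" by linarith
  moreover have "k mod 2 \<le> 1" by simp
  ultimately show ?thesis unfolding theta_def by linarith
qed

text \<open>
  For the small structures only the transposition of two blocks matters, and it is the square of
  the cyclic rotation.
\<close>

lemma small_degenerate_ultracyclic:
  assumes c: "degenerate_cyclic e E" and s: "small E"
  shows "degenerate_ultracyclic e E"
  unfolding degenerate_ultracyclic_def
proof (intro conjI allI impI c)
  have aE: "a_infinity E" using c by (simp add: degenerate_cyclic_def)
  then have gE: "graded_space E" by (simp add: a_infinity_def)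
  show "essentially_odd E" using s by (auto simp: essentially_odd_def small_def)
  have cyc: "form E [ops E n xs, a0] = sg (int n + e0 * sum_list ds) * form E [ops E n (a0 # butlast xs), last xs]"
    if "n \<ge> 1" "a0 \<in> grade E e0" "length xs = n" "homs E ds xs" for n ds xs e0 a0
    using c that unfolding degenerate_cyclic_def by blast
  have "multilin E (*) 2 (form E)" using c by (simp add: degenerate_cyclic_def multihom_def)
  then have form0: "form E [0, y] = 0" if "y \<in> gcar E" for y
    using lin_on_zero[OF gE, of "(*)" "\<lambda>x. form E [x, y]"] that by (simp add: multilin2_iff)
  fix n \<sigma> ds xs assume n: "1 \<le> n" and a: "\<sigma> permutes {..<n} \<and> length xs = 2 * n \<and> homs E ds xs"
  then have \<sigma>: "\<sigma> permutes {..<n}" and l: "length xs = 2 * n" and h: "homs E ds xs" by auto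
  have ld: "length ds = 2 * n" using homs_length[OF h] l by simp
  have car: "set xs \<subseteq> gcar E" by (rule homs_gcar[OF h])
  let ?ys = "perm_list (theta (inv \<sigma>)) xs"
  have ys: "?ys = map (\<lambda>i. xs ! theta \<sigma> i) [0..<2 * n]" by (simp add: perm_list_def theta_inv[OF \<sigma>] l)
  have ycar: "set ?ys \<subseteq> gcar E" using car theta_less[OF \<sigma>] l by (auto simp: ys)
  have kz: "koszul (theta (inv \<sigma>)) ds = (\<Sum>(i, j) \<in> {(i, j). i < j \<and> j < 2 * n \<and> theta \<sigma> i > theta \<sigma> j}. ds ! theta \<sigma> i * ds ! theta \<sigma> j)"
    unfolding koszul_def theta_inv[OF \<sigma>] ld by simp
  have "form E [ops E (2 * n - 1) (butlast ?ys), last ?ys] = sg (koszul (theta (inv \<sigma>)) ds) * form E [ops E (2 * n - 1) (butlast xs), last xs]"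
  proof (cases "n \<ge> 3")
    case True
    \<comment> \<open>For \<open>n \<ge> 3\<close> the operation has arity
      \<open>2 * n - 1 \<ge> 5\<close> and vanishes by smallness, so both sides are 0.\<close>
    have z: "form E [ops E (2 * n - 1) (butlast zs), last zs] = 0" if "length zs = 2 * n" "set zs \<subseteq> gcar E" for zs
    proof -
      have "2 * n - 1 \<ge> 4" using True by simp
      then have "op_zero E (2 * n - 1)" using s unfolding small_def by blast
      moreover have "set (butlast zs) \<subseteq> gcar E" using that by (auto dest: in_set_butlastD)
      ultimately have "ops E (2 * n - 1) (butlast zs) = 0" using that unfolding op_zero_def by simp
      moreover have "last zs \<in> gcar E" using that n by (metis last_in_set length_0_conv mult_is_0 not_one_le_zero subsetD zero_neq_numeral)
      ultimately show ?thesis using form0 by simp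
    qed
    show ?thesis using z[OF l car] z[OF _ ycar] by (simp add: ys)
  next
    case False
    have id_case: ?thesis if "theta \<sigma> = id"
    proof -
      have "?ys = xs" unfolding ys that id_apply by (rule map_nth[of xs, unfolded l])
      moreover have "koszul (theta (inv \<sigma>)) ds = 0" unfolding kz that by (rule sum.neutral) auto
      ultimately show ?thesis by simp
    qed
    have id_theta: "theta id = id" by (auto simp: theta_def fun_eq_iff)
    from False n consider "n = 1" | "n = 2" by linarith
    then show ?thesis
    proof cases
      case 1
      have "{..<Suc 0} = {0}" by auto
      then have "\<sigma> = id" using \<sigma> 1 by (simp add: permutes_sing)
      then show ?thesis using id_case id_theta by simp
    next
      case 2
      have "{..<2} = {0, 1::nat}" by auto
      then have "\<sigma> = id \<or> \<sigma> = Transposition.transpose 0 1" using \<sigma> 2 permutes_doubleton_iff by metis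
      then show ?thesis
      proof
        assume "\<sigma> = id"
        then show ?thesis using id_case id_theta by simp
      next
        assume t: "\<sigma> = Transposition.transpose 0 1"
        obtain x0 x1 x2 x3 i0 i1 i2 i3 where x: "xs = [x0, x1, x2, x3]" "ds = [i0, i1, i2, i3]"
          "x0 \<in> grade E i0" "x1 \<in> grade E i1" "x2 \<in> grade E i2" "x3 \<in> grade E i3"
          using l h 2 by (auto simp: length_Suc_conv homs_Cons numeral_eq_Suc)
        have th: "theta \<sigma> 0 = 2" "theta \<sigma> 1 = 3" "theta \<sigma> 2 = 0" "theta \<sigma> 3 = 1"
          by (simp_all add: t theta_def)
        have "?ys = [x2, x3, x0, x1]"
          unfolding ys using th by (simp add: 2 x upt_rec numeral_2_eq_2 numeral_3_eq_3)
        \<comment> \<open>Swapping two blocks of length two creates exactly the four inversions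
          between an entry of one block and an entry of the other.\<close>
        moreover have "{(i, j). i < j \<and> j < 2 * n \<and> theta \<sigma> i > theta \<sigma> j} = {(0, 2), (0, 3), (1, 2), (1, 3)}"
        proof -
          have r: "j < 4 \<longleftrightarrow> j = 0 \<or> j = 1 \<or> j = 2 \<or> j = 3" for j :: nat by auto
          have "(i < j \<and> j < 4 \<and> theta \<sigma> i > theta \<sigma> j) \<longleftrightarrow> (i, j) \<in> {(0, 2), (0, 3), (1, 2), (1, 3)}" for i j
          proof
            assume ij: "i < j \<and> j < 4 \<and> theta \<sigma> i > theta \<sigma> j"
            then have "i < 4" by simp
            with ij show "(i, j) \<in> {(0, 2), (0, 3), (1, 2), (1, 3)}" unfolding r using th by (elim conjE disjE) auto
          qed (use th in auto)
          then show ?thesis using 2 by auto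
        qed
        then have "koszul (theta (inv \<sigma>)) ds = i2 * i0 + i2 * i1 + i3 * i0 + i3 * i1"
          unfolding kz using th by (simp add: x numeral_2_eq_2 numeral_3_eq_3)
        \<comment> \<open>Two rotations lead from the swapped blocks back to the original order; the
          two contributions 3 of the arity add up to an even exponent.\<close>
        moreover have "form E [ops E 3 [x2, x3, x0], x1] = sg (3 + i1 * (i2 + i3 + i0)) * form E [ops E 3 [x1, x2, x3], x0]"
          using cyc[of 3 x1 i1 "[x2, x3, x0]" "[i2, i3, i0]"] x by (simp add: homs_Cons add.assoc)
        moreover have "form E [ops E 3 [x1, x2, x3], x0] = sg (3 + i0 * (i1 + i2 + i3)) * form E [ops E 3 [x0, x1, x2], x3]"
          using cyc[of 3 x0 i0 "[x1, x2, x3]" "[i1, i2, i3]"] x by (simp add: homs_Cons add.assoc)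
        moreover have "(sg (3 + i1 * (i2 + i3 + i0)) * sg (3 + i0 * (i1 + i2 + i3)) :: 'a) = sg (i2 * i0 + i2 * i1 + i3 * i0 + i3 * i1)"
          unfolding sg_mult by (rule sg_cong) (cases "even i0"; cases "even i1"; cases "even i2"; cases "even i3"; simp)
        ultimately show ?thesis by (simp add: 2 x mult.assoc[symmetric])
      qed
    qed
  qed
  then show "let ys = ?ys in form E [ops E (2 * n - 1) (butlast ys), last ys] =
      sg (koszul (theta (inv \<sigma>)) ds) * form E [ops E (2 * n - 1) (butlast xs), last xs]"
    by (simp add: Let_def)
qed

section \<open>The structure on the carrier and morphisms of double Poisson algebras\<close>

context dpalg
begin

text \<open>The relations known for homogeneous elements extend to the carrier by multilinearity. In
  the Leibniz rule only the second argument is extended, since the degree of the first one enters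
  the sign.\<close>

lemma BE_fully_manageable: "fully_manageable BE"
proof -
  let ?D = "\<lparr>scal = scal BE, grade = grade BE, mul = (\<lambda>x y. ops BE 2 [x, y]), dif = (\<lambda>x. ops BE 1 [x])\<rparr>"
  have c: "gcar ?D = gcar E" "lin_on ?D = lin_on E" "homs ?D = homs E" "graded_space ?D"
    using E_gs graded_space_cong[of ?D E] gcar_cong[of ?D E] lin_on_cong[of ?D E] homs_cong[of ?D E]
    by simp_all
  have o: "mul ?D = op2" "dif ?D = op1" by (simp_all add: ops_br_def fun_eq_iff)
  have o2: "op2 x y \<in> gcar E" if "x \<in> gcar E" "y \<in> gcar E" for x y
    using multihom_gcar[OF BE_cong(4) BE_cong(4) BE_multihom(2), of "[x, y]"] that by (simp add: BE_cong ops_br_def)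
  have b: "y \<in> gcar E \<Longrightarrow> lin_on E (scal E) (\<lambda>x. op2 x y)" "x \<in> gcar E \<Longrightarrow> lin_on E (scal E) (op2 x)" for x y
    using op2_bilin by (simp_all add: bilin_def)
  have tl: "trilin E E E (scal E) (\<lambda>x y z. op2 (op2 x y) z)" "trilin E E E (scal E) (\<lambda>x y z. op2 x (op2 y z))"
    unfolding trilin_def
    by (auto intro!: b o2 lin_on_compose[of E E _ _ "\<lambda>x. op2 x _"] lin_on_compose[of E E _ _ "op2 _"])
  have "dg_algebra ?D"
    unfolding dg_algebra_def
  proof (intro conjI ballI allI c(4))
    show "multihom ?D ?D 2 0 (\<lambda>xs. mul ?D (xs ! 0) (xs ! 1))"
      unfolding multihom_def multilin2_iff c o
    proof (intro conjI ballI allI impI)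
      fix ds xs assume "length xs = 2 \<and> homs E ds xs"
      then show "op2 (xs ! 0) (xs ! 1) \<in> grade ?D (sum_list ds + 0)" by (auto elim!: homs2E intro: op2_grade)
    qed (use b in simp_all)
    show "glin ?D ?D 1 (dif ?D)"
      unfolding glin_iff c o using op1_lin op1_grade by simp
    show "mul ?D (mul ?D x y) z = mul ?D x (mul ?D y z)" if "x \<in> gcar ?D" "y \<in> gcar ?D" "z \<in> gcar ?D" for x y z
      unfolding o by (rule trilin_eqI[OF E_gs E_gs E_gs tl]) (use that c op2_assoc in auto)
    show "dif ?D (dif ?D x) = 0" if "x \<in> gcar ?D" for x
    proof -
      have "lin_on E (scal E) (\<lambda>x. op1 (op1 x))" by (rule lin_on_compose[OF op1_lin op1_lin op1_gcar_E])
      moreover have "lin_on E (scal E) (\<lambda>x. 0)" by (simp add: lin_on_def vs_sc[OF E_gs])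
      ultimately show ?thesis
        using that lin_on_eqI[OF E_gs, of "scal E" "\<lambda>x. op1 (op1 x)" "scal E" "\<lambda>x. 0" x] op1_op1 unfolding c o by blast
    qed
    show "dif ?D (mul ?D x y) = mul ?D (dif ?D x) y + scal ?D (sg i) (mul ?D x (dif ?D y))"
      if x: "x \<in> grade ?D i" and y: "y \<in> gcar ?D" for i x y
    proof -
      have x': "x \<in> grade E i" "x \<in> gcar E" using x gcar_grade[of x E i] by simp_all
      have "op1 (op2 x y) = op2 (op1 x) y + scal E (sg i) (op2 x (op1 y))"
      proof (rule lin_on_eqI[OF E_gs, of "scal E" "\<lambda>y. op1 (op2 x y)" "scal E" "\<lambda>y. op2 (op1 x) y + scal E (sg i) (op2 x (op1 y))"])
        show "lin_on E (scal E) (\<lambda>y. op1 (op2 x y))"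
          by (rule lin_on_compose[OF b(2)[OF x'(2)] op1_lin]) (rule o2[OF x'(2)])
        have "lin_on E (scal E) (\<lambda>y. op2 x (op1 y))"
          by (rule lin_on_compose[OF op1_lin b(2)[OF x'(2)] op1_gcar_E])
        then show "lin_on E (scal E) (\<lambda>y. op2 (op1 x) y + scal E (sg i) (op2 x (op1 y)))"
          using b(2)[OF op1_gcar_E[OF x'(2)]] by (simp add: lin_on_def vs_sc[OF E_gs] mult.commute)
        show "y \<in> gcar E" using y c by simp
      qed (rule op2_leibniz[OF x'(1)])
      then show ?thesis unfolding o by simp
    qed
  qed
  then show ?thesis using BE_a_infinity by (simp add: fully_manageable_def)
qed

section \<open>Uniqueness of the structure that corresponds to a bracket\<close>

lemma op3_split:
  assumes "a1 \<in> gcar A" "a2 \<in> gcar A" "a3 \<in> gcar A" "f1 \<in> gcar (gdual A)" "f2 \<in> gcar (gdual A)" "f3 \<in> gcar (gdual A)"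
  shows "op3 (a1, f1) (a2, f2) (a3, f3) = op3 (a1, 0) (0, f2) (a3, 0) + op3 (0, f1) (a2, 0) (0, f3)"
  using assms gcar_closed(1)[OF gs] gcar_closed(1)[OF gsd] opM_zero opN_zero by (simp add: op3_def)

text \<open>The eight terms are indexed by the patterns of summands; for a good operation only the
  two alternating ones survive.\<close>

lemma trilin_split:
  assumes T: "trilin E E E (scal E) T"
    and x: "x0 \<in> gcar E" "x1 \<in> gcar E" and y: "y0 \<in> gcar E" "y1 \<in> gcar E" and z: "z0 \<in> gcar E" "z1 \<in> gcar E"
  shows "T (x0 + x1) (y0 + y1) (z0 + z1) = T x0 y0 z0 + T x0 y0 z1 + T x0 y1 z0 + T x0 y1 z1
     + T x1 y0 z0 + T x1 y0 z1 + T x1 y1 z0 + T x1 y1 z1"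
proof -
  have 1: "T (x0 + x1) v w = T x0 v w + T x1 v w" if "v \<in> gcar E" "w \<in> gcar E" for v w
    using T x that by (simp add: trilin_def lin_on_def)
  have 2: "T u (y0 + y1) w = T u y0 w + T u y1 w" if "u \<in> gcar E" "w \<in> gcar E" for u w
    using T y that by (simp add: trilin_def lin_on_def)
  have 3: "T u v (z0 + z1) = T u v z0 + T u v z1" if "u \<in> gcar E" "v \<in> gcar E" for u v
    using T z that by (simp add: trilin_def lin_on_def)
  note s = gcar_closed(2)[OF E_gs]
  show ?thesis
    by (simp only: 1[OF s[OF y] s[OF z]] 2[OF x(1) s[OF z]] 2[OF x(2) s[OF z]]
        3[OF x(1) y(1)] 3[OF x(1) y(2)] 3[OF x(2) y(1)] 3[OF x(2) y(2)] add.assoc)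
qed

lemma corresponds_bracket:
  assumes "corresponds d A m" "a \<in> grade A i" "b \<in> grade A j" "f \<in> grade (gdual A) p" "g \<in> grade (gdual A) q"
  shows "tlift A 2 (\<lambda>ds xs. sg (q * ds ! 0) * f (xs ! 0) * g (xs ! 1)) (dbr A [a, b]) =
    sg (j * (i + q + 1)) * bd_form d A A id [m 3 [(b, 0), (0, g), (a, 0)], (0, f)]"
proof -
  have "\<forall>i j p q. \<forall>a\<in>grade A i. \<forall>b\<in>grade A j. \<forall>f\<in>grade (gdual A) p. \<forall>g\<in>grade (gdual A) q.
        tlift A 2 (\<lambda>ds xs. sg (q * ds ! 0) * f (xs ! 0) * g (xs ! 1)) (dbr A [a, b]) =
          sg (j * (i + q + 1)) * bd_form d A A id [m 3 [(b, 0), (0, g), (a, 0)], (0, f)]"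
    using assms(1) unfolding corresponds_def by (elim conjE)
  then show ?thesis using assms(2-5) by blast
qed

text \<open>
  By nondegeneracy of the form, cyclicity and the formula for the bracket determine the ternary
  operation on the carrier.
\<close>

lemma corresponds_op3:
  assumes c: "corresponds d A m" and xyz: "x \<in> gcar E" "y \<in> gcar E" "z \<in> gcar E"
  shows "m 3 [x, y, z] = op3 x y z"
proof -
  let ?P = "bd_ainf d A m"
  have P: "scal ?P = scal E" "grade ?P = grade E" "ops ?P = m" "form ?P = bd_form d A A id"
    by (simp_all add: bd_ainf_def)
  have Pc: "gcar ?P = gcar E" "lin_on ?P = lin_on E" "homs ?P = homs E"
    using P by (auto intro!: gcar_cong lin_on_cong homs_cong)
  have cyc: "degenerate_cyclic (d - 1) ?P" using c by (simp add: corresponds_def pre_CY_def cyclic_def)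
  then have ai: "a_infinity ?P" by (simp add: degenerate_cyclic_def)
  have good: "good_map (bd_part A A) 3 (m 3)" using c P by (simp add: corresponds_def nice_def good_def)
  have T: "trilin E E E (scal E) (\<lambda>x y z. m 3 [x, y, z])"
  proof -
    have "multilin ?P (scal ?P) 3 (ops ?P 3)"
      using ai by (simp add: a_infinity_def multihom_def)
    then show ?thesis unfolding multilin3_iff P Pc by (auto simp: trilin_def)
  qed
  have al: "(\<forall>l. Suc l < 3 \<longrightarrow> [i, j, k] ! l \<noteq> [i, j, k] ! Suc l) \<longleftrightarrow> i \<noteq> j \<and> j \<noteq> k" for i j k :: nat
    by (auto simp: less_Suc_eq numeral_3_eq_3)
  have gd: "if i \<noteq> j \<and> j \<noteq> k then m 3 [x, y, z] \<in> bd_part A A i else m 3 [x, y, z] = 0"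
    if "i \<in> {0, 1}" "j \<in> {0, 1}" "k \<in> {0, 1}" "x \<in> bd_part A A i" "y \<in> bd_part A A j" "z \<in> bd_part A A k" for i j k x y z
    using good[unfolded good_map_def, rule_format, of "[i, j, k]" "[x, y, z]"] that unfolding al by (auto split: if_splits)
  have g0: "(a, 0) \<in> bd_part A A 0 \<and> (a, 0) \<in> gcar E" if "a \<in> gcar A" for a
    using that gcar_closed(1)[OF gsd] by (simp add: bd_part_def gcar_E)
  have g1: "(0, f) \<in> bd_part A A 1 \<and> (0, f) \<in> gcar E" if "f \<in> gcar (gdual A)" for f
    using that gcar_closed(1)[OF gs] by (simp add: bd_part_def gcar_E)
  have Mh: "m 3 [(b, 0), (0, g), (a, 0)] = op3 (b, 0) (0, g) (a, 0)"
    if b: "b \<in> grade A j" and g: "g \<in> grade (gdual A) q" and a: "a \<in> grade A i" for b g a i j q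
  proof -
    note b' = gcar_grade[OF b] and g' = gcar_grade[OF g] and a' = gcar_grade[OF a]
    have "m 3 [(b, 0), (0, g), (a, 0)] \<in> bd_part A A 0"
      using gd[of 0 1 0] g0[OF b'] g1[OF g'] g0[OF a'] by simp
    then obtain z where z: "m 3 [(b, 0), (0, g), (a, 0)] = (z, 0)" "z \<in> gcar A" by (auto simp: bd_part_def)
    \<comment> \<open>The bracket formula fixes the pairing of \<open>z\<close> with every
      homogeneous functional, and these separate points.\<close>
    have "z = opM b g a"
    proof (rule gcar_eqI[OF gs z(2) gcar_grade[OF opM_grade[OF b g a]]])
      fix p and f :: "'v \<Rightarrow> 'k" assume f: "f \<in> grade (gdual A) p"
      have e: "bd_form d A A id [(u, 0), (0, f)] = sg (d * p) * f u" if "u \<in> gcar A" for u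
        using form_gcar[OF that gcar_grade[OF f], of 0 0] gdual_par[OF gs f that, of d] by simp
      have "sg (j * (i + q + 1)) * bd_form d A A id [m 3 [(b, 0), (0, g), (a, 0)], (0, f)]
          = sg (j * (i + q + 1)) * bd_form d A A id [ops_br 3 [(b, 0), (0, g), (a, 0)], (0, f)]"
        using corresponds_bracket[OF c a b f g] corresponds_bracket[OF corresponds_ops_br a b f g] by simp
      moreover have "ops_br 3 [(b, 0), (0, g), (a, 0)] = (opM b g a, 0)"
        using opN_zero[OF gcar_closed(1)[OF gsd] gcar_closed(1)[OF gs] gcar_closed(1)[OF gsd]]
        by (simp add: ops_br_def op3_def)
      ultimately show "f z = f (opM b g a)"
        unfolding z(1) using e[OF z(2)] e[OF gcar_grade[OF opM_grade[OF b g a]]] by simp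
    qed
    then show ?thesis
      using opN_zero[OF gcar_closed(1)[OF gsd] gcar_closed(1)[OF gs] gcar_closed(1)[OF gsd]] z by (simp add: op3_def)
  qed
  have grE: "a \<in> grade A i \<Longrightarrow> (a, 0) \<in> grade E i" "f \<in> grade (gdual A) (i + d - 1) \<Longrightarrow> (0, f) \<in> grade E i" for a f i
    using grade_closed(1)[OF gs] grade_closed(1)[OF gsd] by (simp_all add: I.bd_grade)
  have Nh: "m 3 [(0, f), (a, 0), (0, g)] = op3 (0, f) (a, 0) (0, g)"
    if f: "f \<in> grade (gdual A) (i + d - 1)" and a: "a \<in> grade A j" and g: "g \<in> grade (gdual A) (k + d - 1)" for f a g i j k
  proof -
    note f' = gcar_grade[OF f] and a' = gcar_grade[OF a] and g' = gcar_grade[OF g]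
    have "m 3 [(0, f), (a, 0), (0, g)] \<in> bd_part A A 1"
      using gd[of 1 0 1] g1[OF f'] g0[OF a'] g1[OF g'] by simp
    then obtain h where h: "m 3 [(0, f), (a, 0), (0, g)] = (0, h)" "h \<in> gcar (gdual A)" by (auto simp: bd_part_def)
    \<comment> \<open>Cyclicity of both structures turns the value at \<open>v\<close> into the
      pairing of \<open>m\<^sub>3(v, tf, a)\<close> with \<open>tg\<close>, which is already
      identified by \<open>Mh\<close>.\<close>
    have "h = opN f a g"
    proof (rule gdual_eqI[OF gs h(2) gcar_grade[OF opN_grade[OF f a g]]])
      fix l v assume v: "v \<in> grade A l"
      have hs: "homs ?P [i, j, k] [(0, f), (a, 0), (0, g)]"
        unfolding Pc using grE f a g by (simp add: homs_Cons)
      have "\<forall>n\<ge>1. \<forall>ds xs e0. \<forall>a0\<in>grade E e0. length xs = n \<and> homs ?P ds xs \<longrightarrow>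
          bd_form d A A id [m n xs, a0] = sg (int n + e0 * sum_list ds) * bd_form d A A id [m n (a0 # butlast xs), last xs]"
        using cyc unfolding degenerate_cyclic_def P by (elim conjE)
      from this[rule_format, of 3 "(v, 0)" l "[(0, f), (a, 0), (0, g)]" "[i, j, k]"]
      have "bd_form d A A id [m 3 [(0, f), (a, 0), (0, g)], (v, 0)]
         = sg (int 3 + l * sum_list [i, j, k]) * bd_form d A A id [m 3 [(v, 0), (0, f), (a, 0)], (0, g)]"
        using hs grE(1)[OF v] by simp
      also have "\<dots> = bd_form d A A id [op3 (0, f) (a, 0) (0, g), (v, 0)]"
        using form_op3[OF grE(2)[OF f] grE(1)[OF a] grE(2)[OF g] grE(1)[OF v]] Mh[OF v f a] by (simp add: add.assoc)
      finally show "h v = opN f a g v"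
        using opM_zero[OF gcar_closed(1)[OF gs] gcar_closed(1)[OF gsd] gcar_closed(1)[OF gs]]
          form_gcar[OF gcar_closed(1)[OF gs] gcar_closed(1)[OF gsd]]
        by (simp add: h op3_def)
    qed
    then show ?thesis
      using opM_zero[OF gcar_closed(1)[OF gs] gcar_closed(1)[OF gsd] gcar_closed(1)[OF gs]] h by (simp add: op3_def)
  qed
  show ?thesis
  proof (rule trilin_eqI[OF E_gs E_gs E_gs T op3_trilin _ xyz])
    fix i j k x y z assume x: "x \<in> grade E i" and y: "y \<in> grade E j" and z: "z \<in> grade E k"
    from x obtain a1 f1 where x: "x = (a1, f1)" "a1 \<in> grade A i" "f1 \<in> grade (gdual A) (i + d - 1)" "a1 \<in> gcar A" "f1 \<in> gcar (gdual A)" by (rule gradeE)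
    from y obtain a2 f2 where y: "y = (a2, f2)" "a2 \<in> grade A j" "f2 \<in> grade (gdual A) (j + d - 1)" "a2 \<in> gcar A" "f2 \<in> gcar (gdual A)" by (rule gradeE)
    from z obtain a3 f3 where z: "z = (a3, f3)" "a3 \<in> grade A k" "f3 \<in> grade (gdual A) (k + d - 1)" "a3 \<in> gcar A" "f3 \<in> gcar (gdual A)" by (rule gradeE)
    have s: "(a, f) = (a, 0) + (0, f)" for a :: 'v and f :: "'v \<Rightarrow> 'k" by simp
    \<comment> \<open>Goodness kills the six patterns that do not alternate.\<close>
    have "m 3 [(a1, 0) + (0, f1), (a2, 0) + (0, f2), (a3, 0) + (0, f3)]
       = m 3 [(a1, 0), (0, f2), (a3, 0)] + m 3 [(0, f1), (a2, 0), (0, f3)]"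
      using trilin_split[OF T, of "(a1, 0)" "(0, f1)" "(a2, 0)" "(0, f2)" "(a3, 0)" "(0, f3)"]
        g0[OF x(4)] g1[OF x(5)] g0[OF y(4)] g1[OF y(5)] g0[OF z(4)] g1[OF z(5)]
        gd[of 0 0 0 "(a1, 0)" "(a2, 0)" "(a3, 0)"] gd[of 0 0 1 "(a1, 0)" "(a2, 0)" "(0, f3)"]
        gd[of 0 1 1 "(a1, 0)" "(0, f2)" "(0, f3)"] gd[of 1 0 0 "(0, f1)" "(a2, 0)" "(a3, 0)"]
        gd[of 1 1 0 "(0, f1)" "(0, f2)" "(a3, 0)"] gd[of 1 1 1 "(0, f1)" "(0, f2)" "(0, f3)"]
      by simp
    then have "m 3 [x, y, z] = m 3 [(a1, 0), (0, f2), (a3, 0)] + m 3 [(0, f1), (a2, 0), (0, f3)]"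
      by (simp add: x y z)
    also have "\<dots> = op3 x y z"
      unfolding x(1) y(1) z(1) op3_split[OF x(4) y(4) z(4) x(5) y(5) z(5)]
      using Mh[OF x(2) y(3) z(2)] Nh[OF x(3) y(2) z(3)] by simp
    finally show "m 3 [x, y, z] = op3 x y z" .
  qed
qed

text \<open>Arities 1 and 2 are prescribed by the correspondence, arity 3 is unique, and smallness
  settles the rest.\<close>

lemma dp_ops_eq:
  assumes n: "n \<ge> 1" and xs: "length xs = n" "set xs \<subseteq> gcar E"
  shows "dp_ops d A n xs = ops_br n xs"
proof -
  note c = dp_ops_corresponds
  consider "n = 1" | "n = 2" | "n = 3" | "n \<ge> 4" using n by linarith
  then show ?thesis
  proof cases
    case 1
    then show ?thesis using c xs by (auto simp: length_one_iff ops_br_def corresponds_def op1_def)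
  next
    case 2
    then show ?thesis using c xs by (auto simp: length_two_iff ops_br_def corresponds_def op2_def)
  next
    case 3
    then show ?thesis using corresponds_op3[OF c] xs by (auto simp: length_three_iff ops_br_def)
  next
    case 4
    have "gcar (bd_ainf d A (dp_ops d A)) = gcar E" by (rule gcar_cong) (simp add: bd_ainf_def)
    then have "dp_ops d A n xs = 0"
      using c 4 xs by (auto simp: corresponds_def nice_def small_def op_zero_def bd_ainf_def)
    then show ?thesis using 4 by (simp add: ops_br_def)
  qed
qed

text \<open>Strictness involves the operations of the target only on images of carrier elements,
  where the chosen structure and the constructed one agree.\<close>

lemma strict_to_dp_ops:
  assumes "strict_morphism F BE f" "graded_space F"
  shows "strict_morphism F (bd_ainf d A (dp_ops d A)) f"
  unfolding strict_morphism_def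
proof (intro conjI allI impI)
  show "glin F (bd_ainf d A (dp_ops d A)) 0 f"
    using assms(1) by (simp add: strict_morphism_def glin_def bd_ainf_def)
  fix n xs assume n: "n \<ge> 1" and xs: "length xs = n \<and> set xs \<subseteq> gcar F"
  have "set (map f xs) \<subseteq> gcar (bd_space d A A)"
    using xs strict_morphism_gcar[OF assms(2) BE_cong(4) assms(1)] by (auto simp: BE_cong)
  then have "dp_ops d A n (map f xs) = ops_br n (map f xs)"
    using dp_ops_eq[OF n] xs by simp
  then show "f (ops F n xs) = ops (bd_ainf d A (dp_ops d A)) n (map f xs)"
    using strict_morphismD(3)[OF assms(1) n] xs by (simp add: bd_ainf_def)
qed

end

section \<open>The A-infinity algebra attached to a morphism\<close>

locale dpmor = A: dpalg d A + B: dpalg d B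
  for d :: int and A :: "('k::field_char_0, 'a::ab_group_add, 'y) dpa_scheme"
    and B :: "('k, 'b::ab_group_add, 'z) dpa_scheme" +
  fixes \<phi> :: "'a \<Rightarrow> 'b"
  assumes dpm: "double_poisson_morphism A B \<phi>"

sublocale dpmor \<subseteq> dgmor A B \<phi> d
  by unfold_locales (use dpm in \<open>simp add: double_poisson_morphism_def\<close>)

context dpmor
begin

abbreviation pf where "pf \<equiv> dual_map A \<phi> :: ('b \<Rightarrow> 'k) \<Rightarrow> 'a \<Rightarrow> 'k"

lemma pf_grade:
  assumes f: "f \<in> grade (gdual B) p"
  shows "pf f \<in> grade (gdual A) p"
proof (rule gdualI)
  show "lin_on A (*) (pf f)"
    using lin_on_compose[OF phi_lin gdualD(1)[OF f] phi_gcar]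
    by (simp add: lin_on_def dual_map_def gcar_closed[OF A.gs])
  show "pf f v = 0" if "v \<in> grade A m" "m + p \<noteq> 0" for m v
    using gdualD(2)[OF f phi_grade[OF that(1)] that(2)] by (simp add: dual_map_def)
qed (simp add: dual_map_def)

lemma pf_lin: "lin_on (gdual B) (scal (gdual A)) pf"
  by (auto simp: lin_on_def dual_map_def fun_eq_iff)

lemma pf_gcar: "f \<in> gcar (gdual B) \<Longrightarrow> pf f \<in> gcar (gdual A)"
  by (rule lin_on_gcar[OF B.gsd A.gsd pf_lin]) (auto intro: gcar_grade[OF pf_grade])

lemma pf_zero: "pf 0 = 0"
  by (simp add: dual_map_def fun_eq_iff)

text \<open>The morphism condition is an equality of tensors over \<open>B\<close>; evaluating its
  left side on \<open>f\<close> and \<open>g\<close> is evaluating the bracket of \<open>A\<close>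
  on their pullbacks.\<close>

lemma br_phi:
  assumes a: "a \<in> grade A i" and b: "b \<in> grade A j" and f: "f \<in> grade (gdual B) p" and g: "g \<in> grade (gdual B) q"
  shows "B.br (\<phi> a) (\<phi> b) f g = A.br a b (pf f) (pf g)"
proof -
  note f' = gdualD(1)[OF f] and g' = gdualD(1)[OF g]
  have "tlift A 2 (\<lambda>_ xs. pure B [\<phi> (xs ! 0), \<phi> (xs ! 1)]) (dbr A [a, b]) = dbr B [\<phi> a, \<phi> b]"
    using dpm gcar_grade[OF a] gcar_grade[OF b] by (simp add: double_poisson_morphism_def)
  then have "B.br (\<phi> a) (\<phi> b) f g
      = tlift A 2 (\<lambda>_ xs. pure B [\<phi> (xs ! 0), \<phi> (xs ! 1)]) (dbr A [a, b]) (\<lambda>xs. f (xs ! 0) * g (xs ! 1))"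
    by (simp add: B.br_def)
  also have "\<dots> = A.br a b (pf f) (pf g)"
    unfolding A.br_def
    by (rule tlift_eval[OF A.dbr_tens[OF a b] multilin_prod2[OF gdualD(1)[OF pf_grade[OF f]] gdualD(1)[OF pf_grade[OF g]]]])
      (use multilin_prod2[OF f' g'] in \<open>auto simp: pure_def dual_map_def numeral_2_eq_2 gcar_grade elim!: homs2E[unfolded numeral_2_eq_2]\<close>)
  finally show ?thesis .
qed

text \<open>Under a functional on \<open>B\<close> both sides become the same bracket value by
  \<open>br_phi\<close>, with equal signs because \<open>\<phi>\<close> and the pullback preserve
  degrees. This is strictness in arity 3 of the map to the structure of \<open>B\<close>.\<close>

lemma opM_phi:
  assumes "b \<in> gcar A" "g \<in> gcar (gdual B)" "a \<in> gcar A"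
  shows "\<phi> (A.opM b (pf g) a) = B.opM (\<phi> b) g (\<phi> a)"
proof (rule trilin_eqI[OF A.gs B.gsd A.gs _ _ _ assms])
  have M: "A.opM b g a \<in> gcar A" if "b \<in> gcar A" "g \<in> gcar (gdual A)" "a \<in> gcar A" for b g a
    using A.op3_gcar_E[of "(b, 0)" "(0, g)" "(a, 0)"] that gcar_closed(1)[OF A.gs] gcar_closed(1)[OF A.gsd]
    by (simp add: A.gcar_E A.op3_def)
  show "trilin A (gdual B) A (scal B) (\<lambda>b g a. \<phi> (A.opM b (pf g) a))"
    unfolding trilin_def
  proof (intro conjI ballI)
    fix y z assume y: "y \<in> gcar (gdual B)" and z: "z \<in> gcar A"
    show "lin_on A (scal B) (\<lambda>x. \<phi> (A.opM x (pf y) z))"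
      by (rule lin_on_compose[OF _ phi_lin M]) (use A.opM_trilin pf_gcar[OF y] z in \<open>auto simp: trilin_def\<close>)
  next
    fix x z assume x: "x \<in> gcar A" and z: "z \<in> gcar A"
    have "lin_on (gdual B) (scal A) (\<lambda>y. A.opM x (pf y) z)"
      by (rule lin_on_compose[OF pf_lin _ pf_gcar]) (use A.opM_trilin x z in \<open>auto simp: trilin_def\<close>)
    then show "lin_on (gdual B) (scal B) (\<lambda>y. \<phi> (A.opM x (pf y) z))"
      by (rule lin_on_compose[OF _ phi_lin M]) (use x z pf_gcar in auto)
  next
    fix x y assume x: "x \<in> gcar A" and y: "y \<in> gcar (gdual B)"
    show "lin_on A (scal B) (\<lambda>z. \<phi> (A.opM x (pf y) z))"
      by (rule lin_on_compose[OF _ phi_lin M]) (use A.opM_trilin pf_gcar[OF y] x in \<open>auto simp: trilin_def\<close>)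
  qed
  show "trilin A (gdual B) A (scal B) (\<lambda>b g a. B.opM (\<phi> b) g (\<phi> a))"
    unfolding trilin_def
  proof (intro conjI ballI)
    fix y z assume y: "y \<in> gcar (gdual B)" and z: "z \<in> gcar A"
    show "lin_on A (scal B) (\<lambda>x. B.opM (\<phi> x) y (\<phi> z))" "lin_on A (scal B) (\<lambda>x. B.opM (\<phi> z) y (\<phi> x))"
      by (rule lin_on_compose[OF phi_lin _ phi_gcar]; use B.opM_trilin phi_gcar[OF z] y in \<open>auto simp: trilin_def\<close>)+
  next
    fix x z assume x: "x \<in> gcar A" and z: "z \<in> gcar A"
    show "lin_on (gdual B) (scal B) (\<lambda>y. B.opM (\<phi> x) y (\<phi> z))"
      using B.opM_trilin phi_gcar[OF x] phi_gcar[OF z] by (auto simp: trilin_def)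
  qed
  fix j q i b g a assume b: "b \<in> grade A j" and g: "g \<in> grade (gdual B) q" and a: "a \<in> grade A i"
  note M1 = A.opM_grade[OF b pf_grade[OF g] a]
  show "\<phi> (A.opM b (pf g) a) = B.opM (\<phi> b) g (\<phi> a)"
  proof (rule grade_eqI[OF B.gs phi_grade[OF M1] B.opM_grade[OF phi_grade[OF b] g phi_grade[OF a]]])
    fix f :: "'b \<Rightarrow> 'k" assume f: "f \<in> grade (gdual B) (- (j + q + i - d))"
    have "f (\<phi> (A.opM b (pf g) a)) = pf f (A.opM b (pf g) a)"
      using gcar_grade[OF M1] by (simp add: dual_map_def)
    also have "\<dots> = sg (- (j + q + i - d) * q + j * (i + q + 1) + - (j + q + i - d) * d) * A.br a b (pf f) (pf g)"
      by (rule A.opM_eval[OF b pf_grade[OF g] a pf_grade[OF f]]) simp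
    also have "\<dots> = f (B.opM (\<phi> b) g (\<phi> a))"
      unfolding br_phi[OF a b f g, symmetric]
      by (rule B.opM_eval[OF phi_grade[OF b] g phi_grade[OF a] f, symmetric]) simp
    finally show "f (\<phi> (A.opM b (pf g) a)) = f (B.opM (\<phi> b) g (\<phi> a))" .
  qed
qed

text \<open>Evaluation at \<open>x\<close> rotates the claim into \<open>opM_phi\<close> for
  \<open>x\<close>, \<open>f\<close>, \<open>b\<close>, tested by \<open>h\<close>. This is
  strictness in arity 3 of the map to the structure of \<open>A\<close>.\<close>

lemma opN_phi:
  assumes "f \<in> gcar (gdual B)" "b \<in> gcar A" "h \<in> gcar (gdual B)"
  shows "pf (B.opN f (\<phi> b) h) = A.opN (pf f) b (pf h)"
proof (rule trilin_eqI[OF B.gsd A.gs B.gsd _ _ _ assms])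
  have N: "B.opN f a g \<in> gcar (gdual B)" if "f \<in> gcar (gdual B)" "a \<in> gcar B" "g \<in> gcar (gdual B)" for f a g
    using B.op3_gcar_E[of "(0, f)" "(a, 0)" "(0, g)"] that gcar_closed(1)[OF B.gs] gcar_closed(1)[OF B.gsd]
    by (simp add: B.gcar_E B.op3_def)
  show "trilin (gdual B) A (gdual B) (scal (gdual A)) (\<lambda>f b h. pf (B.opN f (\<phi> b) h))"
    unfolding trilin_def
  proof (intro conjI ballI)
    fix y z assume y: "y \<in> gcar A" and z: "z \<in> gcar (gdual B)"
    show "lin_on (gdual B) (scal (gdual A)) (\<lambda>x. pf (B.opN x (\<phi> y) z))" "lin_on (gdual B) (scal (gdual A)) (\<lambda>x. pf (B.opN z (\<phi> y) x))"
      by (rule lin_on_compose[OF _ pf_lin N]; use B.opN_trilin phi_gcar[OF y] z in \<open>unfold trilin_def, blast\<close>)+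
  next
    fix x z assume x: "x \<in> gcar (gdual B)" and z: "z \<in> gcar (gdual B)"
    have "lin_on A (scal (gdual B)) (\<lambda>y. B.opN x (\<phi> y) z)"
      by (rule lin_on_compose[OF phi_lin _ phi_gcar]) (use B.opN_trilin x z in \<open>unfold trilin_def, blast\<close>)
    then show "lin_on A (scal (gdual A)) (\<lambda>y. pf (B.opN x (\<phi> y) z))"
      by (rule lin_on_compose[OF _ pf_lin N]) (use x z phi_gcar in auto)
  qed
  show "trilin (gdual B) A (gdual B) (scal (gdual A)) (\<lambda>f b h. A.opN (pf f) b (pf h))"
    unfolding trilin_def
  proof (intro conjI ballI)
    fix y z assume y: "y \<in> gcar A" and z: "z \<in> gcar (gdual B)"
    show "lin_on (gdual B) (scal (gdual A)) (\<lambda>x. A.opN (pf x) y (pf z))" "lin_on (gdual B) (scal (gdual A)) (\<lambda>x. A.opN (pf z) y (pf x))"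
      by (rule lin_on_compose[OF pf_lin _ pf_gcar]; use A.opN_trilin pf_gcar[OF z] y in \<open>unfold trilin_def, blast\<close>)+
  next
    fix x z assume x: "x \<in> gcar (gdual B)" and z: "z \<in> gcar (gdual B)"
    show "lin_on A (scal (gdual A)) (\<lambda>y. A.opN (pf x) y (pf z))"
      using A.opN_trilin pf_gcar[OF x] pf_gcar[OF z] unfolding trilin_def by blast
  qed
  fix p i q f b h assume f: "f \<in> grade (gdual B) p" and b: "b \<in> grade A i" and h: "h \<in> grade (gdual B) q"
  show "pf (B.opN f (\<phi> b) h) = A.opN (pf f) b (pf h)"
  proof (rule gdual_eqI[OF A.gs gcar_grade[OF pf_grade[OF B.opN_grade[OF f phi_grade[OF b] h]]]
        gcar_grade[OF A.opN_grade[OF pf_grade[OF f] b pf_grade[OF h]]]])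
    fix n x assume x: "x \<in> grade A n"
    note x' = gcar_grade[OF x]
    have "pf (B.opN f (\<phi> b) h) x = sg (1 + q + (d + 1) * (p + i)) * h (B.opM (\<phi> x) f (\<phi> b))"
      using B.opN_eval[OF f phi_grade[OF b] h phi_gcar[OF x']] x' by (simp add: dual_map_def)
    also have "h (B.opM (\<phi> x) f (\<phi> b)) = pf h (A.opM x (pf f) b)"
      using opM_phi[OF x' gcar_grade[OF f] gcar_grade[OF b]] gcar_grade[OF A.opM_grade[OF x pf_grade[OF f] b]]
      by (simp add: dual_map_def)
    also have "sg (1 + q + (d + 1) * (p + i)) * pf h (A.opM x (pf f) b) = A.opN (pf f) b (pf h) x"
      by (rule A.opN_eval[OF pf_grade[OF f] b pf_grade[OF h] x', symmetric])
    finally show "pf (B.opN f (\<phi> b) h) x = A.opN (pf f) b (pf h) x" .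
  qed
qed

abbreviation D where "D \<equiv> bd_mor d A B \<phi>"

lemma D_simps: "scal D = scal (bd_space d A B)" "grade D = grade (bd_space d A B)" "form D = bd_form d A B \<phi>"
  by (simp_all add: bd_mor_def)

lemma D_gcar: "gcar D = gcar A \<times> gcar (gdual B)"
  using gcar_cong[of D "bd_space d A B"] by (simp add: D_simps bd_gcar)

lemma D_gs: "graded_space D"
  using graded_space_cong[of D "bd_space d A B"] bd_gs by (simp add: D_simps)

lemma D_high: "n \<ge> 4 \<Longrightarrow> ops D n xs = 0"
  by (simp add: bd_mor_def)

lemma D_op1: "f \<in> gcar (gdual B) \<Longrightarrow> ops D 1 [(a, f)] = (dif A a, \<lambda>c. if c \<in> gcar B then sg d * f (par B 1 (dif B c)) else 0)"
  by (simp add: bd_mor_def bd_dif_closed)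

lemma D_op2: "a \<in> gcar A \<Longrightarrow> g \<in> gcar (gdual B) \<Longrightarrow> ops D 2 [(a, f), (b, g)] =
    (mul A a b, \<lambda>c. if c \<in> gcar B then f (mul B (\<phi> b) c) + g (mul B c (\<phi> (par A d a))) else 0)"
  by (simp add: bd_mor_def bd_mul_closed)

text \<open>The operation is defined through the chosen structures of \<open>A\<close> and
  \<open>B\<close>; uniqueness on the carriers replaces them by the explicit ones.\<close>

lemma D_op3:
  assumes "a \<in> gcar A" "b \<in> gcar A" "c \<in> gcar A" "f \<in> gcar (gdual B)" "g \<in> gcar (gdual B)" "h \<in> gcar (gdual B)"
  shows "ops D 3 [(a, f), (b, g), (c, h)] = (A.opM a (pf g) c, B.opN f (\<phi> b) h)"
proof -
  have "dp_ops d A 3 [(a, 0), (0, pf g), (c, 0)] = A.op3 (a, 0) (0, pf g) (c, 0)"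
    using A.dp_ops_eq[of 3 "[(a, 0), (0, pf g), (c, 0)]"] assms pf_gcar gcar_closed(1)[OF A.gs] gcar_closed(1)[OF A.gsd]
    by (simp add: A.gcar_E A.ops_br_def)
  moreover have "dp_ops d B 3 [(0, f), (\<phi> b, 0), (0, h)] = B.op3 (0, f) (\<phi> b, 0) (0, h)"
    using B.dp_ops_eq[of 3 "[(0, f), (\<phi> b, 0), (0, h)]"] assms phi_gcar gcar_closed(1)[OF B.gs] gcar_closed(1)[OF B.gsd]
    by (simp add: B.gcar_E B.ops_br_def)
  ultimately show ?thesis
    by (simp add: bd_mor_def mor_op3_def A.op3_def B.op3_def)
qed

lemma pull_glin: "glin D A.BE 0 (pull_dual A \<phi>)"
  unfolding glin_iff
proof (intro conjI allI ballI)
  show "lin_on D (scal A.BE) (pull_dual A \<phi>)"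
    using pf_lin by (auto simp: lin_on_def D_gcar D_simps bd_scal A.scal_E pull_dual_def)
  show "pull_dual A \<phi> v \<in> grade A.BE (n + 0)" if "v \<in> grade D n" for n v
    using that pf_grade by (cases v) (auto simp: D_simps bd_grade A.I.bd_grade pull_dual_def)
qed

lemma push_glin: "glin D B.BE 0 (push_alg \<phi>)"
  unfolding glin_iff
proof (intro conjI allI ballI)
  show "lin_on D (scal B.BE) (push_alg \<phi>)"
    using phi_lin by (auto simp: lin_on_def D_gcar D_simps bd_scal B.scal_E push_alg_def)
  show "push_alg \<phi> v \<in> grade B.BE (n + 0)" if "v \<in> grade D n" for n v
    using that phi_grade by (cases v) (auto simp: D_simps bd_grade B.I.bd_grade push_alg_def)
qed

text \<open>The \<open>A\<close>-components agree by construction. For the functionals, arities 1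
  and 2 are dual to \<open>\<phi>\<close> respecting differentials, products and sign operators, and
  arity 3 is \<open>opN_phi\<close>.\<close>

lemma pull_strict: "strict_morphism D A.BE (pull_dual A \<phi>)"
  unfolding strict_morphism_def
proof (intro conjI allI impI pull_glin)
  fix n xs assume n: "n \<ge> 1" and xs: "length xs = n \<and> set xs \<subseteq> gcar D"
  consider "n = 1" | "n = 2" | "n = 3" | "n \<ge> 4" using n by linarith
  then show "pull_dual A \<phi> (ops D n xs) = ops A.BE n (map (pull_dual A \<phi>) xs)"
  proof cases
    case 1
    then obtain a f where x: "xs = [(a, f)]" "a \<in> gcar A" "f \<in> gcar (gdual B)"
      using xs by (auto simp: length_one_iff D_gcar)
    have "pf (\<lambda>c. if c \<in> gcar B then sg d * f (par B 1 (dif B c)) else 0)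
        = (\<lambda>c. if c \<in> gcar A then sg d * pf f (par A 1 (dif A c)) else 0)"
      by (auto simp: dual_map_def fun_eq_iff phi_gcar phi_par phi_dif A.dif_gcar par_gcar[OF A.gs])
    then show ?thesis using 1 x D_op1[OF x(3)] by (simp add: A.ops_br_def A.op1_gcar pf_gcar pull_dual_def)
  next
    case 2
    then obtain a f b g where x: "xs = [(a, f), (b, g)]" "a \<in> gcar A" "f \<in> gcar (gdual B)" "b \<in> gcar A" "g \<in> gcar (gdual B)"
      using xs by (auto simp: length_two_iff D_gcar)
    have "pf (\<lambda>c. if c \<in> gcar B then f (mul B (\<phi> b) c) + g (mul B c (\<phi> (par A d a))) else 0)
        = (\<lambda>c. if c \<in> gcar A then pf f (mul A b c) + pf g (mul A c (par A d a)) else 0)"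
      by (auto simp: dual_map_def fun_eq_iff phi_gcar phi_mul A.mul_gcar par_gcar[OF A.gs] x)
    then show ?thesis using 2 x D_op2[OF x(2,5)] by (simp add: A.ops_br_def A.op2_gcar pf_gcar pull_dual_def)
  next
    case 3
    then obtain a f b g c h where x: "xs = [(a, f), (b, g), (c, h)]" "a \<in> gcar A" "f \<in> gcar (gdual B)" "b \<in> gcar A" "g \<in> gcar (gdual B)"
        "c \<in> gcar A" "h \<in> gcar (gdual B)"
      using xs by (auto simp: length_three_iff D_gcar)
    show ?thesis using 3 x D_op3[OF x(2,4,6,3,5,7)] opN_phi[OF x(3,4,7)]
      by (simp add: A.ops_br_def A.op3_def pull_dual_def)
  next
    case 4
    then show ?thesis by (simp add: D_high A.ops_br_def pull_dual_def zero_prod_def dual_map_def fun_eq_iff)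
  qed
qed

text \<open>Here the functionals agree by construction; the other components express that
  \<open>\<phi>\<close> respects differentials and products, and in arity 3
  \<open>opM_phi\<close>.\<close>

lemma push_strict: "strict_morphism D B.BE (push_alg \<phi>)"
  unfolding strict_morphism_def
proof (intro conjI allI impI push_glin)
  fix n xs assume n: "n \<ge> 1" and xs: "length xs = n \<and> set xs \<subseteq> gcar D"
  consider "n = 1" | "n = 2" | "n = 3" | "n \<ge> 4" using n by linarith
  then show "push_alg \<phi> (ops D n xs) = ops B.BE n (map (push_alg \<phi>) xs)"
  proof cases
    case 1
    then obtain a f where x: "xs = [(a, f)]" "a \<in> gcar A" "f \<in> gcar (gdual B)"
      using xs by (auto simp: length_one_iff D_gcar)
    then show ?thesis using 1 D_op1[OF x(3)] by (simp add: B.ops_br_def B.op1_gcar phi_dif push_alg_def)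
  next
    case 2
    then obtain a f b g where x: "xs = [(a, f), (b, g)]" "a \<in> gcar A" "f \<in> gcar (gdual B)" "b \<in> gcar A" "g \<in> gcar (gdual B)"
      using xs by (auto simp: length_two_iff D_gcar)
    then show ?thesis using 2 D_op2[OF x(2,5)]
      by (simp add: B.ops_br_def B.op2_gcar phi_gcar phi_mul phi_par push_alg_def cong: if_cong)
  next
    case 3
    then obtain a f b g c h where x: "xs = [(a, f), (b, g), (c, h)]" "a \<in> gcar A" "f \<in> gcar (gdual B)" "b \<in> gcar A" "g \<in> gcar (gdual B)"
        "c \<in> gcar A" "h \<in> gcar (gdual B)"
      using xs by (auto simp: length_three_iff D_gcar)
    show ?thesis using 3 x D_op3[OF x(2,4,6,3,5,7)] opM_phi[OF x(2,5,6)]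
      by (simp add: B.ops_br_def B.op3_def push_alg_def)
  next
    case 4
    then show ?thesis using lin_on_zero[OF A.gs phi_lin] by (simp add: D_high B.ops_br_def push_alg_def zero_prod_def)
  qed
qed

lemma pull_forms: "preserves_forms D A.BE (pull_dual A \<phi>)"
  unfolding preserves_forms_def
proof (intro ballI)
  fix x y assume "x \<in> gcar D" "y \<in> gcar D"
  then obtain a f b g where x: "x = (a, f)" "y = (b, g)" "a \<in> gcar A" "b \<in> gcar A" "f \<in> gcar (gdual B)" "g \<in> gcar (gdual B)"
    by (cases x, cases y) (auto simp: D_gcar)
  have "bd_form d A A id [(a, pf f), (b, pf g)] = pf f b + pf g (par A d a)"
    by (rule A.form_gcar[OF x(3) pf_gcar[OF x(6)]])
  then show "form D [x, y] = form A.BE [pull_dual A \<phi> x, pull_dual A \<phi> y]"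
    using x par_gcar[OF A.gs x(3), of d] by (simp add: D_simps bd_form_closed pull_dual_def) (simp add: dual_map_def)
qed

lemma push_forms: "preserves_forms D B.BE (push_alg \<phi>)"
  unfolding preserves_forms_def
  by (auto simp: D_gcar D_simps bd_form_closed B.form_gcar push_alg_def phi_gcar phi_par)

sublocale joint: joint_strict D A.BE B.BE "pull_dual A \<phi>" "push_alg \<phi>"
proof
  show "u = 0" if "u \<in> gcar D" "pull_dual A \<phi> u = 0" "push_alg \<phi> u = 0" for u
    using that by (cases u) (auto simp: pull_dual_def push_alg_def zero_prod_def)
  show "u \<in> grade D n" if "u \<in> gcar D" "pull_dual A \<phi> u \<in> grade A.BE n" "push_alg \<phi> u \<in> grade B.BE n" for u n
    using that by (cases u) (auto simp: pull_dual_def push_alg_def D_simps bd_grade A.I.bd_grade B.I.bd_grade)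
  fix n xs assume n: "n \<ge> 1" "length xs = n" "set xs \<subseteq> gcar D"
  have 1: "set (map (pull_dual A \<phi>) xs) \<subseteq> gcar A.BE"
    using n strict_morphism_gcar[OF D_gs A.BE_cong(4) pull_strict] by auto
  have 2: "set (map (push_alg \<phi>) xs) \<subseteq> gcar B.BE"
    using n strict_morphism_gcar[OF D_gs B.BE_cong(4) push_strict] by auto
  have "pull_dual A \<phi> (ops D n xs) \<in> gcar A.BE"
    unfolding strict_morphismD(3)[OF pull_strict n] using ops_gcar[OF A.BE_a_infinity n(1) _ 1] n(2) by simp
  moreover have "push_alg \<phi> (ops D n xs) \<in> gcar B.BE"
    unfolding strict_morphismD(3)[OF push_strict n] using ops_gcar[OF B.BE_a_infinity n(1) _ 2] n(2) by simp
  \<comment> \<open>Membership in the carrier is known for both images, and each component of the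
    value occurs unchanged in one of them.\<close>
  ultimately show "ops D n xs \<in> gcar D"
    by (cases "ops D n xs") (auto simp: D_gcar A.BE_cong B.BE_cong A.gcar_E B.gcar_E pull_dual_def push_alg_def)
qed (rule D_gs A.BE_a_infinity B.BE_a_infinity pull_strict push_strict)+

lemma D_degenerate_cyclic: "degenerate_cyclic (d - 1) D"
  by (rule degenerate_cyclic_pullback[OF joint.joint_a_infinity A.BE_degenerate_cyclic pull_strict pull_forms])

lemma D_small: "small D"
  by (simp add: small_def op_zero_def D_high)

lemma D_ultracyclic: "degenerate_ultracyclic (d - 1) D"
  by (rule small_degenerate_ultracyclic[OF D_degenerate_cyclic D_small])

lemma D_fully_manageable: "fully_manageable D"
  by (rule joint.joint_fully_manageable[OF A.BE_fully_manageable B.BE_fully_manageable])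

lemma D_nice: "nice (bd_part A B) D"
  unfolding nice_def good_def
proof (intro conjI allI impI joint.joint_a_infinity D_small)
  show "essentially_odd D" using D_small by (auto simp: essentially_odd_def small_def)
  fix n :: nat assume n: "odd n"
  then have "n \<ge> 1" using odd_pos by fastforce
  then show "good_map (bd_part A B) n (ops D n)"
  proof (rule joint.joint_good_map[OF _ A.BE_good_map[OF n] B.BE_good_map[OF n]])
    show "x \<in> gcar D \<and> pull_dual A \<phi> x \<in> bd_part A A i \<and> push_alg \<phi> x \<in> bd_part B B i" if "x \<in> bd_part A B i" for i x
      using that gcar_closed(1)[OF A.gs] gcar_closed(1)[OF B.gsd] lin_on_zero[OF A.gs phi_lin]
      by (cases x) (auto simp: bd_part_def D_gcar pull_dual_def push_alg_def pf_gcar pf_zero phi_gcar split: if_splits)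
    show "x \<in> bd_part A B i" if "x \<in> gcar D" "pull_dual A \<phi> x \<in> bd_part A A i" "push_alg \<phi> x \<in> bd_part B B i" for i x
      using that by (cases x) (auto simp: bd_part_def D_gcar pull_dual_def push_alg_def split: if_splits)
  qed
qed

end

section \<open>Two composable morphisms of double Poisson algebras\<close>

locale dpcomp = F: dpmor d A B \<phi> + G: dpmor d B C \<psi>
  for d :: int and A :: "('k::field_char_0, 'a::ab_group_add, 'x) dpa_scheme"
    and B :: "('k, 'b::ab_group_add, 'y) dpa_scheme" and C :: "('k, 'c::ab_group_add, 'z) dpa_scheme"
    and \<phi> :: "'a \<Rightarrow> 'b" and \<psi> :: "'b \<Rightarrow> 'c"
begin

lemma comp_dga_morphism: "dga_morphism A C (\<psi> \<circ> \<phi>)"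
  unfolding dga_morphism_def glin_iff
  using lin_on_compose[OF F.phi_lin G.phi_lin F.phi_gcar] F.phi_grade G.phi_grade
  by (auto simp: o_def F.phi_mul G.phi_mul F.phi_dif G.phi_dif F.phi_gcar)

text \<open>A form over \<open>C\<close> is pulled back along \<open>\<psi>\<close> to
  \<open>B\<close> and from there along \<open>\<phi>\<close> to \<open>A\<close>, one morphism
  condition for each step. Arbitrary forms are needed, not only products of functionals, because
  tensors are equal when they are equal as functions.\<close>

lemma comp_double_poisson_morphism: "double_poisson_morphism A C (\<psi> \<circ> \<phi>)"
  unfolding double_poisson_morphism_def
proof (intro conjI ballI comp_dga_morphism)
  fix a b assume a: "a \<in> gcar A" and b: "b \<in> gcar A"
  note Ta = F.A.dbr_tens_gcar[OF a b] and Tb = F.B.dbr_tens_gcar[OF F.phi_gcar[OF a] F.phi_gcar[OF b]]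
  have F: "tlift A 2 (\<lambda>_ xs. pure B [\<phi> (xs ! 0), \<phi> (xs ! 1)]) (dbr A [a, b]) = dbr B [\<phi> a, \<phi> b]"
    using F.dpm a b by (simp add: double_poisson_morphism_def)
  have G: "tlift B 2 (\<lambda>_ xs. pure C [\<psi> (xs ! 0), \<psi> (xs ! 1)]) (dbr B [\<phi> a, \<phi> b]) = dbr C [\<psi> (\<phi> a), \<psi> (\<phi> b)]"
    using G.dpm F.phi_gcar[OF a] F.phi_gcar[OF b] by (simp add: double_poisson_morphism_def)
  show "tlift A 2 (\<lambda>_ xs. pure C [(\<psi> \<circ> \<phi>) (xs ! 0), (\<psi> \<circ> \<phi>) (xs ! 1)]) (dbr A [a, b]) = dbr C [(\<psi> \<circ> \<phi>) a, (\<psi> \<circ> \<phi>) b]"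
  proof
    fix \<beta>
    have pull: "multilin V (*) 2 (\<lambda>xs. \<gamma> [h (xs ! 0), h (xs ! 1)] :: 'k)"
      if "multilin W (*) 2 \<gamma>" "lin_on V (scal W) h" "\<And>x. x \<in> gcar V \<Longrightarrow> h x \<in> gcar W"
      for V :: "('k, 'u::ab_group_add, 'i) gvs_scheme" and W :: "('k, 'w::ab_group_add, 'j) gvs_scheme" and \<gamma> h
      using that unfolding multilin2_iff by (auto intro!: lin_on_compose[OF that(2)])
    \<comment> \<open>\<open>pure\<close> is 0 on functions that are not multilinear; the default 0
      makes the computation valid for every \<open>\<beta>\<close>.\<close>
    define \<gamma> where "\<gamma> xs = (if multilin C (*) 2 \<beta> then \<beta> [\<psi> (xs ! 0), \<psi> (xs ! 1)] else 0)" for xs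
    have \<gamma>: "multilin B (*) 2 \<gamma>"
    proof (cases "multilin C (*) 2 \<beta>")
      case True
      then show ?thesis using pull[OF True G.phi_lin G.phi_gcar] by (simp add: \<gamma>_def[abs_def])
    next
      case False
      then have "\<gamma> = (\<lambda>_. 0)" by (simp add: \<gamma>_def fun_eq_iff)
      then show ?thesis by (simp add: multilin2_iff lin_on_ground)
    qed
    have \<gamma>': "multilin A (*) 2 (\<lambda>xs. \<gamma> [\<phi> (xs ! 0), \<phi> (xs ! 1)])"
      by (rule pull[OF \<gamma> F.phi_lin F.phi_gcar])
    have "dbr C [\<psi> (\<phi> a), \<psi> (\<phi> b)] \<beta> = dbr B [\<phi> a, \<phi> b] \<gamma>"
      unfolding G[symmetric]
      by (rule tlift_eval[OF Tb \<gamma>]) (simp add: pure_def \<gamma>_def numeral_2_eq_2)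
    also have "\<dots> = dbr A [a, b] (\<lambda>xs. \<gamma> [\<phi> (xs ! 0), \<phi> (xs ! 1)])"
      unfolding F[symmetric]
      by (rule tlift_eval[OF Ta \<gamma>']) (use \<gamma> in \<open>simp add: pure_def numeral_2_eq_2\<close>)
    also have "\<dots> = tlift A 2 (\<lambda>_ xs. pure C [(\<psi> \<circ> \<phi>) (xs ! 0), (\<psi> \<circ> \<phi>) (xs ! 1)]) (dbr A [a, b]) \<beta>"
      by (rule tlift_eval[OF Ta \<gamma>', symmetric]) (simp add: pure_def \<gamma>_def numeral_2_eq_2)
    finally show "tlift A 2 (\<lambda>_ xs. pure C [(\<psi> \<circ> \<phi>) (xs ! 0), (\<psi> \<circ> \<phi>) (xs ! 1)]) (dbr A [a, b]) \<beta>
        = dbr C [(\<psi> \<circ> \<phi>) a, (\<psi> \<circ> \<phi>) b] \<beta>" by simp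
  qed
qed

end

sublocale dpcomp \<subseteq> H: dpmor d A C "\<psi> \<circ> \<phi>"
  by unfold_locales (rule comp_double_poisson_morphism)

context dpcomp
begin

lemma pf_comp: "F.pf (G.pf f) = H.pf f"
  by (auto simp: dual_map_def fun_eq_iff F.phi_gcar)

lemma pull_comp: "pull_dual A \<phi> (pull_dual B \<psi> x) = pull_dual A (\<psi> \<circ> \<phi>) x"
  by (cases x) (simp add: pull_dual_def pf_comp)

lemma push_comp: "push_alg \<psi> (push_alg \<phi> x) = push_alg (\<psi> \<circ> \<phi>) x"
  by (cases x) (simp add: push_alg_def)

lemma push_pull: "push_alg \<phi> (pull_dual B \<psi> x) = pull_dual B \<psi> (push_alg \<phi> x)"
  by (cases x) (simp add: push_alg_def pull_dual_def)

lemma pull_gcar: "x \<in> gcar H.D \<Longrightarrow> pull_dual B \<psi> x \<in> gcar F.D"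
  and push_gcar: "x \<in> gcar H.D \<Longrightarrow> push_alg \<phi> x \<in> gcar G.D"
  by (auto simp: H.D_gcar F.D_gcar G.D_gcar pull_dual_def push_alg_def G.pf_gcar F.phi_gcar)

lemma pull_glin: "glin H.D F.D 0 (pull_dual B \<psi>)"
  unfolding glin_iff
proof (intro conjI allI ballI)
  show "lin_on H.D (scal F.D) (pull_dual B \<psi>)"
    using G.pf_lin by (auto simp: lin_on_def H.D_gcar H.D_simps F.D_simps H.bd_scal F.bd_scal pull_dual_def)
  show "pull_dual B \<psi> v \<in> grade F.D (n + 0)" if "v \<in> grade H.D n" for n v
    using that G.pf_grade by (cases v) (auto simp: H.D_simps F.D_simps H.bd_grade F.bd_grade pull_dual_def)
qed

lemma push_glin: "glin H.D G.D 0 (push_alg \<phi>)"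
  unfolding glin_iff
proof (intro conjI allI ballI)
  show "lin_on H.D (scal G.D) (push_alg \<phi>)"
    using F.phi_lin by (auto simp: lin_on_def H.D_gcar H.D_simps G.D_simps H.bd_scal G.bd_scal push_alg_def)
  show "push_alg \<phi> v \<in> grade G.D (n + 0)" if "v \<in> grade H.D n" for n v
    using that F.phi_grade by (cases v) (auto simp: H.D_simps G.D_simps H.bd_grade G.bd_grade push_alg_def)
qed

text \<open>The first components are compared in the structure of \<open>A\<close>, the functionals
  in that of \<open>C\<close>. The third equation lives in the structure of \<open>B\<close>, where
  the maps from the two given morphisms meet, and supplies the components not seen by the other
  two.\<close>

lemma ops_chase:
  assumes n: "n \<ge> 1" "length xs = n" "set xs \<subseteq> gcar H.D"
  defines "ys \<equiv> map (pull_dual B \<psi>) xs" and "zs \<equiv> map (push_alg \<phi>) xs"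
  shows "fst (ops F.D n ys) = fst (ops H.D n xs)" "snd (ops G.D n zs) = snd (ops H.D n xs)"
    "push_alg \<phi> (ops F.D n ys) = pull_dual B \<psi> (ops G.D n zs)"
proof -
  have ys: "length ys = n" "set ys \<subseteq> gcar F.D" and zs: "length zs = n" "set zs \<subseteq> gcar G.D"
    using n pull_gcar push_gcar by (auto simp: ys_def zs_def)
  have "pull_dual A \<phi> (ops F.D n ys) = pull_dual A (\<psi> \<circ> \<phi>) (ops H.D n xs)"
    unfolding strict_morphismD(3)[OF F.pull_strict n(1) ys] strict_morphismD(3)[OF H.pull_strict n]
    by (simp add: ys_def o_def pull_comp[unfolded o_def])
  then show "fst (ops F.D n ys) = fst (ops H.D n xs)"
    by (cases "ops F.D n ys", cases "ops H.D n xs") (simp add: pull_dual_def)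
  have "push_alg \<psi> (ops G.D n zs) = push_alg (\<psi> \<circ> \<phi>) (ops H.D n xs)"
    unfolding strict_morphismD(3)[OF G.push_strict n(1) zs] strict_morphismD(3)[OF H.push_strict n]
    by (simp add: zs_def o_def push_comp[unfolded o_def])
  then show "snd (ops G.D n zs) = snd (ops H.D n xs)"
    by (cases "ops G.D n zs", cases "ops H.D n xs") (simp add: push_alg_def)
  show "push_alg \<phi> (ops F.D n ys) = pull_dual B \<psi> (ops G.D n zs)"
    unfolding strict_morphismD(3)[OF F.push_strict n(1) ys] strict_morphismD(3)[OF G.pull_strict n(1) zs]
    by (simp add: ys_def zs_def o_def push_pull)
qed

lemma pull_strict: "strict_morphism H.D F.D (pull_dual B \<psi>)"
  unfolding strict_morphism_def
proof (intro conjI allI impI pull_glin)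
  fix n xs assume n: "n \<ge> 1" and xs: "length xs = n \<and> set xs \<subseteq> gcar H.D"
  note c = ops_chase[OF n xs[THEN conjunct1] xs[THEN conjunct2]]
  \<comment> \<open>The functional of the left morphism equals, by the equation over
    \<open>B\<close>, the pullback of the functional of the right one, which is known from
    \<open>C\<close>.\<close>
  show "pull_dual B \<psi> (ops H.D n xs) = ops F.D n (map (pull_dual B \<psi>) xs)"
    using c by (cases "ops H.D n xs", cases "ops F.D n (map (pull_dual B \<psi>) xs)", cases "ops G.D n (map (push_alg \<phi>) xs)")
      (simp add: pull_dual_def push_alg_def)
qed

lemma push_strict: "strict_morphism H.D G.D (push_alg \<phi>)"
  unfolding strict_morphism_def
proof (intro conjI allI impI push_glin)
  fix n xs assume n: "n \<ge> 1" and xs: "length xs = n \<and> set xs \<subseteq> gcar H.D"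
  note c = ops_chase[OF n xs[THEN conjunct1] xs[THEN conjunct2]]
  \<comment> \<open>By the equation over \<open>B\<close>, the first component of the right morphism
    is the image under \<open>\<phi>\<close> of that of the left one, which is known from
    \<open>A\<close>.\<close>
  show "push_alg \<phi> (ops H.D n xs) = ops G.D n (map (push_alg \<phi>) xs)"
    using c by (cases "ops H.D n xs", cases "ops F.D n (map (pull_dual B \<psi>) xs)", cases "ops G.D n (map (push_alg \<phi>) xs)")
      (simp add: pull_dual_def push_alg_def)
qed

lemma pull_forms: "preserves_forms H.D F.D (pull_dual B \<psi>)"
  unfolding preserves_forms_def
proof (intro ballI)
  fix x y assume "x \<in> gcar H.D" "y \<in> gcar H.D"
  then obtain a f b g where x: "x = (a, f)" "y = (b, g)" "a \<in> gcar A" "b \<in> gcar A" "f \<in> gcar (gdual C)" "g \<in> gcar (gdual C)"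
    by (cases x, cases y) (auto simp: H.D_gcar)
  have "bd_form d A B \<phi> [(a, G.pf f), (b, G.pf g)] = G.pf f (\<phi> b) + G.pf g (\<phi> (par A d a))"
    by (rule F.bd_form_closed[OF x(3) G.pf_gcar[OF x(6)]])
  moreover have "bd_form d A C (\<psi> \<circ> \<phi>) [(a, f), (b, g)] = f ((\<psi> \<circ> \<phi>) b) + g ((\<psi> \<circ> \<phi>) (par A d a))"
    by (rule H.bd_form_closed[OF x(3,6)])
  ultimately show "form H.D [x, y] = form F.D [pull_dual B \<psi> x, pull_dual B \<psi> y]"
    using x F.phi_gcar[OF x(4)] F.phi_gcar[OF par_gcar[OF F.A.gs x(3), of d]]
    by (simp add: H.D_simps F.D_simps pull_dual_def) (simp add: dual_map_def)
qed

lemma push_forms: "preserves_forms H.D G.D (push_alg \<phi>)"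
  unfolding preserves_forms_def
  by (auto simp: H.D_gcar H.D_simps G.D_simps H.bd_form_closed G.bd_form_closed push_alg_def F.phi_gcar F.phi_par)

end

text \<open>Strictness was proved with the constructed structures as targets. Gradings and forms do
  not involve the operations, so only strictness has to be carried over to
  \<open>dp_ops\<close>.\<close>

lemma (in dpmor) pre_CY_morphism_induced:
  "pre_CY_morphism d A (dp_ops d A) B (dp_ops d B) (bd_mor d A B \<phi>, pull_dual A \<phi>, push_alg \<phi>)"
proof -
  have "pre_CY d A (dp_ops d A)" "pre_CY d B (dp_ops d B)"
    using A.dp_ops_corresponds B.dp_ops_corresponds by (simp_all add: corresponds_def)
  moreover have "preserves_forms D (bd_ainf d A (dp_ops d A)) (pull_dual A \<phi>)"
    "preserves_forms D (bd_ainf d B (dp_ops d B)) (push_alg \<phi>)"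
    using pull_forms push_forms by (simp_all add: preserves_forms_def bd_ainf_def)
  ultimately show ?thesis
    using D_ultracyclic A.strict_to_dp_ops[OF pull_strict D_gs] B.strict_to_dp_ops[OF push_strict D_gs]
    by (simp add: pre_CY_morphism_def)
qed

theorem theorem5p9:
  fixes d :: int
    and A :: "('k::field_char_0, 'a::ab_group_add) dpa"
    and B :: "('k, 'b::ab_group_add) dpa"
    and C :: "('k, 'c::ab_group_add) dpa"
    and \<phi> :: "'a \<Rightarrow> 'b" and \<psi> :: "'b \<Rightarrow> 'c" and \<upsilon> :: "'a \<Rightarrow> 'c"
  assumes "double_poisson d A" and "double_poisson d B" and "double_poisson d C"
    and "double_poisson_morphism A B \<phi>" and "double_poisson_morphism B C \<psi>"
    and "\<upsilon> = \<psi> \<circ> \<phi>"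
  shows
    "let D\<phi> = bd_mor d A B \<phi>; D\<psi> = bd_mor d B C \<psi>; D\<upsilon> = bd_mor d A C \<upsilon>;
         \<Phi>A = pull_dual A \<phi>; \<Phi>B = push_alg \<phi>;
         \<Psi>B = pull_dual B \<psi>; \<Psi>C = push_alg \<psi>;
         Y\<phi> = pull_dual B \<psi>; Y\<psi> = push_alg \<phi>
     in
       pre_CY_morphism d A (dp_ops d A) B (dp_ops d B) (D\<phi>, \<Phi>A, \<Phi>B) \<and>
       pre_CY_morphism d B (dp_ops d B) C (dp_ops d C) (D\<psi>, \<Psi>B, \<Psi>C) \<and>
       fully_manageable D\<upsilon> \<and> nice (bd_part A C) D\<upsilon> \<and> degenerate_cyclic (d - 1) D\<upsilon> \<and>
       strict_morphism D\<upsilon> D\<phi> Y\<phi> \<and> preserves_forms D\<upsilon> D\<phi> Y\<phi> \<and>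
       strict_morphism D\<upsilon> D\<psi> Y\<psi> \<and> preserves_forms D\<upsilon> D\<psi> Y\<psi> \<and>
       (\<forall>x\<in>gcar D\<upsilon>. \<Phi>B (Y\<phi> x) = \<Psi>B (Y\<psi> x)) \<and>
       composable TYPE('a \<times> ('c \<Rightarrow> 'k)) d (D\<phi>, \<Phi>A, \<Phi>B) (D\<psi>, \<Psi>B, \<Psi>C) \<and>
       composing d (D\<phi>, \<Phi>A, \<Phi>B) (D\<psi>, \<Psi>B, \<Psi>C) (D\<upsilon>, Y\<phi>, Y\<psi>) \<and>
       composition_via (D\<phi>, \<Phi>A, \<Phi>B) (D\<psi>, \<Psi>B, \<Psi>C) (D\<upsilon>, Y\<phi>, Y\<psi>) =
         (D\<upsilon>, \<Phi>A \<circ> Y\<phi>, \<Psi>C \<circ> Y\<psi>)"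
proof -
  interpret dpcomp d A B C \<phi> \<psi>
    by unfold_locales (use assms in auto)
  \<comment> \<open>The algebra attached to the composite serves as the apex; its ultracyclicity
    follows from cyclicity and smallness, and the square commutes because \<open>\<phi>\<close> acts
    on the first component and the pullback along \<open>\<psi>\<close> on the second.\<close>
  have composing: "composing d (bd_mor d A B \<phi>, pull_dual A \<phi>, push_alg \<phi>)
      (bd_mor d B C \<psi>, pull_dual B \<psi>, push_alg \<psi>) (bd_mor d A C (\<psi> \<circ> \<phi>), pull_dual B \<psi>, push_alg \<phi>)"
    using H.D_ultracyclic pull_strict pull_forms push_strict push_forms push_pull
    by (simp add: composing_def)
  then have "composable TYPE('a \<times> ('c \<Rightarrow> 'k)) d (bd_mor d A B \<phi>, pull_dual A \<phi>, push_alg \<phi>)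
      (bd_mor d B C \<psi>, pull_dual B \<psi>, push_alg \<psi>)"
    unfolding composable_def by blast
  with composing show ?thesis
    unfolding assms(6) Let_def
    using F.pre_CY_morphism_induced G.pre_CY_morphism_induced H.D_fully_manageable H.D_nice
      H.D_degenerate_cyclic pull_strict pull_forms push_strict push_forms push_pull
    by (simp add: composition_via_def)
qed

end
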